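(* Let $\alpha>0$ and let $q\in W^{\alpha,2}(\mathbb{R}^2)$ be compactly supported. Let $q_B$ be the Born approximation of $q$ for backscattering data. Then $q-q_B$ is a continuous function.
   Context: Here $n=2$. Fourier transform: $\hat f(\xi)=\int_{\mathbb{R}^n}e^{-i\xi\cdot x}f(x)\,dx$. $W^{\alpha,2}(\mathbb{R}^n)=\{f\in\mathcal S'(\mathbb{R}^n): (1+|\cdot|^2)^{\alpha/2}\hat f\in L^2(\mathbb{R}^n)\}$. For $k>0$ the outgoing resolvent $R_k$ of the Laplacian is defined by $\widehat{R_k(f)}(\xi)=(-|\xi|^2+k^2+i0)^{-1}\hat f(\xi)$. For $\theta\in S^{n-1}$ the scattering solution $u(\cdot,\theta,k)$ is the solution of the Lippmann-Schwinger equation $$u(x,\theta,k)=e^{ikx\cdot\theta}+R_k\big(q(\cdot)u(\cdot,\theta,k)\big)(x),$$ which, for compactly supported $q\in L^r(\mathbb{R}^n)$ with $r>n/2$, exists, is unique and is given by the convergent Neumann-Born series for all $k>k_0$, where $k_0\geq 0$ depends on an a priori bound of $q$ (if $1/p-1/p'=1/r$ with $p'$ the conjugate exponent of $p$, then $R_k:L^p\to L^{p'}$ has norm tending to $0$ as $k\to\infty$). The scattering amplitude (far field pattern) is $$A(\theta',\theta,k)=\int_{\mathbb{R}^n}e^{-ik\theta'\cdot y}q(y)u(y,\theta,k)\,dy,\qquad \theta',\theta\in S^{n-1}.$$ The Born approximation for backscattering data $q_B$ is defined by $\hat q_B(\xi)=A(-\theta,\theta,k)$ where $\xi=-2k\theta$,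 i.e. $k=|\xi|/2$, $\theta=-\xi/|\xi|$. Only large frequencies matter: if $\chi^*\in C^\infty(\mathbb{R})$ vanishes for $t<C_0$ and equals $1$ for $t\ge 2C_0$, with $C_0$ large, and $\hat q_{B,H}(\xi)=A(-\theta,\theta,k)\chi^*(k)$, then $q_B$ and $q_{B,H}$ differ by a $C^\infty$ function, and $q_B$ may be taken to be $q_{B,H}$ modulo $C^\infty(\mathbb{R}^n)$. *)

theory Defs
  imports "HOL-Analysis.Analysis"
begin

subsection \<open>Smooth functions, test functions, Schwartz functions\<close>

primrec iterated_partial ::
  "'a::euclidean_space list \<Rightarrow> ('a \<Rightarrow> 'b::real_normed_vector) \<Rightarrow> 'a \<Rightarrow> 'b" where
  "iterated_partial [] f = f"
| "iterated_partial (b # bs) f = (\<lambda>x. frechet_derivative (iterated_partial bs f) (at x) b)"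

text \<open>Differentiability of all iterated partial derivatives also yields their continuity,
  so this is \<open>C\<^sup>\<infinity>\<close>.\<close>

definition smooth :: "('a::euclidean_space \<Rightarrow> 'b::real_normed_vector) \<Rightarrow> bool" where
  "smooth f \<longleftrightarrow> (\<forall>bs. set bs \<subseteq> Basis \<longrightarrow> (\<forall>x. iterated_partial bs f differentiable (at x)))"

definition test_functions :: "('a::euclidean_space \<Rightarrow> complex) set" where
  "test_functions = {\<phi>. smooth \<phi> \<and> (\<exists>K. compact K \<and> (\<forall>x. x \<notin> K \<longrightarrow> \<phi> x = 0))}"

definition schwartz :: "('a::euclidean_space \<Rightarrow> complex) set" where
  "schwartz = {\<phi>. smooth \<phi> \<and>
     (\<forall>N bs. set bs \<subseteq> Basis \<longrightarrow>
        (\<exists>M. \<forall>x. (1 + norm x) ^ N * norm (iterated_partial bs \<phi> x) \<le> M))}"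

subsection \<open>Tempered distributions\<close>

text \<open>A distribution is a functional on functions of which only the values on
  \<^const>\<open>schwartz\<close> (or \<^const>\<open>test_functions\<close>) are relevant.
  The number \<open>M\<close> below ranges over the upper bounds of the \<open>N\<close>-th Schwartz seminorm
  of \<open>\<phi>\<close>.\<close>

type_synonym 'a distribution = "('a \<Rightarrow> complex) \<Rightarrow> complex"

definition tempered_distribution :: "'a::euclidean_space distribution \<Rightarrow> bool" where
  "tempered_distribution T \<longleftrightarrow>
     (\<forall>\<phi>\<in>schwartz. \<forall>\<psi>\<in>schwartz. T (\<lambda>x. \<phi> x + \<psi> x) = T \<phi> + T \<psi>) \<and>
     (\<forall>c. \<forall>\<phi>\<in>schwartz. T (\<lambda>x. c * \<phi> x) = c * T \<phi>) \<and>
     (\<exists>C N. \<forall>\<phi>\<in>schwartz. \<forall>M.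
        (\<forall>bs x. set bs \<subseteq> Basis \<longrightarrow> length bs \<le> N \<longrightarrow>
           (1 + norm x) ^ N * norm (iterated_partial bs \<phi> x) \<le> M) \<longrightarrow>
        norm (T \<phi>) \<le> C * M)"

text \<open>Functions of at most polynomial growth in the mean: those for which
  \<open>\<phi> \<mapsto> \<integral> f \<phi>\<close> converges absolutely and is a tempered distribution.\<close>

definition tempered_function :: "('a::euclidean_space \<Rightarrow> complex) \<Rightarrow> bool" where
  "tempered_function f \<longleftrightarrow> f \<in> borel_measurable lborel \<and>
     (\<exists>N. integrable lborel (\<lambda>x. f x / of_real ((1 + norm x) ^ N)))"

definition distribution_of :: "('a::euclidean_space \<Rightarrow> complex) \<Rightarrow> 'a distribution" where
  "distribution_of f = (\<lambda>\<phi>. LINT x|lborel. f x * \<phi> x)"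

definition is_continuous_function :: "'a::euclidean_space distribution \<Rightarrow> bool" where
  "is_continuous_function T \<longleftrightarrow>
     (\<exists>g. continuous_on UNIV g \<and> (\<forall>\<phi>\<in>test_functions. T \<phi> = distribution_of g \<phi>))"

subsection \<open>Fourier transform and Sobolev spaces\<close>

definition fourier :: "('a::euclidean_space \<Rightarrow> complex) \<Rightarrow> 'a \<Rightarrow> complex" where
  "fourier f \<xi> = (LINT x|lborel. exp (- \<i> * of_real (\<xi> \<bullet> x)) * f x)"

definition inverse_fourier :: "('a::euclidean_space \<Rightarrow> complex) \<Rightarrow> 'a \<Rightarrow> complex" where
  "inverse_fourier f x =
     (LINT \<xi>|lborel. exp (\<i> * of_real (x \<bullet> \<xi>)) * f \<xi>) / of_real ((2 * pi) ^ DIM('a))"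

definition fourier_distr :: "'a::euclidean_space distribution \<Rightarrow> 'a distribution" where
  "fourier_distr T = (\<lambda>\<phi>. T (fourier \<phi>))"

definition inverse_fourier_distr :: "'a::euclidean_space distribution \<Rightarrow> 'a distribution" where
  "inverse_fourier_distr T = (\<lambda>\<phi>. T (inverse_fourier \<phi>))"

definition square_integrable :: "('a::euclidean_space \<Rightarrow> complex) \<Rightarrow> bool" where
  "square_integrable g \<longleftrightarrow>
     g \<in> borel_measurable lborel \<and> integrable lborel (\<lambda>x. (norm (g x))\<^sup>2)"

text \<open>The space \<open>W\<^sup>\<alpha>\<^sup>,\<^sup>2\<close>. The product of a distribution \<open>S\<close> with a smooth function \<open>m\<close> of
  polynomial growth is \<open>\<phi> \<mapsto> S (m \<phi>)\<close>.\<close>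

definition sobolev :: "real \<Rightarrow> 'a::euclidean_space distribution set" where
  "sobolev \<alpha> = {T. tempered_distribution T \<and>
     (\<exists>g. square_integrable g \<and>
        (\<forall>\<phi>\<in>schwartz.
           fourier_distr T (\<lambda>\<xi>. of_real ((1 + (norm \<xi>)\<^sup>2) powr (\<alpha> / 2)) * \<phi> \<xi>)
             = distribution_of g \<phi>))}"

text \<open>Compact support in the sense of distributions; \<open>f\<close> stands for its class modulo
  null sets.\<close>

definition compactly_supported :: "('a::euclidean_space \<Rightarrow> complex) \<Rightarrow> bool" where
  "compactly_supported f \<longleftrightarrow>
     (\<exists>K. compact K \<and> (AE x in lborel. x \<notin> K \<longrightarrow> f x = 0))"

subsection \<open>Scattering\<close>

text \<open>The outgoing resolvent: the Fourier transform of \<open>R\<^sub>k f\<close> is the limit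
  of \<open>(-\<bar>\<xi>\<bar>\<^sup>2 + k\<^sup>2 + i\<epsilon>)\<^sup>-\<^sup>1\<close> times the Fourier transform of \<open>f\<close>, as \<open>\<epsilon>\<close> decreases to \<open>0\<close>,
  in the sense of tempered distributions. It is applied to compactly supported
  integrable \<open>f\<close> only, for which the limit exists.\<close>

definition outgoing_resolvent ::
  "real \<Rightarrow> ('a::euclidean_space \<Rightarrow> complex) \<Rightarrow> 'a distribution" where
  "outgoing_resolvent k f = inverse_fourier_distr
     (\<lambda>\<phi>. Lim (at_right 0) (\<lambda>\<epsilon>. LINT \<xi>|lborel.
        fourier f \<xi> / (of_real (- (norm \<xi>)\<^sup>2 + k\<^sup>2) + \<i> * of_real \<epsilon>) * \<phi> \<xi>))"

definition plane_wave :: "'a::euclidean_space \<Rightarrow> real \<Rightarrow> 'a \<Rightarrow> complex" where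
  "plane_wave \<theta> k x = exp (\<i> * of_real (k * (x \<bullet> \<theta>)))"

text \<open>The Lippmann-Schwinger equation, as an identity of tempered distributions.\<close>

definition is_scattering_solution ::
  "('a::euclidean_space \<Rightarrow> complex) \<Rightarrow> 'a \<Rightarrow> real \<Rightarrow> ('a \<Rightarrow> complex) \<Rightarrow> bool" where
  "is_scattering_solution q \<theta> k u \<longleftrightarrow>
     tempered_function u \<and> integrable lborel (\<lambda>x. q x * u x) \<and>
     (\<forall>\<phi>\<in>schwartz. distribution_of u \<phi> =
        distribution_of (plane_wave \<theta> k) \<phi> + outgoing_resolvent k (\<lambda>x. q x * u x) \<phi>)"

text \<open>For large \<open>k\<close> the solution exists and is unique up to null sets, so that the
  amplitude below does not depend on the choice of a representative. In dimension two no
  further \<open>L\<^sup>p\<close> condition is needed: the kernel of the resolvent has a logarithmic singularity,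
  so every solution lies in all local \<open>L\<^sup>p\<close> spaces with \<open>p < \<infinity>\<close>.\<close>

definition scattering_solution ::
  "('a::euclidean_space \<Rightarrow> complex) \<Rightarrow> 'a \<Rightarrow> real \<Rightarrow> 'a \<Rightarrow> complex" where
  "scattering_solution q \<theta> k = (SOME u. is_scattering_solution q \<theta> k u)"

definition scattering_amplitude ::
  "('a::euclidean_space \<Rightarrow> complex) \<Rightarrow> 'a \<Rightarrow> 'a \<Rightarrow> real \<Rightarrow> complex" where
  "scattering_amplitude q \<theta>' \<theta> k =
     (LINT y|lborel. exp (- \<i> * of_real (k * (\<theta>' \<bullet> y))) * q y * scattering_solution q \<theta> k y)"

definition high_frequency_cutoff :: "real \<Rightarrow> (real \<Rightarrow> real) \<Rightarrow> bool" where
  "high_frequency_cutoff C\<^sub>0 \<eta> \<longleftrightarrow>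
     smooth \<eta> \<and> (\<forall>t. t < C\<^sub>0 \<longrightarrow> \<eta> t = 0) \<and> (\<forall>t. t \<ge> 2 * C\<^sub>0 \<longrightarrow> \<eta> t = 1)"

text \<open>The Born approximation for backscattering data, truncated to high frequencies by
  \<open>\<eta>\<close>; a different choice of \<open>\<eta>\<close> changes it by a smooth function. The value at
  \<open>\<xi> = 0\<close>, where \<open>\<theta>\<close> is meaningless, vanishes because \<open>\<eta> 0 = 0\<close>.\<close>

definition born_backscattering_fourier ::
  "('a::euclidean_space \<Rightarrow> complex) \<Rightarrow> (real \<Rightarrow> real) \<Rightarrow> 'a \<Rightarrow> complex" where
  "born_backscattering_fourier q \<eta> \<xi> =
     (let k = norm \<xi> / 2; \<theta> = - (\<xi> /\<^sub>R norm \<xi>)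
      in scattering_amplitude q (- \<theta>) \<theta> k * of_real (\<eta> k))"

definition born_backscattering ::
  "('a::euclidean_space \<Rightarrow> complex) \<Rightarrow> (real \<Rightarrow> real) \<Rightarrow> 'a distribution" where
  "born_backscattering q \<eta> =
     inverse_fourier_distr (distribution_of (born_backscattering_fourier q \<eta>))"

end

theory Submission imports Defs "HOL-Probability.Probability" "HOL-Real_Asymp.Real_Asymp" begin

text \<open>Write \<open>\<kappa> = k\<theta>\<close> and let \<open>G\<^sub>k\<close> be the outgoing kernel. The function \<open>f = q u\<close> solves
  \<open>f = q e\<^sup>i\<^sup>\<kappa>\<^sup>x + q (G\<^sub>k * f)\<close>, a contraction in \<open>L\<^sup>1\<close> with constant \<open>O(k\<^sup>-\<^sup>1\<^sup>/\<^sup>2)\<close>, so the amplitude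
  is a Neumann series whose terms of order at least \<open>5\<close> are \<open>O(k\<^sup>-\<^sup>5\<^sup>/\<^sup>2)\<close>, which is integrable in
  the plane. Up to \<open>O(k\<^sup>-\<^sup>3)\<close> the kernel may be truncated, and the Fourier transform of the
  truncated kernel is at most \<open>C / ((1 + \<bar>k - \<bar>\<eta>\<bar>\<bar>) (k + \<bar>\<eta>\<bar>))\<close>. The terms of order \<open>1\<close> to \<open>4\<close>
  are thus bounded by iterated integrals of the Fourier transform of \<open>q\<close> against this bound. With
  \<open>\<tau> = \<kappa> + \<eta>\<close> and \<open>\<tau>' = \<kappa> - \<eta>\<close> one has \<open>k\<^sup>2 - \<bar>\<eta>\<bar>\<^sup>2 = \<tau> \<bullet> \<tau>'\<close>; a weighted Schur test, followed by
  integration in \<open>\<kappa>\<close> for fixed \<open>\<tau>\<close>, shows that they are integrable in \<open>\<kappa>\<close>. So the Fourier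
  transform of \<open>q - q\<^sub>B\<close> is integrable, and \<open>q - q\<^sub>B\<close> is continuous.\<close>

text \<open>On the Fourier side the outgoing kernel is 1 / (k^2 - |eta|^2 + i0), which is not
  absolutely integrable across the circle |eta| = k, so absolute values could not be taken in the
  iterated integrals. Only differences of points of the support of \<open>q\<close> enter, so the
  kernel matters on a bounded set; damping its time integral at late times hardly changes it there
  and spreads the singularity over a ring of width one. The L^2 norm of the resulting bound is
  O(k^-1/2), and O(k^-1) against a weight 1 / (1 + |u - v|); a decay strictly better than 1 / k is
  what the last integration requires. Orders 3 and 4 reach it by these two rates alone. Orders 1 and
  2 are borderline, and only they use the positivity of \<alpha>. The scattering solution is
  selected by choice among all tempered solutions. The series estimate is therefore proved for an
  arbitrary solution, after the resolvent, defined as a distributional limit, has been identified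
  with convolution by an explicit kernel.\<close>

type_synonym plane = "real^2"

abbreviation nn_lborel :: "('a::euclidean_space \<Rightarrow> ennreal) \<Rightarrow> ennreal" (binder "NN " 10) where
  "nn_lborel f \<equiv> integral\<^sup>N lborel f"

abbreviation borel_fun :: "('a::topological_space \<Rightarrow> 'b::topological_space) set" where
  "borel_fun \<equiv> borel_measurable borel"

abbreviation L1 :: "('a::euclidean_space \<Rightarrow> 'b::{banach, second_countable_topology}) \<Rightarrow> bool" where
  "L1 f \<equiv> integrable lborel f"

abbreviation lborel2 :: "('a::euclidean_space \<times> 'b::euclidean_space) measure" where
  "lborel2 \<equiv> lborel \<Otimes>\<^sub>M lborel"

abbreviation ind :: "real set \<Rightarrow> real \<Rightarrow> complex" where
  "ind A t \<equiv> of_real (indicator A t)"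

abbreviation ez :: "complex \<Rightarrow> real \<Rightarrow> complex" where
  "ez z t \<equiv> exp (\<i> * z * of_real t)"

abbreviation jb :: "'a::real_normed_vector \<Rightarrow> real" where "jb x \<equiv> 1 + norm x"

abbreviation ja :: "real \<Rightarrow> real" where "ja t \<equiv> 1 + \<bar>t\<bar>"

abbreviation ep :: "'a::real_inner \<Rightarrow> 'a \<Rightarrow> complex" where "ep a x \<equiv> exp (\<i> * of_real (a \<bullet> x))"

abbreviation em :: "'a::real_inner \<Rightarrow> 'a \<Rightarrow> complex" where "em a x \<equiv> exp (- \<i> * of_real (a \<bullet> x))"

abbreviation en :: "real \<Rightarrow> ennreal" where "en \<equiv> ennreal"

type_synonym cfun = "plane \<Rightarrow> complex"

lemmas L1_bound = Bochner_Integration.integrable_bound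
lemmas L1_add = Bochner_Integration.integrable_add
lemmas L1_diff = Bochner_Integration.integrable_diff
lemmas LB_cong = Bochner_Integration.integral_cong
lemmas LB_add = Bochner_Integration.integral_add
lemmas LB_diff = Bochner_Integration.integral_diff

section \<open>Lebesgue measure on the plane in coordinates\<close>

abbreviation pl :: "real \<Rightarrow> real \<Rightarrow> plane" where "pl x y \<equiv> vector [x, y]"

lemma pl_components [simp]: "pl (v $ 1) (v $ 2) = v"
  by (simp add: vec_eq_iff forall_2)

lemma inner_plane: "(v::plane) \<bullet> w = v $ 1 * w $ 1 + v $ 2 * w $ 2"
  by (simp add: inner_vec_def sum_2)

lemma norm_plane: "norm (v::plane) = sqrt ((v $ 1)^2 + (v $ 2)^2)"
  by (simp add: norm_eq_sqrt_inner inner_plane power2_eq_square)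

lemma norm_pl [simp]: "norm (pl x y) = sqrt (x^2 + y^2)"
  by (simp add: norm_plane)

lemma borel_measurable_pl [measurable (raw)]:
  assumes [measurable]: "f \<in> borel_measurable M" "g \<in> borel_measurable M"
  shows "(\<lambda>x. pl (f x) (g x)) \<in> borel_measurable M"
proof -
  have eq: "pl a b = a *\<^sub>R axis 1 1 + b *\<^sub>R axis 2 1" for a b
    by (simp add: vec_eq_iff forall_2 axis_def)
  show ?thesis unfolding eq by measurable
qed

lemma borel_measurable_vec_nth_plane [measurable (raw)]:
  assumes [measurable]: "f \<in> borel_measurable M"
  shows "(\<lambda>x. (f x :: plane) $ i) \<in> borel_measurable M"
proof -
  have eq: "v $ i = v \<bullet> axis i 1" for v :: plane by (simp add: inner_axis)
  show ?thesis unfolding eq by measurable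
qed

lemma Basis_plane: "(Basis :: plane set) = {axis 1 1, axis 2 1}"
  by (auto simp: Basis_vec_def UNIV_2)

text \<open>Boxes determine the measure, and in coordinates a box is a product of two
  intervals.\<close>

lemma lborel_plane: "lborel = distr lborel2 borel (\<lambda>(x, y). pl x y)"
proof (rule lborel_eqI)
  fix l u :: plane
  assume lu: "\<And>b. b \<in> Basis \<Longrightarrow> l \<bullet> b \<le> u \<bullet> b"
  have m: "(\<lambda>(x, y). pl x y) \<in> borel_measurable lborel2" by measurable
  have "(\<lambda>(x, y). pl x y) -` box l u \<inter> space lborel2 = {l $ 1<..<u $ 1} \<times> {l $ 2<..<u $ 2}"
    by (auto simp: mem_box_cart forall_2 space_pair_measure)
  then have "emeasure (distr lborel2 borel (\<lambda>(x, y). pl x y)) (box l u)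
     = emeasure lborel2 ({l $ 1<..<u $ 1} \<times> {l $ 2<..<u $ 2})"
    using m by (subst emeasure_distr) auto
  also have "... = emeasure lborel {l $ 1<..<u $ 1} * emeasure lborel {l $ 2<..<u $ 2}"
    by (intro lborel.emeasure_pair_measure_Times) auto
  also have "... = en ((u $ 1 - l $ 1) * (u $ 2 - l $ 2))"
    using lu[of "axis 1 1"] lu[of "axis 2 1"] by (auto simp: Basis_plane inner_axis ennreal_mult)
  also have "... = (\<Prod>b\<in>Basis. (u - l) \<bullet> b)"
    by (simp add: Basis_plane inner_axis axis_eq_axis)
  finally show "emeasure (distr lborel2 borel (\<lambda>(x, y). pl x y)) (box l u) = (\<Prod>b\<in>Basis. (u - l) \<bullet> b)" .
qed simp

lemma nn_integral_plane:
  fixes f :: "plane \<Rightarrow> ennreal"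
  assumes [measurable]: "f \<in> borel_fun"
  shows "(NN v. f v) = (NN x. NN y. f (pl x y))"
    and "(NN v. f v) = (NN y. NN x. f (pl x y))"
proof -
  have "(NN v. f v) = (\<integral>\<^sup>+p. f (case p of (x, y) \<Rightarrow> pl x y) \<partial>lborel2)"
    by (subst lborel_plane, subst nn_integral_distr) auto
  then show 1: "(NN v. f v) = (NN x. NN y. f (pl x y))"
    by (simp add: lborel.nn_integral_fst[symmetric])
  show "(NN v. f v) = (NN y. NN x. f (pl x y))"
    unfolding 1 by (rule lborel_pair.Fubini'[symmetric]) measurable
qed

lemma integral_plane_product:
  fixes f g :: "real \<Rightarrow> complex"
  assumes "L1 f" "L1 g"
  shows "L1 (\<lambda>v::plane. f (v $ 1) * g (v $ 2))"
    and "(LBINT v. f ((v::plane) $ 1) * g (v $ 2)) = (LBINT x. f x) * (LBINT y. g y)"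
proof -
  have [measurable]: "f \<in> borel_fun" "g \<in> borel_fun"
    using assms by auto
  have i: "integrable lborel2 (\<lambda>(x, y). f x * g y)"
    by (rule lborel_pair.Fubini_integrable) (use assms in \<open>auto simp: norm_mult\<close>)
  show "L1 (\<lambda>v::plane. f (v $ 1) * g (v $ 2))"
    by (subst lborel_plane, subst integrable_distr_eq) (use i in \<open>auto simp: case_prod_unfold\<close>)
  show "(LBINT v. f ((v::plane) $ 1) * g (v $ 2)) = (LBINT x. f x) * (LBINT y. g y)"
    apply (subst lborel_plane, subst integral_distr)
    using lborel_pair.integral_fst'[OF i[unfolded case_prod_unfold]]
    by (auto simp: case_prod_unfold)
qed

section \<open>Gaussians and their Fourier transforms\<close>

lemma std_normal_fourier:
  "L1 (\<lambda>x::real. exp (- \<i> * of_real (s * x)) * of_real (exp (- x\<^sup>2 / 2)))"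
  "(LBINT x::real. exp (- \<i> * of_real (s * x)) * of_real (exp (- x\<^sup>2 / 2))) =
     of_real (sqrt (2 * pi) * exp (- s\<^sup>2 / 2))"
proof -
  have i: "L1 (\<lambda>x::real. std_normal_density x)"
    by (rule integrable_normal_density) simp
  have "L1 (\<lambda>x::real. sqrt (2 * pi) * std_normal_density x)"
    using i by (rule integrable_mult_right)
  then have i': "L1 (\<lambda>x::real. exp (- x\<^sup>2 / 2))"
    by (simp add: std_normal_density_def)
  show "L1 (\<lambda>x::real. exp (- \<i> * of_real (s * x)) * of_real (exp (- x\<^sup>2 / 2)))"
    by (rule L1_bound[OF i']) (auto simp: norm_mult)
  have "of_real (exp (- s\<^sup>2 / 2)) = (LINT x|density lborel std_normal_density. iexp (- s * x))"
    using fun_cong[OF char_std_normal_distribution, of "-s"] by (simp add: char_def)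
  also have "... = (LBINT x. std_normal_density x *\<^sub>R iexp (- s * x))"
    by (subst integral_density) auto
  also have "... = (LBINT x::real. exp (- \<i> * of_real (s * x)) * of_real (exp (- x\<^sup>2 / 2))) / of_real (sqrt (2 * pi))"
    unfolding integral_divide_zero[symmetric]
    by (intro LB_cong)
       (auto simp: std_normal_density_def scaleR_conv_of_real field_simps)
  finally show "(LBINT x::real. exp (- \<i> * of_real (s * x)) * of_real (exp (- x\<^sup>2 / 2))) =
     of_real (sqrt (2 * pi) * exp (- s\<^sup>2 / 2))"
    by (simp add: field_simps)
qed

lemma gaussian_fourier_real:
  assumes "\<delta> > 0"
  shows "L1 (\<lambda>x::real. exp (- \<i> * of_real (s * x)) * of_real (exp (- \<delta> * x^2)))"
    and "(LBINT x::real. exp (- \<i> * of_real (s * x)) * of_real (exp (- \<delta> * x^2))) =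
     of_real (sqrt (pi / \<delta>) * exp (- s\<^sup>2 / (4 * \<delta>)))"
proof -
  define c where "c = 1 / sqrt (2 * \<delta>)"
  have c: "c > 0" "\<delta> * c^2 = 1 / 2" "c^2 = 1 / (2 * \<delta>)" using assms
    by (auto simp: c_def power_divide field_simps)
  have eq: "exp (- \<i> * of_real (s * (0 + c * x))) * of_real (exp (- \<delta> * (0 + c * x)^2)) =
      exp (- \<i> * of_real ((s * c) * x)) * of_real (exp (- x\<^sup>2 / 2))" for x :: real
    using c(2) by (auto simp: power_mult_distrib mult.assoc[symmetric])
  show "L1 (\<lambda>x::real. exp (- \<i> * of_real (s * x)) * of_real (exp (- \<delta> * x^2)))"
    using lborel_integrable_real_affine_iff[of c "\<lambda>x. exp (- \<i> * of_real (s * x)) * of_real (exp (- \<delta> * x^2))" 0]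
      c(1) std_normal_fourier(1)[of "s * c"] unfolding eq by simp
  have "(LBINT x::real. exp (- \<i> * of_real (s * x)) * of_real (exp (- \<delta> * x^2))) =
     c *\<^sub>R of_real (sqrt (2 * pi) * exp (- (s * c)\<^sup>2 / 2))"
    using lborel_integral_real_affine[of c "\<lambda>x. exp (- \<i> * of_real (s * x)) * of_real (exp (- \<delta> * x^2))" 0]
      c(1) std_normal_fourier(2)[of "s * c"] unfolding eq by simp
  also have "... = of_real ((c * sqrt (2 * pi)) * exp (- (s * c)\<^sup>2 / 2))"
    by (simp add: scaleR_conv_of_real)
  also have "c * sqrt (2 * pi) = sqrt (pi / \<delta>)"
    using assms by (simp add: c_def real_sqrt_divide real_sqrt_mult)
  also have "- (s * c)\<^sup>2 / 2 = - s\<^sup>2 / (4 * \<delta>)"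
    using c(3) assms by (simp add: power_mult_distrib)
  finally show "(LBINT x::real. exp (- \<i> * of_real (s * x)) * of_real (exp (- \<delta> * x^2))) =
     of_real (sqrt (pi / \<delta>) * exp (- s\<^sup>2 / (4 * \<delta>)))" .
qed

definition gauss :: "real \<Rightarrow> plane \<Rightarrow> real" where
  "gauss \<delta> v = exp (- \<delta> * (norm v)^2)"

text \<open>The Fourier transform of \<open>gauss \<delta>\<close>. Since the transform carries no
  normalising factor, its total mass is \<open>(2 * pi)^2\<close>.\<close>

definition gauss_hat :: "real \<Rightarrow> plane \<Rightarrow> real" where
  "gauss_hat \<delta> v = pi / \<delta> * exp (- (norm v)\<^sup>2 / (4 * \<delta>))"

lemma gauss_measurable [measurable]: "gauss \<delta> \<in> borel_fun"
  and gauss_hat_measurable [measurable]: "gauss_hat \<delta> \<in> borel_fun"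
  unfolding gauss_def[abs_def] gauss_hat_def[abs_def] by measurable

lemma gauss_bounds: "0 < gauss \<delta> v" "\<delta> \<ge> 0 \<Longrightarrow> gauss \<delta> v \<le> 1"
  by (auto simp: gauss_def)

lemma gauss_hat_nonneg: "\<delta> > 0 \<Longrightarrow> 0 \<le> gauss_hat \<delta> v"
  by (auto simp: gauss_hat_def)

lemma gauss_fourier:
  assumes "\<delta> > 0"
  shows "L1 (\<lambda>x. em \<xi> x * of_real (gauss \<delta> x))"
    and "fourier (\<lambda>x. of_real (gauss \<delta> x)) \<xi> = of_real (gauss_hat \<delta> \<xi>)"
proof -
  have eq: "em \<xi> x * of_real (gauss \<delta> x) =
     (exp (- \<i> * of_real (\<xi> $ 1 * x $ 1)) * of_real (exp (- \<delta> * (x $ 1)^2))) *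
     (exp (- \<i> * of_real (\<xi> $ 2 * x $ 2)) * of_real (exp (- \<delta> * (x $ 2)^2)))" for x :: plane
  proof -
    have "of_real (gauss \<delta> x) = of_real (exp (- \<delta> * (x $ 1)^2)) * (of_real (exp (- \<delta> * (x $ 2)^2)) :: complex)"
      unfolding gauss_def of_real_mult[symmetric] exp_add[symmetric] norm_plane
      by (auto simp: algebra_simps)
    moreover have "em \<xi> x = exp (- \<i> * of_real (\<xi> $ 1 * x $ 1)) * exp (- \<i> * of_real (\<xi> $ 2 * x $ 2))"
      unfolding exp_add[symmetric] inner_plane by (auto simp: algebra_simps)
    ultimately show ?thesis by simp
  qed
  note * = integral_plane_product[OF gaussian_fourier_real(1)[OF assms, of "\<xi> $ 1"] gaussian_fourier_real(1)[OF assms, of "\<xi> $ 2"]]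
  show "L1 (\<lambda>x. em \<xi> x * of_real (gauss \<delta> x))"
    unfolding eq by (rule *(1))
  show "fourier (\<lambda>x. of_real (gauss \<delta> x)) \<xi> = of_real (gauss_hat \<delta> \<xi>)"
    unfolding fourier_def eq *(2) gaussian_fourier_real(2)[OF assms] of_real_mult[symmetric]
  proof (rule arg_cong[where f=of_real])
    have "sqrt (pi / \<delta>) * sqrt (pi / \<delta>) = pi / \<delta>" using assms by simp
    moreover have "exp (- (\<xi> $ 1)\<^sup>2 / (4 * \<delta>)) * exp (- (\<xi> $ 2)\<^sup>2 / (4 * \<delta>)) = exp (- (norm \<xi>)\<^sup>2 / (4 * \<delta>))"
      unfolding exp_add[symmetric] norm_plane by (simp add: diff_divide_distrib)
    ultimately show "sqrt (pi / \<delta>) * exp (- (\<xi> $ 1)\<^sup>2 / (4 * \<delta>)) * (sqrt (pi / \<delta>) * exp (- (\<xi> $ 2)\<^sup>2 / (4 * \<delta>))) = gauss_hat \<delta> \<xi>"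
      unfolding gauss_hat_def by (metis (no_types, lifting) mult.assoc mult.left_commute)
  qed
qed

lemma gauss_integrable:
  assumes "\<delta> > 0"
  shows "L1 (gauss \<delta>)" "(LBINT x. gauss \<delta> x) = pi / \<delta>"
proof -
  have 1: "L1 (\<lambda>x. complex_of_real (gauss \<delta> x))"
    using gauss_fourier(1)[OF assms, of 0] by simp
  then show "L1 (gauss \<delta>)" by (simp add: complex_of_real_integrable_eq)
  have "complex_of_real (LBINT x. gauss \<delta> x) = of_real (pi / \<delta>)"
    using gauss_fourier(2)[OF assms, of 0] by (simp add: fourier_def gauss_hat_def)
  then show "(LBINT x. gauss \<delta> x) = pi / \<delta>" by (simp only: of_real_eq_iff)
qed

lemma gauss_hat_eq: "\<delta> > 0 \<Longrightarrow> gauss_hat \<delta> v = pi / \<delta> * gauss (1 / (4 * \<delta>)) v"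
  by (simp add: gauss_hat_def gauss_def)

lemma gauss_hat_integrable:
  assumes "\<delta> > 0"
  shows "L1 (gauss_hat \<delta>)" "(LBINT x. gauss_hat \<delta> x) = (2 * pi)^2"
  using gauss_integrable[of "1 / (4 * \<delta>)"] assms
  unfolding gauss_hat_eq[OF assms, abs_def] by (auto simp: power2_eq_square)

lemma gauss_tendsto:
  "((\<lambda>n. gauss (1 / Suc n) v) \<longlongrightarrow> 1) sequentially"
proof -
  have "(\<lambda>n. exp (- (1 / Suc n) * (norm v)^2)) \<longlonglongrightarrow> exp (- 0 * (norm v)^2)"
    by (intro tendsto_intros LIMSEQ_Suc[OF lim_1_over_n])
  then show ?thesis by (simp add: gauss_def)
qed

section \<open>The Fourier transform\<close>

lemma fourier_integrand_integrable:
  fixes f :: "'a::euclidean_space \<Rightarrow> complex"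
  assumes "L1 f"
  shows "L1 (\<lambda>x. em \<xi> x * f x)"
  by (rule L1_bound[OF assms]) (use assms in \<open>auto simp: norm_mult\<close>)

lemma norm_fourier_le:
  fixes f :: "'a::euclidean_space \<Rightarrow> complex"
  shows "norm (fourier f \<xi>) \<le> (LBINT x. norm (f x))"
  using integral_norm_bound[of lborel "\<lambda>x. em \<xi> x * f x"]
  by (simp add: fourier_def norm_mult)

lemma fourier_measurable [measurable (raw)]:
  fixes f :: "'a::euclidean_space \<Rightarrow> complex"
  assumes [measurable]: "f \<in> borel_fun" "g \<in> borel_measurable M"
  shows "(\<lambda>x. fourier f (g x)) \<in> borel_measurable M"
proof -
  have "fourier f \<in> borel_fun"
    unfolding fourier_def[abs_def] by measurable
  from measurable_compose[OF assms(2) this] show ?thesis .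
qed

lemma fourier_modulate:
  "fourier (\<lambda>x. ep a x * f x) \<xi> = fourier f (\<xi> - a)"
  unfolding fourier_def
  by (intro LB_cong)
     (simp_all add: mult.assoc[symmetric] exp_add[symmetric], simp add: inner_diff_left right_diff_distrib')

lemma cnj_fourier: "cnj (fourier f \<xi>) = fourier (\<lambda>x. cnj (f x)) (- \<xi>)"
  unfolding fourier_def
  by (simp only: Bochner_Integration.integral_cnj[symmetric]) (simp add: exp_cnj)

lemma inverse_fourier_eq:
  fixes f :: "cfun"
  shows "inverse_fourier f x = fourier f (- x) / (2 * pi)^2"
  by (simp add: inverse_fourier_def fourier_def)

text \<open>The multiplication formula. It is the bridge between the distributional definitions,
  which put the transform on the test function, and transforms of functions.\<close>

lemma fourier_swap:
  fixes f g :: "'a::euclidean_space \<Rightarrow> complex"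
  assumes f: "L1 f" and g: "L1 g"
  shows "(LBINT \<xi>. fourier f \<xi> * g \<xi>) = (LBINT x. f x * fourier g x)"
proof -
  have [measurable]: "f \<in> borel_fun" "g \<in> borel_fun"
    using f g by auto
  let ?F = "\<lambda>\<xi> x. em \<xi> x * f x * g \<xi>"
  have i: "integrable lborel2 (\<lambda>(\<xi>, x). ?F \<xi> x)"
    by (rule lborel_pair.Fubini_integrable) (use f g fourier_integrand_integrable[OF f] in \<open>auto simp: norm_mult\<close>)
  have "(LBINT \<xi>. fourier f \<xi> * g \<xi>) = (LBINT \<xi>. LBINT x. ?F \<xi> x)"
    by (simp add: fourier_def)
  also have "... = (LBINT x. LBINT \<xi>. ?F \<xi> x)"
    using lborel_pair.Fubini_integral[OF i] by simp
  also have "... = (LBINT x. f x * fourier g x)"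
    unfolding fourier_def integral_mult_right_zero[symmetric]
    by (intro LB_cong refl) (auto simp: inner_commute mult_ac)
  finally show ?thesis .
qed

lemma fourier_cong_AE:
  assumes "AE x in lborel. f x = g x" "f \<in> borel_fun" "g \<in> borel_fun"
  shows "fourier f = fourier g"
  unfolding fourier_def using assms by (auto intro!: ext integral_cong_AE)

lemma lborel_translate:
  fixes f :: "plane \<Rightarrow> 'b::{banach, second_countable_topology}"
  shows "L1 (\<lambda>y. f (x - y)) \<longleftrightarrow> L1 f"
    and "(LBINT y. f (x - y)) = (LBINT y. f y)"
proof -
  have eq: "lborel = distr lborel borel (\<lambda>y::plane. x - y)"
    using lborel_affine[of "-1" x] by (simp add: density_1)
  show "L1 (\<lambda>y. f (x - y)) \<longleftrightarrow> L1 f"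
  proof
    assume "L1 f"
    then have "integrable (distr lborel borel (\<lambda>y. x - y)) f" using eq by simp
    then show "L1 (\<lambda>y. f (x - y))"
      by (rule integrable_distr[rotated]) simp
  next
    assume "L1 (\<lambda>y. f (x - y))"
    then have "integrable (distr lborel borel (\<lambda>y. x - y)) (\<lambda>y. f (x - y))" using eq by simp
    then have "L1 (\<lambda>y. f (x - (x - y)))"
      by (rule integrable_distr[rotated]) simp
    then show "L1 f" by simp
  qed
  note i = this
  show "(LBINT y. f (x - y)) = (LBINT y. f y)"
  proof (cases "L1 f")
    case True
    then have [measurable]: "f \<in> borel_fun" by auto
    have "(LBINT y. f y) = (LINT y|distr lborel borel (\<lambda>y. x - y). f y)"
      using eq by simp
    also have "... = (LBINT y. f (x - y))"
      by (subst integral_distr) auto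
    finally show ?thesis by simp
  next
    case False with i show ?thesis by (simp add: not_integrable_integral_eq)
  qed
qed

lemma nn_integral_translate:
  fixes f :: "plane \<Rightarrow> ennreal"
  assumes [measurable]: "f \<in> borel_fun"
  shows "(NN y. f (x - y)) = (NN y. f y)"
    and "(NN y. f (y - x)) = (NN y. f y)"
    and "(NN y. f (y + x)) = (NN y. f y)"
proof -
  have **: "lborel = distr lborel borel (\<lambda>y::plane. x - y)"
    using lborel_affine[of "-1" x] by (simp add: density_1)
  show "(NN y. f (x - y)) = (NN y. f y)"
    by (subst (2) **, subst nn_integral_distr) auto
  have *: "lborel = distr lborel borel (\<lambda>y::plane. t + y)" for t
    using lborel_affine[of "1" t] by (simp add: density_1)
  show "(NN y. f (y - x)) = (NN y. f y)"
    by (subst (2) *[of "-x"], subst nn_integral_distr) auto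
  show "(NN y. f (y + x)) = (NN y. f y)"
    by (subst (2) *[of "x"], subst nn_integral_distr) (auto simp: add.commute)
qed

text \<open>The Gaussian weight makes the frequency integral absolutely convergent for arbitrary
  integrable \<open>f\<close> and \<open>g\<close>; on the other side it becomes a mollification of
  \<open>g\<close>. Plancherel and Parseval below arise by letting the weight tend to 1.\<close>

lemma gauss_weighted_product:
  fixes f g :: "cfun"
  assumes f: "L1 f" and g: "L1 g" and \<delta>: "\<delta> > 0"
  shows "(LBINT \<xi>. fourier f \<xi> * (fourier g (- \<xi>) * of_real (gauss \<delta> \<xi>))) =
     (LBINT x. f x * (LBINT y. of_real (gauss_hat \<delta> (x - y)) * g y))"
proof -
  have [measurable]: "f \<in> borel_fun" "g \<in> borel_fun"
    using f g by auto
  let ?h = "\<lambda>\<xi>. fourier g (- \<xi>) * of_real (gauss \<delta> \<xi>)"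
  have h: "L1 ?h"
  proof (rule L1_bound)
    show "L1 (\<lambda>\<xi>. (LBINT x. norm (g x)) * gauss \<delta> \<xi>)"
      using gauss_integrable[OF \<delta>] by auto
    show "AE \<xi> in lborel. norm (?h \<xi>) \<le> norm ((LBINT x. norm (g x)) * gauss \<delta> \<xi>)"
      by (auto simp: norm_mult abs_mult intro!: mult_right_mono order_trans[OF norm_fourier_le])
  qed simp
  have "fourier ?h x = (LBINT y. of_real (gauss_hat \<delta> (x - y)) * g y)" for x
  proof -
    have "fourier ?h x = (LBINT \<xi>. fourier g \<xi> * (ep x \<xi> * of_real (gauss \<delta> \<xi>)))"
      unfolding fourier_def[of ?h]
      by (subst lborel_translate(2)[of _ 0, symmetric]) (auto simp: gauss_def mult_ac)
    also have "... = (LBINT y. g y * fourier (\<lambda>\<xi>. ep x \<xi> * of_real (gauss \<delta> \<xi>)) y)"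
      by (rule fourier_swap[OF g]) (use gauss_fourier(1)[OF \<delta>, of "-x"] in \<open>simp\<close>)
    also have "... = (LBINT y. of_real (gauss_hat \<delta> (x - y)) * g y)"
      unfolding fourier_modulate gauss_fourier(2)[OF \<delta>]
      by (auto simp: gauss_hat_def norm_minus_commute mult_ac)
    finally show ?thesis .
  qed
  then show ?thesis using fourier_swap[OF f h] by simp
qed

section \<open>Plancherel, Parseval and inversion in the plane\<close>

lemma ennreal_le_plus: "c \<le> a + b \<Longrightarrow> 0 \<le> a \<Longrightarrow> 0 \<le> b \<Longrightarrow> en c \<le> en a + en b"
  by (metis ennreal_leI ennreal_plus)

lemma norm_integral_le_nn_integral:
  fixes f :: "'a \<Rightarrow> 'b::{banach, second_countable_topology}"
  shows "en (norm (integral\<^sup>L M f)) \<le> (\<integral>\<^sup>+x. en (norm (f x)) \<partial>M)"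
proof (cases "integrable M f")
  case True then show ?thesis by (rule integral_norm_bound_ennreal)
next
  case False then show ?thesis by (simp add: not_integrable_integral_eq)
qed

text \<open>Half of Plancherel, meaningful also when the right side is infinite. With the Gaussian
  weight the left side is a double integral of \<open>f x * cnj (f y)\<close> against a positive
  kernel of mass \<open>(2 * pi)^2\<close>; bounding the product by half the sum of the squares
  suffices, and Fatou removes the weight.\<close>

lemma fourier_L2_le:
  fixes f :: "cfun"
  assumes f: "L1 f"
  shows "(NN \<xi>. en ((norm (fourier f \<xi>))^2)) \<le>
     en ((2 * pi)^2) * (NN x. en ((norm (f x))^2))"
proof (cases "(NN x. en ((norm (f x))^2)) = \<infinity>")
  case True then show ?thesis by (simp add: ennreal_mult_eq_top_iff ennreal_mult_top)
next
  case False
  have [measurable]: "f \<in> borel_fun" using f by auto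
  have f2: "L1 (\<lambda>x. (norm (f x))\<^sup>2)"
    using False by (intro integrableI_bounded) (auto simp: top.not_eq_extremum)
  define A where "A = (LBINT x. (norm (f x))\<^sup>2)"
  have A: "(NN x. en ((norm (f x))^2)) = en A"
    unfolding A_def by (rule nn_integral_eq_integral[OF f2]) simp
  have A0: "A \<ge> 0" unfolding A_def by simp
  have bound: "(NN \<xi>. en ((norm (fourier f \<xi>))^2 * gauss \<delta> \<xi>)) \<le> en ((2 * pi)^2 * A)" if \<delta>: "\<delta> > 0" for \<delta>
  proof -
    note cf = integrable_cnj[OF f]
    have i: "L1 (\<lambda>\<xi>. (norm (fourier f \<xi>))\<^sup>2 * gauss \<delta> \<xi>)"
    proof (rule L1_bound)
      show "L1 (\<lambda>\<xi>. (LBINT x. norm (f x))\<^sup>2 * gauss \<delta> \<xi>)"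
        using gauss_integrable[OF \<delta>] by auto
      show "AE \<xi> in lborel. norm ((norm (fourier f \<xi>))^2 * gauss \<delta> \<xi>) \<le> norm ((LBINT x. norm (f x))^2 * gauss \<delta> \<xi>)"
        by (auto simp: abs_mult intro!: mult_right_mono power_mono norm_fourier_le)
    qed simp
    have "of_real (LBINT \<xi>. (norm (fourier f \<xi>))\<^sup>2 * gauss \<delta> \<xi>) =
      (LBINT \<xi>. fourier f \<xi> * (fourier (\<lambda>x. cnj (f x)) (- \<xi>) * of_real (gauss \<delta> \<xi>)))"
      unfolding integral_complex_of_real[symmetric] cnj_fourier[symmetric]
      by (intro LB_cong refl) (simp only: of_real_mult complex_norm_square mult.assoc)
    also have "... = (LBINT x. f x * (LBINT y. of_real (gauss_hat \<delta> (x - y)) * cnj (f y)))"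
      by (rule gauss_weighted_product[OF f cf \<delta>])
    finally have "norm (of_real (LBINT \<xi>. (norm (fourier f \<xi>))\<^sup>2 * gauss \<delta> \<xi>) :: complex) =
        norm (LBINT x. f x * (LBINT y. of_real (gauss_hat \<delta> (x - y)) * cnj (f y)))"
      by (rule arg_cong)
    moreover have "0 \<le> (LBINT \<xi>. (norm (fourier f \<xi>))\<^sup>2 * gauss \<delta> \<xi>)"
      by (intro Bochner_Integration.integral_nonneg) (simp add: gauss_bounds less_imp_le)
    ultimately have eq: "(LBINT \<xi>. (norm (fourier f \<xi>))\<^sup>2 * gauss \<delta> \<xi>) =
        norm (LBINT x. f x * (LBINT y. of_real (gauss_hat \<delta> (x - y)) * cnj (f y)))"
      by (simp only: norm_of_real abs_of_nonneg)
    have "en (LBINT \<xi>. (norm (fourier f \<xi>))\<^sup>2 * gauss \<delta> \<xi>) \<le>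
        (NN x. norm (f x * (LBINT y. of_real (gauss_hat \<delta> (x - y)) * cnj (f y))))"
      unfolding eq by (rule norm_integral_le_nn_integral)
    also have "... \<le> (NN x. norm (f x) * (NN y. norm (of_real (gauss_hat \<delta> (x - y)) * cnj (f y))))"
      unfolding norm_mult[of "f _"] ennreal_mult'[OF norm_ge_zero]
      by (intro nn_integral_mono mult_left_mono norm_integral_le_nn_integral) auto
    also have "... = (NN x. NN y. en (gauss_hat \<delta> (x - y) * (norm (f x) * norm (f y))))"
      using gauss_hat_nonneg[OF \<delta>]
      by (auto simp: nn_integral_cmult[symmetric] norm_mult ennreal_mult'[symmetric] mult_ac intro!: nn_integral_cong)
    also have "... \<le> (NN x. NN y. en (gauss_hat \<delta> (x - y) * ((norm (f x))^2 / 2)) + en (gauss_hat \<delta> (x - y) * ((norm (f y))^2 / 2)))"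
    proof (intro nn_integral_mono)
      fix x y :: plane
      have "norm (f x) * norm (f y) \<le> (norm (f x))^2 / 2 + (norm (f y))^2 / 2"
        using sum_squares_bound[of "norm (f x)" "norm (f y)"] by (simp add: field_simps)
      then have "gauss_hat \<delta> (x - y) * (norm (f x) * norm (f y)) \<le> gauss_hat \<delta> (x - y) * ((norm (f x))^2 / 2) + gauss_hat \<delta> (x - y) * ((norm (f y))^2 / 2)"
        unfolding distrib_left[symmetric] using gauss_hat_nonneg[OF \<delta>] by (rule mult_left_mono)
      then show "en (gauss_hat \<delta> (x - y) * (norm (f x) * norm (f y))) \<le> en (gauss_hat \<delta> (x - y) * ((norm (f x))^2 / 2)) + en (gauss_hat \<delta> (x - y) * ((norm (f y))^2 / 2))"
        by (rule ennreal_le_plus) (auto simp: gauss_hat_nonneg[OF \<delta>])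
    qed
    also have "... = (NN x. NN y. en (gauss_hat \<delta> (x - y) * ((norm (f x))^2 / 2))) + (NN x. NN y. en (gauss_hat \<delta> (x - y) * ((norm (f y))^2 / 2)))"
      by (simp add: nn_integral_add)
    also have "(NN x. NN y. en (gauss_hat \<delta> (x - y) * ((norm (f y))^2 / 2))) =
       (NN x. NN y. en (gauss_hat \<delta> (x - y) * ((norm (f x))^2 / 2)))"
      by (subst lborel_pair.Fubini') (auto simp: gauss_hat_def norm_minus_commute)
    also have "(NN x. NN y. en (gauss_hat \<delta> (x - y) * ((norm (f x))^2 / 2))) = (NN x. en ((norm (f x))^2) * en ((2 * pi)^2 / 2))"
    proof (intro nn_integral_cong)
      fix x
      have "(NN y. en (gauss_hat \<delta> (x - y) * ((norm (f x))^2 / 2))) = (NN y. en (gauss_hat \<delta> (x - y))) * en ((norm (f x))^2 / 2)"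
        using gauss_hat_nonneg[OF \<delta>] by (simp add: nn_integral_multc[symmetric] ennreal_mult[symmetric])
      also have "(NN y. en (gauss_hat \<delta> (x - y))) = en ((2 * pi)^2)"
        using gauss_hat_integrable[OF \<delta>] gauss_hat_nonneg[OF \<delta>]
        by (subst nn_integral_translate(1)[of "\<lambda>y. en (gauss_hat \<delta> y)"]) (auto simp: nn_integral_eq_integral)
      finally show "(NN y. en (gauss_hat \<delta> (x - y) * ((norm (f x))^2 / 2))) = en ((norm (f x))^2) * en ((2 * pi)^2 / 2)"
        by (simp add: ennreal_mult[symmetric] mult_ac)
    qed
    also have "... = en (A * ((2 * pi)^2 / 2))"
      using A0 by (simp add: nn_integral_multc A ennreal_mult)
    also have "... + ... = en ((2 * pi)^2 * A)"
      using A0 by (subst ennreal_plus[symmetric]) auto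
    finally show ?thesis using i by (subst nn_integral_eq_integral) (auto simp: gauss_bounds less_imp_le)
  qed
  have "(NN \<xi>. en ((norm (fourier f \<xi>))^2)) =
     (NN \<xi>. liminf (\<lambda>n. en ((norm (fourier f \<xi>))^2 * gauss (1 / Suc n) \<xi>)))"
  proof (intro nn_integral_cong)
    fix \<xi>
    have "(\<lambda>n. en ((norm (fourier f \<xi>))^2 * gauss (1 / Suc n) \<xi>)) \<longlonglongrightarrow> en ((norm (fourier f \<xi>))^2 * 1)"
      by (intro tendsto_intros gauss_tendsto)
    from lim_imp_Liminf[OF _ this]
    show "en ((norm (fourier f \<xi>))^2) = liminf (\<lambda>n. en ((norm (fourier f \<xi>))^2 * gauss (1 / Suc n) \<xi>))"
      by simp
  qed
  also have "... \<le> liminf (\<lambda>n. NN \<xi>. en ((norm (fourier f \<xi>))^2 * gauss (1 / Suc n) \<xi>))"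
    by (rule nn_integral_liminf) measurable
  also have "... \<le> en ((2 * pi)^2 * A)"
    by (intro Liminf_le always_eventually allI bound) auto
  finally show ?thesis unfolding A using A0 by (simp add: ennreal_mult)
qed

lemma approx_identity:
  fixes f :: "cfun"
  assumes [measurable]: "f \<in> borel_fun" and B: "\<And>x. norm (f x) \<le> B"
    and c: "isCont f x"
  shows "(\<lambda>n. LBINT y. of_real (gauss_hat (1 / Suc n) (x - y)) * f y) \<longlonglongrightarrow> of_real ((2 * pi)^2) * f x"
proof -
  have eq: "(LBINT y. of_real (gauss_hat (1 / Suc n) (x - y)) * f y) =
      4 * of_real pi * (LBINT w. of_real (gauss 1 w) * f (x + (2 / sqrt (Suc n)) *\<^sub>R w))" for n
  proof -
    \<comment> \<open>The substitution \<open>y = x + ?c *\<^sub>R w\<close> turns the kernel into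
      the fixed Gaussian \<open>gauss 1\<close>, so that \<open>n\<close> survives only in the
      argument of \<open>f\<close>.\<close>
    let ?c = "2 / sqrt (Suc n)"
    have c: "?c \<noteq> 0" "?c > 0" "?c^2 = 4 / Suc n" by (auto simp: power_divide)
    have "(LBINT y. of_real (gauss_hat (1 / Suc n) (x - y)) * f y) =
      (LINT y|density (distr lborel borel (\<lambda>w. x + ?c *\<^sub>R w)) (\<lambda>_. en (\<bar>?c\<bar>^DIM(plane))). of_real (gauss_hat (1 / Suc n) (x - y)) * f y)"
      using lborel_affine[OF c(1), of x] by simp
    also have "... = (LBINT w. (?c^2) *\<^sub>R (of_real (gauss_hat (1 / Suc n) (- (?c *\<^sub>R w))) * f (x + ?c *\<^sub>R w)))"
      using c(2) by (subst integral_density) (auto simp: integral_distr power2_eq_square)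
    also have "... = (LBINT w. (4 * of_real pi) * (of_real (gauss 1 w) * f (x + ?c *\<^sub>R w)))"
    proof (intro LB_cong refl)
      fix w :: plane
      have "?c^2 * gauss_hat (1 / Suc n) (- (?c *\<^sub>R w)) = 4 * pi * gauss 1 w"
        using c(3) by (simp add: gauss_hat_def gauss_def power_mult_distrib power_divide)
      then have "complex_of_real (?c^2 * gauss_hat (1 / Suc n) (- (?c *\<^sub>R w))) = of_real (4 * pi * gauss 1 w)"
        by (rule arg_cong)
      then show "(?c^2) *\<^sub>R (of_real (gauss_hat (1 / Suc n) (- (?c *\<^sub>R w))) * f (x + ?c *\<^sub>R w)) = (4 * of_real pi) * (of_real (gauss 1 w) * f (x + ?c *\<^sub>R w))"
        by (simp only: scaleR_conv_of_real mult.assoc[symmetric] of_real_mult) simp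
    qed
    finally show ?thesis by simp
  qed
  have "(\<lambda>n. LBINT w. of_real (gauss 1 w) * f (x + (2 / sqrt (Suc n)) *\<^sub>R w)) \<longlonglongrightarrow> (LBINT w. of_real (gauss 1 w) * f x)"
  proof (rule integral_dominated_convergence)
    show "L1 (\<lambda>w. gauss 1 w * B)" using gauss_integrable(1)[of 1] by simp
    show "AE w in lborel. norm (of_real (gauss 1 w) * f (x + (2 / sqrt (Suc n)) *\<^sub>R w)) \<le> gauss 1 w * B" for n
      using B gauss_bounds(1)[of 1] by (auto simp: norm_mult less_imp_le)
    show "AE w in lborel. (\<lambda>n. of_real (gauss 1 w) * f (x + (2 / sqrt (Suc n)) *\<^sub>R w)) \<longlonglongrightarrow> of_real (gauss 1 w) * f x"
    proof (intro AE_I2 tendsto_intros)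
      fix w
      have "(\<lambda>n. x + (2 * sqrt (1 / Suc n)) *\<^sub>R w) \<longlonglongrightarrow> x + (2 * sqrt 0) *\<^sub>R w"
        by (intro tendsto_intros LIMSEQ_Suc[OF lim_1_over_n])
      then have "(\<lambda>n. x + (2 / sqrt (Suc n)) *\<^sub>R w) \<longlonglongrightarrow> x" by (simp add: real_sqrt_divide)
      then show "(\<lambda>n. f (x + (2 / sqrt (Suc n)) *\<^sub>R w)) \<longlonglongrightarrow> f x"
        by (rule isCont_tendsto_compose[OF c])
    qed
  qed simp_all
  also have "(LBINT w. of_real (gauss 1 w) * f x) = of_real pi * f x"
    using gauss_integrable[of 1] by simp
  finally have "(\<lambda>n. 4 * of_real pi * (LBINT w. of_real (gauss 1 w) * f (x + (2 / sqrt (Suc n)) *\<^sub>R w))) \<longlonglongrightarrow> 4 * of_real pi * (of_real pi * f x)"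
    by (intro tendsto_intros)
  then show ?thesis unfolding eq by (simp add: power2_eq_square mult_ac)
qed

lemma borel_measurable_cnj [measurable]: "cnj \<in> borel_fun"
  by (intro borel_measurable_continuous_onI continuous_intros)


text \<open>For a non-integrable \<open>f\<close> the Bochner integral is 0 by convention, and the
  majorant is nonnegative, so the bound persists.\<close>

lemma norm_integral_le_dominated:
  fixes f :: "'a \<Rightarrow> 'b::{banach, second_countable_topology}"
  assumes g: "integrable M g" and le: "\<And>x. norm (f x) \<le> g x"
  shows "norm (integral\<^sup>L M f) \<le> integral\<^sup>L M g"
proof (cases "integrable M f")
  case True then show ?thesis using g le by (intro order_trans[OF integral_norm_bound integral_mono[OF integrable_norm]]) auto
next
  case False
  have "0 \<le> g x" for x using le[of x] norm_ge_zero order_trans by blast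
  with False show ?thesis by (simp add: not_integrable_integral_eq)
qed

definition Cc :: "cfun set" where
  "Cc = {\<psi>. continuous_on UNIV \<psi> \<and> (\<exists>B R. \<forall>x. norm (\<psi> x) \<le> B * indicator (cball 0 R) x)}"

lemma integrable_indicator_cball: "L1 (\<lambda>x. B * indicator (cball (0::plane) R) x :: real)"
  using emeasure_lborel_cball_finite[of "0::plane" R] by (simp add: less_top)

lemma CcD:
  assumes "\<psi> \<in> Cc"
  shows "continuous_on UNIV \<psi>" "\<psi> \<in> borel_fun" "L1 \<psi>" "L1 (\<lambda>x. (norm (\<psi> x))\<^sup>2)"
proof -
  from assms obtain B R where B: "\<And>x. norm (\<psi> x) \<le> B * indicator (cball 0 R) x" and c: "continuous_on UNIV \<psi>"
    by (auto simp: Cc_def)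
  show "continuous_on UNIV \<psi>" by (rule c)
  then show [measurable]: "\<psi> \<in> borel_fun" by (rule borel_measurable_continuous_onI)
  show "L1 \<psi>"
    by (rule L1_bound[OF integrable_indicator_cball[of B R]])
       (use B in \<open>auto intro: order_trans[OF _ abs_ge_self]\<close>)
  have "(norm (\<psi> x))^2 \<le> B^2 * indicator (cball 0 R) x" for x
    using power_mono[OF B[of x] norm_ge_zero, of 2] by (auto simp: indicator_def power2_eq_square split: if_splits)
  then show "L1 (\<lambda>x. (norm (\<psi> x))\<^sup>2)"
    by (intro L1_bound[OF integrable_indicator_cball[of "B^2" R]]) auto
qed

text \<open>A Borel function is an almost everywhere limit of continuous ones. Multiplying these by
  a radial cutoff and by the factor that clips the modulus at \<open>n\<close> preserves continuity
  and yields a common bound, ready for dominated convergence.\<close>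

lemma Cc_approx_bounded:
  fixes h :: "cfun"
  assumes h[measurable]: "h \<in> borel_fun" and B: "\<And>x. norm (h x) \<le> real n * indicator (cball 0 (real n)) x"
  shows "\<exists>\<psi>. (\<forall>m. \<psi> m \<in> Cc) \<and> (\<forall>m x. norm (\<psi> m x) \<le> real n * indicator (cball 0 (real n + 1)) x) \<and>
     (AE x in lborel. (\<lambda>m. \<psi> m x) \<longlonglongrightarrow> h x)"
proof -
  have "h measurable_on UNIV"
    by (rule lebesgue_measurable_imp_measurable_on) (auto intro: measurable_completion)
  then obtain N g where N: "negligible N" and g: "\<And>m. continuous_on UNIV (g m)"
    and lim: "\<And>x. x \<notin> N \<Longrightarrow> (\<lambda>m. g m x) \<longlonglongrightarrow> h x"
    by (auto simp: measurable_on_def)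
  define cut where "cut x = max 0 (min 1 (real n + 1 - norm x))" for x :: plane
  define \<psi> where "\<psi> m x = of_real (cut x * (real n / max (real n) (norm (g m x)))) * g m x" for m x
  have cut: "0 \<le> cut x" "cut x \<le> 1" "x \<notin> cball 0 (real n + 1) \<Longrightarrow> cut x = 0" "x \<in> cball 0 (real n) \<Longrightarrow> cut x = 1" for x
    by (auto simp: cut_def)
  show ?thesis
  proof (cases "n = 0")
    case True
    with B have "h = (\<lambda>_. 0)" by auto
    then show ?thesis using True by (intro exI[of _ "\<lambda>_ _. 0"]) (auto simp: Cc_def intro!: exI[of _ 0])
  next
    case False
    have bd: "norm (\<psi> m x) \<le> real n * indicator (cball 0 (real n + 1)) x" for m x
    proof -
      have "norm (\<psi> m x) = cut x * (real n * (norm (g m x) / max (real n) (norm (g m x))))"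
        using cut(1)[of x] unfolding \<psi>_def norm_mult norm_of_real by (simp add: abs_mult)
      also have "norm (g m x) / max (real n) (norm (g m x)) \<le> 1" using False by (intro divide_le_eq_1_pos[THEN iffD2]) auto
      finally have "norm (\<psi> m x) \<le> cut x * real n" using cut(1)[of x] by (simp add: mult_left_mono)
      also have "... \<le> real n * indicator (cball 0 (real n + 1)) x"
        using cut[of x] by (cases "x \<in> cball 0 (real n + 1)") (auto simp: mult_left_le_one_le)
      finally show ?thesis .
    qed
    have cont: "continuous_on UNIV (\<psi> m)" for m
      unfolding \<psi>_def cut_def using g[of m] False by (auto intro!: continuous_intros)
    have "\<psi> m \<in> Cc" for m unfolding Cc_def using cont bd by blast
    moreover have "AE x in lborel. (\<lambda>m. \<psi> m x) \<longlonglongrightarrow> h x"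
    proof -
      have "AE x in lebesgue. x \<notin> N" using N by (auto simp: negligible_iff_null_sets intro: AE_not_in)
      then have "AE x in lebesgue. (\<lambda>m. \<psi> m x) \<longlonglongrightarrow> h x"
      proof (eventually_elim)
        fix x assume x: "x \<notin> N"
        have "(\<lambda>m. \<psi> m x) \<longlonglongrightarrow> of_real (cut x * (real n / max (real n) (norm (h x)))) * h x"
          unfolding \<psi>_def using False by (intro tendsto_intros lim[OF x]) (auto simp: max_def)
        moreover have "of_real (cut x * (real n / max (real n) (norm (h x)))) * h x = h x"
          using B[of x] cut(4)[of x] False by (cases "x \<in> cball 0 (real n)") (auto simp: max_def)
        ultimately show "(\<lambda>m. \<psi> m x) \<longlonglongrightarrow> h x" by simp
      qed
      then show ?thesis by (simp add: AE_completion_iff)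
    qed
    ultimately show ?thesis using bd by blast
  qed
qed

text \<open>Parseval with one factor in \<open>Cc\<close>. When the Gaussian weight is removed, the
  frequency side converges because both transforms are square integrable, the space side because the
  mollifications of \<open>\<psi>\<close> are bounded and converge at every point.\<close>

lemma fourier_Cc_pairing:
  fixes h :: "cfun"
  assumes h: "L1 h" and hL2: "L1 (\<lambda>\<xi>. (norm (fourier h \<xi>))\<^sup>2)" and \<psi>: "\<psi> \<in> Cc"
  shows "L1 (\<lambda>\<xi>. (norm (fourier \<psi> \<xi>))\<^sup>2)"
    and "L1 (\<lambda>\<xi>. fourier h \<xi> * fourier \<psi> (- \<xi>))"
    and "of_real ((2 * pi)^2) * (LBINT x. h x * \<psi> x) = (LBINT \<xi>. fourier h \<xi> * fourier \<psi> (- \<xi>))"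
proof -
  note [measurable] = CcD(2)[OF \<psi>]
  have [measurable]: "h \<in> borel_fun" using h by auto
  have "(NN \<xi>. en ((norm (fourier \<psi> \<xi>))^2)) \<le> en ((2 * pi)^2) * (NN x. en ((norm (\<psi> x))^2))"
    by (rule fourier_L2_le[OF CcD(3)[OF \<psi>]])
  also have "... < \<infinity>" using CcD(4)[OF \<psi>] by (simp add: nn_integral_eq_integral ennreal_mult_less_top)
  finally show \<psi>L2: "L1 (\<lambda>\<xi>. (norm (fourier \<psi> \<xi>))\<^sup>2)"
    by (intro integrableI_bounded) auto
  have dom: "L1 (\<lambda>\<xi>. (norm (fourier h \<xi>))\<^sup>2 + (norm (fourier \<psi> (- \<xi>)))^2)"
    using hL2 \<psi>L2 lborel_translate(1)[of "\<lambda>\<xi>. (norm (fourier \<psi> \<xi>))\<^sup>2" 0] by auto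
  have am: "a * b \<le> a^2 + b^2" if "0 \<le> a" "0 \<le> b" for a b :: real
    using sum_squares_bound[of a b] mult_nonneg_nonneg[OF that] by linarith
  show i: "L1 (\<lambda>\<xi>. fourier h \<xi> * fourier \<psi> (- \<xi>))"
    by (rule L1_bound[OF dom]) (auto simp: norm_mult am)
  have lim1: "(\<lambda>n. LBINT \<xi>. fourier h \<xi> * (fourier \<psi> (- \<xi>) * of_real (gauss (1 / Suc n) \<xi>))) \<longlonglongrightarrow> (LBINT \<xi>. fourier h \<xi> * (fourier \<psi> (- \<xi>) * of_real 1))"
  proof (rule integral_dominated_convergence[OF _ _ integrable_norm[OF i]])
    show "AE \<xi> in lborel. (\<lambda>n. fourier h \<xi> * (fourier \<psi> (- \<xi>) * of_real (gauss (1 / Suc n) \<xi>))) \<longlonglongrightarrow> fourier h \<xi> * (fourier \<psi> (- \<xi>) * of_real 1)"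
      by (intro AE_I2 tendsto_intros gauss_tendsto)
    show "AE \<xi> in lborel. norm (fourier h \<xi> * (fourier \<psi> (- \<xi>) * of_real (gauss (1 / Suc n) \<xi>))) \<le> norm (fourier h \<xi> * fourier \<psi> (- \<xi>))" for n
      by (intro AE_I2) (simp add: norm_mult abs_of_pos gauss_bounds mult_left_mono mult_right_le_one_le less_imp_le)
  qed simp_all
  obtain B R where B: "\<And>x. norm (\<psi> x) \<le> B * indicator (cball 0 R) x" using \<psi> by (auto simp: Cc_def)
  have B': "norm (\<psi> x) \<le> \<bar>B\<bar>" for x
    using B[of x] by (cases "x \<in> cball 0 R") auto
  have Bs: "norm (LBINT y. of_real (gauss_hat (1 / Suc n) (x - y)) * \<psi> y) \<le> (2 * pi)^2 * \<bar>B\<bar>" for n x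
  proof -
    have p: "(1 / Suc n :: real) > 0" by simp
    have i1: "L1 (\<lambda>y. gauss_hat (1 / Suc n) (x - y))"
      using lborel_translate(1)[of "gauss_hat (1 / Suc n)"] gauss_hat_integrable(1)[OF p] by blast
    have "norm (LBINT y. of_real (gauss_hat (1 / Suc n) (x - y)) * \<psi> y) \<le> (LBINT y. gauss_hat (1 / Suc n) (x - y) * \<bar>B\<bar>)"
      by (rule norm_integral_le_dominated[OF integrable_mult_left[OF i1]])
         (use gauss_hat_nonneg[OF p] B' in \<open>auto simp: norm_mult intro!: mult_left_mono\<close>)
    also have "... = (2 * pi)^2 * \<bar>B\<bar>"
      using lborel_translate(2)[of "gauss_hat (1 / Suc n)" x] gauss_hat_integrable(2)[OF p] by simp
    finally show ?thesis .
  qed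
  have lim2: "(\<lambda>n. LBINT x. h x * (LBINT y. of_real (gauss_hat (1 / Suc n) (x - y)) * \<psi> y)) \<longlonglongrightarrow> (LBINT x. h x * (of_real ((2 * pi)^2) * \<psi> x))"
  proof (rule integral_dominated_convergence)
    show "L1 (\<lambda>x. norm (h x) * ((2 * pi)^2 * \<bar>B\<bar>))" using h by auto
    show "AE x in lborel. (\<lambda>n. h x * (LBINT y. of_real (gauss_hat (1 / Suc n) (x - y)) * \<psi> y)) \<longlonglongrightarrow> h x * (of_real ((2 * pi)^2) * \<psi> x)"
      using CcD(1)[OF \<psi>] B' by (intro AE_I2 tendsto_intros approx_identity) (auto simp: continuous_on_eq_continuous_at)
    show "AE x in lborel. norm (h x * (LBINT y. of_real (gauss_hat (1 / Suc n) (x - y)) * \<psi> y)) \<le> norm (h x) * ((2 * pi)^2 * \<bar>B\<bar>)" for n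
      unfolding norm_mult using Bs by (intro AE_I2 mult_left_mono) auto
  qed simp_all
  have "(LBINT x. h x * (of_real ((2 * pi)^2) * \<psi> x)) = (LBINT \<xi>. fourier h \<xi> * (fourier \<psi> (- \<xi>) * of_real 1))"
    using LIMSEQ_unique[OF lim2] lim1 gauss_weighted_product[OF h CcD(3)[OF \<psi>]] by simp
  moreover have "(LBINT x. h x * (of_real ((2 * pi)^2) * \<psi> x)) = of_real ((2 * pi)^2) * (LBINT x. h x * \<psi> x)"
    by (subst integral_mult_right_zero[symmetric]) (simp add: mult_ac)
  ultimately show "of_real ((2 * pi)^2) * (LBINT x. h x * \<psi> x) = (LBINT \<xi>. fourier h \<xi> * fourier \<psi> (- \<xi>))"
    by simp
qed


text \<open>The converse half of Plancherel, by duality: \<open>h\<close> is tested against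
  approximations of the conjugate of its own truncation \<open>hn\<close>, so the pairing tends to
  the square integral of \<open>hn\<close>. Fatou then removes the truncation.\<close>

lemma square_integrable_of_fourier:
  fixes h :: "cfun"
  assumes h: "L1 h" and hL2: "L1 (\<lambda>\<xi>. (norm (fourier h \<xi>))\<^sup>2)"
  shows "(NN x. en ((norm (h x))^2)) \<le> en ((LBINT \<xi>. (norm (fourier h \<xi>))\<^sup>2) / (2 * pi)^2)"
proof -
  have [measurable]: "h \<in> borel_fun" using h by auto
  define C where "C = (LBINT \<xi>. (norm (fourier h \<xi>))\<^sup>2)"
  define hn where "hn n x = h x * indicator {x. norm x \<le> real n \<and> norm (h x) \<le> real n} x" for n x
  have [measurable]: "hn n \<in> borel_fun" for n unfolding hn_def by measurable
  have hn_bd: "norm (hn n x) \<le> real n * indicator (cball 0 (real n)) x" for n x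
    by (auto simp: hn_def indicator_def)
  have hn_le: "norm (hn n x) \<le> norm (h x)" for n x by (auto simp: hn_def indicator_def)
  have main: "(NN x. en ((norm (hn n x))^2)) \<le> en (C / (2 * pi)^2)" for n
  proof -
    have "\<exists>\<psi>. (\<forall>m. \<psi> m \<in> Cc) \<and> (\<forall>m x. norm (\<psi> m x) \<le> real n * indicator (cball 0 (real n + 1)) x) \<and>
     (AE x in lborel. (\<lambda>m. \<psi> m x) \<longlonglongrightarrow> cnj (hn n x))"
    proof (rule Cc_approx_bounded)
      show "(\<lambda>x. cnj (hn n x)) \<in> borel_fun" by measurable
    qed (use hn_bd in auto)
    then obtain \<psi> where \<psi>: "\<And>m. \<psi> m \<in> Cc" and bd: "\<And>m x. norm (\<psi> m x) \<le> real n * indicator (cball 0 (real n + 1)) x"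
      and lim: "AE x in lborel. (\<lambda>m. \<psi> m x) \<longlonglongrightarrow> cnj (hn n x)" by blast
    have [measurable]: "\<psi> m \<in> borel_fun" for m by (rule CcD(2)[OF \<psi>])
    have ih: "L1 (\<lambda>x. (norm (hn n x))\<^sup>2)"
      by (rule L1_bound[OF integrable_indicator_cball[of "(real n)^2" "real n"]])
         (auto simp: hn_def indicator_def intro!: power_mono)
    have l1: "(\<lambda>m. LBINT x. h x * \<psi> m x) \<longlonglongrightarrow> (LBINT x. h x * cnj (hn n x))"
    proof (rule integral_dominated_convergence)
      show "L1 (\<lambda>x. norm (h x) * real n)" using h by auto
      show "AE x in lborel. (\<lambda>m. h x * \<psi> m x) \<longlonglongrightarrow> h x * cnj (hn n x)"
        using lim by eventually_elim (intro tendsto_intros)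
      show "AE x in lborel. norm (h x * \<psi> m x) \<le> norm (h x) * real n" for m
      proof (intro AE_I2)
        fix x have "norm (\<psi> m x) \<le> real n" using bd[of m x] by (cases "x \<in> cball 0 (real n + 1)") auto
        then show "norm (h x * \<psi> m x) \<le> norm (h x) * real n" by (simp add: norm_mult mult_left_mono)
      qed
    qed simp_all
    have l2: "(\<lambda>m. LBINT x. (norm (\<psi> m x))\<^sup>2) \<longlonglongrightarrow> (LBINT x. (norm (cnj (hn n x)))\<^sup>2)"
    proof (rule integral_dominated_convergence[OF _ _ integrable_indicator_cball[of "(real n)^2" "real n + 1"]])
      show "AE x in lborel. (\<lambda>m. (norm (\<psi> m x))\<^sup>2) \<longlonglongrightarrow> (norm (cnj (hn n x)))^2"
        using lim by eventually_elim (intro tendsto_intros)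
      show "AE x in lborel. norm ((norm (\<psi> m x))^2) \<le> (real n)^2 * indicator (cball 0 (real n + 1)) x" for m
      proof (intro AE_I2)
        fix x have "(norm (\<psi> m x))^2 \<le> (real n * indicator (cball 0 (real n + 1)) x)^2" using bd[of m x] by (intro power_mono) auto
        then show "norm ((norm (\<psi> m x))^2) \<le> (real n)^2 * indicator (cball 0 (real n + 1)) x" by (cases "x \<in> cball 0 (real n + 1)") auto
      qed
    qed simp_all
    \<comment> \<open>Doubled, so that in the limit half of the left side absorbs the norm of
      \<open>\<psi> m\<close> on the right.\<close>
    have ineq: "2 * (2 * pi)^2 * norm (LBINT x. h x * \<psi> m x) \<le> C + (2 * pi)^2 * (LBINT x. (norm (\<psi> m x))\<^sup>2)" for m
    proof -
      note p = fourier_Cc_pairing[OF h hL2 \<psi>[of m]]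
      have "(2 * pi)^2 * norm (LBINT x. h x * \<psi> m x) = norm (LBINT \<xi>. fourier h \<xi> * fourier (\<psi> m) (- \<xi>))"
        unfolding p(3)[symmetric] by (simp add: norm_mult norm_power)
      also have "... \<le> (LBINT \<xi>. ((norm (fourier h \<xi>))^2 + (norm (fourier (\<psi> m) (- \<xi>)))^2) / 2)"
      proof (rule norm_integral_le_dominated)
        show "L1 (\<lambda>\<xi>. ((norm (fourier h \<xi>))^2 + (norm (fourier (\<psi> m) (- \<xi>)))^2) / 2)"
          using hL2 p(1) lborel_translate(1)[of "\<lambda>\<xi>. (norm (fourier (\<psi> m) \<xi>))\<^sup>2" 0] by auto
        fix \<xi>
        show "norm (fourier h \<xi> * fourier (\<psi> m) (- \<xi>)) \<le> ((norm (fourier h \<xi>))^2 + (norm (fourier (\<psi> m) (- \<xi>)))^2) / 2"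
          using sum_squares_bound[of "norm (fourier h \<xi>)" "norm (fourier (\<psi> m) (- \<xi>))"] by (simp add: norm_mult)
      qed
      also have "... = (C + (LBINT \<xi>. (norm (fourier (\<psi> m) \<xi>))\<^sup>2)) / 2"
        using hL2 p(1) lborel_translate[of "\<lambda>\<xi>. (norm (fourier (\<psi> m) \<xi>))\<^sup>2" 0] by (simp add: C_def)
      finally have 1: "2 * (2 * pi)^2 * norm (LBINT x. h x * \<psi> m x) \<le> C + (LBINT \<xi>. (norm (fourier (\<psi> m) \<xi>))\<^sup>2)"
        by simp
      have "en (LBINT \<xi>. (norm (fourier (\<psi> m) \<xi>))\<^sup>2) \<le> en ((2 * pi)^2) * en (LBINT x. (norm (\<psi> m x))\<^sup>2)"
        using fourier_L2_le[OF CcD(3)[OF \<psi>[of m]]] CcD(4)[OF \<psi>[of m]] p(1) by (simp add: nn_integral_eq_integral)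
      then have "(LBINT \<xi>. (norm (fourier (\<psi> m) \<xi>))\<^sup>2) \<le> (2 * pi)^2 * (LBINT x. (norm (\<psi> m x))\<^sup>2)"
        by (simp add: ennreal_mult[symmetric] ennreal_le_iff)
      with 1 show ?thesis by linarith
    qed
    have "2 * (2 * pi)^2 * norm (LBINT x. h x * cnj (hn n x)) \<le> C + (2 * pi)^2 * (LBINT x. (norm (cnj (hn n x)))\<^sup>2)"
      by (rule LIMSEQ_le[OF tendsto_mult[OF tendsto_const tendsto_norm[OF l1]] tendsto_add[OF tendsto_const tendsto_mult[OF tendsto_const l2]]])
         (use ineq in auto)
    moreover have "(LBINT x. h x * cnj (hn n x)) = of_real (LBINT x. (norm (hn n x))\<^sup>2)"
      unfolding integral_complex_of_real[symmetric]
      by (intro LB_cong refl) (auto simp: hn_def indicator_def complex_norm_square[symmetric])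
    ultimately have "(2 * pi)^2 * (LBINT x. (norm (hn n x))\<^sup>2) \<le> C"
      by simp
    then have "(LBINT x. (norm (hn n x))\<^sup>2) \<le> C / (2 * pi)^2" by (simp add: field_simps)
    then show ?thesis using ih by (simp add: nn_integral_eq_integral ennreal_leI)
  qed
  have "(NN x. en ((norm (h x))^2)) = (NN x. liminf (\<lambda>n. en ((norm (hn n x))^2)))"
  proof (intro nn_integral_cong)
    fix x
    have "eventually (\<lambda>n. hn n x = h x) sequentially"
      using eventually_ge_at_top[of "nat \<lceil>norm x\<rceil>"] eventually_ge_at_top[of "nat \<lceil>norm (h x)\<rceil>"]
      by eventually_elim (auto simp: hn_def indicator_def nat_le_iff ceiling_le_iff)
    then have "(\<lambda>n. en ((norm (hn n x))^2)) \<longlonglongrightarrow> en ((norm (h x))^2)"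
      by (intro tendsto_eventually) (auto elim: eventually_mono)
    from lim_imp_Liminf[OF _ this]
    show "en ((norm (h x))^2) = liminf (\<lambda>n. en ((norm (hn n x))^2))" by simp
  qed
  also have "... \<le> liminf (\<lambda>n. NN x. en ((norm (hn n x))^2))"
    by (rule nn_integral_liminf) measurable
  also have "... \<le> en (C / (2 * pi)^2)"
    by (intro Liminf_le always_eventually allI main) auto
  finally show ?thesis by (simp add: C_def)
qed

lemma square_integrable_of_fourier':
  fixes h :: "cfun"
  assumes h: "L1 h" and hL2: "L1 (\<lambda>\<xi>. (norm (fourier h \<xi>))\<^sup>2)"
  shows "L1 (\<lambda>x. (norm (h x))\<^sup>2)"
  using square_integrable_of_fourier[OF assms] h
  by (intro integrableI_bounded) (auto intro: le_less_trans)

text \<open>Injectivity of the transform on integrable functions is a by-product: a vanishing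
  transform is square integrable with norm 0.\<close>

lemma AE_zero_of_fourier_zero:
  fixes h :: "cfun"
  assumes h: "L1 h" and z: "\<And>\<xi>. fourier h \<xi> = 0"
  shows "AE x in lborel. h x = 0"
proof -
  have [measurable]: "h \<in> borel_fun" using h by auto
  have "(NN x. en ((norm (h x))^2)) \<le> 0"
    using square_integrable_of_fourier[OF h] by (simp add: z)
  then have "AE x in lborel. en ((norm (h x))^2) = 0"
    by (subst (asm) le_zero_eq, subst (asm) nn_integral_0_iff_AE) auto
  then show ?thesis by eventually_elim (simp add: ennreal_eq_0_iff)
qed

lemma Cc_dense_L2:
  fixes h :: "cfun"
  assumes [measurable]: "h \<in> borel_fun" and h2: "L1 (\<lambda>x. (norm (h x))\<^sup>2)" and \<epsilon>: "\<epsilon> > 0"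
  shows "\<exists>\<psi>\<in>Cc. L1 (\<lambda>x. (norm (h x - \<psi> x))\<^sup>2) \<and> (LBINT x. (norm (h x - \<psi> x))\<^sup>2) < \<epsilon>"
proof -
  define hn where "hn n x = h x * indicator {x. norm x \<le> real n \<and> norm (h x) \<le> real n} x" for n x
  have [measurable]: "hn n \<in> borel_fun" for n unfolding hn_def by measurable
  have hn_bd: "norm (hn n x) \<le> real n * indicator (cball 0 (real n)) x" for n x
    by (auto simp: hn_def indicator_def)
  have "(\<lambda>n. LBINT x. (norm (h x - hn n x))\<^sup>2) \<longlonglongrightarrow> (LINT x|(lborel::plane measure). 0)"
  proof (rule integral_dominated_convergence[OF _ _ h2])
    show "AE x in lborel. (\<lambda>n. (norm (h x - hn n x))\<^sup>2) \<longlonglongrightarrow> 0"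
    proof (intro AE_I2)
      fix x
      have "eventually (\<lambda>n. hn n x = h x) sequentially"
        using eventually_ge_at_top[of "nat \<lceil>norm x\<rceil>"] eventually_ge_at_top[of "nat \<lceil>norm (h x)\<rceil>"]
        by eventually_elim (auto simp: hn_def indicator_def nat_le_iff ceiling_le_iff)
      then show "(\<lambda>n. (norm (h x - hn n x))\<^sup>2) \<longlonglongrightarrow> 0"
        by (intro tendsto_eventually) (auto elim: eventually_mono)
    qed
    show "AE x in lborel. norm ((norm (h x - hn n x))^2) \<le> (norm (h x))^2" for n
      by (auto simp: hn_def indicator_def)
  qed simp_all
  then have "eventually (\<lambda>n. (LBINT x. (norm (h x - hn n x))\<^sup>2) < \<epsilon> / 4) sequentially"
    using \<epsilon> by (intro order_tendstoD(2)) auto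
  then obtain n where n: "(LBINT x. (norm (h x - hn n x))\<^sup>2) < \<epsilon> / 4" by (auto simp: eventually_sequentially)
  obtain \<psi> where \<psi>: "\<And>m. \<psi> m \<in> Cc" and bd: "\<And>m x. norm (\<psi> m x) \<le> real n * indicator (cball 0 (real n + 1)) x"
      and lim: "AE x in lborel. (\<lambda>m. \<psi> m x) \<longlonglongrightarrow> hn n x" using Cc_approx_bounded[of "hn n" n] hn_bd by auto
  have [measurable]: "\<psi> m \<in> borel_fun" for m by (rule CcD(2)[OF \<psi>])
  have bd2: "norm ((norm (hn n x - \<psi> m x))^2) \<le> (2 * real n)^2 * indicator (cball 0 (real n + 1)) x" for m x
  proof (cases "x \<in> cball 0 (real n + 1)")
    case True
    have "norm (hn n x - \<psi> m x) \<le> norm (hn n x) + norm (\<psi> m x)" by (rule norm_triangle_ineq4)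
    also have "norm (hn n x) \<le> real n" by (auto simp: hn_def indicator_def)
    also have "norm (\<psi> m x) \<le> real n" using bd[of m x] True by simp
    finally have "(norm (hn n x - \<psi> m x))^2 \<le> (2 * real n)^2" by (intro power_mono) auto
    then show ?thesis using True by simp
  next
    case False then show ?thesis using bd[of m x] hn_bd[of n x] by (simp add: indicator_def split: if_splits)
  qed
  have "(\<lambda>m. LBINT x. (norm (hn n x - \<psi> m x))\<^sup>2) \<longlonglongrightarrow> (LINT x|(lborel::plane measure). 0)"
  proof (rule integral_dominated_convergence[OF _ _ integrable_indicator_cball[of "(2 * real n)^2" "real n + 1"]])
    show "AE x in lborel. (\<lambda>m. (norm (hn n x - \<psi> m x))\<^sup>2) \<longlonglongrightarrow> 0"
      using lim by eventually_elim (auto intro!: tendsto_eq_intros)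
  qed (use bd2 in auto)
  then have "eventually (\<lambda>m. (LBINT x. (norm (hn n x - \<psi> m x))\<^sup>2) < \<epsilon> / 4) sequentially"
    using \<epsilon> by (intro order_tendstoD(2)) auto
  then obtain m where m: "(LBINT x. (norm (hn n x - \<psi> m x))\<^sup>2) < \<epsilon> / 4" by (auto simp: eventually_sequentially)
  have i1: "L1 (\<lambda>x. (norm (h x - hn n x))\<^sup>2)"
    by (rule L1_bound[OF h2]) (auto simp: hn_def indicator_def)
  have i2: "L1 (\<lambda>x. (norm (hn n x - \<psi> m x))\<^sup>2)"
    by (rule L1_bound[OF integrable_indicator_cball[of "(2 * real n)^2" "real n + 1"]])
       (use bd2 in \<open>auto simp: abs_mult\<close>)
  have le: "(norm (h x - \<psi> m x))^2 \<le> 2 * (norm (h x - hn n x))^2 + 2 * (norm (hn n x - \<psi> m x))^2" for x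
  proof -
    have "norm (h x - \<psi> m x) \<le> norm (h x - hn n x) + norm (hn n x - \<psi> m x)"
      by (rule norm_diff_triangle_ineq[of "h x" "hn n x" "hn n x" "\<psi> m x", simplified])
    then have "(norm (h x - \<psi> m x))^2 \<le> (norm (h x - hn n x) + norm (hn n x - \<psi> m x))^2" by (intro power_mono) auto
    also have "... \<le> 2 * (norm (h x - hn n x))^2 + 2 * (norm (hn n x - \<psi> m x))^2"
      using sum_squares_bound[of "norm (h x - hn n x)" "norm (hn n x - \<psi> m x)"] by (simp add: power2_sum)
    finally show ?thesis .
  qed
  have i3: "L1 (\<lambda>x. 2 * (norm (h x - hn n x))^2 + 2 * (norm (hn n x - \<psi> m x))^2)"
    using i1 i2 by auto
  have i4: "L1 (\<lambda>x. (norm (h x - \<psi> m x))\<^sup>2)"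
    by (rule L1_bound[OF i3]) (use le in auto)
  have "(LBINT x. (norm (h x - \<psi> m x))\<^sup>2) \<le> (LBINT x. 2 * (norm (h x - hn n x))^2 + 2 * (norm (hn n x - \<psi> m x))^2)"
    by (rule integral_mono[OF i4 i3]) (rule le)
  also have "... < \<epsilon>" using m n i1 i2 by simp
  finally show ?thesis using \<psi> i4 by blast
qed

text \<open>Bilinear Parseval, with a reflection in place of a conjugate. By
  \<open>fourier_Cc_pairing\<close> it holds when the second factor lies in \<open>Cc\<close>;
  approximating \<open>g\<close> within \<open>t * t\<close> in squared norm leaves a defect
  \<open>D\<close> of order \<open>t\<close>.\<close>

lemma Parseval_plane:
  fixes f g :: "cfun"
  assumes f: "L1 f" and f2: "L1 (\<lambda>\<xi>. (norm (fourier f \<xi>))\<^sup>2)"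
    and g: "L1 g" and g2: "L1 (\<lambda>\<xi>. (norm (fourier g \<xi>))\<^sup>2)"
  shows "L1 (\<lambda>x. f x * g x)"
    and "of_real ((2 * pi)^2) * (LBINT x. f x * g x) = (LBINT \<xi>. fourier f \<xi> * fourier g (- \<xi>))"
proof -
  let ?d = "\<lambda>\<psi> x. g x - \<psi> x"
  have [measurable]: "f \<in> borel_fun" "g \<in> borel_fun" using f g by auto
  note F = square_integrable_of_fourier'[OF f f2] and G = square_integrable_of_fourier'[OF g g2]
  have product: "L1 (\<lambda>x. a x * b x)" "norm (LBINT x. a x * b x) \<le> (t * (LBINT x. (norm (a x))\<^sup>2) + (LBINT x. (norm (b x))\<^sup>2) / t) / 2"
    if [measurable]: "a \<in> borel_fun" "b \<in> borel_fun" and ab: "L1 (\<lambda>x. (norm (a x))\<^sup>2)" "L1 (\<lambda>x. (norm (b x))\<^sup>2)" and t: "t > 0"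
    for a b :: "cfun" and t :: real
  proof -
    have le: "norm (a x * b x) \<le> (t * (norm (a x))^2 + (norm (b x))^2 / t) / 2" for x
    proof -
      have "2 * (sqrt t * norm (a x)) * (norm (b x) / sqrt t) \<le> (sqrt t * norm (a x))^2 + (norm (b x) / sqrt t)^2"
        by (rule sum_squares_bound)
      then show ?thesis using t by (simp add: power_mult_distrib power_divide norm_mult)
    qed
    have i: "L1 (\<lambda>x. (t * (norm (a x))^2 + (norm (b x))^2 / t) / 2)" using ab by auto
    show "L1 (\<lambda>x. a x * b x)"
      by (rule L1_bound[OF i]) (use le t in \<open>auto intro: order_trans[OF _ abs_ge_self]\<close>)
    have "norm (LBINT x. a x * b x) \<le> (LBINT x. (t * (norm (a x))^2 + (norm (b x))^2 / t) / 2)"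
      by (rule norm_integral_le_dominated[OF i le])
    also have "... = (t * (LBINT x. (norm (a x))\<^sup>2) + (LBINT x. (norm (b x))\<^sup>2) / t) / 2"
      using ab by simp
    finally show "norm (LBINT x. a x * b x) \<le> (t * (LBINT x. (norm (a x))\<^sup>2) + (LBINT x. (norm (b x))\<^sup>2) / t) / 2" .
  qed
  show fg: "L1 (\<lambda>x. f x * g x)" by (rule product(1)[OF _ _ F G zero_less_one]) auto
  define A where "A = (LBINT x. (norm (f x))\<^sup>2)"
  define A' where "A' = (LBINT \<xi>. (norm (fourier f \<xi>))\<^sup>2)"
  have A: "A \<ge> 0" "A' \<ge> 0" by (auto simp: A_def A'_def)
  define D where "D = of_real ((2 * pi)^2) * (LBINT x. f x * g x) - (LBINT \<xi>. fourier f \<xi> * fourier g (- \<xi>))"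
  have neg: "L1 (\<lambda>\<xi>. h (- \<xi>)) \<longleftrightarrow> L1 h" "(LBINT \<xi>. h (- \<xi>)) = (LBINT \<xi>. h \<xi>)" for h :: "plane \<Rightarrow> real"
    using lborel_translate[of h 0] by auto
  \<comment> \<open>The factors \<open>t\<close> and \<open>1 / t\<close> in
    \<open>product(2)\<close> balance the squared error \<open>t * t\<close> against the fixed norms
    of \<open>f\<close> and of its transform.\<close>
  have key: "norm D \<le> (2 * pi)^2 * (t * (A + A') + 2 / t * (t * t)) / 2" if t: "t > 0" for t
  proof -
    obtain \<psi> where \<psi>: "\<psi> \<in> Cc" "L1 (\<lambda>x. (norm (g x - \<psi> x))\<^sup>2)" and small: "(LBINT x. (norm (g x - \<psi> x))\<^sup>2) < t * t"
      using Cc_dense_L2[OF _ G, of "t * t"] t by auto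
    note [measurable] = CcD(2)[OF \<psi>(1)]
    note P = fourier_Cc_pairing[OF f f2 \<psi>(1)]
    have id: "L1 (\<lambda>x. g x - \<psi> x)" using g CcD(3)[OF \<psi>(1)] by auto
    have Fd: "fourier (?d \<psi>) \<xi> = fourier g \<xi> - fourier \<psi> \<xi>" for \<xi>
      unfolding fourier_def right_diff_distrib
      by (rule LB_diff) (auto intro!: fourier_integrand_integrable[unfolded] simp del: of_real_mult simp: g fourier_integrand_integrable[OF g, simplified] fourier_integrand_integrable[OF CcD(3)[OF \<psi>(1)], simplified])
    have "(NN \<xi>. en ((norm (fourier (?d \<psi>) \<xi>))^2)) \<le> en ((2 * pi)^2) * en (LBINT x. (norm (g x - \<psi> x))\<^sup>2)"
      using fourier_L2_le[OF id] \<psi>(2) by (simp add: nn_integral_eq_integral)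
    also have "... \<le> en ((2 * pi)^2 * (t * t))"
      using small by (subst ennreal_mult[symmetric]) (auto intro!: ennreal_leI)
    finally have d: "(NN \<xi>. en ((norm (fourier (?d \<psi>) \<xi>))^2)) \<le> en ((2 * pi)^2 * (t * t))" .
    then have di: "L1 (\<lambda>\<xi>. (norm (fourier (?d \<psi>) \<xi>))\<^sup>2)"
      by (intro integrableI_bounded) (auto intro: le_less_trans)
    with d have d': "(LBINT \<xi>. (norm (fourier (?d \<psi>) \<xi>))\<^sup>2) \<le> (2 * pi)^2 * (t * t)"
      using t by (simp add: nn_integral_eq_integral ennreal_le_iff)
    have "D = of_real ((2 * pi)^2) * (LBINT x. f x * (g x - \<psi> x)) - (LBINT \<xi>. fourier f \<xi> * fourier (?d \<psi>) (- \<xi>))"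
    proof -
      have "(LBINT x. f x * (g x - \<psi> x)) = (LBINT x. f x * g x) - (LBINT x. f x * \<psi> x)"
        unfolding right_diff_distrib
        by (rule LB_diff[OF fg product(1)[OF _ _ F CcD(4)[OF \<psi>(1)] zero_less_one]]) auto
      moreover have "(LBINT \<xi>. fourier f \<xi> * fourier (?d \<psi>) (- \<xi>)) = (LBINT \<xi>. fourier f \<xi> * fourier g (- \<xi>)) - (LBINT \<xi>. fourier f \<xi> * fourier \<psi> (- \<xi>))"
        unfolding Fd right_diff_distrib
        by (rule LB_diff[OF product(1)[OF _ _ f2 _ zero_less_one] P(2)]) (auto simp: neg(1)[of "\<lambda>\<xi>. (norm (fourier g \<xi>))\<^sup>2"] g2)
      ultimately show ?thesis unfolding D_def by (simp only: right_diff_distrib P(3)) simp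
    qed
    also have "norm ... \<le> (2 * pi)^2 * norm (LBINT x. f x * (g x - \<psi> x)) + norm (LBINT \<xi>. fourier f \<xi> * fourier (?d \<psi>) (- \<xi>))"
      by (rule order_trans[OF norm_triangle_ineq4]) (simp add: norm_mult norm_power)
    also have "norm (LBINT x. f x * (g x - \<psi> x)) \<le> (t * A + (LBINT x. (norm (g x - \<psi> x))\<^sup>2) / t) / 2"
      unfolding A_def by (rule product(2)[OF _ _ F \<psi>(2) t]) auto
    also have "norm (LBINT \<xi>. fourier f \<xi> * fourier (?d \<psi>) (- \<xi>)) \<le> (t * A' + (LBINT \<xi>. (norm (fourier (?d \<psi>) (-\<xi>)))\<^sup>2) / t) / 2"
      unfolding A'_def by (rule product(2)[OF _ _ f2 _ t]) (auto simp: neg(1)[of "\<lambda>\<xi>. (norm (fourier (?d \<psi>) \<xi>))\<^sup>2"] di)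
    also have "(LBINT \<xi>. (norm (fourier (?d \<psi>) (-\<xi>)))\<^sup>2) = (LBINT \<xi>. (norm (fourier (?d \<psi>) \<xi>))\<^sup>2)"
      by (rule neg(2))
    finally have "norm D \<le> (2 * pi)^2 * ((t * A + (LBINT x. (norm (g x - \<psi> x))\<^sup>2) / t) / 2) + (t * A' + (LBINT \<xi>. (norm (fourier (?d \<psi>) \<xi>))\<^sup>2) / t) / 2"
      by simp
    also have "... \<le> (2 * pi)^2 * ((t * A + (t * t) / t) / 2) + (t * A' + ((2 * pi)^2 * (t * t)) / t) / 2"
      using small d' t by (intro add_mono mult_left_mono divide_right_mono) auto
    also have "t * A' \<le> (2 * pi)^2 * (t * A')"
    proof -
      have "1 \<le> (2 * pi)^2" by (rule one_le_power) (use pi_gt3 in auto)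
      then have "1 * (t * A') \<le> (2 * pi)^2 * (t * A')"
        using A(2) t by (intro mult_right_mono) auto
      then show ?thesis by simp
    qed
    finally show ?thesis using t by (simp add: field_simps)
  qed
  have "D = 0"
  proof (rule ccontr)
    assume "D \<noteq> 0"
    define M where "M = (2 * pi)^2 * (A + A' + 2)"
    have M: "M > 0" unfolding M_def using A by (intro mult_pos_pos) auto
    have "norm D \<le> t * M / 2" if "t > 0" for t
      using key[OF that] that by (simp add: M_def field_simps)
    from this[of "norm D / M"] have "norm D \<le> norm D / 2" using M \<open>D \<noteq> 0\<close> by simp
    then show False using \<open>D \<noteq> 0\<close> by simp
  qed
  then show "of_real ((2 * pi)^2) * (LBINT x. f x * g x) = (LBINT \<xi>. fourier f \<xi> * fourier g (- \<xi>))"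
    by (simp add: D_def)
qed

text \<open>By \<open>fourier_swap\<close> with a modulated Gaussian, the mollification of
  \<open>f\<close> at \<open>x\<close> equals the damped inverse transform. Continuity of
  \<open>f\<close> gives the limit of the former, integrability of the transform that of the
  latter.\<close>

lemma fourier_inversion:
  fixes f :: "cfun"
  assumes f: "L1 f" and cont: "continuous_on UNIV f" and B: "\<And>x. norm (f x) \<le> B"
    and ff: "L1 (fourier f)"
  shows "fourier (inverse_fourier f) x = f x" "inverse_fourier (fourier f) x = f x"
proof -
  let ?e = "\<lambda>x n \<xi>. ep x \<xi> * of_real (gauss (1 / Suc n) \<xi>)"
  have [measurable]: "f \<in> borel_fun" using f by auto
  have 1: "of_real ((2 * pi)^2) * f x = (LBINT \<xi>. ep x \<xi> * fourier f \<xi>)" for x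
  proof -
    have "(\<lambda>n. LBINT y. of_real (gauss_hat (1 / Suc n) (x - y)) * f y) \<longlonglongrightarrow> of_real ((2 * pi)^2) * f x"
      using cont B by (intro approx_identity) (auto simp: continuous_on_eq_continuous_at)
    moreover have "(LBINT y. of_real (gauss_hat (1 / Suc n) (x - y)) * f y) =
        (LBINT \<xi>. fourier f \<xi> * (?e x n \<xi>))" for n
    proof -
      have p: "(1 / Suc n :: real) > 0" by simp
      have "(LBINT \<xi>. fourier f \<xi> * (?e x n \<xi>)) =
        (LBINT y. f y * fourier (\<lambda>\<xi>. ?e x n \<xi>) y)"
        by (rule fourier_swap[OF f]) (use gauss_fourier(1)[OF p, of "-x"] in simp)
      also have "... = (LBINT y. of_real (gauss_hat (1 / Suc n) (x - y)) * f y)"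
        unfolding fourier_modulate gauss_fourier(2)[OF p]
        by (auto simp: gauss_hat_def norm_minus_commute mult_ac)
      finally show ?thesis by simp
    qed
    moreover have "(\<lambda>n. LBINT \<xi>. fourier f \<xi> * (?e x n \<xi>)) \<longlonglongrightarrow> (LBINT \<xi>. fourier f \<xi> * (ep x \<xi> * of_real 1))"
    proof (rule integral_dominated_convergence[OF _ _ integrable_norm[OF ff]])
      show "AE \<xi> in lborel. (\<lambda>n. fourier f \<xi> * (?e x n \<xi>)) \<longlonglongrightarrow> fourier f \<xi> * (ep x \<xi> * of_real 1)"
        by (intro AE_I2 tendsto_intros gauss_tendsto)
      show "AE \<xi> in lborel. norm (fourier f \<xi> * (?e x n \<xi>)) \<le> norm (fourier f \<xi>)" for n
        by (intro AE_I2) (simp add: norm_mult abs_of_pos gauss_bounds mult_right_le_one_le less_imp_le)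
    qed simp_all
    ultimately show ?thesis using LIMSEQ_unique by (fastforce simp: mult_ac)
  qed
  then show "inverse_fourier (fourier f) x = f x"
    unfolding inverse_fourier_def 1[symmetric] by simp
  have "fourier (inverse_fourier f) x = (LBINT \<xi>. em x \<xi> * fourier f (- \<xi>)) / of_real ((2 * pi)^2)"
    unfolding fourier_def[of "inverse_fourier f"] inverse_fourier_eq by (simp add: field_simps)
  also have "(LBINT \<xi>. em x \<xi> * fourier f (- \<xi>)) = (LBINT \<xi>. ep x \<xi> * fourier f \<xi>)"
    by (subst lborel_translate(2)[of _ 0, symmetric]) simp
  finally show "fourier (inverse_fourier f) x = f x"
    unfolding 1[of x, symmetric] by simp
qed

section \<open>Integrable power weights\<close>

lemma nn_integral_one_plus_powr:
  assumes p: "p > 1"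
  shows "(NN x. en (ja x powr - p)) \<le> en (2 / (p - 1))"
proof -
  let ?f = "\<lambda>x::real. (ja x) powr - p"
  have half: "(NN x. en (?f x) * indicator {0..} x) = en (1 / (p - 1))"
  proof -
    have "(NN x. en ((1 + x) powr - p) * indicator {0..} x) = 0 - (1 + 0) powr (1 - p) / (1 - p)"
    proof (rule nn_integral_FTC_atLeast)
      fix x :: real assume "0 \<le> x"
      then show "((\<lambda>x. (1 + x) powr (1 - p) / (1 - p)) has_real_derivative (1 + x) powr - p) (at x)"
        using p DERIV_cdivide[OF DERIV_chain2[OF has_real_derivative_powr[of "1 + x" "1 - p"] DERIV_add[OF DERIV_const DERIV_ident, of 1]], of "1 - p"]
        by simp
    next
      show "((\<lambda>x. (1 + x) powr (1 - p) / (1 - p)) \<longlongrightarrow> 0) at_top"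
        using p by (intro tendsto_divide_zero tendsto_neg_powr filterlim_tendsto_add_at_top[OF tendsto_const filterlim_ident]) auto
    qed auto
    also have "(NN x. en ((1 + x) powr - p) * indicator {0..} x) = (NN x. en (?f x) * indicator {0..} x)"
      by (intro nn_integral_cong) (auto simp: indicator_def)
    finally show ?thesis using p by (simp add: divide_simps)
  qed
  have "(NN x. en (?f x)) \<le> (NN x. en (?f x) * indicator {0..} x + en (?f x) * indicator {0..} (0 + (-1) * x))"
    by (intro nn_integral_mono) (auto simp: indicator_def)
  also have "... = (NN x. en (?f x) * indicator {0..} x) + (NN x. en (?f x) * indicator {0..} (0 + (-1) * x))"
    by (rule nn_integral_add) auto
  also have "(NN x. en (?f x) * indicator {0..} (0 + (-1) * x)) = (NN x. en (?f x) * indicator {0..} x)"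
    using nn_integral_real_affine[of "\<lambda>x. en (?f x) * indicator {0..} x" "-1" 0] by simp
  finally show ?thesis using half p by (simp add: ennreal_plus[symmetric] del: ennreal_plus)
qed

lemma nn_integral_plane_product:
  assumes [measurable]: "f \<in> borel_fun" "g \<in> borel_fun"
  shows "(NN v. (f ((v::plane) $ 1) :: ennreal) * g (v $ 2)) = (NN x. f x) * (NN y. g y)"
  by (subst nn_integral_plane(1)) (auto simp: nn_integral_cmult nn_integral_multc)

text \<open>Each coordinate is at most the norm, so the weight is dominated by a product of
  one-dimensional weights with half the exponent. This takes the place of polar coordinates.\<close>

lemma nn_integral_plane_powr:
  assumes p: "p > 2"
  shows "(NN v. en (jb (v::plane) powr - p)) < \<infinity>"
proof -
  have "jb v powr - p \<le> ja (v $ 1) powr - (p / 2) * ja (v $ 2) powr - (p / 2)" for v :: plane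
  proof -
    have "jb v powr - (p / 2) \<le> ja (v $ i) powr - (p / 2)" for i
      using p component_le_norm_cart[of v i] by (intro powr_mono2') auto
    then have "jb v powr - (p / 2) * jb v powr - (p / 2) \<le> ja (v $ 1) powr - (p / 2) * ja (v $ 2) powr - (p / 2)"
      by (intro mult_mono) auto
    then show ?thesis by (simp add: powr_add[symmetric])
  qed
  then have "(NN v. en (jb (v::plane) powr - p)) \<le>
      (NN v. en (ja ((v::plane) $ 1) powr - (p / 2)) * en (ja (v $ 2) powr - (p / 2)))"
    by (intro nn_integral_mono) (auto simp: ennreal_mult[symmetric] intro!: ennreal_leI)
  also have "... = (NN x. en (ja x powr - (p / 2))) * (NN x. en (ja x powr - (p / 2)))"
    by (rule nn_integral_plane_product[of "\<lambda>x. en (ja x powr - (p / 2))" "\<lambda>x. en (ja x powr - (p / 2))"]) auto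
  also have "... < \<infinity>"
    using nn_integral_one_plus_powr[of "p / 2"] p by (auto intro!: ennreal_mult_less_top[THEN iffD2] le_less_trans[OF nn_integral_one_plus_powr])
  finally show ?thesis .
qed

lemma integrable_plane_powr: "p > 2 \<Longrightarrow> L1 (\<lambda>v::plane. (jb v) powr - p)"
  using nn_integral_plane_powr by (intro integrableI_bounded) auto

lemma integrable_inverse_cube: "L1 (\<lambda>v::plane. B / jb v ^ 3)"
proof -
  have "L1 (\<lambda>v::plane. B * jb v powr - real 3)" using integrable_plane_powr[of 3] by auto
  moreover have "B * jb v powr - real 3 = B / jb v ^ 3" for v :: plane
    by (subst powr_minus, subst powr_realpow) (auto simp: divide_simps add_pos_nonneg)
  ultimately show ?thesis by (simp only:)
qed

section \<open>Schwartz functions and derivatives under the Fourier transform\<close>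

lemma vector_derivative_sequence:
  fixes g :: "real \<Rightarrow> 'b::real_normed_vector"
  assumes "(g has_vector_derivative v) (at 0)"
  shows "(\<lambda>n. (g (1 / Suc n) - g 0) /\<^sub>R (1 / Suc n)) \<longlonglongrightarrow> v"
proof -
  have "((\<lambda>h. norm (g (0 + h) - g 0 - h *\<^sub>R v) / norm h) \<longlongrightarrow> 0) (at 0)"
    using assms unfolding has_vector_derivative_def has_derivative_at by simp
  moreover have "filterlim (\<lambda>n. 1 / real (Suc n)) (at 0) sequentially"
    by (auto simp: filterlim_at LIMSEQ_Suc[OF lim_1_over_n] simp del: of_nat_Suc)
  ultimately have "(\<lambda>n. norm (g (0 + 1 / Suc n) - g 0 - (1 / Suc n) *\<^sub>R v) / norm (1 / Suc n)) \<longlonglongrightarrow> 0"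
    by (rule filterlim_compose)
  moreover have "norm (g (0 + 1 / Suc n) - g 0 - (1 / Suc n) *\<^sub>R v) / norm (1 / real (Suc n)) = norm ((g (1 / Suc n) - g 0) /\<^sub>R (1 / Suc n) - v)" for n
  proof -
    have "(g (1 / Suc n) - g 0) /\<^sub>R (1 / Suc n) - v = (g (0 + 1 / Suc n) - g 0 - (1 / Suc n) *\<^sub>R v) /\<^sub>R (1 / real (Suc n))"
      by (simp add: scaleR_diff_right)
    then show ?thesis by (simp add: divide_inverse mult.commute)
  qed
  ultimately have "(\<lambda>n. norm ((g (1 / Suc n) - g 0) /\<^sub>R (1 / Suc n) - v)) \<longlonglongrightarrow> 0" by simp
  then show ?thesis by (simp add: tendsto_norm_zero_iff LIM_zero_iff del: of_nat_Suc)
qed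
lemma fourier_shift:
  fixes f :: "cfun"
  shows "fourier (\<lambda>x. f (x + v)) \<xi> = ep \<xi> v * fourier f \<xi>"
proof -
  let ?g = "\<lambda>x. exp (- \<i> * of_real (\<xi> \<bullet> (x - v))) * f x"
  have "fourier (\<lambda>x. f (x + v)) \<xi> = (LBINT x. ?g (x + v))" by (simp add: fourier_def)
  also have "... = (LBINT x. ?g x)"
    using lborel_translate(2)[of "?g" "v"] lborel_translate(2)[of "\<lambda>x. ?g (v + x)" 0] by (simp add: add.commute)
  also have "... = (LBINT x. ep \<xi> v * (em \<xi> x * f x))"
    unfolding mult.assoc[symmetric] exp_add[symmetric]
    by (intro LB_cong refl) (simp add: inner_diff_right algebra_simps)
  finally show ?thesis by (simp add: fourier_def)
qed

text \<open>Difference quotients along \<open>1 / Suc n\<close> and dominated convergence replace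
  integration by parts, because translation becomes multiplication by a character. Cubic decay is
  the integrable majorant in the plane.\<close>

lemma fourier_partial:
  fixes f :: "cfun"
  assumes df: "\<And>x. f differentiable (at x)" and f: "\<And>x. norm (f x) \<le> M / jb x ^ 3"
    and b: "norm b = 1" and f': "\<And>x. norm (frechet_derivative f (at x) b) \<le> M / jb x ^ 3"
  shows "fourier (\<lambda>x. frechet_derivative f (at x) b) \<xi> = \<i> * of_real (\<xi> \<bullet> b) * fourier f \<xi>"
proof -
  let ?h = "\<lambda>n. 1 / real (Suc n)"
  have [measurable]: "f \<in> borel_fun"
    using df by (intro borel_measurable_continuous_onI) (auto simp: continuous_on_eq_continuous_at intro: differentiable_imp_continuous_within)
  have M: "M \<ge> 0" using f[of 0] norm_ge_zero[of "f 0"] by (simp del: norm_ge_zero)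
  have if': "L1 f"
    by (rule L1_bound[OF integrable_inverse_cube[of M]]) (use f M in auto)
  have lin: "frechet_derivative f (at x) (t *\<^sub>R b) = t *\<^sub>R frechet_derivative f (at x) b" for x t
    using linear_frechet_derivative[OF df] by (rule linear_scale)
  have fd: "(f has_derivative frechet_derivative f (at x)) (at x)" for x
    using df by (simp add: frechet_derivative_works)
  have vd: "((\<lambda>s. f (x + s *\<^sub>R b)) has_derivative (\<lambda>s. s *\<^sub>R frechet_derivative f (at (x + t *\<^sub>R b)) b)) (at t)" for x t
  proof -
    have "((\<lambda>s. x + s *\<^sub>R b) has_derivative (\<lambda>s. s *\<^sub>R b)) (at t)" by (auto intro!: derivative_eq_intros)
    from has_derivative_compose[OF this fd] show ?thesis by (simp only: lin)
  qed
  define D where "D n x = (f (x + ?h n *\<^sub>R b) - f x) /\<^sub>R ?h n" for n x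
  have Dlim: "(\<lambda>n. D n x) \<longlonglongrightarrow> frechet_derivative f (at x) b" for x
  proof -
    have "((\<lambda>t. f (x + t *\<^sub>R b)) has_vector_derivative frechet_derivative f (at x) b) (at 0)"
      unfolding has_vector_derivative_def
      using vd[of x 0] by simp
    from vector_derivative_sequence[OF this] show ?thesis unfolding D_def by simp
  qed
  \<comment> \<open>A shift of length at most 1 changes \<open>jb\<close> by a factor of at most 2,
    whence \<open>2 ^ 3 = 8\<close>.\<close>
  have Dbd: "norm (D n x) \<le> 8 * M / jb x ^ 3" for n x
  proof -
    have h: "0 < ?h n" "?h n \<le> 1" by auto
    have DB: "norm (f (x + ?h n *\<^sub>R b) - f (x + 0 *\<^sub>R b)) \<le> 8 * M / jb x ^ 3 * norm (?h n - 0)"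
    proof (rule differentiable_bound[of "{0..?h n}" "\<lambda>t. f (x + t *\<^sub>R b)" "\<lambda>t s. s *\<^sub>R frechet_derivative f (at (x + t *\<^sub>R b)) b"])
      fix t assume t: "t \<in> {0..?h n}"
      show "((\<lambda>t. f (x + t *\<^sub>R b)) has_derivative (\<lambda>s. s *\<^sub>R frechet_derivative f (at (x + t *\<^sub>R b)) b)) (at t within {0..?h n})"
        by (rule has_derivative_at_withinI) (rule vd)
      have "norm x - norm (t *\<^sub>R b) \<le> norm (x + t *\<^sub>R b)" by (rule norm_diff_ineq)
      moreover have "0 \<le> t" "t \<le> 1" using t h(2) by (auto intro: order_trans)
      ultimately have "norm x - 1 \<le> norm (x + t *\<^sub>R b)" using b by simp
      have "1 + r \<le> 2 * (1 + n)" if "r - 1 \<le> n" "0 \<le> n" for r n :: real using that by simp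
      from this[OF \<open>norm x - 1 \<le> _\<close> norm_ge_zero] have le: "1 + norm x \<le> 2 * jb (x + t *\<^sub>R b)" .
      have "norm (frechet_derivative f (at (x + t *\<^sub>R b)) b) \<le> M / jb (x + t *\<^sub>R b) ^ 3" by (rule f')
      also have "... = 8 * M / (2 * jb (x + t *\<^sub>R b)) ^ 3" unfolding power_mult_distrib by simp
      also have "... \<le> 8 * M / jb x ^ 3"
        using le M by (intro divide_left_mono power_mono mult_pos_pos zero_less_power) (auto simp: add_pos_nonneg)
      finally have c: "norm (frechet_derivative f (at (x + t *\<^sub>R b)) b) \<le> 8 * M / jb x ^ 3" .
      show "onorm (\<lambda>s. s *\<^sub>R frechet_derivative f (at (x + t *\<^sub>R b)) b) \<le> 8 * M / jb x ^ 3"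
      proof (rule onorm_le)
        fix s :: real
        show "norm (s *\<^sub>R frechet_derivative f (at (x + t *\<^sub>R b)) b) \<le> 8 * M / jb x ^ 3 * norm s"
          using mult_left_mono[OF c, of "\<bar>s\<bar>"] by (simp add: mult.commute)
      qed
    qed (use h in auto)
    have aux: "norm (a /\<^sub>R r) \<le> C" if "norm a \<le> C * norm (r - 0)" "0 < r" for a :: complex and r C :: real
      using that by (simp add: divide_inverse[symmetric] field_simps)
    from aux[OF DB h(1)] show ?thesis unfolding D_def by simp
  qed
  have [measurable]: "D n \<in> borel_fun" for n unfolding D_def[abs_def] by measurable
  have [measurable]: "(\<lambda>x. frechet_derivative f (at x) b) \<in> borel_fun"
    by (rule borel_measurable_LIMSEQ_metric[where f=D]) (auto intro: Dlim)
  have "(\<lambda>n. LBINT x. em \<xi> x * D n x) \<longlonglongrightarrow> (LBINT x. em \<xi> x * frechet_derivative f (at x) b)"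
    by (rule integral_dominated_convergence[OF _ _ integrable_inverse_cube[of "8 * M"]])
       (auto intro!: tendsto_intros Dlim Dbd simp: norm_mult)
  moreover have "(LBINT x. em \<xi> x * D n x) = ((exp (\<i> * of_real (\<xi> \<bullet> b) * of_real (?h n)) - 1) / of_real (?h n)) * fourier f \<xi>" for n
  proof -
    have ish: "L1 (\<lambda>x. f (x + ?h n *\<^sub>R b))"
    proof -
      have "L1 (\<lambda>x. f (?h n *\<^sub>R b + - x))"
        using lborel_translate(1)[of f "?h n *\<^sub>R b"] if' by simp
      from lborel_translate(1)[of "\<lambda>x. f (?h n *\<^sub>R b + - x)" 0, THEN iffD2, OF this] show ?thesis
        by (simp add: add.commute)
    qed
    have "(LBINT x. em \<xi> x * D n x) = (LBINT x. (em \<xi> x * f (x + ?h n *\<^sub>R b) - em \<xi> x * f x) / of_real (?h n))"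
      by (intro LB_cong refl) (simp add: D_def scaleR_conv_of_real field_simps)
    also have "... = (fourier (\<lambda>x. f (x + ?h n *\<^sub>R b)) \<xi> - fourier f \<xi>) / of_real (?h n)"
      unfolding integral_divide_zero fourier_def
      by (subst LB_diff) (use fourier_integrand_integrable[OF ish] fourier_integrand_integrable[OF if'] in auto)
    finally show ?thesis by (simp add: fourier_shift field_simps)
  qed
  moreover have "(\<lambda>n. ((exp (\<i> * of_real (\<xi> \<bullet> b) * of_real (?h n)) - 1) / of_real (?h n)) * fourier f \<xi>) \<longlonglongrightarrow> \<i> * of_real (\<xi> \<bullet> b) * fourier f \<xi>"
  proof (intro tendsto_intros)
    have "((\<lambda>t. exp (\<i> * of_real (\<xi> \<bullet> b) * of_real t)) has_vector_derivative \<i> * of_real (\<xi> \<bullet> b)) (at (0::real))"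
      by (rule has_vector_derivative_real_field) (auto intro!: derivative_eq_intros)
    from vector_derivative_sequence[OF this]
    show "(\<lambda>n. (exp (\<i> * of_real (\<xi> \<bullet> b) * of_real (?h n)) - 1) / of_real (?h n)) \<longlonglongrightarrow> \<i> * of_real (\<xi> \<bullet> b)"
      by (simp add: scaleR_conv_of_real divide_inverse mult_ac)
  qed
  ultimately show ?thesis
    unfolding fourier_def[of "\<lambda>x. frechet_derivative f (at x) b"] using LIMSEQ_unique by simp
qed

lemma schwartz_partialD:
  assumes "\<phi> \<in> schwartz" "set bs \<subseteq> Basis"
  shows "iterated_partial bs \<phi> differentiable (at x)"
    and "\<exists>M. \<forall>x. norm (iterated_partial bs \<phi> x) \<le> M / jb x ^ N"
proof -
  show "iterated_partial bs \<phi> differentiable (at x)"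
    using assms by (auto simp: schwartz_def smooth_def)
  from assms obtain M where M: "\<And>x. (jb x) ^ N * norm (iterated_partial bs \<phi> x) \<le> M"
    by (auto simp: schwartz_def) blast
  have "norm (iterated_partial bs \<phi> x) \<le> M / jb x ^ N" for x
    using M[of x] by (subst pos_le_divide_eq) (auto simp: mult.commute add_pos_nonneg)
  then show "\<exists>M. \<forall>x. norm (iterated_partial bs \<phi> x) \<le> M / jb x ^ N" by blast
qed

lemma schwartz_partial_integrable:
  fixes \<phi> :: "cfun"
  assumes "\<phi> \<in> schwartz" "set bs \<subseteq> Basis"
  shows "continuous_on UNIV (iterated_partial bs \<phi>)" "L1 (iterated_partial bs \<phi>)"
proof -
  show c: "continuous_on UNIV (iterated_partial bs \<phi>)"
    using schwartz_partialD(1)[OF assms] by (auto simp: continuous_on_eq_continuous_at intro: differentiable_imp_continuous_within)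
  obtain M where M: "\<And>x. norm (iterated_partial bs \<phi> x) \<le> M / jb x ^ 3"
    using schwartz_partialD(2)[OF assms] by blast
  show "L1 (iterated_partial bs \<phi>)"
    by (rule L1_bound[OF integrable_inverse_cube[of M]])
       (use borel_measurable_continuous_onI[OF c] in \<open>auto intro!: order_trans[OF M] divide_right_mono\<close>)
qed

lemma fourier_iterated_partial:
  fixes \<phi> :: "cfun"
  assumes "\<phi> \<in> schwartz" "set bs \<subseteq> Basis"
  shows "fourier (iterated_partial bs \<phi>) \<xi> = (\<Prod>b\<leftarrow>bs. \<i> * of_real (\<xi> \<bullet> b)) * fourier \<phi> \<xi>"
  using assms(2)
proof (induction bs)
  case Nil then show ?case by simp
next
  case (Cons b bs)
  obtain M1 where M1: "\<And>x. norm (iterated_partial bs \<phi> x) \<le> M1 / jb x ^ 3"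
    using schwartz_partialD(2)[OF assms(1), of bs 3] Cons.prems by auto
  obtain M2 where M2: "\<And>x. norm (iterated_partial (b # bs) \<phi> x) \<le> M2 / jb x ^ 3"
    using schwartz_partialD(2)[OF assms(1) Cons.prems] by blast
  have "fourier (\<lambda>x. frechet_derivative (iterated_partial bs \<phi>) (at x) b) \<xi> = \<i> * of_real (\<xi> \<bullet> b) * fourier (iterated_partial bs \<phi>) \<xi>"
  proof (rule fourier_partial[where M="max M1 M2"])
    show "iterated_partial bs \<phi> differentiable (at x)" for x using schwartz_partialD(1)[OF assms(1)] Cons.prems by auto
    show "norm (iterated_partial bs \<phi> x) \<le> max M1 M2 / jb x ^ 3" for x
      by (rule order_trans[OF M1]) (auto intro!: divide_right_mono)
    show "norm (frechet_derivative (iterated_partial bs \<phi>) (at x) b) \<le> max M1 M2 / jb x ^ 3" for x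
      by (rule order_trans[OF M2[of x, simplified]]) (auto intro!: divide_right_mono)
    show "norm b = 1" using Cons.prems by auto
  qed
  then show ?case using Cons by simp
qed

text \<open>Two derivatives in each coordinate bound the transform by a product of integrable
  functions of one variable.\<close>

lemma schwartz_fourier_integrable:
  fixes \<phi> :: "cfun"
  assumes "\<phi> \<in> schwartz"
  shows "L1 (fourier \<phi>)"
proof -
  let ?a = "axis 1 1 :: plane" and ?b = "axis 2 1 :: plane"
  let ?I = "\<lambda>bs. LBINT x. norm (iterated_partial bs \<phi> x)"
  have [measurable]: "\<phi> \<in> borel_fun"
    using schwartz_partial_integrable(2)[OF assms, of "[]"] by auto
  have B: "norm (fourier \<phi> \<xi>) * \<bar>\<Prod>b\<leftarrow>bs. \<xi> \<bullet> b\<bar> \<le> ?I bs" if "set bs \<subseteq> Basis" for bs \<xi>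
  proof -
    have "norm (fourier (iterated_partial bs \<phi>) \<xi>) \<le> ?I bs" by (rule norm_fourier_le)
    moreover have "norm (\<Prod>b\<leftarrow>bs. \<i> * of_real (\<xi> \<bullet> b) :: complex) = \<bar>\<Prod>b\<leftarrow>bs. \<xi> \<bullet> b\<bar>"
      by (induction bs) (auto simp: norm_mult abs_mult)
    ultimately show ?thesis using fourier_iterated_partial[OF assms that] by (simp add: norm_mult mult.commute)
  qed
  define C where "C = ?I [] + ?I [?a, ?a] + ?I [?b, ?b] + ?I [?a, ?a, ?b, ?b]"
  have C: "norm (fourier \<phi> \<xi>) * ((1 + (\<xi> $ 1)^2) * (1 + (\<xi> $ 2)^2)) \<le> C" for \<xi>
    using B[of "[]" \<xi>] B[of "[?a, ?a]" \<xi>] B[of "[?b, ?b]" \<xi>] B[of "[?a, ?a, ?b, ?b]" \<xi>]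
    by (simp add: C_def Basis_plane inner_axis abs_mult algebra_simps power2_eq_square)
  have le: "norm (fourier \<phi> \<xi>) \<le> norm (of_real (4 * C) * (of_real (ja (\<xi> $ 1) powr - 2) * of_real (ja (\<xi> $ 2) powr - 2)) :: complex)" for \<xi>
  proof -
    have C0: "0 \<le> C" unfolding C_def by (intro add_nonneg_nonneg Bochner_Integration.integral_nonneg) auto
    have j: "ja t^2 \<le> 2 * (1 + t^2)" for t :: real using sum_squares_bound[of 1 "\<bar>t\<bar>"] by (simp add: power2_sum)
    have p: "ja t powr - 2 = 1 / ja t^2" for t :: real
      by (subst powr_minus) (simp add: powr_numeral divide_inverse)
    have "norm (fourier \<phi> \<xi>) * (ja (\<xi> $ 1)^2 * ja (\<xi> $ 2)^2) \<le> norm (fourier \<phi> \<xi>) * ((2 * (1 + (\<xi> $ 1)^2)) * (2 * (1 + (\<xi> $ 2)^2)))"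
      by (intro mult_left_mono mult_mono j) auto
    also have "... = 4 * (norm (fourier \<phi> \<xi>) * ((1 + (\<xi> $ 1)^2) * (1 + (\<xi> $ 2)^2)))" by (simp add: algebra_simps)
    also have "... \<le> 4 * C" using C[of \<xi>] by simp
    finally have "norm (fourier \<phi> \<xi>) \<le> 4 * C / (ja (\<xi> $ 1)^2 * ja (\<xi> $ 2)^2)"
      by (subst pos_le_divide_eq) (auto intro!: mult_pos_pos zero_less_power)
    then show ?thesis unfolding of_real_mult[symmetric] norm_of_real p using C0 by simp
  qed
  have i1: "L1 (\<lambda>x::real. complex_of_real (ja x powr - 2))"
    unfolding complex_of_real_integrable_eq
    by (intro integrableI_bounded) (auto intro: le_less_trans[OF nn_integral_one_plus_powr[of 2]])
  show ?thesis
    by (rule L1_bound[OF integrable_mult_right[OF integral_plane_product(1)[OF i1 i1], of "of_real (4 * C)"]])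
       (use le in \<open>auto simp del: of_real_mult norm_mult\<close>)
qed

text \<open>The inverse transform of a Schwartz function is recorded as integrable rather than
  Schwartz; that is the form in which \<open>fourier_swap\<close> uses it.\<close>

lemma schwartz_facts:
  fixes \<phi> :: "cfun"
  assumes "\<phi> \<in> schwartz"
  shows "L1 \<phi>" "continuous_on UNIV \<phi>" "\<exists>M. \<forall>x. norm (\<phi> x) \<le> M / jb x ^ N"
    "fourier (inverse_fourier \<phi>) = \<phi>" "L1 (inverse_fourier \<phi>)"
proof -
  show i: "L1 \<phi>" and c: "continuous_on UNIV \<phi>"
    using schwartz_partial_integrable[OF assms, of "[]"] by auto
  show "\<exists>M. \<forall>x. norm (\<phi> x) \<le> M / jb x ^ N" using schwartz_partialD(2)[OF assms, of "[]"] by auto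
  obtain M where "\<And>x. norm (\<phi> x) \<le> M / jb x ^ 0" using schwartz_partialD(2)[OF assms, of "[]" 0] by auto
  then have M: "\<And>x. norm (\<phi> x) \<le> M" by simp
  note f = schwartz_fourier_integrable[OF assms]
  show "fourier (inverse_fourier \<phi>) = \<phi>" using fourier_inversion(1)[OF i c M f] by auto
  show "L1 (inverse_fourier \<phi>)"
    unfolding inverse_fourier_eq[abs_def] using lborel_translate(1)[of "fourier \<phi>" 0] f by auto
qed

text \<open>Off \<open>K\<close> all iterated derivatives vanish because the complement is open, and
  on \<open>K\<close> continuity bounds them.\<close>

lemma test_functions_subset_schwartz: "test_functions \<subseteq> schwartz"
proof
  fix \<phi> :: "'a \<Rightarrow> complex" assume "\<phi> \<in> test_functions"
  then obtain K where sm: "smooth \<phi>" and K: "compact K" and z: "\<And>x. x \<notin> K \<Longrightarrow> \<phi> x = 0"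
    by (auto simp: test_functions_def)
  have zero: "iterated_partial bs \<phi> x = 0" if "x \<notin> K" for bs x
    using that
  proof (induction bs arbitrary: x)
    case Nil then show ?case using z by simp
  next
    case (Cons b bs)
    have "((\<lambda>_. 0) has_derivative (\<lambda>_. 0 :: complex)) (at x)" by simp
    then have "(iterated_partial bs \<phi> has_derivative (\<lambda>_. 0)) (at x)"
      by (rule has_derivative_transform_within_open[where s="- K"]) (use K Cons in \<open>auto intro: compact_imp_closed simp: open_Compl\<close>)
    then have "frechet_derivative (iterated_partial bs \<phi>) (at x) = (\<lambda>_. 0)"
      by (metis frechet_derivative_at)
    then show ?case by simp
  qed
  have "\<exists>M. \<forall>x. (jb x) ^ N * norm (iterated_partial bs \<phi> x) \<le> M" if "set bs \<subseteq> Basis" for N bs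
  proof -
    have "continuous_on UNIV (iterated_partial bs \<phi>)"
      using sm that by (auto simp: smooth_def continuous_on_eq_continuous_at intro: differentiable_imp_continuous_within)
    then have "continuous_on K (\<lambda>x. (jb x) ^ N * norm (iterated_partial bs \<phi> x))"
      by (intro continuous_intros) (auto elim: continuous_on_subset)
    then have "bounded ((\<lambda>x. (jb x) ^ N * norm (iterated_partial bs \<phi> x)) ` K)"
      using K by (intro compact_imp_bounded compact_continuous_image)
    then obtain M where M: "\<And>x. x \<in> K \<Longrightarrow> \<bar>jb x ^ N * norm (iterated_partial bs \<phi> x)\<bar> \<le> M"
      by (auto simp: bounded_iff)
    have "jb x ^ N * norm (iterated_partial bs \<phi> x) \<le> max 0 M" for x
      using M[of x] zero[of x bs] by (cases "x \<in> K") auto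
    then show ?thesis by blast
  qed
  then show "\<phi> \<in> schwartz" using sm by (auto simp: schwartz_def)
qed

section \<open>Gaussian test functions separate tempered functions\<close>

lemma power_divide_fact_le_exp:
  assumes "(0::real) \<le> t"
  shows "t ^ n / fact n \<le> exp t"
proof -
  have s: "(\<lambda>n. t ^ n /\<^sub>R fact n) sums exp t" by (rule exp_converges)
  have "(\<Sum>i\<in>{n}. t ^ i /\<^sub>R fact i) \<le> (\<Sum>i. t ^ i /\<^sub>R fact i)"
    by (rule sum_le_suminf) (use s assms in \<open>auto simp: sums_iff\<close>)
  then show ?thesis using s by (simp add: sums_iff divide_inverse mult.commute)
qed

text \<open>Polynomials times a Gaussian times a character of frequency \<open>a\<close>: a class
  visibly closed under differentiation. It supplies the concrete Schwartz functions of
  \<open>AE_zero_of_schwartz\<close>.\<close>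

inductive_set poly_gauss :: "plane \<Rightarrow> cfun set" for a :: plane where
  base: "(\<lambda>x. of_real (gauss 1 x) * em a x) \<in> poly_gauss a"
| scale: "f \<in> poly_gauss a \<Longrightarrow> (\<lambda>x. c * f x) \<in> poly_gauss a"
| add: "f \<in> poly_gauss a \<Longrightarrow> g \<in> poly_gauss a \<Longrightarrow> (\<lambda>x. f x + g x) \<in> poly_gauss a"
| coord: "f \<in> poly_gauss a \<Longrightarrow> (\<lambda>x. of_real (x \<bullet> b) * f x) \<in> poly_gauss a"

lemma poly_gauss_derivative:
  assumes "f \<in> poly_gauss a"
  shows "\<exists>D. (\<forall>x. (f has_derivative D x) (at x)) \<and> (\<forall>b. (\<lambda>x. D x b) \<in> poly_gauss a)"
  using assms
proof induction
  case base
  let ?f = "\<lambda>x. of_real (gauss 1 x) * em a x :: complex"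
  let ?D = "\<lambda>x b. - 2 * (of_real (x \<bullet> b) * ?f x) + (- \<i> * of_real (a \<bullet> b)) * ?f x"
  have "(?f has_derivative ?D x) (at x)" for x
  proof -
    have eqx: "?f x = exp (of_real (- (x \<bullet> x)) - \<i> * of_real (a \<bullet> x))" for x
      by (simp add: gauss_def power2_norm_eq_inner exp_of_real[symmetric] exp_add[symmetric])
    then have eq: "?f = (\<lambda>x. exp (of_real (- (x \<bullet> x)) - \<i> * of_real (a \<bullet> x)))" by (rule ext)
    have "((\<lambda>x. of_real (- (x \<bullet> x)) - \<i> * of_real (a \<bullet> x)) has_derivative (\<lambda>b. of_real (- (x \<bullet> b + b \<bullet> x)) - \<i> * of_real (a \<bullet> b) :: complex)) (at x)"
      by (auto intro!: derivative_eq_intros)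
    moreover have "(exp has_derivative (\<lambda>h. exp z * h)) (at z)" for z :: complex
      using DERIV_exp[of z] by (simp add: has_field_derivative_def)
    ultimately have "((\<lambda>x. exp (of_real (- (x \<bullet> x)) - \<i> * of_real (a \<bullet> x))) has_derivative (\<lambda>b. exp (of_real (- (x \<bullet> x)) - \<i> * of_real (a \<bullet> x)) * (of_real (- (x \<bullet> b + b \<bullet> x)) - \<i> * of_real (a \<bullet> b)))) (at x)"
      by (rule has_derivative_compose)
    then show ?thesis unfolding eq
      by (rule has_derivative_eq_rhs) (simp only: eqx, simp add: fun_eq_iff inner_commute algebra_simps)
  qed
  moreover have "(\<lambda>x. ?D x b) \<in> poly_gauss a" for b
    by (intro poly_gauss.intros)
  ultimately show ?case by (intro exI[of _ ?D]) blast
next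
  case (scale f c)
  then obtain D where D: "\<And>x. (f has_derivative D x) (at x)" "\<And>b. (\<lambda>x. D x b) \<in> poly_gauss a" by blast
  show ?case
    by (intro exI[of _ "\<lambda>x b. c * D x b"] conjI allI poly_gauss.scale D(2) has_derivative_mult_right D(1))
next
  case (add f g)
  then obtain D D' where D: "\<And>x. (f has_derivative D x) (at x)" "\<And>b. (\<lambda>x. D x b) \<in> poly_gauss a"
    and D': "\<And>x. (g has_derivative D' x) (at x)" "\<And>b. (\<lambda>x. D' x b) \<in> poly_gauss a" by blast
  show ?case
    by (intro exI[of _ "\<lambda>x b. D x b + D' x b"] conjI allI poly_gauss.add D(2) D'(2) has_derivative_add D(1) D'(1))
next
  case (coord f c)
  then obtain D where D: "\<And>x. (f has_derivative D x) (at x)" "\<And>b. (\<lambda>x. D x b) \<in> poly_gauss a" by blast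
  have "((\<lambda>x. of_real (x \<bullet> c) * f x) has_derivative (\<lambda>b. of_real (x \<bullet> c) * D x b + of_real (b \<bullet> c) * f x)) (at x)" for x
    by (rule has_derivative_mult[OF _ D(1)]) (auto intro!: derivative_eq_intros)
  moreover have "(\<lambda>x. of_real (x \<bullet> c) * D x b + of_real (b \<bullet> c) * f x) \<in> poly_gauss a" for b
    by (intro poly_gauss.intros D(2) coord.hyps)
  ultimately show ?case by (intro exI[of _ "\<lambda>x b. of_real (x \<bullet> c) * D x b + of_real (b \<bullet> c) * f x"]) blast
qed

lemma poly_gauss_bound:
  assumes "f \<in> poly_gauss a"
  shows "\<exists>M. \<forall>x. (jb x) ^ N * norm (f x) \<le> M"
  using assms
proof (induction arbitrary: N)
  case base
  have "jb x ^ N * norm (of_real (gauss 1 x) * em a x :: complex) \<le> fact N * exp 2" for x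
  proof -
    have "jb x ^ N / fact N \<le> exp (jb x)"
      by (rule power_divide_fact_le_exp) simp
    then have "jb x ^ N * gauss 1 x \<le> (fact N * exp (jb x)) * gauss 1 x"
      using gauss_bounds(1)[of 1 x] by (intro mult_right_mono) (auto simp: field_simps less_imp_le)
    also have "... = fact N * exp (1 + norm x - (norm x)^2)"
      by (simp add: gauss_def exp_add[symmetric] exp_diff exp_minus field_simps)
    also have "... \<le> fact N * exp 2"
      using sum_squares_bound[of "norm x" "1/2"] by (simp add: power2_eq_square)
    finally show ?thesis using gauss_bounds(1)[of 1 x] by (simp add: norm_mult abs_of_pos)
  qed
  then show ?case by blast
next
  case (scale f c)
  then obtain M where M: "\<And>x. (jb x) ^ N * norm (f x) \<le> M" by blast
  have "jb x ^ N * norm (c * f x) \<le> norm c * M" for x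
    using mult_left_mono[OF M[of x], of "norm c"] by (simp add: norm_mult mult_ac)
  then show ?case by blast
next
  case (add f g)
  then obtain M M' where M: "\<And>x. (jb x) ^ N * norm (f x) \<le> M" "\<And>x. (jb x) ^ N * norm (g x) \<le> M'" by metis
  have "jb x ^ N * norm (f x + g x) \<le> M + M'" for x
  proof -
    have "jb x ^ N * norm (f x + g x) \<le> jb x ^ N * (norm (f x) + norm (g x))"
      by (intro mult_left_mono norm_triangle_ineq) auto
    then show ?thesis using M[of x] by (simp add: distrib_left)
  qed
  then show ?case by blast
next
  case (coord f b)
  obtain M where M: "\<And>x. (jb x) ^ Suc N * norm (f x) \<le> M" using coord.IH by blast
  have "jb x ^ N * norm (of_real (x \<bullet> b) * f x) \<le> norm b * M" for x
  proof -
    have "norm (of_real (x \<bullet> b) * f x) \<le> (jb x * norm b) * norm (f x)"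
      unfolding norm_mult norm_of_real
      by (intro mult_right_mono order_trans[OF Cauchy_Schwarz_ineq2]) auto
    then have "jb x ^ N * norm (of_real (x \<bullet> b) * f x) \<le> jb x ^ N * ((jb x * norm b) * norm (f x))"
      by (intro mult_left_mono) auto
    also have "... = norm b * (jb x ^ Suc N * norm (f x))" by (simp add: mult_ac)
    also have "... \<le> norm b * M" by (intro mult_left_mono M) auto
    finally show ?thesis .
  qed
  then show ?case by blast
qed

lemma poly_gauss_schwartz:
  assumes f: "f \<in> poly_gauss a"
  shows "f \<in> schwartz"
proof -
  have it: "iterated_partial bs f \<in> poly_gauss a" for bs
  proof (induction bs)
    case Nil then show ?case using f by simp
  next
    case (Cons b bs)
    then obtain D where D: "\<And>x. (iterated_partial bs f has_derivative D x) (at x)" "\<And>b. (\<lambda>x. D x b) \<in> poly_gauss a"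
      using poly_gauss_derivative by blast
    have "frechet_derivative (iterated_partial bs f) (at x) = D x" for x
      using frechet_derivative_at[OF D(1)] by simp
    then show ?case using D(2) by simp
  qed
  have "iterated_partial bs f differentiable at x" for bs x
    using poly_gauss_derivative[OF it[of bs]] by (auto simp: differentiable_def)
  then show ?thesis using poly_gauss_bound[OF it] by (simp add: schwartz_def smooth_def)
qed

text \<open>Tested against \<open>gauss 1\<close> times a character, the hypothesis says that the
  Fourier transform of \<open>w\<close> times a Gaussian vanishes, so injectivity applies.\<close>

lemma AE_zero_of_schwartz:
  fixes w :: "cfun"
  assumes [measurable]: "w \<in> borel_fun" and w: "L1 (\<lambda>x. w x / of_real (jb x ^ N))"
    and z: "\<And>\<phi>. \<phi> \<in> schwartz \<Longrightarrow> (LBINT x. w x * \<phi> x) = 0"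
  shows "AE x in lborel. w x = 0"
proof -
  obtain M where M: "\<And>x. (jb x) ^ N * norm (of_real (gauss 1 x) * em 0 x :: complex) \<le> M"
    using poly_gauss_bound[OF poly_gauss.base[of 0]] by blast
  have "AE x in lborel. w x * of_real (gauss 1 x) = 0"
  proof (rule AE_zero_of_fourier_zero)
    show "L1 (\<lambda>x. w x * of_real (gauss 1 x))"
    proof (rule L1_bound)
      show "L1 (\<lambda>x. M * norm (w x / of_real (jb x ^ N)))" using w by (intro integrable_mult_right integrable_norm)
      have "norm (w x * of_real (gauss 1 x)) \<le> \<bar>M\<bar> * norm (w x / of_real (jb x ^ N))" for x
      proof -
        define c where "c = jb x ^ N"
        have "c > 0" unfolding c_def by (intro zero_less_power) (simp add: add_pos_nonneg)
        then have "norm (w x * of_real (gauss 1 x)) = norm (w x / of_real c) * (c * norm (of_real (gauss 1 x) :: complex))"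
          by (simp add: norm_mult norm_divide)
        then have "norm (w x * of_real (gauss 1 x)) = norm (w x / of_real (jb x ^ N)) * (jb x ^ N * norm (of_real (gauss 1 x) :: complex))"
          unfolding c_def .
        also have "... \<le> norm (w x / of_real (jb x ^ N)) * \<bar>M\<bar>"
          using M[of x] by (intro mult_left_mono) auto
        finally show ?thesis by (simp add: mult.commute)
      qed
      then show "AE x in lborel. norm (w x * of_real (gauss 1 x)) \<le> norm (M * norm (w x / of_real (jb x ^ N)))"
        by (auto simp: abs_mult)
    qed simp
    fix \<xi>
    show "fourier (\<lambda>x. w x * of_real (gauss 1 x)) \<xi> = 0"
      using z[OF poly_gauss_schwartz[OF poly_gauss.base[of \<xi>]]] by (simp add: fourier_def mult_ac)
  qed
  then show ?thesis by eventually_elim (use gauss_bounds(1) in \<open>simp add: less_imp_neq[THEN not_sym]\<close>)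
qed

section \<open>Rotation invariance and iterated integration\<close>

lemma lborel_orthogonal:
  fixes T :: "plane \<Rightarrow> plane"
  assumes T: "orthogonal_transformation T"
  shows "lborel = distr lborel borel T"
proof (rule lborel_eqI)
  have lin: "linear T" using T by (rule orthogonal_transformation_linear)
  have [measurable]: "T \<in> borel_fun"
    by (intro borel_measurable_continuous_onI linear_continuous_on linear_conv_bounded_linear[THEN iffD1] lin)
  have inv: "orthogonal_transformation (inv T)" "bij T"
    using T by (auto intro: orthogonal_transformation_inv orthogonal_transformation_bij)
  fix l u :: plane assume lu: "\<And>b. b \<in> Basis \<Longrightarrow> l \<bullet> b \<le> u \<bullet> b"
  have vim: "T -` box l u = inv T ` box l u" using inv(2) by (rule bij_vimage_eq_inv_image)
  have mb: "inv T ` box l u \<in> sets borel"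
    unfolding vim[symmetric] using measurable_sets[of T borel borel "box l u"] by simp
  have "emeasure (distr lborel borel T) (box l u) = emeasure lborel (inv T ` box l u)"
    by (subst emeasure_distr) (auto simp: vim)
  also have "... = emeasure lebesgue (inv T ` box l u)" using mb by simp
  also have "... = en (measure lebesgue (inv T ` box l u))"
    using measurable_orthogonal_image[OF inv(1) lmeasurable_box] by (simp add: emeasure_eq_measure2)
  also have "measure lebesgue (inv T ` box l u) = measure lebesgue (box l u)"
    by (rule measure_orthogonal_image[OF inv(1) lmeasurable_box])
  also have "... = (\<Prod>b\<in>Basis. (u - l) \<bullet> b)"
    using lu by (simp add: measure_lborel_box)
  finally show "emeasure (distr lborel borel T) (box l u) = en (\<Prod>b\<in>Basis. (u - l) \<bullet> b)" .
qed simp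

lemma integral_plane:
  fixes f :: "plane \<Rightarrow> 'b::{banach, second_countable_topology}"
  assumes f: "L1 f"
  shows "(LBINT v. f v) = (LBINT x. LBINT y. f (pl x y))"
proof -
  have [measurable]: "f \<in> borel_fun" using f by auto
  have m: "(\<lambda>(x, y). pl x y) \<in> borel_measurable lborel2" by measurable
  have i: "integrable lborel2 (\<lambda>p. f (case p of (x, y) \<Rightarrow> pl x y))"
    by (rule integrable_distr[OF m]) (use f lborel_plane in simp)
  have "(LBINT v. f v) = (LINT p|lborel2. f (case p of (x, y) \<Rightarrow> pl x y))"
    by (subst lborel_plane, subst integral_distr) (use m in auto)
  also have "... = (LBINT x. LBINT y. f (pl x y))"
    using lborel_pair.integral_fst'[OF i] by simp
  finally show ?thesis .
qed

section \<open>The outgoing kernel\<close>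

text \<open>\<open>wk t \<bar>x\<bar> / (2 pi)\<close> is the fundamental solution of the wave equation in the plane. Its time integral
  against \<open>e\<^sup>i\<^sup>z\<^sup>t\<close> gives the kernel of \<open>(\<Delta> + z\<^sup>2)\<^sup>-\<^sup>1\<close> without Bessel functions.\<close>

definition wk :: "real \<Rightarrow> real \<Rightarrow> real" where
  "wk t r = (if r < t then 1 / sqrt (t^2 - r^2) else 0)"

lemma wk_measurable [measurable (raw)]:
  assumes [measurable]: "f \<in> borel_measurable M" "g \<in> borel_measurable M"
  shows "(\<lambda>x. wk (f x) (g x)) \<in> borel_measurable M"
  unfolding wk_def by measurable

lemma wk_nonneg: "0 \<le> r \<Longrightarrow> 0 \<le> wk t r"
  by (auto simp: wk_def power_mono)

lemma nn_integral_arcsine: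
  assumes a: "a > 0"
  shows "(NN y. en (indicator {-a<..<a} y * (1 / sqrt (a^2 - y^2)))) = en pi"
proof -
  have pos: "a^2 - y^2 > 0" if "-a < y" "y < a" for y
    using that abs_square_less_1[of "y / a"] a by (simp add: power_divide field_simps abs_less_iff)
  have D: "((\<lambda>y. arcsin (y / a)) has_real_derivative 1 / sqrt (a^2 - y^2)) (at y)"
    and C: "isCont (\<lambda>y. 1 / sqrt (a^2 - y^2)) y" if "ereal (-a) < ereal y" "ereal y < ereal a" for y
  proof -
    have y: "-a < y" "y < a" using that by auto
    have "((\<lambda>y. arcsin (y / a)) has_real_derivative inverse (sqrt (1 - (y / a)^2)) * (1 / a)) (at y)"
      using y a by (intro DERIV_chain2[OF DERIV_arcsin] DERIV_cdivide DERIV_ident) (auto simp: field_simps)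
    also have "inverse (sqrt (1 - (y / a)^2)) * (1 / a) = 1 / sqrt (a^2 - y^2)"
    proof -
      have "sqrt (a^2 - y^2) = sqrt (a^2 * (1 - (y / a)^2))" using a by (simp add: power_divide field_simps)
      also have "... = a * sqrt (1 - (y / a)^2)" using a by (simp add: real_sqrt_mult)
      finally show ?thesis by (simp add: field_simps)
    qed
    finally show "((\<lambda>y. arcsin (y / a)) has_real_derivative 1 / sqrt (a^2 - y^2)) (at y)" .
    show "isCont (\<lambda>y. 1 / sqrt (a^2 - y^2)) y" using pos[OF y] by (intro continuous_intros) auto
  qed
  have N: "AE x in lborel. ereal (-a) < ereal x \<longrightarrow> ereal x < ereal a \<longrightarrow> 0 \<le> 1 / sqrt (a^2 - x^2)"
    using pos by (auto intro: less_imp_le)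
  have c: "continuous_on {-a..a} (\<lambda>y. arcsin (y / a))"
    using a by (intro continuous_intros) (auto simp: field_simps)
  then have "((\<lambda>y. arcsin (y / a)) \<longlongrightarrow> arcsin (- a / a)) (at (-a) within {-a..a})" "((\<lambda>y. arcsin (y / a)) \<longlongrightarrow> arcsin (a / a)) (at a within {-a..a})"
    using bspec[OF continuous_on_def[THEN iffD1, OF c], of "-a"] bspec[OF continuous_on_def[THEN iffD1, OF c], of a] a by simp_all
  then have L: "(((\<lambda>y. arcsin (y / a)) \<circ> real_of_ereal) \<longlongrightarrow> - (pi / 2)) (at_right (ereal (-a)))"
     "(((\<lambda>y. arcsin (y / a)) \<circ> real_of_ereal) \<longlongrightarrow> pi / 2) (at_left (ereal a))"
    using a by (simp_all add: ereal_tendsto_simps at_within_Icc_at_right at_within_Icc_at_left)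
  have lt: "ereal (-a) < ereal a" using a by simp
  note * = interval_integral_FTC_nonneg[OF lt D C N L]
  have e: "einterval (ereal (-a)) (ereal a) = {-a<..<a}" by (auto simp: einterval_def)
  have i: "L1 (\<lambda>y. indicator {-a<..<a} y * (1 / sqrt (a^2 - y^2)))"
    using *(1) unfolding e set_integrable_def by simp
  have v: "(LBINT y. indicator {-a<..<a} y * (1 / sqrt (a^2 - y^2))) = pi"
    using *(2) a unfolding interval_lebesgue_integral_def e set_lebesgue_integral_def by simp
  show ?thesis unfolding v[symmetric]
    by (rule nn_integral_eq_integral[OF i]) (use pos in \<open>auto simp: indicator_def intro: less_imp_le\<close>)
qed

text \<open>Along a vertical line this is an arcsine integral over an interval of half-length
  \<open>a\<close>, and its value pi is the same for every line that meets the disc. This is what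
  makes the two-dimensional transform elementary.\<close>

lemma wk_slice:
  assumes t: "t > 0"
  shows "(NN y. en (wk t (norm (pl x y)))) = en (pi * indicator {-t<..<t} x)"
proof (cases "x \<in> {-t<..<t}")
  case True
  define a where "a = sqrt (t^2 - x^2)"
  have p: "t^2 - x^2 > 0" using True abs_square_less_1[of "x / t"] t by (simp add: power_divide field_simps abs_less_iff)
  then have a: "a > 0" "a^2 = t^2 - x^2" by (auto simp: a_def)
  have "wk t (norm (pl x y)) = indicator {-a<..<a} y * (1 / sqrt (a^2 - y^2))" for y
  proof -
    have "sqrt (x^2 + y^2) < t \<longleftrightarrow> x\<^sup>2 + y^2 < t^2" using t by (metis abs_of_pos real_sqrt_abs real_sqrt_less_iff)
    also have "... \<longleftrightarrow> y\<^sup>2 < a^2" unfolding a by auto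
    also have "... \<longleftrightarrow> \<bar>y\<bar> < a" using a(1) by (metis abs_of_pos abs_le_square_iff linorder_not_less)
    finally have "sqrt (x^2 + y^2) < t \<longleftrightarrow> y \<in> {-a<..<a}" by auto
    then show ?thesis by (auto simp: wk_def a(2) indicator_def algebra_simps)
  qed
  then show ?thesis using nn_integral_arcsine[OF a(1)] True by simp
next
  case False
  have "wk t (norm (pl x y)) = 0" for y
  proof -
    have "t \<le> \<bar>x\<bar>" using False by auto
    also have "\<bar>x\<bar> \<le> norm (pl x y)" using component_le_norm_cart[of "pl x y" 1] by simp
    finally show ?thesis by (simp add: wk_def)
  qed
  then show ?thesis using False by simp
qed

lemma wk_mass:
  assumes t: "t > 0"
  shows "(NN v. en (wk t (norm (v::plane)))) = en (2 * pi * t)"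
proof -
  have "(NN v. en (wk t (norm (v::plane)))) = (NN x. en (pi * indicator {-t<..<t} x))"
    by (subst nn_integral_plane(1)) (auto simp del: norm_pl simp: wk_slice[OF t])
  also have "... = (NN x. en pi * indicator {-t<..<t} x)"
    by (intro nn_integral_cong) (auto simp: indicator_def)
  also have "... = en (2 * pi * t)"
    using t by (simp add: nn_integral_cmult_indicator ennreal_mult[symmetric] mult_ac)
  finally show ?thesis .
qed

lemma wk_integrable: "t > 0 \<Longrightarrow> L1 (\<lambda>v::plane. wk t (norm v))"
  by (rule integrableI_bounded) (auto simp: wk_nonneg wk_mass)

text \<open>After a rotation of \<open>\<xi>\<close> onto the first axis, the constant slices reduce
  the transform to that of pi times the indicator of the interval from \<open>- t\<close> to
  \<open>t\<close>.\<close>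

lemma wk_fourier:
  assumes t: "t > 0" and \<xi>: "\<xi> \<noteq> (0::plane)"
  shows "fourier (\<lambda>v. of_real (wk t (norm v))) \<xi> = of_real (2 * pi * (sin (t * norm \<xi>) / norm \<xi>))"
proof -
  define s where "s = norm \<xi>"
  have s: "s > 0" using \<xi> by (simp add: s_def)
  have "norm (axis 1 s :: plane) = norm \<xi>" by (simp add: s_def norm_plane axis_def)
  then obtain T :: "plane \<Rightarrow> plane" where T: "orthogonal_transformation T" "T (axis 1 s) = \<xi>"
    by (rule orthogonal_transformation_exists) (rule that)
  have [measurable]: "T \<in> borel_fun"
    using T(1) by (intro borel_measurable_continuous_onI linear_continuous_on linear_conv_bounded_linear[THEN iffD1] orthogonal_transformation_linear)
  have nT: "norm (T v) = norm v" for v using T(1) by (rule orthogonal_transformation_norm)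
  have iT: "\<xi> \<bullet> T v = s * v $ 1" for v
  proof -
    have "\<xi> \<bullet> T v = T (axis 1 s) \<bullet> T v" using T by simp
    also have "... = axis 1 s \<bullet> v" using T(1) by (simp add: orthogonal_transformation_def)
    finally show ?thesis by (simp add: inner_axis inner_commute)
  qed
  let ?g = "\<lambda>v::plane. exp (- \<i> * of_real (s * v $ 1)) * of_real (wk t (norm v))"
  have "fourier (\<lambda>v. of_real (wk t (norm v))) \<xi> = (LINT v|distr lborel borel T. em \<xi> v * of_real (wk t (norm v)))"
    unfolding fourier_def using lborel_orthogonal[OF T(1)] by simp
  also have "... = (LBINT v. ?g v)"
    by (subst integral_distr) (auto simp: nT iT)
  also have "... = (LBINT x. LBINT y. ?g (pl x y))"
    by (rule integral_plane, rule L1_bound[OF wk_integrable[OF t]]) (auto simp: norm_mult)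
  also have "... = (LBINT x. indicator {-t<..<t} x *\<^sub>R (of_real pi * exp (- \<i> * of_real (s * x))))"
  proof (intro LB_cong refl)
    fix x
    have "(LBINT y. wk t (norm (pl x y))) = pi * indicator {-t<..<t} x"
      by (rule integral_eq_nn_integral[THEN trans]) (auto simp: wk_nonneg wk_slice[OF t] simp del: norm_pl)
    then have "(LBINT y. complex_of_real (wk t (norm (pl x y)))) = of_real (pi * indicator {-t<..<t} x)"
      by simp
    then show "(LBINT y. ?g (pl x y)) = indicator {-t<..<t} x *\<^sub>R (of_real pi * exp (- \<i> * of_real (s * x)))"
      by (simp add: scaleR_conv_of_real mult_ac del: norm_pl)
  qed
  also have "... = (LBINT x=-t..t. of_real pi * exp (- \<i> * of_real (s * x)))"
    using t unfolding interval_lebesgue_integral_def set_lebesgue_integral_def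
    by (simp add: einterval_def greaterThanLessThan_def[symmetric]) (simp add: greaterThanLessThan_def Int_def greaterThan_def lessThan_def)
  also have "... = (of_real pi * (\<i> / of_real s)) * exp (- \<i> * of_real (s * t)) - (of_real pi * (\<i> / of_real s)) * exp (- \<i> * of_real (s * (-t)))"
  proof (rule interval_integral_FTC_finite)
    show "continuous_on {min (-t) t..max (-t) t} (\<lambda>x. of_real pi * exp (- \<i> * of_real (s * x)))"
      by (intro continuous_intros)
    fix x
    have ii: "\<i> * (a * \<i>) = - a" for a :: complex by (simp add: mult.left_commute[of _ a])
    have "((\<lambda>x. of_real pi * (\<i> / of_real s) * exp (- \<i> * (of_real s * of_real x))) has_vector_derivative of_real pi * exp (- \<i> * (of_real s * of_real x))) (at x)"
      using s by (intro has_vector_derivative_real_field[where f="\<lambda>z. of_real pi * (\<i> / of_real s) * exp (- \<i> * (of_real s * z))"]) (auto intro!: derivative_eq_intros simp: ii)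
    then show "((\<lambda>x. of_real pi * (\<i> / of_real s) * exp (- \<i> * of_real (s * x))) has_vector_derivative of_real pi * exp (- \<i> * of_real (s * x))) (at x within {min (- t) t..max (- t) t})"
      by (auto intro: has_vector_derivative_at_within)
  qed
  also have "... = of_real (2 * pi * (sin (t * s) / s))"
    using s by (simp add: complex_eq_iff Re_exp Im_exp mult_ac)
  finally show ?thesis by (simp add: s_def)
qed

section \<open>Superpositions of wave propagators and the damped resolvent\<close>

definition wave :: "(real \<Rightarrow> complex) \<Rightarrow> cfun" where
  "wave a x = - (1 / (2 * of_real pi)) * (LBINT t. a t * of_real (wk t (norm x)))"

lemma wave_measurable [measurable]:
  assumes [measurable]: "a \<in> borel_fun"
  shows "wave a \<in> borel_fun"
  unfolding wave_def[abs_def] by measurable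

text \<open>Fubini, the majorant being the mass \<open>2 * pi * t\<close> of \<open>wk t\<close>;
  this mass is the weight \<open>max 0 t\<close> in the hypothesis.\<close>

lemma wave_facts:
  assumes a: "a \<in> borel_fun" and ai: "L1 (\<lambda>t. norm (a t) * max 0 t)"
  shows "L1 (wave a)"
    and "\<xi> \<noteq> 0 \<Longrightarrow> fourier (wave a) \<xi> = - (LBINT t. a t * of_real (indicator {0<..} t * (sin (t * norm \<xi>) / norm \<xi>)))"
proof -
  note [measurable] = a
  have wk0: "wk t (norm (x::plane)) = 0" if "t \<le> 0" for t x using that norm_ge_zero[of x] by (auto simp: wk_def simp del: norm_ge_zero)
  have iw: "L1 (\<lambda>x::plane. wk t (norm x))" for t
    using wk_integrable[of t] wk0[of t] by (cases "t > 0") auto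
  have mass: "(LBINT x. norm (a t * of_real (wk t (norm (x::plane))))) = 2 * pi * (norm (a t) * max 0 t)" for t
  proof (cases "t > 0")
    case True
    have "(LBINT x. wk t (norm (x::plane))) = 2 * pi * t"
      by (rule integral_eq_nn_integral[THEN trans]) (use True in \<open>auto simp: wk_nonneg wk_mass\<close>)
    then show ?thesis using True by (simp add: norm_mult wk_nonneg abs_of_nonneg)
  next
    case False then show ?thesis using wk0[of t] by (simp add: max_def)
  qed
  have F: "integrable lborel2 (\<lambda>(t, x). b x * (a t * of_real (wk t (norm (x::plane)))))"
    if [measurable]: "b \<in> borel_fun" and b: "\<And>x. norm (b x) = 1" for b :: "cfun"
  proof (rule lborel_pair.Fubini_integrable)
    show "L1 (\<lambda>t. LBINT x. norm (case (t, x) of (t, x) \<Rightarrow> b x * (a t * of_real (wk t (norm (x::plane))))))"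
      using ai mass by (simp add: norm_mult[of "b _"] b)
    show "AE t in lborel. L1 (\<lambda>x. case (t, x) of (t, x) \<Rightarrow> b x * (a t * of_real (wk t (norm (x::plane)))))"
    proof (intro AE_I2)
      fix t
      show "L1 (\<lambda>x. case (t, x) of (t, x) \<Rightarrow> b x * (a t * of_real (wk t (norm (x::plane)))))"
        by (rule L1_bound[OF integrable_mult_right[OF iw[of t], of "norm (a t)"]]) (auto simp: norm_mult b)
    qed
  qed simp
  have "L1 (\<lambda>x::plane. LBINT t. 1 * (a t * of_real (wk t (norm x))))"
    using lborel_pair.integrable_snd[OF F[of "\<lambda>_. 1"]] by simp
  then show "L1 (wave a)" unfolding wave_def[abs_def] by simp
  assume \<xi>: "\<xi> \<noteq> 0"
  let ?b = "\<lambda>x. em \<xi> x"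
  have "fourier (wave a) \<xi> = - (1 / (2 * of_real pi)) * (LBINT x. LBINT t. ?b x * (a t * of_real (wk t (norm x))))"
  proof -
    have "fourier (wave a) \<xi> = (LBINT x. - (1 / (2 * of_real pi)) * (LBINT t. ?b x * (a t * of_real (wk t (norm x)))))"
      unfolding fourier_def wave_def by (intro LB_cong refl) simp
    then show ?thesis by (simp only: integral_mult_right_zero)
  qed
  also have "(LBINT x. LBINT t. ?b x * (a t * of_real (wk t (norm x)))) = (LBINT t. LBINT x. ?b x * (a t * of_real (wk t (norm x))))"
    using lborel_pair.Fubini_integral[OF F[of ?b]] by simp
  also have "... = (LBINT t. (2 * of_real pi) * (a t * of_real (indicator {0<..} t * (sin (t * norm \<xi>) / norm \<xi>))))"
  proof (intro LB_cong refl)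
    fix t
    have "(LBINT x. ?b x * (a t * of_real (wk t (norm x)))) = a t * fourier (\<lambda>v. of_real (wk t (norm v))) \<xi>"
      unfolding fourier_def by (subst integral_mult_right_zero[symmetric]) (simp add: mult_ac)
    also have "... = (2 * of_real pi) * (a t * of_real (indicator {0<..} t * (sin (t * norm \<xi>) / norm \<xi>)))"
    proof (cases "t > 0")
      case True then show ?thesis using wk_fourier[OF True \<xi>] by (simp add: mult_ac)
    next
      case False then show ?thesis using wk0[of t] by (simp add: fourier_def)
    qed
    finally show "(LBINT x. ?b x * (a t * of_real (wk t (norm x)))) = (2 * of_real pi) * (a t * of_real (indicator {0<..} t * (sin (t * norm \<xi>) / norm \<xi>)))" .
  qed
  finally show "fourier (wave a) \<xi> = - (LBINT t. a t * of_real (indicator {0<..} t * (sin (t * norm \<xi>) / norm \<xi>)))"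
    by simp
qed

definition conv :: "cfun \<Rightarrow> cfun \<Rightarrow> cfun" where
  "conv g f x = (LBINT y. g (x - y) * f y)"

lemma conv_measurable [measurable]:
  assumes [measurable]: "f \<in> borel_fun" "g \<in> borel_fun"
  shows "conv g f \<in> borel_fun"
  unfolding conv_def[abs_def] by measurable

lemma conv_facts:
  assumes f: "L1 f" and g: "L1 g"
  shows "L1 (conv g f)" "fourier (conv g f) \<xi> = fourier g \<xi> * fourier f \<xi>"
proof -
  have [measurable]: "f \<in> borel_fun" "g \<in> borel_fun" using f g by auto
  have ig: "L1 (\<lambda>x. g (x - y))" for y
  proof -
    have "L1 (\<lambda>x. g (0 - x))" using lborel_translate(1)[of g 0] g by simp
    then have "L1 (\<lambda>x. (\<lambda>x. g (0 - x)) (y - x))" using lborel_translate(1)[of "\<lambda>x. g (0 - x)" y] by simp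
    then show ?thesis by simp
  qed
  have tg: "(LBINT x. h (x - y)) = (LBINT x. h x)" for h :: "plane \<Rightarrow> 'c::{banach, second_countable_topology}" and y
    using lborel_translate(2)[of "\<lambda>x. h (0 - x)" y] lborel_translate(2)[of h 0] by simp
  have F: "integrable lborel2 (\<lambda>(y, x). b x * (g (x - y) * f y))"
    if [measurable]: "b \<in> borel_fun" and b: "\<And>x. norm (b x) = 1" for b :: "cfun"
  proof (rule lborel_pair.Fubini_integrable)
    show "L1 (\<lambda>y. LBINT x. norm (case (y, x) of (y, x) \<Rightarrow> b x * (g (x - y) * f y)))"
      using f tg[of "\<lambda>x. norm (g x)"] by (simp add: norm_mult b)
    show "AE y in lborel. L1 (\<lambda>x. case (y, x) of (y, x) \<Rightarrow> b x * (g (x - y) * f y))"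
    proof (intro AE_I2)
      fix y
      show "L1 (\<lambda>x. case (y, x) of (y, x) \<Rightarrow> b x * (g (x - y) * f y))"
        by (rule L1_bound[OF integrable_mult_left[OF ig[of y], of "f y"]]) (auto simp: norm_mult b)
    qed
  qed simp
  have "L1 (\<lambda>x. LBINT y. 1 * (g (x - y) * f y))"
    using lborel_pair.integrable_snd[OF F[of "\<lambda>_. 1"]] by simp
  then show "L1 (conv g f)" unfolding conv_def[abs_def] by simp
  let ?b = "\<lambda>x. em \<xi> x"
  have "fourier (conv g f) \<xi> = (LBINT x. LBINT y. ?b x * (g (x - y) * f y))"
    unfolding fourier_def conv_def by simp
  also have "... = (LBINT y. LBINT x. ?b x * (g (x - y) * f y))"
    using lborel_pair.Fubini_integral[OF F[of ?b]] by simp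
  also have "... = (LBINT y. fourier g \<xi> * (?b y * f y))"
  proof (intro LB_cong refl)
    fix y
    have "(LBINT x. ?b x * (g (x - y) * f y)) = (LBINT x. (\<lambda>x. ?b x * g x * (?b y * f y)) (x - y))"
    proof (intro LB_cong refl)
      fix x
      have "?b x = ?b (x - y) * ?b y"
        unfolding exp_add[symmetric] by (rule arg_cong[where f=exp]) (simp add: inner_diff_right algebra_simps)
      then show "?b x * (g (x - y) * f y) = ?b (x - y) * g (x - y) * (?b y * f y)" by (simp only: mult_ac)
    qed
    also have "... = (LBINT x. ?b x * g x * (?b y * f y))" by (rule tg)
    finally show "(LBINT x. ?b x * (g (x - y) * f y)) = fourier g \<xi> * (?b y * f y)" by (simp add: fourier_def)
  qed
  finally show "fourier (conv g f) \<xi> = fourier g \<xi> * fourier f \<xi>" by (simp add: fourier_def)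
qed

text \<open>The common majorant of the time integrals; the factor 2 bounds the integral of
  \<open>1 / ja t^2\<close> over the line.\<close>

lemma inverse_square_dominated:
  fixes f :: "real \<Rightarrow> 'b::{banach, second_countable_topology}"
  assumes [measurable]: "f \<in> borel_fun" and le: "\<And>t. norm (f t) \<le> C / ja t^2"
  shows "L1 f" "norm (LBINT t. f t) \<le> 2 * C" "(LBINT t. norm (f t)) \<le> 2 * C"
proof -
  have C: "C \<ge> 0" using le[of 0] norm_ge_zero[of "f 0"] by (simp del: norm_ge_zero)
  have p: "C / ja t^2 = C * ja t powr - 2" for t :: real
    by (subst powr_minus) (simp add: powr_numeral divide_inverse)
  have nn: "(NN t. en (norm (f t))) \<le> en (2 * C)"
  proof -
    have "(NN t. en (norm (f t))) \<le> (NN t. en C * en (ja t powr - 2))"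
      using le C unfolding p by (intro nn_integral_mono) (auto simp: ennreal_mult[symmetric] intro!: ennreal_leI)
    also have "... = en C * (NN t. en (ja t powr - 2))" by (simp add: nn_integral_cmult)
    also have "... \<le> en C * en (2 / (2 - 1))" by (intro mult_left_mono nn_integral_one_plus_powr) auto
    finally show ?thesis using C by (simp add: ennreal_mult mult.commute)
  qed
  show i: "L1 f" by (rule integrableI_bounded) (use nn in \<open>auto intro: le_less_trans\<close>)
  show "(LBINT t. norm (f t)) \<le> 2 * C"
    using nn i C by (subst (asm) nn_integral_eq_integral) (auto simp: ennreal_le_iff)
  then show "norm (LBINT t. f t) \<le> 2 * C" using integral_norm_bound[of lborel f] by linarith
qed

text \<open>This is the cubic term of the exponential series at \<open>b * (1 + t)\<close>.\<close>

lemma exp_decay: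
  fixes b t :: real
  assumes b: "b > 0" and t: "t \<ge> 0"
  shows "exp (- (b * t)) * (1 + t) ^ 3 \<le> 6 * exp b / b ^ 3"
proof -
  have "(b * (1 + t)) ^ 3 / fact 3 \<le> exp (b * (1 + t))"
    using power_divide_fact_le_exp[of "b * (1 + t)" 3] b t by simp
  then have "exp (- (b * t)) * ((b * (1 + t)) ^ 3) \<le> exp (- (b * t)) * (6 * exp (b * (1 + t)))"
    by (intro mult_left_mono) (auto simp: fact_numeral)
  also have "... = 6 * exp (- (b * t) + b * (1 + t))" by (simp only: exp_add mult.left_commute)
  also have "- (b * t) + b * (1 + t) = b" by (simp add: algebra_simps)
  finally have "(exp (- (b * t)) * (1 + t) ^ 3) * b ^ 3 \<le> 6 * exp b" by (simp only: power_mult_distrib mult_ac)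
  then show ?thesis using b by (simp add: pos_le_divide_eq)
qed

lemma exp_integral_half_line:
  assumes c: "Re c < 0"
  shows "L1 (\<lambda>t. ind {0<..} t * exp (c * of_real t))"
    and "(LBINT t. ind {0<..} t * exp (c * of_real t)) = - 1 / c"
    and "L1 (\<lambda>t. norm (exp (c * of_real t)) * max 0 t)"
proof -
  define b where "b = - Re c"
  define C where "C = 6 * exp b / b ^ 3"
  have b: "b > 0" using c by (simp add: b_def)
  have dec: "exp (- (b * t)) * (1 + t) \<le> C / ja t^2" if "t \<ge> 0" for t
  proof -
    have "(exp (- (b * t)) * (1 + t)) * (1 + t)^2 \<le> C"
      using exp_decay[OF b that] by (simp add: C_def power2_eq_square power3_eq_cube mult.assoc)
    then show ?thesis using that by (subst pos_le_divide_eq) auto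
  qed
  have ne: "norm (exp (c * of_real t)) = exp (- (b * t))" for t by (simp add: b_def norm_exp_eq_Re)
  have C0: "C \<ge> 0" using b by (simp add: C_def)
  show i1: "L1 (\<lambda>t. ind {0<..} t * exp (c * of_real t))"
  proof (rule inverse_square_dominated(1))
    fix t :: real
    show "norm (ind {0<..} t * exp (c * of_real t)) \<le> C / ja t^2"
    proof (cases "t > 0")
      case True
      have "exp (- (b * t)) \<le> exp (- (b * t)) * (1 + t)" using True by simp
      also have "... \<le> C / ja t^2" using dec[of t] True by simp
      finally show ?thesis using True by (simp add: norm_mult ne del: norm_exp_eq_Re)
    qed (use C0 in simp)
  qed simp
  show "L1 (\<lambda>t. norm (exp (c * of_real t)) * max 0 t)"
  proof (rule inverse_square_dominated(1))
    fix t :: real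
    show "norm (norm (exp (c * of_real t)) * max 0 t) \<le> C / ja t^2"
    proof (cases "t > 0")
      case True
      have "exp (- (b * t)) * t \<le> exp (- (b * t)) * (1 + t)" using True by (intro mult_left_mono) auto
      also have "... \<le> C / ja t^2" using dec[of t] True by simp
      finally show ?thesis using True by (simp add: ne del: norm_exp_eq_Re)
    qed (use C0 in simp)
  qed simp
  show "(LBINT t. ind {0<..} t * exp (c * of_real t)) = - 1 / c"
  proof -
    have e: "einterval 0 \<infinity> = {0<..}" by (auto simp: einterval_def)
    have c0: "c \<noteq> 0" using c by auto
    have "(LBINT t=0..\<infinity>. exp (c * of_real t)) = 0 - 1 / c"
    proof (rule interval_integral_FTC_integrable[where F="\<lambda>t. exp (c * of_real t) / c"])
      show "((\<lambda>t. exp (c * of_real t) / c) has_vector_derivative exp (c * of_real t)) (at t)" for t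
        using c0 by (intro has_vector_derivative_real_field[where f="\<lambda>z. exp (c * z) / c"]) (auto intro!: derivative_eq_intros)
      show "set_integrable lborel (einterval 0 \<infinity>) (\<lambda>t. exp (c * of_real t))"
        using i1 unfolding e set_integrable_def by (simp add: scaleR_conv_of_real)
      have "((\<lambda>t. exp (c * of_real t) / c) \<longlongrightarrow> exp (c * of_real 0) / c) (at_right (0::real))"
        using c0 by (intro tendsto_intros)
      then show "(((\<lambda>t. exp (c * of_real t) / c) \<circ> real_of_ereal) \<longlongrightarrow> 1 / c) (at_right 0)"
        by (simp add: zero_ereal_def ereal_tendsto_simps)
      have "((\<lambda>t. exp (- (b * t)) / norm c) \<longlongrightarrow> 0) at_top"
        using b by (intro tendsto_divide_zero) real_asymp
      then have "((\<lambda>t. norm (exp (c * of_real t) / c)) \<longlongrightarrow> 0) at_top"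
        by (simp add: norm_divide ne del: norm_exp_eq_Re)
      then show "(((\<lambda>t. exp (c * of_real t) / c) \<circ> real_of_ereal) \<longlongrightarrow> 0) (at_left \<infinity>)"
        by (simp add: ereal_tendsto_simps tendsto_norm_zero_iff)
    qed (auto intro!: continuous_intros)
    then show ?thesis unfolding interval_lebesgue_integral_def e set_lebesgue_integral_def by (simp add: scaleR_conv_of_real)
  qed
qed


text \<open>Writing the sine by exponentials leaves two half-line integrals, which partial fractions
  recombine. Hence \<open>wave\<close> of a decaying exponential is the resolvent kernel off the
  spectrum.\<close>

lemma wave_exp_fourier:
  assumes z: "Im z > 0" and \<xi>: "\<xi> \<noteq> (0::plane)"
  shows "fourier (wave (\<lambda>t. ez z t)) \<xi> = 1 / (z^2 - of_real ((norm \<xi>)^2))"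
proof -
  define s where "s = norm \<xi>"
  have s: "s > 0" using \<xi> by (simp add: s_def)
  let ?p = "\<i> * (z + of_real s)" and ?m = "\<i> * (z - of_real s)"
  have re: "Re ?p < 0" "Re ?m < 0" "Re (\<i> * z) < 0" using z by auto
  have "fourier (wave (\<lambda>t. ez z t)) \<xi> = - (LBINT t. ez z t * of_real (indicator {0<..} t * (sin (t * s) / s)))"
    unfolding s_def by (rule wave_facts(2)[OF _ exp_integral_half_line(3)[OF re(3)] \<xi>]) simp
  also have "(LBINT t. ez z t * of_real (indicator {0<..} t * (sin (t * s) / s))) =
    (LBINT t. (ind {0<..} t * exp (?p * of_real t) - ind {0<..} t * exp (?m * of_real t)) / (2 * \<i> * of_real s))"
  proof (intro LB_cong refl)
    fix t :: real
    define E where "E = ez z t"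
    have sin: "of_real (sin (t * s)) = (exp (\<i> * of_real (t * s)) - exp (- \<i> * of_real (t * s))) / (2 * \<i>)"
    proof -
      have "exp (\<i> * of_real (t * s)) = cis (t * s)" "exp (- \<i> * of_real (t * s)) = cis (- (t * s))" by (simp_all add: cis_conv_exp)
      then show ?thesis by (simp only:) (simp add: complex_eq_iff)
    qed
    have p: "exp (?p * of_real t) = E * exp (\<i> * of_real (t * s))" "exp (?m * of_real t) = E * exp (- \<i> * of_real (t * s))"
      unfolding E_def exp_add[symmetric] by (rule arg_cong[where f=exp], simp add: algebra_simps)+
    have "E * of_real (sin (t * s)) = (exp (?p * of_real t) - exp (?m * of_real t)) / (2 * \<i>)"
      unfolding sin p by (simp only: right_diff_distrib times_divide_eq_right)
    then have "(E * of_real (sin (t * s))) / of_real s = (exp (?p * of_real t) - exp (?m * of_real t)) / (2 * \<i>) / of_real s"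
      by (rule arg_cong)
    then show "ez z t * of_real (indicator {0<..} t * (sin (t * s) / s)) = (ind {0<..} t * exp (?p * of_real t) - ind {0<..} t * exp (?m * of_real t)) / (2 * \<i> * of_real s)"
      unfolding E_def[symmetric] by (cases "t > 0") (simp_all only: divide_divide_eq_left, simp_all)
  qed
  also have "... = ((- 1 / ?p) - (- 1 / ?m)) / (2 * \<i> * of_real s)"
    unfolding integral_divide_zero
    by (subst LB_diff) (use exp_integral_half_line[OF re(1)] exp_integral_half_line[OF re(2)] in auto)
  also have "- ... = 1 / (z^2 - of_real (s^2))"
  proof -
    define A B where "A = z + of_real s" and "B = z - of_real s"
    have nz: "A \<noteq> 0" "B \<noteq> 0" "of_real s \<noteq> (0::complex)" using z s by (auto simp: complex_eq_iff A_def B_def)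
    have "1 / A - 1 / B = - (2 * of_real s) / (A * B)" using nz by (simp add: diff_frac_eq A_def B_def)
    moreover have "- 1 / (\<i> * w) = \<i> * (1 / w)" for w
      by (cases "w = 0") (auto simp: divide_eq_eq eq_divide_eq)
    ultimately have "((- 1 / (\<i> * A)) - (- 1 / (\<i> * B))) / (2 * \<i> * of_real s) = (\<i> * (- (2 * of_real s) / (A * B))) / (\<i> * (2 * of_real s))"
      by (simp only: right_diff_distrib[symmetric] mult.left_commute[of 2 \<i>] mult.assoc)
    also have "... = - 1 / (A * B)" using nz by simp
    finally have "((- 1 / (\<i> * A)) - (- 1 / (\<i> * B))) / (2 * \<i> * of_real s) = - 1 / (A * B)" .
    moreover have "z^2 - of_real (s^2) = A * B" by (simp add: algebra_simps power2_eq_square A_def B_def)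
    ultimately show ?thesis by (simp add: A_def B_def)
  qed
  finally show ?thesis by (simp add: s_def)
qed

section \<open>A cutoff in time with explicit derivatives\<close>

lemma DERIV_max_square: "((\<lambda>y::real. (max 0 y)\<^sup>2) has_real_derivative 2 * max 0 y) (at y)"
proof -
  consider "y < 0" | "y = 0" | "y > 0" by linarith
  then show ?thesis
  proof cases
    case 1
    have "((\<lambda>_::real. 0::real) has_real_derivative 2 * max 0 y) (at y)" using 1 by simp
    then show ?thesis by (rule has_field_derivative_transform_within_open[where S="{..<0}"]) (use 1 in auto)
  next
    case 2
    have "isCont (\<lambda>z::real. max 0 z) 0" by (intro continuous_intros)
    then show ?thesis unfolding CARAT_DERIV 2
      by (intro exI[of _ "\<lambda>z. max 0 z"]) (auto simp: max_def power2_eq_square)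
  next
    case 3
    have "((\<lambda>y::real. y\<^sup>2) has_real_derivative 2 * max 0 y) (at y)" using 3 by (auto intro!: derivative_eq_intros)
    then show ?thesis by (rule has_field_derivative_transform_within_open[where S="{0<..}"]) (use 3 in auto)
  qed
qed

lemma DERIV_max_cube: "((\<lambda>y::real. (max 0 y) ^ 3) has_real_derivative 3 * (max 0 y)^2) (at y)"
proof -
  consider "y < 0" | "y = 0" | "y > 0" by linarith
  then show ?thesis
  proof cases
    case 1
    have "((\<lambda>_::real. 0::real) has_real_derivative 3 * (max 0 y)^2) (at y)" using 1 by simp
    then show ?thesis by (rule has_field_derivative_transform_within_open[where S="{..<0}"]) (use 1 in auto)
  next
    case 2
    have "isCont (\<lambda>z::real. (max 0 z)\<^sup>2) 0" by (intro continuous_intros)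
    then show ?thesis unfolding CARAT_DERIV 2
      by (intro exI[of _ "\<lambda>z. (max 0 z)\<^sup>2"]) (auto simp: max_def power2_eq_square power3_eq_cube)
  next
    case 3
    have "((\<lambda>y::real. y ^ 3) has_real_derivative 3 * (max 0 y)^2) (at y)" using 3 by (auto intro!: derivative_eq_intros)
    then show ?thesis by (rule has_field_derivative_transform_within_open[where S="{0<..}"]) (use 3 in auto)
  qed
qed

text \<open>\<open>cut L\<close> vanishes on \<open>(0, L]\<close> and \<open>1 - cut L t\<close> is \<open>O(t\<^sup>-\<^sup>4)\<close>; \<open>cut1\<close>, \<open>cut2\<close> and \<open>cut3\<close> are its
  derivatives, the last one for \<open>t > L\<close> only.\<close>

definition cutw :: "real \<Rightarrow> real \<Rightarrow> real" where "cutw L t = max 0 (1 - L ^ 4 / t ^ 4)"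
definition cut :: "real \<Rightarrow> real \<Rightarrow> real" where "cut L t = (cutw L t) ^ 3"
definition cut1 :: "real \<Rightarrow> real \<Rightarrow> real" where "cut1 L t = 12 * L ^ 4 * (cutw L t)^2 / t ^ 5"
definition cut2 :: "real \<Rightarrow> real \<Rightarrow> real" where
  "cut2 L t = 12 * L ^ 4 * (8 * L ^ 4 * cutw L t / t ^ 10 - 5 * (cutw L t)^2 / t ^ 6)"
definition chi :: "real \<Rightarrow> real \<Rightarrow> real" where "chi L t = 1 - cut L t"

lemma cut_measurable [measurable]:
  "cutw L \<in> borel_fun" "cut L \<in> borel_fun" "cut1 L \<in> borel_fun"
  "cut2 L \<in> borel_fun" "chi L \<in> borel_fun"
proof -
  show [measurable]: "cutw L \<in> borel_fun" unfolding cutw_def[abs_def] by measurable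
  show [measurable]: "cut L \<in> borel_fun" unfolding cut_def[abs_def] by measurable
  show "cut1 L \<in> borel_fun" unfolding cut1_def[abs_def] by measurable
  show "cut2 L \<in> borel_fun" unfolding cut2_def[abs_def] by measurable
  show "chi L \<in> borel_fun" unfolding chi_def[abs_def] by measurable
qed

lemma chi_measurable2 [measurable (raw)]:
  assumes [measurable]: "f \<in> borel_measurable M" "g \<in> borel_measurable M"
  shows "(\<lambda>x. chi (f x) (g x)) \<in> borel_measurable M"
  unfolding chi_def cut_def cutw_def by measurable

lemma cut_DERIV:
  assumes t: "t > 0"
  shows "(cut L has_real_derivative cut1 L t) (at t)" "(cut1 L has_real_derivative cut2 L t) (at t)"
    "(chi L has_real_derivative - cut1 L t) (at t)"
proof -
  have w: "((\<lambda>t. 1 - L ^ 4 / t ^ 4) has_real_derivative 4 * L ^ 4 / t ^ 5) (at t)"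
    using t by (auto intro!: derivative_eq_intros simp: field_simps power_numeral_reduce)
  have c3: "((\<lambda>t. (max 0 (1 - L ^ 4 / t ^ 4)) ^ 3) has_real_derivative 3 * (max 0 (1 - L ^ 4 / t ^ 4))^2 * (4 * L ^ 4 / t ^ 5)) (at t)"
    by (rule DERIV_chain2[OF DERIV_max_cube w])
  show 1: "(cut L has_real_derivative cut1 L t) (at t)"
    unfolding cut_def[abs_def] cut1_def cutw_def using c3 by (rule DERIV_cong) simp
  show "(chi L has_real_derivative - cut1 L t) (at t)"
    unfolding chi_def[abs_def] by (auto intro!: derivative_eq_intros 1)
  have c2: "((\<lambda>t. (max 0 (1 - L ^ 4 / t ^ 4))\<^sup>2) has_real_derivative 2 * (max 0 (1 - L ^ 4 / t ^ 4)) * (4 * L ^ 4 / t ^ 5)) (at t)"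
    by (rule DERIV_chain2[OF DERIV_max_square w])
  have i5: "((\<lambda>t. 1 / t ^ 5) has_real_derivative - 5 / t ^ 6) (at t)"
    using t by (auto intro!: derivative_eq_intros simp: field_simps power_numeral_reduce)
  have "((\<lambda>t. 12 * L ^ 4 * (cutw L t)^2 / t ^ 5) has_real_derivative 12 * L ^ 4 * ((cutw L t)^2 * (- 5 / t ^ 6) + 2 * cutw L t * (4 * L ^ 4 / t ^ 5) * (1 / t ^ 5))) (at t)"
    using DERIV_cmult[OF DERIV_mult'[OF c2[folded cutw_def] i5], of "12 * L ^ 4"] by simp
  then show "(cut1 L has_real_derivative cut2 L t) (at t)"
    unfolding cut1_def[abs_def] cut2_def
    by (rule DERIV_cong) (use t in \<open>simp add: field_simps power_numeral_reduce\<close>)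
qed

lemma cut_zero: "0 < t \<Longrightarrow> t \<le> L \<Longrightarrow> cutw L t = 0"
  by (simp add: cutw_def max_def le_divide_eq power_mono)

lemma cutw_bounds: "0 \<le> cutw L t" "cutw L t \<le> 1"
  by (auto simp: cutw_def)

text \<open>Up to \<open>L\<close> the function \<open>chi\<close> is 1 and \<open>t\<close> is
  bounded; beyond \<open>L\<close> everything is controlled by powers of
  \<open>u = L ^ 4 / t ^ 4\<close>. All bounds are brought to the shape of
  \<open>inverse_square_dominated\<close>, with constants explicit in \<open>L\<close>.\<close>

lemma chi_bounds:
  assumes L: "L \<ge> 1" and t: "t > 0"
  shows "0 \<le> chi L t" "chi L t \<le> 1" "chi L t \<le> 16 * L ^ 4 / ja t^2" "chi L t * t \<le> 16 * L ^ 4 / ja t^2"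
    "0 \<le> cut1 L t" "cut1 L t \<le> 48 * L ^ 4 / ja t^2" "\<bar>cut2 L t\<bar> * t \<le> 624 * L ^ 4 / ja t^2"
proof -
  have w: "0 \<le> cutw L t" "cutw L t \<le> 1" by (rule cutw_bounds)+
  have c: "0 \<le> cut L t" "cut L t \<le> 1" unfolding cut_def using w by (auto intro: power_le_one)
  show "0 \<le> chi L t" "chi L t \<le> 1" using c by (auto simp: chi_def)
  show "0 \<le> cut1 L t" using w t L by (simp add: cut1_def)
  have L4: "L \<le> L ^ 4" "L^2 \<le> L ^ 4" "L ^ 3 \<le> L ^ 4" "1 \<le> L ^ 4"
    using L power_increasing[of 1 4 L] power_increasing[of 2 4 L] power_increasing[of 3 4 L] power_increasing[of 0 4 L] by auto
  have "chi L t \<le> 16 * L ^ 4 / ja t^2 \<and> chi L t * t \<le> 16 * L ^ 4 / ja t^2 \<and> cut1 L t \<le> 48 * L ^ 4 / ja t^2 \<and> \<bar>cut2 L t\<bar> * t \<le> 624 * L ^ 4 / ja t^2"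
  proof (cases "t \<le> L")
    case True
    have z: "cutw L t = 0" using t True by (rule cut_zero)
    have q: "(1 + t)^2 \<le> (2 * L)^2" using True t L by (intro power_mono) auto
    have "1 * (1 + t)^2 \<le> 16 * L ^ 4" using q L4 by (simp add: power_mult_distrib)
    moreover have "t * (1 + t)^2 \<le> L * (2 * L)^2" using q True t by (intro mult_mono) auto
    then have "t * (1 + t)^2 \<le> 16 * L ^ 4" using L4 L by (simp add: power2_eq_square power3_eq_cube)
    ultimately show ?thesis using z t L by (simp add: chi_def cut_def cut1_def cut2_def le_divide_eq)
  next
    case False
    then have tL: "L < t" by simp
    have t1: "t > 1" using tL L by simp
    define u where "u = L ^ 4 / t ^ 4"
    have u: "0 \<le> u" "u \<le> 1" using tL L t by (auto simp: u_def divide_le_eq_1 power_mono)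
    have wu: "cutw L t = 1 - u" using u by (simp add: cutw_def u_def)
    have q: "(1 + t)^2 \<le> 4 * t^2" using t1 power_mono[of "1 + t" "2 * t" 2] by (simp add: power_mult_distrib)
    have "1 - (1 - u) ^ 3 \<le> 3 * u"
    proof -
      have "u * (u * u) \<le> u * (u * 3)" using u by (intro mult_left_mono) auto
      then show ?thesis by (simp add: power3_eq_cube algebra_simps)
    qed
    then have chi: "chi L t \<le> 3 * L ^ 4 / t ^ 4" by (simp add: chi_def cut_def wu) (simp add: u_def)
    have A: "a / t ^ 4 \<le> 4 * a / (1 + t)^2" "a / t ^ 3 \<le> 4 * a / (1 + t)^2" "a / t ^ 5 \<le> 4 * a / (1 + t)^2" if "a \<ge> 0" for a
    proof -
      have "a / t^2 \<le> 4 * a / (1 + t)^2" using mult_left_mono[OF q that] t by (simp add: field_simps)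
      moreover have "a / t ^ n \<le> a / t^2" if "n \<ge> 2" for n using t1 \<open>a \<ge> 0\<close> that by (intro divide_left_mono power_increasing) auto
      from this[of 4] this[of 3] this[of 5] have "a / t ^ 4 \<le> a / t^2" "a / t ^ 3 \<le> a / t^2" "a / t ^ 5 \<le> a / t^2" by auto
      ultimately show "a / t ^ 4 \<le> 4 * a / (1 + t)^2" "a / t ^ 3 \<le> 4 * a / (1 + t)^2" "a / t ^ 5 \<le> 4 * a / (1 + t)^2" by linarith+
    qed
    have Lp: "0 \<le> L ^ 4" by simp
    have "chi L t \<le> 4 * (3 * L ^ 4) / (1 + t)^2" using chi A(1)[of "3 * L ^ 4"] by simp
    also have "... \<le> 16 * L ^ 4 / (1 + t)^2" by (intro divide_right_mono) auto
    finally have 1: "chi L t \<le> 16 * L ^ 4 / (1 + t)^2" .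
    have "chi L t * t \<le> 3 * L ^ 4 / t ^ 4 * t" using chi t by (intro mult_right_mono) auto
    also have "... = 3 * L ^ 4 / t ^ 3" using t by (simp add: power_numeral_reduce)
    also have "... \<le> 4 * (3 * L ^ 4) / (1 + t)^2" by (rule A(2)) simp
    also have "... \<le> 16 * L ^ 4 / (1 + t)^2" by (intro divide_right_mono) auto
    finally have 2: "chi L t * t \<le> 16 * L ^ 4 / (1 + t)^2" .
    have w2: "(cutw L t)^2 \<le> 1" using w by (simp add: power_le_one)
    have "cut1 L t \<le> 12 * L ^ 4 * 1 / t ^ 5" unfolding cut1_def using w2 t by (intro divide_right_mono mult_left_mono) auto
    also have "... \<le> 4 * (12 * L ^ 4) / (1 + t)^2" using A(3)[of "12 * L ^ 4"] by simp
    finally have 3: "cut1 L t \<le> 48 * L ^ 4 / (1 + t)^2" by simp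
    have "\<bar>cut2 L t\<bar> \<le> 12 * L ^ 4 * (\<bar>8 * L ^ 4 * cutw L t / t ^ 10\<bar> + \<bar>5 * (cutw L t)^2 / t ^ 6\<bar>)"
    proof -
      have "\<bar>cut2 L t\<bar> = 12 * L ^ 4 * \<bar>8 * L ^ 4 * cutw L t / t ^ 10 - 5 * (cutw L t)^2 / t ^ 6\<bar>"
        unfolding cut2_def abs_mult by simp
      also have "... \<le> 12 * L ^ 4 * (\<bar>8 * L ^ 4 * cutw L t / t ^ 10\<bar> + \<bar>5 * (cutw L t)^2 / t ^ 6\<bar>)"
        by (rule mult_left_mono[OF abs_triangle_ineq4]) simp
      finally show ?thesis .
    qed
    also have "\<bar>8 * L ^ 4 * cutw L t / t ^ 10\<bar> = 8 * u * cutw L t / t ^ 6"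
      using w t L by (simp add: u_def abs_mult power_numeral_reduce)
    also have "... \<le> 8 * 1 * 1 / t ^ 6" using w u t by (intro divide_right_mono mult_mono) auto
    also have "\<bar>5 * (cutw L t)^2 / t ^ 6\<bar> \<le> 5 * 1 / t ^ 6" using w2 t by (simp add: divide_right_mono)
    finally have "\<bar>cut2 L t\<bar> \<le> 12 * L ^ 4 * (8 * 1 * 1 / t ^ 6 + 5 * 1 / t ^ 6)" by (simp add: mult_left_mono)
    then have "\<bar>cut2 L t\<bar> * t \<le> 12 * L ^ 4 * (8 * 1 * 1 / t ^ 6 + 5 * 1 / t ^ 6) * t" using t by (intro mult_right_mono) auto
    also have "... = 156 * L ^ 4 / t ^ 5" using t by (simp add: power_numeral_reduce field_simps)
    also have "... \<le> 4 * (156 * L ^ 4) / (1 + t)^2" by (rule A(3)) simp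
    finally show ?thesis using 1 2 3 t by simp
  qed
  then show "chi L t \<le> 16 * L ^ 4 / ja t^2" "chi L t * t \<le> 16 * L ^ 4 / ja t^2"
    "cut1 L t \<le> 48 * L ^ 4 / ja t^2" "\<bar>cut2 L t\<bar> * t \<le> 624 * L ^ 4 / ja t^2" by auto
qed

lemma exp_vector_derivative:
  fixes c :: complex
  shows "((\<lambda>t. exp (c * of_real t)) has_vector_derivative c * exp (c * of_real t)) (at t)"
  by (rule has_vector_derivative_real_field[where f="\<lambda>z. exp (c * z)"]) (auto intro!: derivative_eq_intros)

lemma half_line_FTC:
  fixes F f :: "real \<Rightarrow> complex"
  assumes D: "\<And>t. t > a \<Longrightarrow> (F has_vector_derivative f t) (at t)" and C: "\<And>t. t > a \<Longrightarrow> isCont f t"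
    and i: "L1 (\<lambda>t. ind {a<..} t * f t)"
    and A: "(F \<longlongrightarrow> A) (at_right a)" and B: "(F \<longlongrightarrow> B) at_top"
  shows "(LBINT t. ind {a<..} t * f t) = B - A"
proof -
  have e: "einterval (ereal a) \<infinity> = {a<..}" by (auto simp: einterval_def)
  have "(LBINT t=a..\<infinity>. f t) = B - A"
  proof (rule interval_integral_FTC_integrable[where F=F])
    show "set_integrable lborel (einterval (ereal a) \<infinity>) f"
      using i unfolding e set_integrable_def by (simp add: scaleR_conv_of_real)
    show "((F \<circ> real_of_ereal) \<longlongrightarrow> A) (at_right (ereal a))" using A by (simp add: ereal_tendsto_simps)
    show "((F \<circ> real_of_ereal) \<longlongrightarrow> B) (at_left \<infinity>)" using B by (simp add: ereal_tendsto_simps)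
  qed (use D C in auto)
  then show ?thesis unfolding interval_lebesgue_integral_def e set_lebesgue_integral_def by (simp add: scaleR_conv_of_real)
qed

lemma inverse_square_tendsto:
  fixes F :: "real \<Rightarrow> complex"
  assumes "\<And>t. t > a \<Longrightarrow> norm (F t) \<le> C / ja t^2"
  shows "(F \<longlongrightarrow> 0) at_top"
proof (rule Lim_null_comparison)
  show "\<forall>\<^sub>F t in at_top. norm (F t) \<le> C / ja t^2"
    using eventually_gt_at_top[of a] by eventually_elim (use assms in auto)
  show "((\<lambda>t::real. C / ja t^2) \<longlongrightarrow> 0) at_top" by real_asymp
qed

section \<open>The Fourier transform of the truncated kernel\<close>

definition kernel_hat :: "real \<Rightarrow> real \<Rightarrow> real \<Rightarrow> complex" where
  "kernel_hat L k s = - (LBINT t. (of_real (chi L t) * exp (\<i> * of_real k * of_real t)) * of_real (indicator {0<..} t * (sin (t * s) / s)))"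

lemma sin_over_le: "s > 0 \<Longrightarrow> t > 0 \<Longrightarrow> \<bar>sin (t * s) / s\<bar> \<le> t" for s t :: real
  using abs_sin_x_le_abs_x[of "t * s"] by (simp add: abs_mult field_simps)

text \<open>Two estimates are combined. Within distance 1 of the circle \<open>s = k\<close> the
  trivial bound of order \<open>1 / s\<close> is used, which exists thanks to the cutoff; farther
  away, integration by parts shows that \<open>k^2 - s^2\<close> times the integral stays
  bounded.\<close>

lemma kernel_hat_bound:
  assumes L: "L \<ge> 1" and k: "k \<ge> 2" and s: "s > 0"
  shows "norm (kernel_hat L k s) \<le> 3000 * L ^ 4 / (ja (k - s) * (k + s))"
proof -
  let ?S = "\<lambda>t. sin (t * s) / s" and ?C = "\<lambda>t. cos (t * s)"
  define E where "E t = exp (\<i> * of_real k * of_real t)" for t :: real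
  have nE: "norm (E t) = 1" for t by (simp add: E_def norm_exp_eq_Re)
  have [measurable]: "E \<in> borel_fun" unfolding E_def[abs_def] by measurable
  let ?m = "\<lambda>t. of_real (chi L t * ?S t) * E t"
  define I where "I = (LBINT t. ind {0<..} t * (?m t))"
  have K: "kernel_hat L k s = - I"
    unfolding kernel_hat_def I_def E_def by (intro arg_cong[where f=uminus] LB_cong refl) (simp add: mult_ac)
  have L4: "1 \<le> L ^ 4" using L by (simp add: one_le_power)
  have b0: "norm (ind {0<..} t * (?m t)) \<le> (16 * L ^ 4 / s) / ja t^2" for t
  proof (cases "t > 0")
    case True
    have "norm (ind {0<..} t * (?m t)) = chi L t * (\<bar>sin (t * s)\<bar> / s)"
      using True chi_bounds(1)[OF L True] s by (simp add: norm_mult norm_divide nE abs_mult)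
    also have "... \<le> (16 * L ^ 4 / ja t^2) * (1 / s)"
      using chi_bounds(1,3)[OF L True] s by (intro mult_mono divide_right_mono) auto
    finally show ?thesis by (simp add: mult.commute)
  qed (use s in simp)
  have I1: "norm I \<le> 32 * L ^ 4 / s"
    using inverse_square_dominated(2)[OF _ b0] unfolding I_def by simp
  have iI: "L1 (\<lambda>t. ind {0<..} t * (?m t))"
    by (rule inverse_square_dominated(1)[OF _ b0]) simp
  define R where "R t = of_real (- cut2 L t * ?S t - 2 * cut1 L t * ?C t) * E t" for t
  have [measurable]: "R \<in> borel_fun" unfolding R_def[abs_def] by measurable
  have bR: "norm (ind {0<..} t * R t) \<le> (720 * L ^ 4) / ja t^2" for t
  proof (cases "t > 0")
    case True
    have "norm (ind {0<..} t * R t) = \<bar>- cut2 L t * ?S t - 2 * cut1 L t * ?C t\<bar>"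
      using True unfolding R_def norm_mult nE norm_of_real by simp
    also have "... \<le> \<bar>cut2 L t\<bar> * \<bar>sin (t * s) / s\<bar> + 2 * cut1 L t * \<bar>?C t\<bar>"
      using chi_bounds(5)[OF L True] by (auto intro!: order_trans[OF abs_triangle_ineq4] simp: abs_mult)
    also have "... \<le> \<bar>cut2 L t\<bar> * t + 2 * cut1 L t * 1"
      using chi_bounds(5)[OF L True] sin_over_le[OF s True] by (intro add_mono mult_left_mono) auto
    also have "... \<le> 624 * L ^ 4 / ja t^2 + 2 * (48 * L ^ 4 / ja t^2) * 1"
      using chi_bounds[OF L True] by (intro add_mono mult_mono) auto
    finally show ?thesis by simp
  qed simp
  have iR: "L1 (\<lambda>t. ind {0<..} t * R t)"
    by (rule inverse_square_dominated(1)[OF _ bR]) simp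
  have R1: "norm (LBINT t. ind {0<..} t * R t) \<le> 1440 * L ^ 4"
    using inverse_square_dominated(2)[OF _ bR] by simp
  \<comment> \<open>With \<open>g = chi * S\<close> this is \<open>(g' - i k g) E\<close>, whose
    derivative is \<open>(g'' + k^2 g) E\<close>. As \<open>S'' = - s^2 S\<close>, that equals
    \<open>(k^2 - s^2) g E\<close> plus the terms \<open>R\<close> in which the cutoff is
    differentiated.\<close>
  define F where "F t = (of_real (- cut1 L t * ?S t + chi L t * ?C t) - \<i> * of_real k * of_real (chi L t * ?S t)) * E t" for t
  define f where "f t = of_real (k^2 - s^2) * (?m t) + R t" for t
  have split: "ind {0<..} t * f t = of_real (k^2 - s^2) * (ind {0<..} t * (?m t)) + ind {0<..} t * R t" for t
    by (simp add: f_def algebra_simps)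
  \<comment> \<open>The boundary value 1 at the origin is the derivative of
    \<open>sin (t * s) / s\<close> at 0, where \<open>chi\<close> equals 1.\<close>
  have "(LBINT t. ind {0<..} t * f t) = 0 - 1"
  proof (rule half_line_FTC[where F=F])
    fix t :: real assume t: "t > 0"
    have sS': "((\<lambda>t. sin (t * s) / s) has_real_derivative ?C t) (at t)"
      using s by (auto intro!: derivative_eq_intros)
    have cS': "((\<lambda>t. ?C t) has_real_derivative - sin (t * s) * s) (at t)"
      by (auto intro!: derivative_eq_intros)
    have d1: "((\<lambda>t. - cut1 L t * ?S t + chi L t * ?C t) has_real_derivative
        (- cut2 L t * ?S t + - cut1 L t * ?C t) + (- cut1 L t * ?C t + chi L t * (- sin (t * s) * s))) (at t)"
      by (rule DERIV_cong[OF DERIV_add[OF DERIV_mult'[OF DERIV_minus[OF cut_DERIV(2)[OF t]] sS'] DERIV_mult'[OF cut_DERIV(3)[OF t] cS']]]) (simp add: algebra_simps)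
    have d2: "((\<lambda>t. chi L t * ?S t) has_real_derivative - cut1 L t * ?S t + chi L t * ?C t) (at t)"
      by (rule DERIV_cong[OF DERIV_mult'[OF cut_DERIV(3)[OF t] sS']]) (simp add: algebra_simps)
    note v1 = has_vector_derivative_of_real[OF d1]
    note v2 = has_vector_derivative_of_real[OF d2]
    have vE: "(E has_vector_derivative \<i> * of_real k * E t) (at t)"
      unfolding E_def[abs_def] by (rule exp_vector_derivative)
    have "(F has_vector_derivative
      (of_real (- cut1 L t * ?S t + chi L t * ?C t) - \<i> * of_real k * of_real (chi L t * ?S t)) * (\<i> * of_real k * E t) +
      (of_real ((- cut2 L t * ?S t + - cut1 L t * ?C t) + (- cut1 L t * ?C t + chi L t * (- sin (t * s) * s))) - \<i> * of_real k * of_real (- cut1 L t * ?S t + chi L t * ?C t)) * E t) (at t)"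
      unfolding F_def[abs_def]
      by (intro has_vector_derivative_mult has_vector_derivative_diff v1 vE has_vector_derivative_mult_right v2)
    moreover have "(of_real (- cut1 L t * ?S t + chi L t * ?C t) - \<i> * of_real k * of_real (chi L t * ?S t)) * (\<i> * of_real k * E t) +
      (of_real ((- cut2 L t * ?S t + - cut1 L t * ?C t) + (- cut1 L t * ?C t + chi L t * (- sin (t * s) * s))) - \<i> * of_real k * of_real (- cut1 L t * ?S t + chi L t * ?C t)) * E t = f t"
    proof -
      define a b c S where "a = complex_of_real (cut2 L t)" and "b = complex_of_real (cut1 L t)" and "c = complex_of_real (chi L t)" and "S = complex_of_real (?S t)"
      define Co where "Co = complex_of_real (?C t)"
      have ss: "sin (t * s) * s = s^2 * ?S t" using s by (simp add: power2_eq_square)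
      have sS: "complex_of_real (- sin (t * s) * s) = - (of_real s)\<^sup>2 * S" unfolding S_def using ss by (metis of_real_minus of_real_mult of_real_power mult_minus_left)
      show ?thesis unfolding f_def R_def of_real_add of_real_mult of_real_diff of_real_minus sS[unfolded of_real_mult of_real_minus] a_def[symmetric] b_def[symmetric] c_def[symmetric] S_def[symmetric] Co_def[symmetric] of_real_power
        by (simp add: algebra_simps power2_eq_square)
    qed
    ultimately show "(F has_vector_derivative f t) (at t)" by simp
    have "continuous (at t) (cut1 L)" "continuous (at t) (chi L)" by (auto intro: DERIV_isCont cut_DERIV[OF t])
    moreover have "continuous (at t) (cutw L)" unfolding cutw_def[abs_def] using t by (intro continuous_intros) auto
    then have "continuous (at t) (cut2 L)" unfolding cut2_def[abs_def] using t by (intro continuous_intros) auto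
    ultimately show "isCont f t" unfolding f_def[abs_def] R_def E_def using s by (intro continuous_intros) auto
  next
    show "L1 (\<lambda>t. ind {0<..} t * f t)"
      unfolding split by (rule L1_add[OF integrable_mult_right[OF iI] iR])
  next
    have "((\<lambda>t. (of_real (?C t) - \<i> * of_real k * of_real (?S t)) * E t) \<longlongrightarrow> (of_real (cos (0 * s)) - \<i> * of_real k * of_real (sin (0 * s) / s)) * exp (\<i> * of_real k * of_real 0)) (at_right 0)"
      unfolding E_def using s by (intro tendsto_intros) auto
    moreover have "\<forall>\<^sub>F t in at_right 0. (of_real (?C t) - \<i> * of_real k * of_real (?S t)) * E t = F t"
    proof -
      have "\<forall>\<^sub>F t in at_right 0. t \<in> {0<..<L}" using L by (intro eventually_at_right_real) auto
      then show ?thesis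
      proof eventually_elim
        case (elim t) then show ?case using cut_zero[of t L] by (simp add: F_def chi_def cut_def cut1_def)
      qed
    qed
    ultimately show "(F \<longlongrightarrow> 1) (at_right 0)" by (simp add: tendsto_cong)
  next
    show "(F \<longlongrightarrow> 0) at_top"
    proof (rule inverse_square_tendsto[of 0 _ "48 * L ^ 4 / s + 16 * L ^ 4 + k * (16 * L ^ 4 / s)"])
      fix t :: real assume t: "t > 0"
      note cb = chi_bounds[OF L t]
      have "norm (F t) \<le> \<bar>- cut1 L t * ?S t + chi L t * ?C t\<bar> + k * \<bar>chi L t * ?S t\<bar>"
        unfolding F_def norm_mult nE mult_1_right
        by (rule order_trans[OF norm_triangle_ineq4]) (use k in \<open>simp only: norm_of_real norm_mult norm_ii mult_1_left abs_of_nonneg\<close>)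
      also have "... \<le> (cut1 L t * (1 / s) + chi L t * 1) + k * (chi L t * (1 / s))"
      proof (intro add_mono mult_left_mono)
        have "\<bar>- cut1 L t * ?S t\<bar> \<le> cut1 L t * (1 / s)" "\<bar>chi L t * ?C t\<bar> \<le> chi L t * 1"
          "\<bar>chi L t * ?S t\<bar> \<le> chi L t * (1 / s)"
        proof -
          have sc: "\<bar>sin (t * s) / s\<bar> \<le> 1 / s" "\<bar>?C t\<bar> \<le> 1" using s by (auto simp: abs_divide divide_right_mono)
          show "\<bar>- cut1 L t * ?S t\<bar> \<le> cut1 L t * (1 / s)"
            unfolding abs_mult abs_minus using mult_left_mono[OF sc(1) cb(5)] cb(5) by (simp only: abs_of_nonneg)
          show "\<bar>chi L t * ?C t\<bar> \<le> chi L t * 1"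
            unfolding abs_mult using mult_left_mono[OF sc(2) cb(1)] cb(1) by (simp only: abs_of_nonneg)
          show "\<bar>chi L t * ?S t\<bar> \<le> chi L t * (1 / s)"
            unfolding abs_mult using mult_left_mono[OF sc(1) cb(1)] cb(1) by (simp only: abs_of_nonneg)
        qed
        then show "\<bar>- cut1 L t * ?S t + chi L t * ?C t\<bar> \<le> cut1 L t * (1 / s) + chi L t * 1"
          "\<bar>chi L t * ?S t\<bar> \<le> chi L t * (1 / s)" by linarith+
      qed (use k in auto)
      also have "... \<le> (48 * L ^ 4 / ja t^2 * (1 / s) + 16 * L ^ 4 / ja t^2 * 1) + k * (16 * L ^ 4 / ja t^2 * (1 / s))"
        using cb s k by (intro add_mono mult_left_mono mult_right_mono) auto
      also have "... = (48 * L ^ 4 / s + 16 * L ^ 4 + k * (16 * L ^ 4 / s)) / ja t^2"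
        by (simp add: add_divide_distrib mult.commute)
      finally show "norm (F t) \<le> (48 * L ^ 4 / s + 16 * L ^ 4 + k * (16 * L ^ 4 / s)) / ja t^2" .
    qed
  qed
  moreover have "(LBINT t. ind {0<..} t * f t) = of_real (k^2 - s^2) * I + (LBINT t. ind {0<..} t * R t)"
    unfolding split I_def by (subst LB_add[OF integrable_mult_right[OF iI] iR], simp only: integral_mult_right_zero)
  ultimately have "of_real (k^2 - s^2) * I = - 1 - (LBINT t. ind {0<..} t * R t)"
    by (simp add: eq_diff_eq)
  then have "norm (of_real (k^2 - s^2) * I) \<le> norm (- 1 :: complex) + norm (LBINT t. ind {0<..} t * R t)"
    by (simp only: norm_triangle_ineq4)
  also have "... \<le> 1 + 1440 * L ^ 4" using R1 by simp
  finally have I2: "\<bar>k^2 - s^2\<bar> * norm I \<le> 1441 * L ^ 4" using L4 by (simp only: norm_mult norm_of_real)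
  have D0: "ja (k - s) * (k + s) > 0" using k s by (intro mult_pos_pos) auto
  have "norm I * (ja (k - s) * (k + s)) \<le> 3000 * L ^ 4"
  proof (cases "\<bar>k - s\<bar> \<ge> 1")
    case True
    have "ja (k - s) * (k + s) \<le> (2 * \<bar>k - s\<bar>) * (k + s)" using True k s by (intro mult_right_mono) auto
    also have "... = 2 * \<bar>k^2 - s^2\<bar>"
    proof -
      have "k^2 - s^2 = (k - s) * (k + s)" by (simp add: power2_eq_square algebra_simps)
      then show ?thesis using k s by (simp add: abs_mult)
    qed
    finally have "norm I * (ja (k - s) * (k + s)) \<le> norm I * (2 * \<bar>k^2 - s^2\<bar>)" by (intro mult_left_mono) auto
    then show ?thesis using I2 L4 by (simp add: mult.commute)
  next
    case False
    \<comment> \<open>Here \<open>s > 1\<close>, because \<open>k\<close> is at least 2.\<close>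
    then have "1 + \<bar>k - s\<bar> \<le> 2" "k + s \<le> 3 * s" using k by auto
    then have "ja (k - s) * (k + s) \<le> 2 * (3 * s)" using k s by (intro mult_mono) auto
    then have "norm I * (ja (k - s) * (k + s)) \<le> (32 * L ^ 4 / s) * (2 * (3 * s))"
      by (rule mult_mono[OF I1 _ _ less_imp_le[OF D0]]) (use s in auto)
    also have "... \<le> 3000 * L ^ 4" using s L4 by simp
    finally show ?thesis .
  qed
  then show ?thesis unfolding K using D0 by (simp add: pos_le_divide_eq)
qed

lemma ennreal_lin: "0 \<le> x \<Longrightarrow> 0 \<le> a \<Longrightarrow> 0 \<le> y \<Longrightarrow> 0 \<le> b \<Longrightarrow> en x * en a + en y * en b = en (x * a + y * b)"
  by (simp add: ennreal_mult ennreal_plus)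

section \<open>Pointwise decay of the truncated kernel\<close>

lemma nn_integral_inverse_sqrt:
  assumes ab: "a < b"
  shows "(NN t. en (indicator {a<..<b} t * (1 / sqrt (t - a)))) = en (2 * sqrt (b - a))"
proof -
  have D: "((\<lambda>t. 2 * sqrt (t - a)) has_real_derivative 1 / sqrt (t - a)) (at t)"
    and C: "isCont (\<lambda>t. 1 / sqrt (t - a)) t" if "ereal a < ereal t" "ereal t < ereal b" for t
    using that by (auto intro!: derivative_eq_intros continuous_intros simp: field_simps)
  have N: "AE t in lborel. ereal a < ereal t \<longrightarrow> ereal t < ereal b \<longrightarrow> 0 \<le> 1 / sqrt (t - a)" by auto
  have L: "(((\<lambda>t. 2 * sqrt (t - a)) \<circ> real_of_ereal) \<longlongrightarrow> 2 * sqrt (a - a)) (at_right (ereal a))"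
     "(((\<lambda>t. 2 * sqrt (t - a)) \<circ> real_of_ereal) \<longlongrightarrow> 2 * sqrt (b - a)) (at_left (ereal b))"
    unfolding ereal_tendsto_simps by (intro tendsto_intros)+
  have lt: "ereal a < ereal b" using ab by simp
  note * = interval_integral_FTC_nonneg[OF lt D C N L]
  have e: "einterval (ereal a) (ereal b) = {a<..<b}" by (auto simp: einterval_def)
  have i: "L1 (\<lambda>t. indicator {a<..<b} t * (1 / sqrt (t - a)))"
    using *(1) unfolding e set_integrable_def by simp
  have v: "(LBINT t. indicator {a<..<b} t * (1 / sqrt (t - a))) = 2 * sqrt (b - a)"
    using *(2) ab unfolding interval_lebesgue_integral_def e set_lebesgue_integral_def by simp
  show ?thesis unfolding v[symmetric]
    by (rule nn_integral_eq_integral[OF i]) (auto simp: indicator_def)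
qed

lemma wk_le:
  assumes r: "r > 0" and t: "r < t"
  shows "wk t r \<le> 1 / sqrt (2 * r) * (1 / sqrt (t - r))"
proof -
  have "(2 * r) * (t - r) \<le> (t + r) * (t - r)" using r t by (intro mult_right_mono) auto
  also have "... = t^2 - r^2" by (simp add: power2_eq_square algebra_simps)
  finally have "sqrt (2 * r) * sqrt (t - r) \<le> sqrt (t^2 - r^2)" by (simp add: real_sqrt_mult[symmetric])
  moreover have "0 < sqrt (2 * r) * sqrt (t - r)" using r t by simp
  ultimately have "1 / sqrt (t^2 - r^2) \<le> 1 / (sqrt (2 * r) * sqrt (t - r))" by (intro frac_le) auto
  then show ?thesis using t by (simp add: wk_def)
qed

text \<open>Within distance 1 of the wave front \<open>t = r\<close> only the root singularity
  counts; farther out \<open>wk t r\<close> is at most \<open>1 / sqrt (2 * r)\<close> and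
  \<open>chi\<close> is integrable. The constant 34 is \<open>2 + 16 * 2\<close>.\<close>

lemma chi_wk_integrable:
  assumes L: "L \<ge> 1" and r: "r > 0"
  shows "L1 (\<lambda>t. chi L t * wk t r)" "(LBINT t. chi L t * wk t r) \<le> 34 * L ^ 4 / sqrt (2 * r)"
    "0 \<le> chi L t * wk t r"
proof -
  have nonneg: "0 \<le> chi L t * wk t r" for t
    using chi_bounds(1)[OF L, of t] wk_nonneg[of r t] r by (cases "t > r") (auto simp: wk_def)
  then show "0 \<le> chi L t * wk t r" .
  let ?c = "1 / sqrt (2 * r)"
  have L4: "1 \<le> L ^ 4" using L by (simp add: one_le_power)
  have le: "chi L t * wk t r \<le> ?c * (indicator {r<..<r+1} t * (1 / sqrt (t - r))) + ?c * (16 * L ^ 4 * ja t powr - 2)" for t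
  proof (cases "t > r")
    case False then show ?thesis using r by (auto simp: wk_def intro!: add_nonneg_nonneg)
  next
    case True
    have cb: "0 \<le> chi L t" "chi L t \<le> 1" "chi L t \<le> 16 * L ^ 4 * ja t powr - 2"
      using chi_bounds(1,2,3)[OF L, of t] True r by (auto simp: powr_minus powr_numeral divide_inverse)
    show ?thesis
    proof (cases "t < r + 1")
      case T: True
      have "chi L t * wk t r \<le> 1 * (?c * (1 / sqrt (t - r)))" using cb wk_le[OF r True] r True by (intro mult_mono) (auto simp: wk_nonneg)
      also have "... \<le> ?c * (indicator {r<..<r+1} t * (1 / sqrt (t - r))) + ?c * (16 * L ^ 4 * ja t powr - 2)"
        using T True r by simp
      finally show ?thesis .
    next
      case F: False
      have "wk t r \<le> ?c * (1 / sqrt (t - r))" by (rule wk_le[OF r True])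
      also have "... \<le> ?c * 1" using F r by (intro mult_left_mono) (auto simp: divide_le_eq_1)
      finally have "chi L t * wk t r \<le> (16 * L ^ 4 * ja t powr - 2) * (?c * 1)"
        using cb wk_nonneg[of r t] r by (intro mult_mono) auto
      then show ?thesis using F by (simp add: mult_ac)
    qed
  qed
  have nn: "(NN t. en (chi L t * wk t r)) \<le> en (34 * L ^ 4 / sqrt (2 * r))"
  proof -
    have "(NN t. en (chi L t * wk t r)) \<le> (NN t. ennreal ?c * en (indicator {r<..<r+1} t * (1 / sqrt (t - r))) + en (?c * (16 * L ^ 4)) * en (ja t powr - 2))"
    proof (intro nn_integral_mono)
      fix t
      have "en (chi L t * wk t r) \<le> en (?c * (indicator {r<..<r+1} t * (1 / sqrt (t - r)))) + en (?c * (16 * L ^ 4 * ja t powr - 2))"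
        by (rule ennreal_le_plus[OF le]) (use r in \<open>auto simp: indicator_def\<close>)
      then show "en (chi L t * wk t r) \<le> ennreal ?c * en (indicator {r<..<r+1} t * (1 / sqrt (t - r))) + en (?c * (16 * L ^ 4)) * en (ja t powr - 2)"
        using r by (simp add: ennreal_mult[symmetric] indicator_def mult.assoc)
    qed
    also have "... = ennreal ?c * en (2 * sqrt ((r + 1) - r)) + en (?c * (16 * L ^ 4)) * (NN t. en (ja t powr - 2))"
      by (subst nn_integral_add) (auto simp: nn_integral_cmult nn_integral_inverse_sqrt[of r "r + 1", simplified])
    also have "... \<le> ennreal ?c * en (2 * sqrt ((r + 1) - r)) + en (?c * (16 * L ^ 4)) * en (2 / (2 - 1))"
      by (intro add_left_mono mult_left_mono nn_integral_one_plus_powr) auto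
    also have "... = en (?c * (2 * sqrt ((r + 1) - r)) + ?c * (16 * L ^ 4) * (2 / (2 - 1)))"
      using r by (intro ennreal_lin) auto
    also have "... \<le> en (34 * L ^ 4 / sqrt (2 * r))"
      using r L4 by (intro ennreal_leI) (simp add: field_simps)
    finally show ?thesis .
  qed
  show i: "L1 (\<lambda>t. chi L t * wk t r)"
    by (rule integrableI_bounded) (use nn nonneg in \<open>auto intro: le_less_trans\<close>)
  show "(LBINT t. chi L t * wk t r) \<le> 34 * L ^ 4 / sqrt (2 * r)"
    using nn nonneg r L4 by (subst (asm) nn_integral_eq_integral[OF i]) (auto simp: ennreal_le_iff)
qed

text \<open>The truncated outgoing kernel at real frequency \<open>k\<close>: its time integral is
  damped from \<open>L\<close> on.\<close>

definition Gam :: "real \<Rightarrow> real \<Rightarrow> cfun" where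
  "Gam L k = wave (\<lambda>t. of_real (chi L t) * exp (\<i> * of_real k * of_real t))"

lemma Gam_facts:
  assumes L: "L \<ge> 1"
  shows "L1 (Gam L k)" "\<xi> \<noteq> 0 \<Longrightarrow> fourier (Gam L k) \<xi> = kernel_hat L k (norm \<xi>)"
proof -
  have i: "L1 (\<lambda>t. norm (of_real (chi L t) * exp (\<i> * of_real k * of_real t) :: complex) * max 0 t)"
  proof (rule inverse_square_dominated(1))
    fix t :: real
    show "norm (norm (of_real (chi L t) * exp (\<i> * of_real k * of_real t) :: complex) * max 0 t) \<le> (16 * L ^ 4) / ja t^2"
      using chi_bounds(1,4)[OF L, of t] by (cases "t > 0") (auto simp: norm_mult)
  qed simp
  show "L1 (Gam L k)" unfolding Gam_def by (rule wave_facts(1)[OF _ i]) simp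
  show "fourier (Gam L k) \<xi> = kernel_hat L k (norm \<xi>)" if "\<xi> \<noteq> 0"
    unfolding Gam_def kernel_hat_def by (rule wave_facts(2)[OF _ i that]) simp
qed

text \<open>The true size of the outgoing kernel at high frequency, with a constant independent of
  \<open>L\<close>. Up to the distance \<open>1 / k\<close> behind the wave front the root
  singularity is integrated directly; from there on one integration by parts gains
  \<open>1 / k\<close>, and since the amplitude \<open>P\<close> decreases, its variation is just
  \<open>P b\<close>.\<close>

lemma Gam_decay:
  assumes L: "L \<ge> 1" and k: "k \<ge> 1" and x: "x \<noteq> 0"
  shows "norm (Gam L k x) \<le> 1 / sqrt (k * norm x)"
proof -
  define r where "r = norm x"
  have r: "r > 0" using x by (simp add: r_def)
  define b where "b = r + 1 / k"
  have b: "b > r" "b > 0" using k r by (auto simp: b_def add_pos_pos)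
  define E where "E t = exp (\<i> * of_real k * of_real t)" for t :: real
  have nE: "norm (E t) = 1" for t by (simp add: E_def norm_exp_eq_Re)
  let ?w = "\<lambda>t. of_real (chi L t) * E t * of_real (wk t r)"
  let ?int = "\<lambda>A t. ind A t * ?w t"
  have [measurable]: "E \<in> borel_fun" unfolding E_def[abs_def] by measurable
  define P where "P t = chi L t / sqrt (t^2 - r^2)" for t
  define Q where "Q t = cut1 L t / sqrt (t^2 - r^2) + chi L t * t / (sqrt (t^2 - r^2)) ^ 3" for t
  let ?p = "\<lambda>t. ind {b<..} t * (of_real (P t) * E t)" and ?q = "\<lambda>t. ind {b<..} t * (of_real (Q t) * E t)"
  have pos: "t^2 - r^2 > 0" if "t \<ge> b" for t using that b r power_strict_mono[of r t 2] by auto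
  have sb: "1 / sqrt (b^2 - r^2) \<le> sqrt (k / (2 * r))"
  proof -
    have "b^2 - r^2 = 2 * r / k + 1 / k^2" using k by (simp add: b_def power2_eq_square field_simps)
    then have "2 * r / k \<le> b^2 - r^2" using k by simp
    then have "sqrt (2 * r / k) \<le> sqrt (b^2 - r^2)" by simp
    then have "1 / sqrt (b^2 - r^2) \<le> 1 / sqrt (2 * r / k)" using r k by (intro frac_le) auto
    also have "... = sqrt (k / (2 * r))" using r k by (simp add: real_sqrt_divide)
    finally show ?thesis .
  qed
  have sle: "1 / sqrt (t^2 - r^2) \<le> 1 / sqrt (b^2 - r^2)" if "t > b" for t
    using pos[of b] pos[of t] that b by (intro divide_left_mono mult_pos_pos) (auto intro!: power_mono)
  have PQ0: "0 \<le> P t" "0 \<le> Q t" if "t > b" for t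
    using chi_bounds(1,5)[OF L, of t] pos[of t] that b by (auto simp: P_def Q_def intro!: add_nonneg_nonneg divide_nonneg_pos mult_nonneg_nonneg)
  have Pd: "(P has_real_derivative - Q t) (at t)" if t: "t > b" for t
  proof -
    have t0: "t > 0" "t^2 - r^2 > 0" using t b pos[of t] by auto
    have "((\<lambda>t. sqrt (t^2 - r^2)) has_real_derivative t / sqrt (t^2 - r^2)) (at t)"
      using t0 by (auto intro!: derivative_eq_intros simp: field_simps)
    from DERIV_divide[OF cut_DERIV(3)[OF t0(1)] this]
    have D: "((\<lambda>t. chi L t / sqrt (t^2 - r^2)) has_real_derivative (- cut1 L t * sqrt (t^2 - r^2) - chi L t * (t / sqrt (t^2 - r^2))) / (sqrt (t^2 - r^2) * sqrt (t^2 - r^2))) (at t)"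
      using t0 by auto
    have gen: "(- c * S - x * (t / S)) / (S * S) = - (c / S + x * t / S ^ 3)" if "S > 0" for c x S t :: real
      using that by (simp add: field_simps power3_eq_cube)
    show ?thesis unfolding P_def[abs_def] Q_def using D by (simp only: gen[OF real_sqrt_gt_zero[OF t0(2)]])
  qed
  have Pb: "P t \<le> (16 * L ^ 4 * sqrt (k / (2 * r))) / ja t^2" if t: "t > b" for t
  proof -
    have "P t \<le> (16 * L ^ 4 / ja t^2) * sqrt (k / (2 * r))"
      unfolding P_def using chi_bounds(1,3)[OF L, of t] t b sle[OF t] sb pos[of t]
      by (subst divide_inverse, intro mult_mono) (auto simp: inverse_eq_divide)
    then show ?thesis by simp
  qed
  have P1: "P b \<le> sqrt (k / (2 * r))"
    unfolding P_def using chi_bounds(1,2)[OF L b(2)] sb pos[of b]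
    by (subst divide_inverse, intro order_trans[OF mult_left_le_one_le]) (auto simp: inverse_eq_divide)
  have contP: "isCont P t" if "t \<ge> b" for t
    unfolding P_def[abs_def] using DERIV_isCont[OF cut_DERIV(3)[of t L]] pos[OF that] that b by (intro continuous_intros) auto
  have contQ: "isCont Q t" if "t > b" for t
    unfolding Q_def[abs_def] using DERIV_isCont[OF cut_DERIV(3)[of t L]] DERIV_isCont[OF cut_DERIV(2)[of t L]] pos[of t] that b by (intro continuous_intros) auto
  have [measurable]: "P \<in> borel_fun" "Q \<in> borel_fun"
    unfolding P_def[abs_def] Q_def[abs_def] by measurable
  have limP: "((\<lambda>t. complex_of_real (P t)) \<longlongrightarrow> 0) at_top"
    using Pb PQ0(1) by (intro inverse_square_tendsto[of b _ "16 * L ^ 4 * sqrt (k / (2 * r))"]) auto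
  then have limP': "(P \<longlongrightarrow> 0) at_top" by (simp add: tendsto_of_real_iff[where 'a=complex, of P 0, simplified])
  \<comment> \<open>\<open>Q\<close> is nonnegative with antiderivative \<open>- P\<close>, so its
    integral is \<open>P b\<close> however large it is near the wave front.\<close>
  have Qint: "L1 (\<lambda>t. indicator {b<..} t * Q t)" "(LBINT t. indicator {b<..} t * Q t) = P b"
  proof -
    have lt: "ereal b < \<infinity>" by simp
    have D: "DERIV (\<lambda>t. - P t) t :> Q t" if "ereal b < ereal t" "ereal t < \<infinity>" for t
      using DERIV_minus[OF Pd[of t]] that by simp
    have C: "isCont Q t" if "ereal b < ereal t" "ereal t < \<infinity>" for t using contQ that by simp
    have N: "AE t in lborel. ereal b < ereal t \<longrightarrow> ereal t < \<infinity> \<longrightarrow> 0 \<le> Q t" using PQ0 by auto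
    have A: "(((\<lambda>t. - P t) \<circ> real_of_ereal) \<longlongrightarrow> - P b) (at_right (ereal b))"
      unfolding ereal_tendsto_simps using contP[of b] by (intro tendsto_minus) (simp add: continuous_within filterlim_at_split)
    have B: "(((\<lambda>t. - P t) \<circ> real_of_ereal) \<longlongrightarrow> - 0) (at_left \<infinity>)"
      unfolding ereal_tendsto_simps by (intro tendsto_minus limP')
    note * = interval_integral_FTC_nonneg[OF lt D C N A B]
    have e: "einterval (ereal b) \<infinity> = {b<..}" by (auto simp: einterval_def)
    show "L1 (\<lambda>t. indicator {b<..} t * Q t)" using *(1) unfolding e set_integrable_def by simp
    show "(LBINT t. indicator {b<..} t * Q t) = P b"
      using *(2) unfolding interval_lebesgue_integral_def e set_lebesgue_integral_def by simp
  qed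
  let ?ik = "\<i> * of_real k :: complex"
  have iPE: "L1 (\<lambda>t. ?p t)"
    by (rule inverse_square_dominated(1)[where C="16 * L ^ 4 * sqrt (k / (2 * r))"])
       (use Pb PQ0(1) r k in \<open>auto simp: norm_mult nE indicator_def\<close>)
  have iQE: "L1 (\<lambda>t. ?q t)"
    by (rule L1_bound[OF Qint(1)]) (auto simp: norm_mult nE)
  have QE: "norm (LBINT t. ?q t) \<le> P b"
    unfolding Qint(2)[symmetric]
    by (rule norm_integral_le_dominated[OF Qint(1)]) (use PQ0(2) in \<open>auto simp: norm_mult nE indicator_def\<close>)
  have FTC: "(LBINT t. ind {b<..} t * (of_real (P t) * E t - of_real (Q t) * E t / ?ik)) = 0 - of_real (P b) * E b / ?ik"
  proof (rule half_line_FTC[where F="\<lambda>t. of_real (P t) * E t / ?ik"])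
    fix t assume t: "t > b"
    note v = has_vector_derivative_of_real[OF Pd[OF t]]
    have vE: "(E has_vector_derivative ?ik * E t) (at t)"
      unfolding E_def[abs_def] by (rule exp_vector_derivative)
    have "((\<lambda>t. of_real (P t) * E t / ?ik) has_vector_derivative (of_real (P t) * (?ik * E t) + of_real (- Q t) * E t) / ?ik) (at t)"
      by (rule has_vector_derivative_divide[OF has_vector_derivative_mult[OF v vE]])
    then show "((\<lambda>t. of_real (P t) * E t / ?ik) has_vector_derivative of_real (P t) * E t - of_real (Q t) * E t / ?ik) (at t)"
      using k by (simp add: add_divide_distrib diff_divide_distrib)
    show "isCont (\<lambda>t. of_real (P t) * E t - of_real (Q t) * E t / ?ik) t"
      using contP[of t] contQ[OF t] t k unfolding E_def by (intro continuous_intros) auto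
  next
    show "L1 (\<lambda>t. ind {b<..} t * (of_real (P t) * E t - of_real (Q t) * E t / ?ik))"
      using L1_diff[OF iPE integrable_divide_zero[OF iQE, of ?ik]] by (simp add: right_diff_distrib)
    have "isCont (\<lambda>t. of_real (P t) * E t / ?ik) b" using contP[of b] k unfolding E_def by (intro continuous_intros) auto
    then show "((\<lambda>t. of_real (P t) * E t / ?ik) \<longlongrightarrow> of_real (P b) * E b / ?ik) (at_right b)"
      by (simp add: continuous_within filterlim_at_split)
    show "((\<lambda>t. of_real (P t) * E t / ?ik) \<longlongrightarrow> 0) at_top"
    proof (rule tendsto_divide_zero, rule tendsto_norm_zero_cancel)
      show "((\<lambda>t. norm (of_real (P t) * E t)) \<longlongrightarrow> 0) at_top"
        using tendsto_norm_zero[OF limP] by (simp add: norm_mult nE)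
    qed
  qed
  have PE: "norm (LBINT t. ?p t) \<le> 2 * P b / k"
  proof -
    have "(LBINT t. ind {b<..} t * (of_real (P t) * E t - of_real (Q t) * E t / ?ik)) =
       (LBINT t. ?p t) - (LBINT t. ?q t) / ?ik"
      using LB_diff[OF iPE integrable_divide_zero[OF iQE, of ?ik]] by (simp add: right_diff_distrib)
    with FTC have "(LBINT t. ?p t) = (LBINT t. ?q t) / ?ik - of_real (P b) * E b / ?ik"
      by (simp add: algebra_simps)
    also have "norm ... \<le> norm (LBINT t. ?q t) / k + P b / k"
      using k PQ0 chi_bounds(1)[OF L b(2)] pos[of b] by (intro order_trans[OF norm_triangle_ineq4]) (auto simp: norm_divide norm_mult nE P_def)
    also have "... \<le> P b / k + P b / k" using QE k by (intro add_mono divide_right_mono) auto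
    finally show ?thesis by simp
  qed
  have near: "norm (LBINT t. ?int {..b} t) \<le> 2 / sqrt (2 * r * k)"
  proof -
    have "en (norm (LBINT t. ?int {..b} t)) \<le> (NN t. en (norm (?int {..b} t)))"
      by (rule norm_integral_le_nn_integral)
    also have "... \<le> (NN t. en (1 / sqrt (2 * r)) * en (indicator {r<..<b} t * (1 / sqrt (t - r))))"
    proof (intro nn_integral_mono_AE)
      have "AE t in lborel. t \<noteq> b" by (rule AE_lborel_singleton)
      then show "AE t in lborel. en (norm (?int {..b} t)) \<le> en (1 / sqrt (2 * r)) * en (indicator {r<..<b} t * (1 / sqrt (t - r)))"
      proof eventually_elim
        fix t assume tb: "t \<noteq> b"
        show "en (norm (?int {..b} t)) \<le> en (1 / sqrt (2 * r)) * en (indicator {r<..<b} t * (1 / sqrt (t - r)))"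
        proof (cases "t \<in> {r<..<b}")
          case True
          have "chi L t * wk t r \<le> 1 * (1 / sqrt (2 * r) * (1 / sqrt (t - r)))"
            using chi_bounds(1,2)[OF L, of t] wk_le[OF r, of t] True r wk_nonneg[of r t] by (intro mult_mono) auto
          then show ?thesis using True r chi_bounds(1)[OF L, of t] wk_nonneg[of r t]
            by (simp add: norm_mult nE ennreal_mult[symmetric] ennreal_leI abs_of_nonneg)
        next
          case False
          then have "wk t r = 0 \<or> t > b" using tb by (auto simp: wk_def)
          then show ?thesis by (auto simp: indicator_def)
        qed
      qed
    qed
    also have "... = en (1 / sqrt (2 * r)) * en (2 * sqrt (b - r))"
      by (subst nn_integral_cmult, measurable, subst nn_integral_inverse_sqrt[OF b(1)], rule refl)
    also have "... = en (2 / sqrt (2 * r * k))"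
      using r k by (simp add: ennreal_mult[symmetric] b_def real_sqrt_divide real_sqrt_mult)
    finally show ?thesis using r k by (simp add: ennreal_le_iff)
  qed
  have I0: "L1 (\<lambda>t. ?w t)"
    by (rule L1_bound[OF chi_wk_integrable(1)[OF L r]]) (auto simp: norm_mult nE abs_mult)
  have i12: "L1 (\<lambda>t. ?int A t)" if [measurable]: "A \<in> sets borel" for A
    by (rule L1_bound[OF I0]) (auto simp: norm_mult indicator_def)
  have "(LBINT t. ?w t) =
     (LBINT t. ?int {..b} t + ?int {b<..} t)"
    by (intro LB_cong refl) (auto simp: indicator_def)
  also have "... = (LBINT t. ?int {..b} t) + (LBINT t. ?int {b<..} t)"
    by (intro LB_add i12) auto
  also have "(LBINT t. ?int {b<..} t) = (LBINT t. ?p t)"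
    using b by (intro LB_cong refl) (auto simp: indicator_def P_def wk_def)
  finally have "norm (LBINT t. ?w t) \<le>
      norm (LBINT t. ?int {..b} t) + norm (LBINT t. ?p t)"
    by (simp only: norm_triangle_ineq)
  with near PE have tot: "norm (LBINT t. ?w t) \<le> 2 / sqrt (2 * r * k) + 2 * P b / k"
    by linarith
  have "2 * P b / k \<le> 2 * sqrt (k / (2 * r)) / k" using P1 k by (intro divide_right_mono) auto
  also have "... = 2 / sqrt (2 * r * k)"
  proof -
    have "k / (2 * r) = k^2 / (2 * r * k)" using r k by (simp add: power2_eq_square)
    then have "sqrt (k / (2 * r)) = sqrt (k^2) / sqrt (2 * r * k)" by (simp only: real_sqrt_divide)
    also have "sqrt (k^2) = k" using k by simp
    finally show ?thesis using k by simp
  qed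
  finally have tot': "norm (LBINT t. ?w t) \<le> 4 / sqrt (2 * r * k)" using tot by simp
  have "norm (Gam L k x) = norm (LBINT t. ?w t) / (2 * pi)"
    by (simp add: Gam_def wave_def E_def r_def norm_mult norm_divide)
  also have "... \<le> (4 / sqrt (2 * r * k)) / (2 * pi)" using tot' by (intro divide_right_mono) auto
  also have "... \<le> (4 / sqrt (r * k)) / 4"
  proof (rule frac_le)
    have "r * k \<le> 2 * r * k" using r k by simp
    then show "4 / sqrt (2 * r * k) \<le> 4 / sqrt (r * k)" using r k by (intro frac_le real_sqrt_le_mono) auto
  qed (use r k pi_gt3 in auto)
  also have "... = 1 / sqrt (k * norm x)" unfolding r_def by (simp add: mult.commute[of k])
  finally show ?thesis .
qed

text \<open>\<open>h1\<close>, \<open>h2\<close>, \<open>h3\<close> and \<open>g1\<close>, \<open>g2\<close>, \<open>g3\<close> are the derivatives in \<open>t\<close> of \<open>h0\<close> and of \<open>1 / root2\<close>.\<close>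

definition root2 :: "real \<Rightarrow> real \<Rightarrow> real" where "root2 r t = sqrt (t^2 - r^2)"
definition cut3 :: "real \<Rightarrow> real \<Rightarrow> real" where
  "cut3 L t = 12 * L ^ 4 * (30 * (cutw L t)^2 / t ^ 7 - 120 * L ^ 4 * cutw L t / t ^ 11 + 32 * L ^ 8 / t ^ 15)"
definition g1 :: "real \<Rightarrow> real \<Rightarrow> real" where "g1 r t = - (t / root2 r t ^ 3)"
definition g2 :: "real \<Rightarrow> real \<Rightarrow> real" where "g2 r t = - (1 / root2 r t ^ 3) + 3 * t^2 / root2 r t ^ 5"
definition g3 :: "real \<Rightarrow> real \<Rightarrow> real" where "g3 r t = 9 * t / root2 r t ^ 5 - 15 * t ^ 3 / root2 r t ^ 7"
definition h0 where "h0 L r t = cut L t * (1 / root2 r t)"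
definition h1 where "h1 L r t = cut1 L t * (1 / root2 r t) + cut L t * g1 r t"
definition h2 where "h2 L r t = cut2 L t * (1 / root2 r t) + 2 * cut1 L t * g1 r t + cut L t * g2 r t"
definition h3 where "h3 L r t = cut3 L t * (1 / root2 r t) + 3 * cut2 L t * g1 r t + 3 * cut1 L t * g2 r t + cut L t * g3 r t"

lemmas h_defs = h0_def h1_def h2_def h3_def root2_def g1_def g2_def g3_def cut_def cut1_def cut2_def cut3_def cutw_def

lemma h3_measurable [measurable (raw)]:
  assumes [measurable]: "L \<in> borel_measurable M" "r \<in> borel_measurable M" "t \<in> borel_measurable M"
  shows "(\<lambda>x. h3 (L x) (r x) (t x)) \<in> borel_measurable M"
  unfolding h_defs by measurable

lemma h0_measurable: "h0 L r \<in> borel_fun"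
  unfolding h_defs[abs_def] by measurable

text \<open>For \<open>t > L\<close> the positive part in \<open>cutw\<close> is inactive; at
  \<open>L\<close> itself the third derivative of the cube jumps.\<close>

lemma cut3_DERIV:
  assumes t: "t > L" and L: "L > 0"
  shows "(cut2 L has_real_derivative cut3 L t) (at t)"
proof -
  have t0: "t > 0" using t L by simp
  have "((\<lambda>t. 1 - L ^ 4 / t ^ 4) has_real_derivative 4 * L ^ 4 / t ^ 5) (at t)"
    using t0 by (auto intro!: derivative_eq_intros simp: field_simps power_numeral_reduce)
  then have w: "(cutw L has_real_derivative 4 * L ^ 4 / t ^ 5) (at t)"
    by (rule has_field_derivative_transform_within_open[where S="{L<..}"])
       (use t L in \<open>auto simp: cutw_def max_def divide_le_eq power_mono dest: less_imp_le\<close>)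
  have w2: "((\<lambda>t. (cutw L t)\<^sup>2) has_real_derivative 2 * cutw L t * (4 * L ^ 4 / t ^ 5)) (at t)"
    using w by (auto intro!: derivative_eq_intros)
  have i6: "((\<lambda>t. 1 / t ^ 6) has_real_derivative - 6 / t ^ 7) (at t)" "((\<lambda>t. 1 / t ^ 10) has_real_derivative - 10 / t ^ 11) (at t)"
    using t0 by (auto intro!: derivative_eq_intros simp: field_simps power_numeral_reduce)
  have "((\<lambda>t. 12 * L ^ 4 * (8 * L ^ 4 * (cutw L t * (1 / t ^ 10)) - 5 * ((cutw L t)^2 * (1 / t ^ 6)))) has_real_derivative
    12 * L ^ 4 * (8 * L ^ 4 * (cutw L t * (- 10 / t ^ 11) + (4 * L ^ 4 / t ^ 5) * (1 / t ^ 10)) - 5 * ((cutw L t)^2 * (- 6 / t ^ 7) + 2 * cutw L t * (4 * L ^ 4 / t ^ 5) * (1 / t ^ 6)))) (at t)"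
    by (intro DERIV_cmult DERIV_diff DERIV_mult' w w2 i6)
  moreover have "12 * L ^ 4 * (8 * L ^ 4 * (cutw L t * (- 10 / t ^ 11) + (4 * L ^ 4 / t ^ 5) * (1 / t ^ 10)) - 5 * ((cutw L t)^2 * (- 6 / t ^ 7) + 2 * cutw L t * (4 * L ^ 4 / t ^ 5) * (1 / t ^ 6))) = cut3 L t"
  proof -
    have p: "t ^ 15 = t ^ 5 * t ^ 10" "t ^ 11 = t ^ 5 * t ^ 6" "L ^ 8 = L ^ 4 * L ^ 4" by (simp_all add: power_add[symmetric])
    show ?thesis unfolding cut3_def p by (simp add: algebra_simps)
  qed
  moreover have "cut2 L = (\<lambda>t. 12 * L ^ 4 * (8 * L ^ 4 * (cutw L t * (1 / t ^ 10)) - 5 * ((cutw L t)^2 * (1 / t ^ 6))))"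
    by (simp add: cut2_def fun_eq_iff)
  ultimately show ?thesis by simp
qed

section \<open>Three integrations by parts in the tail of the time integral\<close>

context
  fixes L r :: real
  assumes L: "L \<ge> 1" and r: "0 \<le> r" "2 * r \<le> L"
begin

text \<open>Because of \<open>2 * r \<le> L\<close> the tail \<open>t \<ge> L\<close> stays away
  from the wave front \<open>t = r\<close>, and \<open>root2 r t\<close> is at least
  \<open>t / 2\<close>.\<close>

lemma root2_facts:
  assumes t: "t \<ge> L"
  shows "0 < root2 r t" "r < t" "0 < t" "1 / root2 r t ^ n \<le> 2 ^ n / t ^ n"
proof -
  show t0: "0 < t" and rt: "r < t" using t L r by auto
  have "4 * r^2 \<le> t^2" using power_mono[of "2 * r" t 2] r t by simp
  moreover have "(t / 2)^2 = t^2 / 4" by (simp add: power_divide)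
  ultimately have "(t / 2)^2 \<le> t^2 - r^2" using zero_le_power2[of t] by linarith
  then have "sqrt ((t / 2)^2) \<le> root2 r t" unfolding root2_def by (rule real_sqrt_le_mono)
  then have le: "t / 2 \<le> root2 r t" using t0 by simp
  then show p: "0 < root2 r t" using t0 by linarith
  have "(t / 2) ^ n \<le> root2 r t ^ n" using le t0 by (intro power_mono) auto
  then have "1 / root2 r t ^ n \<le> 1 / (t / 2) ^ n" using p t0 by (intro divide_left_mono mult_pos_pos zero_less_power) auto
  then show "1 / root2 r t ^ n \<le> 2 ^ n / t ^ n" by (simp add: power_divide)
qed

lemma root2_DERIV:
  assumes t: "t \<ge> L"
  shows "((\<lambda>t. 1 / root2 r t ^ n) has_real_derivative - (of_nat n * t / root2 r t ^ (n + 2))) (at t)"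
proof -
  note f = root2_facts[OF t]
  have "t^2 - r^2 > 0" using f(1) by (simp add: root2_def)
  then have "(root2 r has_real_derivative t / root2 r t) (at t)"
    unfolding root2_def[abs_def] by (auto intro!: derivative_eq_intros simp: field_simps)
  then have "((\<lambda>t. inverse (root2 r t ^ n)) has_real_derivative - (inverse (root2 r t ^ n) * (of_nat n * (t / root2 r t * root2 r t ^ (n - Suc 0))) * inverse (root2 r t ^ n))) (at t)"
    using f(1) by (intro DERIV_inverse' DERIV_power) auto
  moreover have "- (inverse (root2 r t ^ n) * (of_nat n * (t / root2 r t * root2 r t ^ (n - Suc 0))) * inverse (root2 r t ^ n)) = - (of_nat n * t / root2 r t ^ (n + 2))"
    using f(1) by (cases n) (simp_all add: field_simps power2_eq_square)
  ultimately show ?thesis by (simp add: inverse_eq_divide)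
qed

lemma g_DERIV:
  assumes t: "t \<ge> L"
  shows "((\<lambda>t. 1 / root2 r t) has_real_derivative g1 r t) (at t)"
    "(g1 r has_real_derivative g2 r t) (at t)" "(g2 r has_real_derivative g3 r t) (at t)"
proof -
  note f = root2_facts[OF t]
  show "((\<lambda>t. 1 / root2 r t) has_real_derivative g1 r t) (at t)"
    using root2_DERIV[OF t, of 1] by (simp add: g1_def numeral_3_eq_3)
  have t2: "((\<lambda>t. 3 * t^2) has_real_derivative 6 * t) (at t)" by (auto intro!: derivative_eq_intros)
  have "((\<lambda>t. - (t * (1 / root2 r t ^ 3))) has_real_derivative - (t * (- (of_nat 3 * t / root2 r t ^ (3 + 2))) + 1 * (1 / root2 r t ^ 3))) (at t)"
    by (intro DERIV_minus DERIV_mult' DERIV_ident root2_DERIV[OF t])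
  then show "(g1 r has_real_derivative g2 r t) (at t)"
    unfolding g1_def[abs_def] g2_def by (simp add: algebra_simps power2_eq_square)
  have "((\<lambda>t. - (1 / root2 r t ^ 3) + (3 * t^2) * (1 / root2 r t ^ 5)) has_real_derivative - (- (of_nat 3 * t / root2 r t ^ (3 + 2))) + ((3 * t^2) * (- (of_nat 5 * t / root2 r t ^ (5 + 2))) + (6 * t) * (1 / root2 r t ^ 5))) (at t)"
    by (intro DERIV_minus DERIV_add DERIV_mult' t2 root2_DERIV[OF t])
  then show "(g2 r has_real_derivative g3 r t) (at t)"
    unfolding g2_def[abs_def] g3_def by (simp add: algebra_simps power2_eq_square power3_eq_cube)
qed

lemma h_DERIV:
  assumes t: "t > L"
  shows "(h0 L r has_real_derivative h1 L r t) (at t)" "(h1 L r has_real_derivative h2 L r t) (at t)" "(h2 L r has_real_derivative h3 L r t) (at t)"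
proof -
  have t': "t \<ge> L" "L > 0" "t > 0" using t L by auto
  note g = g_DERIV[OF t'(1)] and c = cut_DERIV(1,2)[OF t'(3), of L] cut3_DERIV[OF t t'(2)]
  show "(h0 L r has_real_derivative h1 L r t) (at t)"
    unfolding h0_def[abs_def] h1_def by (rule DERIV_cong[OF DERIV_mult'[OF c(1) g(1)]]) simp
  show "(h1 L r has_real_derivative h2 L r t) (at t)"
    unfolding h1_def[abs_def] h2_def by (rule DERIV_cong[OF DERIV_add[OF DERIV_mult'[OF c(2) g(1)] DERIV_mult'[OF c(1) g(2)]]]) simp
  show "(h2 L r has_real_derivative h3 L r t) (at t)"
    unfolding h2_def[abs_def] h3_def
    by (rule DERIV_cong[OF DERIV_add[OF DERIV_add[OF DERIV_mult'[OF c(3) g(1)] DERIV_mult'[OF DERIV_cmult[OF c(2), of 2] g(2)]] DERIV_mult'[OF c(1) g(3)]]]) simp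
qed

text \<open>Expressed by \<open>u = L ^ 4 / t ^ 4\<close> and \<open>w = cutw L t\<close>, both in
  the unit interval, every derivative of the cutoff gains a factor \<open>1 / t\<close>, and so does
  every derivative of \<open>1 / root2\<close>. The third derivative thus decays like the inverse
  fourth power, uniformly in \<open>L\<close> and \<open>r\<close>.\<close>

lemma h_bounds:
  assumes t: "t \<ge> L"
  shows "\<bar>h0 L r t\<bar> \<le> 2 / t" "\<bar>h1 L r t\<bar> \<le> 32 / t" "\<bar>h2 L r t\<bar> \<le> 700 / t" "\<bar>h3 L r t\<bar> \<le> 80000 / ja t^2"
proof -
  note f = root2_facts[OF t]
  have t1: "t \<ge> 1" "t > 0" using t L by auto
  define u where "u = L ^ 4 / t ^ 4"
  have u: "0 \<le> u" "u \<le> 1" using t L t1 by (auto simp: u_def divide_le_eq_1 power_mono)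
  define w where "w = cutw L t"
  have w: "0 \<le> w" "w \<le> 1" "0 \<le> w^2" "w^2 \<le> 1" "0 \<le> w ^ 3" "w ^ 3 \<le> 1" using cutw_bounds[of L t] by (auto simp: w_def power_le_one)
  have c0: "cut L t = w ^ 3" by (simp add: cut_def w_def)
  have c1: "cut1 L t = 12 * u * w^2 / t"
    using t1 unfolding cut1_def w_def[symmetric] u_def by (simp add: power_numeral_reduce)
  have c2: "cut2 L t = 12 * u * (8 * u * w - 5 * w^2) / t^2"
    using t1 unfolding cut2_def w_def[symmetric] u_def by (simp add: power_numeral_reduce field_simps)
  have c3: "cut3 L t = 12 * u * (30 * w^2 - 120 * u * w + 32 * u * u) / t ^ 3"
    using t1 unfolding cut3_def w_def[symmetric] u_def by (simp add: power_numeral_reduce field_simps)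
  have uw: "0 \<le> u * w" "u * w \<le> 1" "0 \<le> u * u" "u * u \<le> 1" using u w by (auto intro: mult_le_one)
  have b0: "\<bar>cut L t\<bar> \<le> 1" using w by (simp add: c0)
  have b1: "\<bar>cut1 L t\<bar> \<le> 12 / t"
  proof -
    have "\<bar>12 * u * w^2\<bar> \<le> 12" using mult_le_one[OF u(2) w(3,4)] u w by (simp add: abs_mult)
    then show ?thesis unfolding c1 abs_divide using t1 by (simp add: divide_right_mono)
  qed
  have b2: "\<bar>cut2 L t\<bar> \<le> 156 / t^2"
  proof -
    have "\<bar>8 * u * w - 5 * w^2\<bar> \<le> 13" using uw w unfolding abs_le_iff mult.assoc by linarith
    then have "\<bar>12 * u\<bar> * \<bar>8 * u * w - 5 * w^2\<bar> \<le> 12 * 13" using u by (intro mult_mono) auto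
    then show ?thesis unfolding c2 abs_divide abs_mult using t1 by (simp add: divide_right_mono)
  qed
  have b3: "\<bar>cut3 L t\<bar> \<le> 2184 / t ^ 3"
  proof -
    have "\<bar>30 * w^2 - 120 * u * w + 32 * u * u\<bar> \<le> 182" using uw w unfolding abs_le_iff mult.assoc by linarith
    then have "\<bar>12 * u\<bar> * \<bar>30 * w^2 - 120 * u * w + 32 * u * u\<bar> \<le> 12 * 182" using u by (intro mult_mono) auto
    then show ?thesis unfolding c3 abs_divide abs_mult using t1 by (simp add: divide_right_mono)
  qed
  have a0: "\<bar>1 / root2 r t\<bar> \<le> 2 / t" using f(1) f(4)[of 1] by simp
  have a1: "\<bar>g1 r t\<bar> \<le> 8 / t^2"
  proof -
    have "\<bar>g1 r t\<bar> = t * (1 / root2 r t ^ 3)" using f t1 by (simp add: g1_def abs_mult abs_divide)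
    also have "... \<le> t * (2 ^ 3 / t ^ 3)" using t1 by (intro mult_left_mono f(4)) auto
    also have "... = 8 / t^2" using t1 by (simp add: power_numeral_reduce)
    finally show ?thesis .
  qed
  have a2: "\<bar>g2 r t\<bar> \<le> 104 / t ^ 3"
  proof -
    have "\<bar>g2 r t\<bar> \<le> 1 / root2 r t ^ 3 + 3 * t^2 * (1 / root2 r t ^ 5)"
      unfolding g2_def using f t1 by (intro order_trans[OF abs_triangle_ineq]) (simp add: abs_mult abs_divide)
    also have "... \<le> 2 ^ 3 / t ^ 3 + 3 * t^2 * (2 ^ 5 / t ^ 5)" using t1 by (intro add_mono mult_left_mono f(4)) auto
    also have "... = 104 / t ^ 3" using t1 by (simp add: power_numeral_reduce field_simps)
    finally show ?thesis .
  qed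
  have a3: "\<bar>g3 r t\<bar> \<le> 2208 / t ^ 4"
  proof -
    have "\<bar>g3 r t\<bar> \<le> 9 * t * (1 / root2 r t ^ 5) + 15 * t ^ 3 * (1 / root2 r t ^ 7)"
      unfolding g3_def using f t1 by (intro order_trans[OF abs_triangle_ineq4]) (simp add: abs_mult abs_divide)
    also have "... \<le> 9 * t * (2 ^ 5 / t ^ 5) + 15 * t ^ 3 * (2 ^ 7 / t ^ 7)" using t1 by (intro add_mono mult_left_mono f(4)) auto
    also have "... = 2208 / t ^ 4" using t1 by (simp add: power_numeral_reduce field_simps)
    finally show ?thesis .
  qed
  have pw: "a / t ^ n \<le> a / t" if "n \<ge> 1" "a \<ge> 0" for a n
    using t1 that self_le_power[of t n] by (intro divide_left_mono) auto
  have m: "\<bar>a * b\<bar> \<le> A * B" if "\<bar>a\<bar> \<le> A" "\<bar>b\<bar> \<le> B" for a b A B :: real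
    unfolding abs_mult using that by (intro mult_mono) auto
  show "\<bar>h0 L r t\<bar> \<le> 2 / t" unfolding h0_def using m[OF b0 a0] by simp
  have "\<bar>h1 L r t\<bar> \<le> 12 / t * (2 / t) + 1 * (8 / t^2)"
    unfolding h1_def by (intro order_trans[OF abs_triangle_ineq] add_mono m b1 a0 b0 a1)
  also have "... = 32 / t^2" by (simp add: power2_eq_square)
  finally show "\<bar>h1 L r t\<bar> \<le> 32 / t" using pw[of 2 32] by simp
  have "\<bar>h2 L r t\<bar> \<le> (156 / t^2 * (2 / t) + (2 * (12 / t)) * (8 / t^2)) + 1 * (104 / t ^ 3)"
    unfolding h2_def by (intro order_trans[OF abs_triangle_ineq] add_mono m b2 b1 a0 b0 a1 a2) (use b1 in simp)
  also have "... = 608 / t ^ 3" by (simp add: power2_eq_square power3_eq_cube)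
  also have "... \<le> 700 / t ^ 3" using t1 by (intro divide_right_mono) auto
  finally show "\<bar>h2 L r t\<bar> \<le> 700 / t" using pw[of 3 700] by simp
  have "\<bar>h3 L r t\<bar> \<le> ((2184 / t ^ 3 * (2 / t) + (3 * (156 / t^2)) * (8 / t^2)) + (3 * (12 / t)) * (104 / t ^ 3)) + 1 * (2208 / t ^ 4)"
    unfolding h3_def by (intro order_trans[OF abs_triangle_ineq] add_mono m b3 a0 b0 a1 a2 a3) (use b1 b2 in simp_all)
  also have "... = 14064 / t ^ 4" using t1 by (simp add: power_numeral_reduce field_simps)
  also have "... \<le> 14064 / t^2" using t1 by (intro divide_left_mono power_increasing) auto
  also have "... \<le> 80000 / ja t^2"
  proof -
    have "(1 + t)^2 \<le> (2 * t)^2" using t1 by (intro power_mono) auto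
    moreover have "(2 * t)^2 = 4 * t^2" by (simp add: power_mult_distrib)
    ultimately have "14064 * (1 + t)^2 \<le> 80000 * t^2" using zero_le_power2[of t] by linarith
    then show ?thesis using t1 by (simp add: field_simps)
  qed
  finally show "\<bar>h3 L r t\<bar> \<le> 80000 / ja t^2" .
qed

lemma norm_exp_le: "Im z \<ge> 0 \<Longrightarrow> t \<ge> 0 \<Longrightarrow> norm (ez z t) \<le> 1"
  by (simp add: norm_exp_eq_Re)

lemma err_integral:
  assumes z: "Im z \<ge> 0"
  shows "L1 (\<lambda>t. ind {L<..} t * (of_real (h3 L r t) * ez z t))"
    "norm (LBINT t. ind {L<..} t * (of_real (h3 L r t) * ez z t)) \<le> 160000"
    "norm (ind {L<..} t * (of_real (h3 L r t) * ez z t)) \<le> 80000 / ja t^2"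
proof -
  show b: "norm (ind {L<..} t * (of_real (h3 L r t) * ez z t)) \<le> 80000 / ja t^2" for t
  proof (cases "t > L")
    case True
    have "\<bar>h3 L r t\<bar> * norm (ez z t) \<le> \<bar>h3 L r t\<bar> * 1"
      using True L z by (intro mult_left_mono norm_exp_le) auto
    then show ?thesis using h_bounds(4)[of t] True by (simp add: norm_mult)
  qed simp
  show "L1 (\<lambda>t. ind {L<..} t * (of_real (h3 L r t) * ez z t))"
    by (rule inverse_square_dominated(1)[OF _ b]) simp
  show "norm (LBINT t. ind {L<..} t * (of_real (h3 L r t) * ez z t)) \<le> 160000"
    using inverse_square_dominated(2)[OF _ b] by simp
qed

text \<open>All three integrations by parts are performed at once through the antiderivative
  \<open>F\<close>. No boundary term arises at \<open>L\<close>, since the cutoff and its first two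
  derivatives vanish there. Three of them produce the factor \<open>1 / z ^ 3\<close>, hence an
  error that is integrable in the plane.\<close>

lemma h0_integral:
  assumes z: "Im z > 0"
  shows "L1 (\<lambda>t. ind {L<..} t * (of_real (h0 L r t) * ez z t))"
    "(LBINT t. ind {L<..} t * (of_real (h0 L r t) * ez z t)) =
      - (1 / (\<i> * z) ^ 3) * (LBINT t. ind {L<..} t * (of_real (h3 L r t) * ez z t))"
proof -
  let ?w = "\<i> * z"
  have w: "?w \<noteq> 0" "Re ?w < 0" using z by auto
  define E where "E t = exp (?w * of_real t)" for t :: real
  have [measurable]: "E \<in> borel_fun" unfolding E_def[abs_def] by measurable
  note [measurable] = h0_measurable
  show i0: "L1 (\<lambda>t. ind {L<..} t * (of_real (h0 L r t) * ez z t))"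
  proof (rule L1_bound)
    show "L1 (\<lambda>t. 2 * (ind {0<..} t * exp (?w * of_real t)))"
      by (intro integrable_mult_right exp_integral_half_line(1) w(2))
    show "AE t in lborel. norm (ind {L<..} t * (of_real (h0 L r t) * ez z t)) \<le> norm (2 * (ind {0<..} t * exp (?w * of_real t)))"
    proof (intro AE_I2)
      fix t
      show "norm (ind {L<..} t * (of_real (h0 L r t) * ez z t)) \<le> norm (2 * (ind {0<..} t * exp (?w * of_real t)))"
      proof (cases "t > L")
        case True
        have "2 / t \<le> 2" using True L by (simp add: divide_le_eq)
        then have "\<bar>h0 L r t\<bar> \<le> 2" using h_bounds(1)[of t] True by linarith
        then have "\<bar>h0 L r t\<bar> * norm (exp (?w * of_real t)) \<le> 2 * norm (exp (?w * of_real t))" by (intro mult_right_mono) auto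
        then show ?thesis using True L by (simp add: norm_mult del: norm_exp_eq_Re)
      qed simp
    qed
  qed simp
  note i3 = err_integral(1)[of z]
  have i3: "L1 (\<lambda>t. ind {L<..} t * (of_real (h3 L r t) * ez z t))"
    using z by (intro err_integral(1)) simp
  define F where "F t = (of_real (h0 L r t) / ?w - of_real (h1 L r t) / ?w ^ 2 + of_real (h2 L r t) / ?w ^ 3) * E t" for t
  define f where "f t = of_real (h0 L r t) * E t + (1 / ?w ^ 3) * (of_real (h3 L r t) * E t)" for t
  have split: "ind {L<..} t * f t = ind {L<..} t * (of_real (h0 L r t) * ez z t) + (1 / ?w ^ 3) * (ind {L<..} t * (of_real (h3 L r t) * ez z t))" for t
    unfolding f_def E_def by (simp only: distrib_left mult.left_commute)
  have "(LBINT t. ind {L<..} t * f t) = 0 - 0"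
  proof (rule half_line_FTC[where F=F])
    fix t assume t: "t > L"
    note v = has_vector_derivative_of_real[OF h_DERIV(1)[OF t]] has_vector_derivative_of_real[OF h_DERIV(2)[OF t]] has_vector_derivative_of_real[OF h_DERIV(3)[OF t]]
    have vE: "(E has_vector_derivative ?w * E t) (at t)" unfolding E_def[abs_def] by (rule exp_vector_derivative)
    have "(F has_vector_derivative (of_real (h0 L r t) / ?w - of_real (h1 L r t) / ?w ^ 2 + of_real (h2 L r t) / ?w ^ 3) * (?w * E t) + (of_real (h1 L r t) / ?w - of_real (h2 L r t) / ?w ^ 2 + of_real (h3 L r t) / ?w ^ 3) * E t) (at t)"
      unfolding F_def[abs_def]
      by (intro has_vector_derivative_mult has_vector_derivative_add has_vector_derivative_diff has_vector_derivative_divide v vE)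
    moreover have "(a / w' - b / w' ^ 2 + c / w' ^ 3) * (w' * e) + (b / w' - c / w' ^ 2 + d / w' ^ 3) * e = a * e + (1 / w' ^ 3) * (d * e)" if "w' \<noteq> 0" for a b c d e w' :: complex
      using that by (simp add: field_simps power2_eq_square power3_eq_cube)
    ultimately show "(F has_vector_derivative f t) (at t)" unfolding f_def using w(1) by (simp only: not_False_eq_True)
    have ch: "isCont (h0 L r) t" using h_DERIV(1)[OF t] by (rule DERIV_isCont)
    have t0: "t > 0" "t \<ge> L" using t L by auto
    have cw: "isCont (cutw L) t" unfolding cutw_def[abs_def] using t0 by (intro continuous_intros) auto
    have cr: "isCont (root2 r) t" unfolding root2_def[abs_def] by (intro continuous_intros)
    have "isCont (h3 L r) t"
      unfolding h3_def[abs_def] cut3_def cut2_def cut1_def cut_def g1_def g2_def g3_def using t0 root2_facts(1)[OF t0(2)]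
      by (intro continuous_intros cw cr) auto
    then show "isCont f t" unfolding f_def[abs_def] E_def using w(1) ch by (intro continuous_intros) auto
  next
    show "L1 (\<lambda>t. ind {L<..} t * f t)"
      unfolding split by (intro L1_add integrable_mult_right i0 i3)
  next
    have L0: "L > 0" using L by simp
    have cw: "isCont (cutw L) L" unfolding cutw_def[abs_def] using L0 by (intro continuous_intros) auto
    have cr: "isCont (root2 r) L" unfolding root2_def[abs_def] by (intro continuous_intros)
    have "isCont (h0 L r) L" "isCont (h1 L r) L" "isCont (h2 L r) L"
      unfolding h0_def[abs_def] h1_def[abs_def] h2_def[abs_def] cut2_def cut1_def cut_def g1_def g2_def using L0 root2_facts(1)[OF order_refl]
      by (intro continuous_intros cw cr; simp)+
    then have "isCont F L" unfolding F_def[abs_def] E_def using w(1) by (intro continuous_intros) auto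
    moreover have "F L = 0" unfolding F_def h0_def h1_def h2_def cut_def cut1_def cut2_def using cut_zero[OF L0 order_refl] by simp
    ultimately show "(F \<longlongrightarrow> 0) (at_right L)" by (simp add: continuous_within filterlim_at_split)
  next
    show "(F \<longlongrightarrow> 0) at_top"
    proof (rule Lim_null_comparison)
      show "\<forall>\<^sub>F t in at_top. norm (F t) \<le> (2 / norm ?w + 32 / norm ?w ^ 2 + 700 / norm ?w ^ 3) / t"
        using eventually_ge_at_top[of L]
      proof eventually_elim
        case (elim t)
        have nE: "norm (E t) \<le> 1" unfolding E_def using z elim L by (intro norm_exp_le) auto
        have "norm (of_real (h0 L r t) / ?w - of_real (h1 L r t) / ?w ^ 2 + of_real (h2 L r t) / ?w ^ 3) \<le> \<bar>h0 L r t\<bar> / norm ?w + \<bar>h1 L r t\<bar> / norm ?w ^ 2 + \<bar>h2 L r t\<bar> / norm ?w ^ 3"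
          by (intro order_trans[OF norm_triangle_ineq] add_mono order_trans[OF norm_triangle_ineq4]) (simp_all only: norm_divide norm_power norm_of_real order_refl)
        also have "... \<le> (2 / t) / norm ?w + (32 / t) / norm ?w ^ 2 + (700 / t) / norm ?w ^ 3"
          using elim by (intro add_mono divide_right_mono h_bounds zero_le_power norm_ge_zero)
        also have "... = (2 / norm ?w + 32 / norm ?w ^ 2 + 700 / norm ?w ^ 3) / t" by (simp add: add_divide_distrib mult.commute)
        finally have nn: "norm (of_real (h0 L r t) / ?w - of_real (h1 L r t) / ?w ^ 2 + of_real (h2 L r t) / ?w ^ 3) \<le> (2 / norm ?w + 32 / norm ?w ^ 2 + 700 / norm ?w ^ 3) / t" .
        then have "norm (of_real (h0 L r t) / ?w - of_real (h1 L r t) / ?w ^ 2 + of_real (h2 L r t) / ?w ^ 3) * norm (E t) \<le> (2 / norm ?w + 32 / norm ?w ^ 2 + 700 / norm ?w ^ 3) / t * 1"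
          by (rule mult_mono[OF _ nE order_trans[OF norm_ge_zero nn] norm_ge_zero])
        then show ?case unfolding F_def norm_mult by simp
      qed
      show "((\<lambda>t::real. (2 / norm ?w + 32 / norm ?w ^ 2 + 700 / norm ?w ^ 3) / t) \<longlongrightarrow> 0) at_top"
        by (intro tendsto_divide_0[OF tendsto_const] filterlim_at_top_imp_at_infinity filterlim_ident)
    qed
  qed
  then have "0 = (LBINT t. ind {L<..} t * (of_real (h0 L r t) * ez z t)) + (1 / ?w ^ 3) * (LBINT t. ind {L<..} t * (of_real (h3 L r t) * ez z t))"
    unfolding split by (subst (asm) LB_add[OF i0 integrable_mult_right[OF i3]], subst (asm) integral_mult_right_zero) simp
  then show "(LBINT t. ind {L<..} t * (of_real (h0 L r t) * ez z t)) =
      - (1 / (\<i> * z) ^ 3) * (LBINT t. ind {L<..} t * (of_real (h3 L r t) * ez z t))"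
    by (simp add: eq_neg_iff_add_eq_0)
qed

end

section \<open>The kernel up to the real axis and limiting absorption\<close>

definition Lr :: "real \<Rightarrow> real \<Rightarrow> real" where "Lr L0 r = max L0 (2 * r)"

text \<open>Three integrations by parts turn the tail of the time integral into \<open>err\<close>, which still converges
  absolutely for real \<open>z\<close>. Thus \<open>Gk L0 z\<close> is the resolvent kernel for \<open>Im z > 0\<close> and its boundary value,
  the outgoing kernel, for real \<open>z\<close>; it does not depend on the truncation.\<close>

definition err :: "real \<Rightarrow> complex \<Rightarrow> real \<Rightarrow> complex" where
  "err L z r = 1 / (2 * of_real pi * (\<i> * z) ^ 3) * (LBINT t. ind {L<..} t * (of_real (h3 L r t) * ez z t))"

definition Gk :: "real \<Rightarrow> complex \<Rightarrow> cfun" where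
  "Gk L0 z x = - (1 / (2 * of_real pi)) * (LBINT t. of_real (chi (Lr L0 (norm x)) t) * ez z t * of_real (wk t (norm x))) + err (Lr L0 (norm x)) z (norm x)"

lemma err_bound:
  assumes "L \<ge> 1" "0 \<le> r" "2 * r \<le> L" "Im z \<ge> 0"
  shows "norm (err L z r) \<le> 160000 / norm z ^ 3"
proof -
  let ?I = "LBINT t. ind {L<..} t * (of_real (h3 L r t) * ez z t) :: complex"
  have "norm (err L z r) = norm ?I / (2 * pi) / norm z ^ 3"
    by (simp add: err_def norm_mult norm_divide norm_power power_mult_distrib)
  also have "norm ?I / (2 * pi) \<le> norm ?I / 1" using pi_gt3 by (intro divide_left_mono) auto
  also have "norm ?I / 1 / norm z ^ 3 \<le> 160000 / 1 / norm z ^ 3" using err_integral(2)[OF assms] by (intro divide_right_mono) auto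
  finally show ?thesis by (simp add: divide_right_mono)
qed

text \<open>In this range the truncation radius \<open>Lr\<close> is constant, so the exact kernel
  differs from the truncated one by the error term alone.\<close>

lemma Gk_near:
  assumes "2 * norm x \<le> L0"
  shows "Gk L0 (of_real k) x = Gam L0 k x + err L0 (of_real k) (norm x)"
  using assms by (simp add: Gk_def Gam_def wave_def Lr_def max_def)

text \<open>In the upper half plane the whole time integral converges. Splitting it by
  \<open>chi + cut = 1\<close> and integrating the second part by parts gives the expression that
  still makes sense on the real axis.\<close>

lemma wave_eq_Gk:
  assumes L0: "L0 \<ge> 1" and z: "Im z > 0" and x: "x \<noteq> 0"
  shows "wave (\<lambda>t. ez z t) x = Gk L0 z x"
proof -
  define r where "r = norm x"
  define L where "L = Lr L0 r"
  have L: "L \<ge> 1" "2 * r \<le> L" "0 \<le> r" "0 < r" using L0 x by (auto simp: L_def Lr_def r_def)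
  note h0i = h0_integral[OF L(1,3,2) z]
  have i1: "L1 (\<lambda>t. of_real (chi L t) * ez z t * of_real (wk t r))"
  proof (rule L1_bound[OF chi_wk_integrable(1)[OF L(1,4)]])
    show "AE t in lborel. norm (of_real (chi L t) * ez z t * of_real (wk t r)) \<le> norm (chi L t * wk t r)"
    proof (intro AE_I2)
      fix t
      show "norm (of_real (chi L t) * ez z t * of_real (wk t r)) \<le> norm (chi L t * wk t r)"
      proof (cases "t > r")
        case True
        then have "norm (ez z t) \<le> 1" using z L by (intro norm_exp_le[OF L(1,3,2)]) auto
        then have "\<bar>chi L t\<bar> * norm (ez z t) * \<bar>wk t r\<bar> \<le> \<bar>chi L t\<bar> * 1 * \<bar>wk t r\<bar>" by (intro mult_right_mono mult_left_mono) auto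
        then show ?thesis by (simp add: norm_mult abs_mult del: norm_exp_eq_Re)
      qed (simp add: wk_def)
    qed
  qed simp
  have "(LBINT t. ez z t * of_real (wk t r)) =
     (LBINT t. of_real (chi L t) * ez z t * of_real (wk t r) + ind {L<..} t * (of_real (h0 L r t) * ez z t))"
  proof (intro LB_cong refl)
    fix t
    consider "t \<le> r" | "r < t" "t \<le> L" | "L < t" by linarith
    then show "ez z t * of_real (wk t r) = of_real (chi L t) * ez z t * of_real (wk t r) + ind {L<..} t * (of_real (h0 L r t) * ez z t)"
    proof cases
      case 1 then show ?thesis using L by (simp add: wk_def)
    next
      case 2 then show ?thesis using L cut_zero[of t L] by (simp add: chi_def cut_def)
    next
      case 3
      then have "wk t r = 1 / root2 r t" using L by (simp add: wk_def root2_def)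
      then have "h0 L r t = cut L t * wk t r" by (simp add: h0_def)
      then show ?thesis using 3 by (simp add: chi_def algebra_simps)
    qed
  qed
  also have "... = (LBINT t. of_real (chi L t) * ez z t * of_real (wk t r)) - (1 / (\<i> * z) ^ 3) * (LBINT t. ind {L<..} t * (of_real (h3 L r t) * ez z t))"
    by (subst LB_add[OF i1 h0i(1)]) (simp only: h0i(2) mult_minus_left add_uminus_conv_diff minus_mult_left[symmetric])
  finally show ?thesis unfolding wave_def Gk_def err_def r_def[symmetric] L_def[symmetric]
    by (simp only: right_diff_distrib) (simp add: mult.assoc)
qed

lemma nn_integral_inverse_sqrt_abs:
  assumes R: "R > 0"
  shows "(NN t. en (indicator {-R<..<R} t * (1 / sqrt \<bar>t\<bar>))) \<le> en (4 * sqrt R)"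
proof -
  let ?f = "\<lambda>t::real. indicator {0<..<R} t * (1 / sqrt (t - 0)) :: real"
  have f: "(NN t. en (?f t)) = en (2 * sqrt R)" using nn_integral_inverse_sqrt[OF R] by simp
  have "(NN t. en (indicator {-R<..<R} t * (1 / sqrt \<bar>t\<bar>))) \<le> (NN t. en (?f t) + en (?f (0 + (-1) * t)))"
    by (intro nn_integral_mono) (auto simp: indicator_def)
  also have "... = (NN t. en (?f t)) + (NN t. en (?f (0 + (-1) * t)))"
    by (rule nn_integral_add) auto
  also have "(NN t. en (?f (0 + (-1) * t))) = (NN t. en (?f t))"
    using nn_integral_real_affine[of "\<lambda>t. en (?f t)" "-1" 0] by simp
  finally show ?thesis unfolding f using R by (simp add: ennreal_plus[symmetric] del: ennreal_plus)
qed

text \<open>The norm is at least the geometric mean of the coordinates, which splits the singularity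
  into two integrable ones of exponent 1/2. The coordinate axes form a null set.\<close>

lemma nn_integral_inverse_norm:
  "(NN v. en (indicator (cball 0 R) v * (1 / norm (v::plane)))) < \<infinity>"
proof -
  define S where "S = max R 0 + 1"
  have S: "S > 0" "R < S" by (auto simp: S_def)
  let ?g = "\<lambda>t::real. en (indicator {-S<..<S} t * (1 / sqrt \<bar>t\<bar>))"
  have "AE v in lborel. (v::plane) $ 1 \<noteq> 0 \<and> v $ 2 \<noteq> 0"
  proof -
    have "(NN v. indicator {v::plane. v $ 1 = 0} v) = (NN x. NN y. indicator {v::plane. v $ 1 = 0} (pl x y))"
      by (rule nn_integral_plane(1)) measurable
    also have "... = (\<integral>\<^sup>+x. indicator {0} x * \<infinity> \<partial>(lborel::real measure))"
      by (intro nn_integral_cong) (auto simp: indicator_def)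
    also have "... = 0" by (simp add: nn_integral_multc)
    finally have 1: "AE v in lborel. (v::plane) $ 1 \<noteq> 0"
      by (subst (asm) nn_integral_0_iff_AE) (auto simp: indicator_def)
    have "(NN v. indicator {v::plane. v $ 2 = 0} v) = (NN y. NN x. indicator {v::plane. v $ 2 = 0} (pl x y))"
      by (rule nn_integral_plane(2)) measurable
    also have "... = (\<integral>\<^sup>+x. indicator {0} x * \<infinity> \<partial>(lborel::real measure))"
      by (intro nn_integral_cong) (auto simp: indicator_def)
    also have "... = 0" by (simp add: nn_integral_multc)
    finally have 2: "AE v in lborel. (v::plane) $ 2 \<noteq> 0"
      by (subst (asm) nn_integral_0_iff_AE) (auto simp: indicator_def)
    from 1 2 show ?thesis by auto
  qed
  then have "(NN v. en (indicator (cball 0 R) v * (1 / norm (v::plane)))) \<le> (NN v. ?g ((v::plane) $ 1) * ?g (v $ 2))"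
  proof (intro nn_integral_mono_AE, eventually_elim)
    fix v :: plane assume v: "v $ 1 \<noteq> 0 \<and> v $ 2 \<noteq> 0"
    show "en (indicator (cball 0 R) v * (1 / norm v)) \<le> ?g (v $ 1) * ?g (v $ 2)"
    proof (cases "v \<in> cball 0 R")
      case True
      have c: "\<bar>v $ i\<bar> < S" for i using component_le_norm_cart[of v i] True S by auto
      have "\<bar>v $ 1\<bar> * \<bar>v $ 2\<bar> \<le> (norm v)^2"
        unfolding power2_eq_square by (intro mult_mono component_le_norm_cart) auto
      then have "sqrt (\<bar>v $ 1\<bar> * \<bar>v $ 2\<bar>) \<le> norm v" using real_sqrt_le_mono by fastforce
      then have "1 / norm v \<le> 1 / sqrt (\<bar>v $ 1\<bar> * \<bar>v $ 2\<bar>)" using v by (intro frac_le) auto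
      then show ?thesis using True c[of 1] c[of 2]
        by (auto simp: ennreal_mult[symmetric] real_sqrt_mult abs_less_iff intro!: ennreal_leI)
    qed simp
  qed
  also have "... = (NN t. ?g t) * (NN t. ?g t)"
    by (rule nn_integral_plane_product) auto
  also have "... < \<infinity>"
  proof -
    have "(NN t. ?g t) < \<infinity>" by (rule le_less_trans[OF nn_integral_inverse_sqrt_abs[OF S(1)]]) simp
    then show ?thesis by (simp add: ennreal_mult_less_top)
  qed
  finally show ?thesis .
qed

lemma Gk_measurable [measurable (raw)]:
  assumes [measurable]: "z \<in> borel_measurable M" "x \<in> borel_measurable M"
  shows "(\<lambda>w. Gk L0 (z w) (x w)) \<in> borel_measurable M"
  unfolding Gk_def err_def Lr_def indicator_def greaterThan_iff by measurable

text \<open>A majorant of \<open>Gk\<close>, uniform over the closed upper half plane outside the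
  unit disc. The fourth power stems from the truncation radius, which grows with
  \<open>r\<close>.\<close>

definition Gbd :: "real \<Rightarrow> real \<Rightarrow> real" where "Gbd L0 r = 34 * (L0 + 2 * r) ^ 4 / sqrt r + 160000"

lemma Lr_facts: "L0 \<ge> 1 \<Longrightarrow> 0 \<le> r \<Longrightarrow> Lr L0 r \<ge> 1 \<and> 2 * r \<le> Lr L0 r \<and> Lr L0 r \<le> L0 + 2 * r"
  by (auto simp: Lr_def)

lemma Gk_integrand_le:
  assumes L: "L \<ge> 1" and z: "Im z \<ge> 0" and r: "r \<ge> 0"
  shows "norm (of_real (chi L t) * ez z t * of_real (wk t r)) \<le> chi L t * wk t r"
proof (cases "t > r")
  case True
  then have "norm (ez z t) \<le> 1" using z r by (simp add: norm_exp_eq_Re)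
  then have "chi L t * norm (ez z t) * wk t r \<le> chi L t * 1 * wk t r"
    using chi_bounds(1)[OF L, of t] True r by (intro mult_right_mono mult_left_mono) (auto simp: wk_nonneg)
  then show ?thesis using chi_bounds(1)[OF L, of t] True r wk_nonneg[of r t] by (simp add: norm_mult abs_of_nonneg del: norm_exp_eq_Re)
qed (simp add: wk_def)

lemma Gk_bound:
  assumes L0: "L0 \<ge> 1" and z: "Im z \<ge> 0" "norm z \<ge> 1" and x: "x \<noteq> 0"
  shows "norm (Gk L0 z x) \<le> Gbd L0 (norm x)"
proof -
  define r where "r = norm x"
  define L where "L = Lr L0 r"
  have r: "r > 0" using x by (simp add: r_def)
  have L: "L \<ge> 1" "2 * r \<le> L" "L \<le> L0 + 2 * r" using Lr_facts[OF L0, of r] r by (auto simp: L_def)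
  let ?I = "LBINT t. of_real (chi L t) * ez z t * of_real (wk t r) :: complex"
  have "norm ?I \<le> (LBINT t. chi L t * wk t r)"
    by (rule norm_integral_le_dominated[OF chi_wk_integrable(1)[OF L(1) r]]) (use Gk_integrand_le[OF L(1) z(1)] r in auto)
  also have "... \<le> 34 * L ^ 4 / sqrt (2 * r)" by (rule chi_wk_integrable(2)[OF L(1) r])
  also have "... \<le> 34 * (L0 + 2 * r) ^ 4 / sqrt r"
    using L r by (intro frac_le mult_left_mono power_mono) auto
  finally have I: "norm ?I \<le> 34 * (L0 + 2 * r) ^ 4 / sqrt r" .
  have "norm (Gk L0 z x) \<le> norm (- (1 / (2 * of_real pi)) * ?I) + norm (err L z r)"
    unfolding Gk_def r_def[symmetric] L_def[symmetric] by (rule norm_triangle_ineq)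
  also have "norm (- (1 / (2 * of_real pi)) * ?I) = norm ?I / (2 * pi)" by (simp add: norm_mult norm_divide)
  also have "... \<le> norm ?I / 1" using pi_gt3 by (intro divide_left_mono) auto
  also have "norm (err L z r) \<le> 160000 / norm z ^ 3" by (rule err_bound) (use L r z in auto)
  also have "... \<le> 160000 / 1" using z(2) by (intro divide_left_mono) (auto intro: one_le_power)
  finally show ?thesis using I by (simp add: Gbd_def r_def)
qed

lemma Gk_tendsto:
  assumes L0: "L0 \<ge> 1" and x: "x \<noteq> 0" and k: "k \<ge> 1"
    and Z: "\<And>n. Im (Z n) \<ge> 0" "Z \<longlonglongrightarrow> of_real k"
  shows "(\<lambda>n. Gk L0 (Z n) x) \<longlonglongrightarrow> Gk L0 (of_real k) x"
proof -
  define r where "r = norm x"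
  define L where "L = Lr L0 r"
  have r: "r > 0" using x by (simp add: r_def)
  have L: "L \<ge> 1" "2 * r \<le> L" "0 \<le> r" using Lr_facts[OF L0, of r] r by (auto simp: L_def)
  have "(\<lambda>n. LBINT t. of_real (chi L t) * exp (\<i> * Z n * of_real t) * of_real (wk t r)) \<longlonglongrightarrow> (LBINT t. of_real (chi L t) * exp (\<i> * of_real k * of_real t) * of_real (wk t r))"
  proof (rule integral_dominated_convergence[OF _ _ chi_wk_integrable(1)[OF L(1) r]])
    show "AE t in lborel. (\<lambda>n. of_real (chi L t) * exp (\<i> * Z n * of_real t) * of_real (wk t r)) \<longlonglongrightarrow> of_real (chi L t) * exp (\<i> * of_real k * of_real t) * of_real (wk t r)"
      by (intro AE_I2 tendsto_intros Z)
    show "AE t in lborel. norm (of_real (chi L t) * exp (\<i> * Z n * of_real t) * of_real (wk t r) :: complex) \<le> chi L t * wk t r" for n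
      by (intro AE_I2 Gk_integrand_le L Z)
  qed simp_all
  moreover have "(\<lambda>n. LBINT t. ind {L<..} t * (of_real (h3 L r t) * exp (\<i> * Z n * of_real t))) \<longlonglongrightarrow> (LBINT t. ind {L<..} t * (of_real (h3 L r t) * exp (\<i> * of_real k * of_real t)))"
  proof (rule integral_dominated_convergence)
    show "L1 (\<lambda>t::real. 80000 / ja t^2)" by (rule inverse_square_dominated(1)) auto
    show "AE t in lborel. (\<lambda>n. ind {L<..} t * (of_real (h3 L r t) * exp (\<i> * Z n * of_real t))) \<longlonglongrightarrow> ind {L<..} t * (of_real (h3 L r t) * exp (\<i> * of_real k * of_real t))"
      by (intro AE_I2 tendsto_intros Z)
    show "AE t in lborel. norm (ind {L<..} t * (of_real (h3 L r t) * exp (\<i> * Z n * of_real t)) :: complex) \<le> 80000 / ja t^2" for n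
      by (intro AE_I2 err_integral(3)[OF L(1,3,2) Z(1)])
  qed simp_all
  ultimately show ?thesis
    unfolding Gk_def err_def r_def[symmetric] L_def[symmetric] using k by (intro tendsto_intros Z) auto
qed

text \<open>The exponent 7 beats the growth of degree 4 in \<open>Gbd\<close> and leaves integrable
  cubic decay. The majorant is independent of \<open>z\<close> and so serves the passage to the real
  axis.\<close>

lemma Gbd_pair_bound:
  fixes f \<phi> :: "cfun"
  assumes L0: "L0 \<ge> 1" and f: "L1 f" and supp: "AE y in lborel. norm y \<le> \<rho> \<or> f y = 0"
    and [measurable]: "\<phi> \<in> borel_fun" and \<phi>: "\<And>x. norm (\<phi> x) \<le> M / jb x ^ 7"
  shows "integrable lborel2 (\<lambda>(y, x). Gbd L0 (norm (x - y)) * norm (f y) * norm (\<phi> x))"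
proof -
  let ?g = "\<lambda>x y. Gbd L0 (norm (x - y)) * norm (\<phi> x)"
  have [measurable]: "f \<in> borel_fun" using f by auto
  have [measurable]: "Gbd L0 \<in> borel_fun" unfolding Gbd_def[abs_def] by measurable
  have [measurable]: "cball (0::plane) 1 \<in> sets borel" by simp
  have M: "M \<ge> 0" using \<phi>[of 0] norm_ge_zero[of "\<phi> 0"] by (simp del: norm_ge_zero)
  have Gnn: "0 \<le> Gbd L0 r" if "r \<ge> 0" for r using L0 that by (simp add: Gbd_def)
  define C where "C = 34 * (L0 + 2) ^ 4 + 160000"
  have C: "C \<ge> 0" using L0 by (simp add: C_def)
  \<comment> \<open>For \<open>r \<le> 1\<close> the root of \<open>r\<close> is at least
    \<open>r\<close>, so the root singularity is dominated by \<open>1 / r\<close>, whose local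
    integrability is \<open>nn_integral_inverse_norm\<close>.\<close>
  have G1: "Gbd L0 r \<le> C * (1 + r) ^ 4 * (2 + indicator {..1} r * (1 / r))" if r: "r \<ge> 0" for r
  proof -
    have s: "1 / sqrt r \<le> 1 + indicator {..1} r * (1 / r)"
    proof (cases "r > 1")
      case True then show ?thesis by (simp add: divide_le_eq_1)
    next
      case False
      show ?thesis
      proof (cases "r = 0")
        case False
        have "sqrt r \<ge> r" using \<open>\<not> r > 1\<close> r by (intro real_le_rsqrt) (simp add: power2_eq_square mult_left_le)
        then have "1 / sqrt r \<le> 1 / r" using False r by (intro frac_le) auto
        then show ?thesis using \<open>\<not> r > 1\<close> by simp
      qed simp
    qed
    have "(L0 + 2 * r) \<le> (L0 + 2) * (1 + r)" using L0 r by (simp add: algebra_simps)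
    then have p: "(L0 + 2 * r) ^ 4 \<le> (L0 + 2) ^ 4 * (1 + r) ^ 4" using L0 r by (subst power_mult_distrib[symmetric], intro power_mono) auto
    have "Gbd L0 r = 34 * (L0 + 2 * r) ^ 4 * (1 / sqrt r) + 160000 * 1 * 1" by (simp add: Gbd_def)
    also have "... \<le> 34 * ((L0 + 2) ^ 4 * (1 + r) ^ 4) * (2 + indicator {..1} r * (1 / r)) + 160000 * (1 + r) ^ 4 * (2 + indicator {..1} r * (1 / r))"
      using s p r L0 by (intro add_mono mult_mono mult_left_mono) (auto intro: one_le_power)
    finally show ?thesis by (simp add: C_def algebra_simps)
  qed
  define J where "J = (NN v. en (Gbd L0 (norm (v::plane)) * (1 / jb v ^ 7)))"
  have J: "J < \<infinity>"
  proof -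
    have "Gbd L0 (norm v) * (1 / jb v ^ 7) \<le> C * (2 * jb v powr - 3 + indicator (cball 0 1) v * (1 / norm v))" for v :: plane
    proof -
      let ?i = "indicator {..1} (norm v) * (1 / norm v)"
      have n: "0 < jb v" "1 / jb v ^ 3 \<le> 1" by (simp_all add: add_pos_nonneg one_le_power divide_le_eq_1_pos zero_less_power)
      have "Gbd L0 (norm v) * (1 / jb v ^ 7) \<le> C * jb v ^ 4 * (2 + ?i) * (1 / jb v ^ 7)" by (rule mult_right_mono[OF G1]) simp_all
      also have "... = C * ((2 + ?i) * (1 / jb v ^ 3))"
      proof -
        have "C * c ^ 4 * x * (1 / c ^ 7) = C * (x * (1 / c ^ 3))" if "c > 0" for c x :: real using that by (simp add: power_numeral_reduce)
        from this[OF n(1)] show ?thesis .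
      qed
      also have "(2 + ?i) * (1 / jb v ^ 3) \<le> 2 * (1 / jb v ^ 3) + ?i * 1"
        unfolding distrib_right using n(2) by (intro add_left_mono mult_left_mono) simp_all
      finally show ?thesis using C n by (simp add: powr_minus powr_numeral divide_inverse indicator_def mult_left_mono)
    qed
    then have "J \<le> (NN v. en C * (2 * en (jb (v::plane) powr - 3) + en (indicator (cball 0 1) v * (1 / norm v))))"
      unfolding J_def using C by (intro nn_integral_mono) (simp add: ennreal_leI ennreal_mult'[symmetric] ennreal_plus[symmetric] ennreal_numeral[symmetric] del: ennreal_plus ennreal_numeral)
    also have "... = en C * (2 * (NN v. en (jb (v::plane) powr - 3)) + (NN v. en (indicator (cball 0 1) v * (1 / norm (v::plane)))))"
      by (simp add: nn_integral_cmult nn_integral_add)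
    also have "... < \<infinity>" using nn_integral_plane_powr[of 3] nn_integral_inverse_norm[of 1] by (simp add: ennreal_mult_less_top)
    finally show ?thesis .
  qed
  define D where "D = M * (1 + max \<rho> 0) ^ 7"
  have D: "D \<ge> 0" using M by (simp add: D_def)
  have inner: "(NN x. en (?g x y)) \<le> en D * J" if y: "norm y \<le> \<rho>" for y
  proof -
    have "?g x y \<le> D * (Gbd L0 (norm (x - y)) * (1 / jb (x - y) ^ 7))" for x
    proof -
      have "0 \<le> norm x * max \<rho> 0" "norm y \<le> max \<rho> 0" using y by auto
      moreover have "jb x * (1 + max \<rho> 0) = jb x + max \<rho> 0 + norm x * max \<rho> 0" by (simp add: algebra_simps)
      ultimately have "jb (x - y) \<le> jb x * (1 + max \<rho> 0)" using norm_triangle_ineq4[of x y] by linarith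
      then have "jb (x - y) ^ 7 \<le> jb x ^ 7 * (1 + max \<rho> 0) ^ 7" by (subst power_mult_distrib[symmetric], intro power_mono) auto
      moreover have "1 / a \<le> c * (1 / b)" if "0 < a" "0 < b" "b \<le> a * c" for a b c :: real using that by (simp add: field_simps)
      ultimately have "1 / jb x ^ 7 \<le> (1 + max \<rho> 0) ^ 7 * (1 / jb (x - y) ^ 7)" by (simp add: add_pos_nonneg)
      then have "M * (1 / jb x ^ 7) \<le> M * ((1 + max \<rho> 0) ^ 7 * (1 / jb (x - y) ^ 7))" using M by (rule mult_left_mono)
      then have "norm (\<phi> x) \<le> D * (1 / jb (x - y) ^ 7)" using \<phi>[of x] by (simp add: D_def)
      from mult_left_mono[OF this Gnn[OF norm_ge_zero]] show ?thesis by (simp only: mult.left_commute)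
    qed
    then have "(NN x. en (?g x y)) \<le> (NN x. en D * en (Gbd L0 (norm (x - y)) * (1 / jb (x - y) ^ 7)))"
      using D by (intro nn_integral_mono) (simp add: ennreal_leI ennreal_mult'[symmetric])
    also have "... = en D * (NN x. en (Gbd L0 (norm (x - y)) * (1 / jb (x - y) ^ 7)))" by (rule nn_integral_cmult) measurable
    also have "... = en D * J"
      unfolding J_def by (subst nn_integral_translate(2)[where f = "\<lambda>v. en (Gbd L0 (norm v) * (1 / jb v ^ 7))"]) simp_all
    finally show ?thesis .
  qed
  have "(\<integral>\<^sup>+p. en (norm (case p of (y, x) \<Rightarrow> Gbd L0 (norm (x - y)) * norm (f y) * norm (\<phi> x))) \<partial>lborel2) =
    (NN y. NN x. en (norm (f y)) * en (?g x y))"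
  proof (subst lborel.nn_integral_fst[symmetric])
    have "en (norm (Gbd L0 (norm (x - y)) * norm (f y) * norm (\<phi> x))) = en (norm (f y)) * en (?g x y)" for x y
      using Gnn[of "norm (x - y)"] by (subst ennreal_mult[symmetric]) (auto simp: abs_mult mult_ac)
    then show "(NN y. NN x. en (norm (case (y, x) of (y, x) \<Rightarrow> Gbd L0 (norm (x - y)) * norm (f y) * norm (\<phi> x)))) = (NN y. NN x. en (norm (f y)) * en (?g x y))"
      by (simp only: prod.case)
  qed measurable
  also have "... = (NN y. en (norm (f y)) * (NN x. en (?g x y)))"
    by (intro nn_integral_cong nn_integral_cmult) measurable
  also have "... \<le> (NN y. en (norm (f y)) * (en D * J))"
  proof (intro nn_integral_mono_AE)
    show "AE y in lborel. en (norm (f y)) * (NN x. en (?g x y)) \<le> en (norm (f y)) * (en D * J)"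
      using supp
    proof eventually_elim
      case (elim y) then show ?case by (cases "f y = 0") (auto intro: mult_left_mono inner)
    qed
  qed
  also have "... = (NN y. en (norm (f y))) * (en D * J)"
    by (rule nn_integral_multc) auto
  also have "... < \<infinity>"
    using f J by (simp add: ennreal_mult_less_top nn_integral_eq_integral)
  finally show ?thesis by (intro integrableI_bounded) measurable
qed

lemma Gk_pair_integrable:
  fixes f \<phi> :: "cfun"
  assumes L0: "L0 \<ge> 1" and f: "L1 f" and supp: "AE y in lborel. norm y \<le> \<rho> \<or> f y = 0"
    and [measurable]: "\<phi> \<in> borel_fun" and \<phi>: "\<And>x. norm (\<phi> x) \<le> M / jb x ^ 7"
    and z: "Im z \<ge> 0" "norm z \<ge> 1"
  shows "integrable lborel2 (\<lambda>(y, x). Gk L0 z (x - y) * f y * \<phi> x)"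
    and "AE p in lborel2. norm (case p of (y, x) \<Rightarrow> Gk L0 z (x - y) * f y * \<phi> x) \<le> (case p of (y, x) \<Rightarrow> Gbd L0 (norm (x - y)) * norm (f y) * norm (\<phi> x))"
proof -
  have [measurable]: "f \<in> borel_fun" using f by auto
  \<comment> \<open>\<open>Gk_bound\<close> speaks of nonzero arguments only; the diagonal is a null
    set of the product measure.\<close>
  have ne: "AE p in lborel2. fst p \<noteq> (snd p :: plane)"
  proof (rule lborel_pair.AE_pair_measure)
    show "AE x in lborel. AE y in lborel. fst (x, y :: plane) \<noteq> snd (x, y)"
    proof (rule AE_I2)
      fix x :: plane
      show "AE y in lborel. fst (x, y) \<noteq> snd (x, y)" using AE_lborel_singleton[of x] by eventually_elim auto
    qed
  qed measurable
  show 2: "AE p in lborel2. norm (case p of (y, x) \<Rightarrow> Gk L0 z (x - y) * f y * \<phi> x) \<le> (case p of (y, x) \<Rightarrow> Gbd L0 (norm (x - y)) * norm (f y) * norm (\<phi> x))"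
    using ne
  proof eventually_elim
    fix p :: "plane \<times> plane" assume p: "fst p \<noteq> snd p"
    obtain y x where px: "p = (y, x)" by (cases p)
    show "norm (case p of (y, x) \<Rightarrow> Gk L0 z (x - y) * f y * \<phi> x) \<le> (case p of (y, x) \<Rightarrow> Gbd L0 (norm (x - y)) * norm (f y) * norm (\<phi> x))"
      unfolding px prod.case norm_mult using p px
      by (intro mult_right_mono Gk_bound L0 z) auto
  qed
  have B: "integrable lborel2 (\<lambda>(y, x). Gbd L0 (norm (x - y)) * norm (f y) * norm (\<phi> x))"
    by (rule Gbd_pair_bound[OF L0 f supp]) (use \<phi> in auto)
  show "integrable lborel2 (\<lambda>(y, x). Gk L0 z (x - y) * f y * \<phi> x)"
  proof (rule L1_bound[OF B])
    show "AE p in lborel2. norm (case p of (y, x) \<Rightarrow> Gk L0 z (x - y) * f y * \<phi> x) \<le> norm (case p of (y, x) \<Rightarrow> Gbd L0 (norm (x - y)) * norm (f y) * norm (\<phi> x))"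
      using 2 by eventually_elim (subst real_norm_def, rule order_trans, assumption, rule abs_ge_self)
  qed measurable
qed

lemma conv_Gk_integrable:
  fixes f \<phi> :: "cfun"
  assumes L0: "L0 \<ge> 1" and f: "L1 f" and supp: "AE y in lborel. norm y \<le> \<rho> \<or> f y = 0"
    and m: "\<phi> \<in> borel_fun" and \<phi>: "\<And>x. norm (\<phi> x) \<le> M / jb x ^ 7"
    and z: "Im z \<ge> 0" "norm z \<ge> 1"
  shows "L1 (\<lambda>x. conv (Gk L0 z) f x * \<phi> x)"
    and "(LBINT x. conv (Gk L0 z) f x * \<phi> x) = (LINT p|lborel2. (case p of (y, x) \<Rightarrow> Gk L0 z (x - y) * f y * \<phi> x))"
proof -
  have eq: "conv (Gk L0 z) f x * \<phi> x = (LBINT y. Gk L0 z (x - y) * f y * \<phi> x)" for x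
    by (simp add: conv_def)
  note i = Gk_pair_integrable(1)[OF L0 f supp m \<phi> z]
  show "L1 (\<lambda>x. conv (Gk L0 z) f x * \<phi> x)"
    unfolding eq by (rule lborel_pair.integrable_snd[OF i])
  show "(LBINT x. conv (Gk L0 z) f x * \<phi> x) = (LINT p|lborel2. (case p of (y, x) \<Rightarrow> Gk L0 z (x - y) * f y * \<phi> x))"
    unfolding eq by (rule lborel_pair.integral_snd[OF i])
qed

text \<open>The principal root of \<open>k^2 + i \<epsilon>\<close> lies in the upper half plane,
  and this sign is what selects the outgoing solution.\<close>

lemma csqrt_upper:
  assumes k: "k \<ge> 1" and e: "\<epsilon> > 0"
  shows "(csqrt (of_real (k^2) + \<i> * of_real \<epsilon>))^2 = of_real (k^2) + \<i> * of_real \<epsilon>"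
    "Im (csqrt (of_real (k^2) + \<i> * of_real \<epsilon>)) > 0" "norm (csqrt (of_real (k^2) + \<i> * of_real \<epsilon>)) \<ge> 1"
proof -
  define w where "w = of_real (k^2) + \<i> * of_real \<epsilon>"
  define z where "z = csqrt w"
  have z2: "z^2 = w" by (simp add: z_def)
  then show "(csqrt (of_real (k^2) + \<i> * of_real \<epsilon>))^2 = of_real (k^2) + \<i> * of_real \<epsilon>" by (simp add: z_def w_def)
  have re: "Re z \<ge> 0" unfolding z_def by (rule csqrt_principal[of w, THEN disjE]) (auto simp: less_imp_le)
  have "Im (z^2) = \<epsilon>" using z2 by (simp add: w_def)
  then have "2 * Re z * Im z = \<epsilon>" by (simp add: power2_eq_square mult.commute)
  then have "0 < Re z * Im z" using e by simp
  then show "Im (csqrt (of_real (k^2) + \<i> * of_real \<epsilon>)) > 0" using re unfolding z_def[symmetric, unfolded w_def] by (simp add: zero_less_mult_iff)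
  have "1 \<le> k^2" using k by (simp add: one_le_power)
  also have "... = Re w" by (simp add: w_def)
  also have "... \<le> norm w" by (rule complex_Re_le_cmod)
  also have "... = (norm z)^2" using z2 by (metis norm_power)
  finally have "1 \<le> (norm z)^2" .
  then show "norm (csqrt (of_real (k^2) + \<i> * of_real \<epsilon>)) \<ge> 1"
    unfolding z_def[symmetric, unfolded w_def] using power2_le_imp_le[of 1 "norm z"] by simp
qed

text \<open>For positive \<open>\<epsilon>\<close> the multiplier is the transform of an integrable
  function, so the claim is the convolution theorem followed by \<open>fourier_swap\<close>.\<close>

lemma damped_resolvent:
  fixes f \<phi> :: "cfun"
  assumes L0: "L0 \<ge> 1" and f: "L1 f" and \<phi>: "\<phi> \<in> schwartz" and k: "k \<ge> 1" and e: "\<epsilon> > 0"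
  defines "z \<equiv> csqrt (of_real (k^2) + \<i> * of_real \<epsilon>)"
  shows "(LBINT \<xi>. fourier f \<xi> / (of_real (- (norm \<xi>)\<^sup>2 + k^2) + \<i> * of_real \<epsilon>) * inverse_fourier \<phi> \<xi>) = (LBINT x. conv (Gk L0 z) f x * \<phi> x)"
proof -
  have z: "z^2 = of_real (k^2) + \<i> * of_real \<epsilon>" "Im z > 0" using csqrt_upper[OF k e] by (auto simp: z_def)
  define W where "W = wave (\<lambda>t. ez z t)"
  have re: "Re (\<i> * z) < 0" using z by simp
  have W: "L1 W" unfolding W_def by (rule wave_facts(1)[OF _ exp_integral_half_line(3)[OF re]]) simp
  have [measurable]: "f \<in> borel_fun" "W \<in> borel_fun" using f W by auto
  note s = schwartz_facts[OF \<phi>]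
  have [measurable]: "inverse_fourier \<phi> \<in> borel_fun" using s(5) by auto
  have "(LBINT \<xi>. fourier f \<xi> / (of_real (- (norm \<xi>)\<^sup>2 + k^2) + \<i> * of_real \<epsilon>) * inverse_fourier \<phi> \<xi>) = (LBINT \<xi>. fourier (conv W f) \<xi> * inverse_fourier \<phi> \<xi>)"
  proof (rule integral_cong_AE)
    show "AE \<xi> in lborel. fourier f \<xi> / (of_real (- (norm \<xi>)\<^sup>2 + k^2) + \<i> * of_real \<epsilon>) * inverse_fourier \<phi> \<xi> = fourier (conv W f) \<xi> * inverse_fourier \<phi> \<xi>"
      using AE_lborel_singleton[of "0::plane"]
    proof eventually_elim
      fix \<xi> :: plane assume "\<xi> \<noteq> 0"
      then have "fourier W \<xi> = 1 / (z^2 - of_real ((norm \<xi>)^2))" unfolding W_def by (rule wave_exp_fourier[OF z(2)])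
      also have "z^2 - of_real ((norm \<xi>)^2) = of_real (- (norm \<xi>)\<^sup>2 + k^2) + \<i> * of_real \<epsilon>" unfolding z(1) by simp
      finally show "fourier f \<xi> / (of_real (- (norm \<xi>)\<^sup>2 + k^2) + \<i> * of_real \<epsilon>) * inverse_fourier \<phi> \<xi> = fourier (conv W f) \<xi> * inverse_fourier \<phi> \<xi>"
        unfolding conv_facts(2)[OF f W] by simp
    qed
  qed measurable
  also have "... = (LBINT x. conv W f x * \<phi> x)"
    using fourier_swap[OF conv_facts(1)[OF f W] s(5)] s(4) by simp
  also have "conv W f = conv (Gk L0 z) f"
  proof
    fix x
    show "conv W f x = conv (Gk L0 z) f x" unfolding conv_def
    proof (rule integral_cong_AE)
      show "AE y in lborel. W (x - y) * f y = Gk L0 z (x - y) * f y"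
        using AE_lborel_singleton[of x] by eventually_elim (simp add: W_def wave_eq_Gk[OF L0 z(2)])
    qed measurable
  qed
  finally show ?thesis .
qed

text \<open>Limiting absorption: as \<open>\<epsilon>\<close> decreases to 0 the root tends to
  \<open>k\<close> from the upper half plane, and the kernels converge off the diagonal under the
  majorant \<open>Gbd\<close>. The distributional limit in the definition thereby becomes
  convolution with an explicit kernel.\<close>

lemma outgoing_resolvent_eq:
  fixes f \<phi> :: "cfun"
  assumes L0: "L0 \<ge> 1" and f: "L1 f" and supp: "AE y in lborel. norm y \<le> \<rho> \<or> f y = 0"
    and \<phi>: "\<phi> \<in> schwartz" and k: "k \<ge> 1"
  shows "outgoing_resolvent k f \<phi> = (LBINT x. conv (Gk L0 (of_real k)) f x * \<phi> x)"
proof -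
  note s = schwartz_facts[OF \<phi>]
  have [measurable]: "f \<in> borel_fun" "\<phi> \<in> borel_fun" using f s(1) by auto
  have m: "\<phi> \<in> borel_fun" by simp
  obtain M where M: "\<And>x. norm (\<phi> x) \<le> M / jb x ^ 7" using schwartz_facts(3)[OF \<phi>, of 7] by blast
  define Z where "Z \<epsilon> = csqrt (of_real (k^2) + \<i> * of_real \<epsilon>)" for \<epsilon> :: real
  define V where "V \<epsilon> = (LBINT \<xi>. fourier f \<xi> / (of_real (- (norm \<xi>)\<^sup>2 + k^2) + \<i> * of_real \<epsilon>) * inverse_fourier \<phi> \<xi>)" for \<epsilon> :: real
  define P where "P z = (LINT p|lborel2. (case p of (y, x) \<Rightarrow> Gk L0 z (x - y) * f y * \<phi> x))" for z
  have kc: "Im (of_real k) \<ge> 0" "norm (of_real k :: complex) \<ge> 1" using k by auto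
  have VP: "V \<epsilon> = P (Z \<epsilon>)" if "\<epsilon> > 0" for \<epsilon>
    unfolding V_def P_def Z_def damped_resolvent[OF L0 f \<phi> k that]
    by (rule conv_Gk_integrable(2)[OF L0 f supp m M]) (use csqrt_upper[OF k that] in auto)
  have "(V \<longlongrightarrow> P (of_real k)) (at_right 0)"
    unfolding tendsto_at_iff_sequentially
  proof (intro allI impI)
    fix X :: "nat \<Rightarrow> real" assume X: "\<forall>i. X i \<in> {0<..} - {0}" "X \<longlonglongrightarrow> 0"
    have Xp: "X n > 0" for n using X(1) by auto
    have "isCont csqrt (of_real (k^2))" using k by (intro continuous_at_csqrt) (auto simp: complex_nonpos_Reals_iff)
    moreover have "(\<lambda>n. of_real (k^2) + \<i> * of_real (X n)) \<longlonglongrightarrow> of_real (k^2) + \<i> * of_real 0" by (intro tendsto_intros X(2))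
    ultimately have "(\<lambda>n. Z (X n)) \<longlonglongrightarrow> csqrt (of_real (k^2))" unfolding Z_def by (intro isCont_tendsto_compose[where g=csqrt]) auto
    also have "csqrt (of_real (k^2)) = of_real k" using k by (simp add: csqrt_of_real_nonneg)
    finally have Zlim: "(\<lambda>n. Z (X n)) \<longlonglongrightarrow> of_real k" .
    have Zp: "Im (Z (X n)) \<ge> 0" "norm (Z (X n)) \<ge> 1" for n using csqrt_upper[OF k Xp[of n]] by (auto simp: Z_def)
    have ne: "AE p in lborel2. fst p \<noteq> (snd p :: plane)"
    proof (rule lborel_pair.AE_pair_measure)
      show "AE x in lborel. AE y in lborel. fst (x, y :: plane) \<noteq> snd (x, y)"
      proof (rule AE_I2)
        fix x :: plane
        show "AE y in lborel. fst (x, y) \<noteq> snd (x, y)" using AE_lborel_singleton[of x] by eventually_elim auto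
      qed
    qed measurable
    have "(\<lambda>n. P (Z (X n))) \<longlonglongrightarrow> P (of_real k)"
      unfolding P_def
    proof (rule integral_dominated_convergence[where w="\<lambda>p. case p of (y, x) \<Rightarrow> Gbd L0 (norm (x - y)) * norm (f y) * norm (\<phi> x)"])
      show "integrable lborel2 (\<lambda>(y, x). Gbd L0 (norm (x - y)) * norm (f y) * norm (\<phi> x))"
        by (rule Gbd_pair_bound[OF L0 f supp m M])
      show "AE p in lborel2. norm (case p of (y, x) \<Rightarrow> Gk L0 (Z (X n)) (x - y) * f y * \<phi> x) \<le> (case p of (y, x) \<Rightarrow> Gbd L0 (norm (x - y)) * norm (f y) * norm (\<phi> x))" for n
        by (rule Gk_pair_integrable(2)[OF L0 f supp m M Zp])
      show "AE p in lborel2. (\<lambda>n. case p of (y, x) \<Rightarrow> Gk L0 (Z (X n)) (x - y) * f y * \<phi> x) \<longlonglongrightarrow> (case p of (y, x) \<Rightarrow> Gk L0 (of_real k) (x - y) * f y * \<phi> x)"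
        using ne
      proof eventually_elim
        fix p :: "plane \<times> plane" assume p: "fst p \<noteq> snd p"
        obtain y x where px: "p = (y, x)" by (cases p)
        then have "x - y \<noteq> 0" using p by auto
        then show "(\<lambda>n. case p of (y, x) \<Rightarrow> Gk L0 (Z (X n)) (x - y) * f y * \<phi> x) \<longlonglongrightarrow> (case p of (y, x) \<Rightarrow> Gk L0 (of_real k) (x - y) * f y * \<phi> x)"
          unfolding px prod.case by (intro tendsto_intros Gk_tendsto[OF L0 _ k Zp(1) Zlim])
      qed
    qed measurable
    then show "(V \<circ> X) \<longlonglongrightarrow> P (of_real k)" using VP[OF Xp] by (simp add: comp_def)
  qed
  then have "Lim (at_right 0) V = P (of_real k)" by (intro tendsto_Lim) auto
  then show ?thesis
    unfolding outgoing_resolvent_def inverse_fourier_distr_def V_def[symmetric, abs_def]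
    using conv_Gk_integrable(2)[OF L0 f supp m M kc] by (simp add: P_def)
qed

lemma tempered_function_conv:
  fixes f :: "cfun"
  assumes L0: "L0 \<ge> 1" and f: "L1 f" and supp: "AE y in lborel. norm y \<le> \<rho> \<or> f y = 0" and k: "k \<ge> 1"
  shows "L1 (\<lambda>x. conv (Gk L0 (of_real k)) f x / of_real (jb x ^ 7))"
proof -
  have "L1 (\<lambda>x. conv (Gk L0 (of_real k)) f x * (1 / of_real (jb x ^ 7)))"
    by (rule conv_Gk_integrable(1)[OF L0 f supp, where M=1]) (use k in \<open>auto simp: norm_divide norm_power add_pos_nonneg abs_of_nonneg simp del: of_real_power of_real_add\<close>)
  then show ?thesis by simp
qed

section \<open>The Neumann series of the amplitude\<close>

locale potential =
  fixes q :: "cfun" and \<rho> :: real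
  assumes q_int: "L1 q" and q_sq: "L1 (\<lambda>x. (norm (q x))\<^sup>2)"
    and rho: "\<rho> > 0" and q_supp: "AE x in lborel. norm x \<le> \<rho> \<or> q x = 0"
begin

lemma q_measurable [measurable]: "q \<in> borel_fun"
  using q_int by auto

text \<open>Differences of points of the support have norm at most \<open>2 * \<rho>\<close>, so
  with this value \<open>Gk_near\<close> applies to all of them.\<close>

definition L0 :: real where "L0 = 4 * \<rho> + 1"

lemma L0_ge: "L0 \<ge> 1" using rho by (simp add: L0_def)

definition Jq :: ennreal where
  "Jq = (NN v. en (indicator (cball 0 (2 * \<rho>)) v * (1 / norm (v::plane))))"

text \<open>Collects the three integrals that appear in \<open>kernel_column\<close> when the
  product of \<open>q\<close> with the root singularity is bounded by a sum of squares.\<close>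

definition Cq :: real where
  "Cq = (LBINT x. (norm (q x))\<^sup>2) + enn2real Jq + (LBINT x. norm (q x))"

definition N1 :: real where "N1 = (LBINT x. norm (q x))"

lemma N1_nonneg: "0 \<le> N1" by (simp add: N1_def)

lemma Cq_nonneg: "0 \<le> Cq" by (simp add: Cq_def)

lemma Jq_eq: "Jq = en (enn2real Jq)"
  using nn_integral_inverse_norm[of "2 * \<rho>"] by (simp add: Jq_def less_top)

definition sup_ball :: "cfun \<Rightarrow> bool" where
  "sup_ball f \<longleftrightarrow> L1 f \<and> (AE x in lborel. norm x \<le> \<rho> \<or> f x = 0)"

text \<open>Modelled on the bound in \<open>Gam_decay\<close>; only arguments of norm at most
  \<open>2 * \<rho>\<close> occur between points of the support of \<open>q\<close>.\<close>

definition sing_kernel :: "real \<Rightarrow> cfun \<Rightarrow> bool" where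
  "sing_kernel c H \<longleftrightarrow> H \<in> borel_fun \<and> c \<ge> 0 \<and>
     (\<forall>v. v \<noteq> 0 \<longrightarrow> norm v \<le> 2 * \<rho> \<longrightarrow> norm (H v) \<le> c * (1 / sqrt (norm v) + 1))"

definition Tq :: "cfun \<Rightarrow> cfun \<Rightarrow> cfun" where
  "Tq H f x = q x * conv H f x"

text \<open>A bound on the columns of the kernel of \<open>Tq\<close>, hence on its norm in L^1. The
  product of \<open>q\<close> with the root singularity is at most the square of \<open>q\<close>
  plus \<open>1 / norm v\<close>; this is where square integrability of \<open>q\<close>
  enters.\<close>

lemma kernel_column:
  assumes H: "sing_kernel c H" and y: "norm y \<le> \<rho>"
  shows "(NN x. en (norm (q x) * norm (H (x - y)))) \<le> en (c * Cq)"
proof -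
  have [measurable]: "H \<in> borel_fun" and c: "c \<ge> 0" using H by (auto simp: sing_kernel_def)
  define B where "B v = indicator (cball 0 (2 * \<rho>)) v * (1 / norm (v::plane))" for v
  have [measurable]: "cball (0::plane) (2 * \<rho>) \<in> sets borel" by simp
  have [measurable]: "B \<in> borel_fun" unfolding B_def[abs_def] by measurable
  have B0: "0 \<le> B v" for v by (simp add: B_def)
  have "(NN x. en (norm (q x) * norm (H (x - y)))) \<le> (NN x. en c * (en ((norm (q x))^2) + en (B (x - y)) + en (norm (q x))))"
  proof (rule nn_integral_mono_AE)
    show "AE x in lborel. en (norm (q x) * norm (H (x - y))) \<le> en c * (en ((norm (q x))^2) + en (B (x - y)) + en (norm (q x)))"
      using q_supp AE_lborel_singleton[of y]
    proof eventually_elim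
      case (elim x)
      show ?case
      proof (cases "q x = 0")
        case False
        with elim have x: "norm x \<le> \<rho>" "x - y \<noteq> 0" by auto
        have n: "norm (x - y) \<le> 2 * \<rho>" using norm_triangle_ineq4[of x y] x y by linarith
        define s where "s = 1 / sqrt (norm (x - y))"
        have s2: "s^2 = B (x - y)" using n by (simp add: s_def B_def power_divide)
        have "norm (H (x - y)) \<le> c * (s + 1)" using H x(2) n by (auto simp: sing_kernel_def s_def)
        then have "norm (q x) * norm (H (x - y)) \<le> norm (q x) * (c * (s + 1))" by (intro mult_left_mono) auto
        also have "... = c * (norm (q x) * s + norm (q x))" by (simp add: algebra_simps)
        also have "... \<le> c * ((norm (q x))^2 + s^2 + norm (q x))"
        proof (rule mult_left_mono[OF _ c])
          have "0 \<le> s" by (simp add: s_def)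
          then have "0 \<le> norm (q x) * s" by simp
          then show "norm (q x) * s + norm (q x) \<le> (norm (q x))^2 + s^2 + norm (q x)"
            using sum_squares_bound[of "norm (q x)" s] by linarith
        qed
        finally have "norm (q x) * norm (H (x - y)) \<le> c * ((norm (q x))^2 + B (x - y) + norm (q x))" unfolding s2 .
        moreover have "en (c * ((norm (q x))^2 + B (x - y) + norm (q x))) = en c * (en ((norm (q x))^2) + en (B (x - y)) + en (norm (q x)))"
          using c B0[of "x - y"] by (subst ennreal_mult) (auto simp: ennreal_plus)
        ultimately show ?thesis by (metis ennreal_leI)
      qed simp
    qed
  qed
  also have "... = en c * ((NN x. en ((norm (q x))^2)) + (NN x. en (B (x - y))) + (NN x. en (norm (q x))))"
    by (simp add: nn_integral_cmult nn_integral_add)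
  also have "(NN x. en (B (x - y))) = Jq"
    using nn_integral_translate(2)[of "\<lambda>v. en (B v)" y] by (simp add: Jq_def B_def)
  also have "(NN x. en ((norm (q x))^2)) = en (LBINT x. (norm (q x))\<^sup>2)" by (rule nn_integral_eq_integral[OF q_sq]) simp
  also have "(NN x. en (norm (q x))) = en (LBINT x. norm (q x))" by (rule nn_integral_eq_integral[OF integrable_norm[OF q_int]]) simp
  also have "en c * (en (LBINT x. (norm (q x))\<^sup>2) + Jq + en (LBINT x. norm (q x))) = en (c * Cq)"
    unfolding Cq_def using c by (subst Jq_eq, subst ennreal_mult) (auto simp: ennreal_plus)
  finally show ?thesis .
qed

lemma Tq_double:
  assumes H: "sing_kernel c H" and f: "sup_ball f"
  shows "(NN x. NN y. en (norm (q x) * norm (H (x - y) * f y))) \<le> en (c * Cq * (LBINT y. norm (f y)))"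
proof -
  have [measurable]: "H \<in> borel_fun" "f \<in> borel_fun" and c: "c \<ge> 0" using H f by (auto simp: sing_kernel_def sup_ball_def)
  have fi: "L1 f" and fs: "AE x in lborel. norm x \<le> \<rho> \<or> f x = 0" using f by (auto simp: sup_ball_def)
  have "(NN x. NN y. en (norm (q x) * norm (H (x - y) * f y))) = (NN y. NN x. en (norm (q x) * norm (H (x - y) * f y)))"
    by (rule lborel_pair.Fubini') measurable
  also have "... = (NN y. en (norm (f y)) * (NN x. en (norm (q x) * norm (H (x - y)))))"
    by (intro nn_integral_cong) (simp add: nn_integral_cmult[symmetric] ennreal_mult[symmetric] norm_mult mult_ac)
  also have "... \<le> (NN y. en (norm (f y)) * en (c * Cq))"
  proof (rule nn_integral_mono_AE)
    show "AE y in lborel. en (norm (f y)) * (NN x. en (norm (q x) * norm (H (x - y)))) \<le> en (norm (f y)) * en (c * Cq)"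
      using fs
    proof eventually_elim
      case (elim y) then show ?case
        by (cases "f y = 0") (auto intro!: mult_left_mono kernel_column[OF H])
    qed
  qed
  also have "... = en (LBINT y. norm (f y)) * en (c * Cq)"
    using fi by (simp add: nn_integral_multc nn_integral_eq_integral)
  also have "... = en (c * Cq * (LBINT y. norm (f y)))"
    using c Cq_nonneg by (simp add: ennreal_mult[symmetric] mult_ac)
  finally show ?thesis .
qed

text \<open>Finiteness of the double integral makes the inner one converge for almost all
  \<open>x\<close> with \<open>q x\<close> nonzero. Where \<open>q\<close> vanishes so does
  \<open>Tq\<close>, hence \<open>Tq\<close> is additive almost everywhere in spite of the default
  value 0 of divergent integrals.\<close>

lemma Tq_facts:
  assumes H: "sing_kernel c H" and f: "sup_ball f"
  shows "AE x in lborel. q x = 0 \<or> L1 (\<lambda>y. H (x - y) * f y)"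
    and "sup_ball (Tq H f)" "(LBINT x. norm (Tq H f x)) \<le> c * Cq * (LBINT y. norm (f y))"
proof -
  have [measurable]: "H \<in> borel_fun" "f \<in> borel_fun" and c: "c \<ge> 0" using H f by (auto simp: sing_kernel_def sup_ball_def)
  have [measurable]: "Tq H f \<in> borel_fun" unfolding Tq_def[abs_def] by measurable
  note D = Tq_double[OF H f]
  have "AE x in lborel. (NN y. en (norm (q x) * norm (H (x - y) * f y))) \<noteq> \<infinity>"
    by (rule nn_integral_PInf_AE) (use D in \<open>auto simp: top_unique\<close>)
  then show "AE x in lborel. q x = 0 \<or> L1 (\<lambda>y. H (x - y) * f y)"
  proof eventually_elim
    case (elim x)
    show ?case
    proof (cases "q x = 0")
      case False
      have "(NN y. en (norm (q x) * norm (H (x - y) * f y))) = en (norm (q x)) * (NN y. en (norm (H (x - y) * f y)))"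
        by (subst nn_integral_cmult[symmetric]) (auto simp: ennreal_mult)
      with elim False have "(NN y. en (norm (H (x - y) * f y))) < \<infinity>"
        by (auto simp: ennreal_mult_eq_top_iff less_top)
      then have "L1 (\<lambda>y. H (x - y) * f y)" by (intro integrableI_bounded) auto
      then show ?thesis by simp
    qed simp
  qed
  have nn: "(NN x. en (norm (Tq H f x))) \<le> en (c * Cq * (LBINT y. norm (f y)))"
  proof (rule order_trans[OF nn_integral_mono D])
    fix x
    have "en (norm (Tq H f x)) = en (norm (q x)) * en (norm (LBINT y. H (x - y) * f y))"
      by (simp add: Tq_def conv_def norm_mult ennreal_mult)
    also have "... \<le> en (norm (q x)) * (NN y. en (norm (H (x - y) * f y)))"
      by (intro mult_left_mono norm_integral_le_nn_integral) auto
    also have "... = (NN y. en (norm (q x) * norm (H (x - y) * f y)))"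
      by (subst nn_integral_cmult[symmetric]) (auto simp: ennreal_mult)
    finally show "en (norm (Tq H f x)) \<le> (NN y. en (norm (q x) * norm (H (x - y) * f y)))" .
  qed
  have i: "L1 (Tq H f)"
    by (rule integrableI_bounded) (use nn in \<open>auto intro: le_less_trans\<close>)
  moreover have "AE x in lborel. norm x \<le> \<rho> \<or> Tq H f x = 0" using q_supp by eventually_elim (auto simp: Tq_def)
  ultimately show "sup_ball (Tq H f)" by (simp add: sup_ball_def)
  have "0 \<le> c * Cq * (LBINT y. norm (f y))" using c Cq_nonneg by simp
  then show "(LBINT x. norm (Tq H f x)) \<le> c * Cq * (LBINT y. norm (f y))"
    using nn by (subst (asm) nn_integral_eq_integral[OF integrable_norm[OF i]]) (auto simp: ennreal_le_iff)
qed

lemma Tq_diff: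
  assumes H: "sing_kernel c H" and f: "sup_ball f" and g: "sup_ball g"
  shows "AE x in lborel. Tq H f x - Tq H g x = Tq H (\<lambda>y. f y - g y) x"
  using Tq_facts(1)[OF H f] Tq_facts(1)[OF H g]
proof eventually_elim
  case (elim x)
  then show ?case by (cases "q x = 0") (auto simp: Tq_def conv_def right_diff_distrib)
qed

lemma Tq_diff_kernel:
  assumes H: "sing_kernel c H" and H': "sing_kernel c' H'" and f: "sup_ball f"
  shows "AE x in lborel. Tq H f x - Tq H' f x = Tq (\<lambda>v. H v - H' v) f x"
  using Tq_facts(1)[OF H f] Tq_facts(1)[OF H' f]
proof eventually_elim
  case (elim x)
  then show ?case by (cases "q x = 0") (auto simp: Tq_def conv_def left_diff_distrib right_diff_distrib)
qed

lemma sup_ball_diff: "sup_ball f \<Longrightarrow> sup_ball g \<Longrightarrow> sup_ball (\<lambda>x. f x - g x)"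
  unfolding sup_ball_def by (auto elim: AE_mp[OF conjunct2])

definition Cb :: real where "Cb = 160001 * Cq"

text \<open>The constant adds the 1 of \<open>Gam_decay\<close> to the 160000 of
  \<open>err_bound\<close>, the latter weakened from the inverse cube to the inverse root of
  \<open>k\<close>.\<close>

lemma Gk_sing:
  assumes k: "k \<ge> 1"
  shows "sing_kernel (160001 / sqrt k) (Gk L0 (of_real k))" "sing_kernel (160001 / sqrt k) (Gam L0 k)"
    "sing_kernel (160000 / k ^ 3) (\<lambda>v. Gk L0 (of_real k) v - Gam L0 k v)"
proof -
  have mG: "(\<lambda>v. Gk L0 (of_real k) v) \<in> borel_fun" by measurable
  have mGa: "Gam L0 k \<in> borel_fun" unfolding Gam_def by measurable
  have s: "sqrt k \<le> k ^ 3"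
  proof -
    have "sqrt k \<le> k" using k by (intro real_le_lsqrt) (auto simp: power2_eq_square)
    also have "... \<le> k ^ 3" using k by (simp add: self_le_power)
    finally show ?thesis .
  qed
  have Ga: "norm (Gam L0 k v) \<le> 1 / sqrt k * (1 / sqrt (norm v))" if "v \<noteq> 0" for v
    using Gam_decay[OF L0_ge k that] by (simp add: real_sqrt_mult)
  have E: "Gk L0 (of_real k) v = Gam L0 k v + err L0 (of_real k) (norm v)" "norm (err L0 (of_real k) (norm v)) \<le> 160000 / k ^ 3" if "norm v \<le> 2 * \<rho>" for v
  proof -
    have l: "2 * norm v \<le> L0" using that by (simp add: L0_def)
    show "Gk L0 (of_real k) v = Gam L0 k v + err L0 (of_real k) (norm v)" by (rule Gk_near[OF l])
    show "norm (err L0 (of_real k) (norm v)) \<le> 160000 / k ^ 3"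
      using err_bound[OF L0_ge norm_ge_zero l, of "of_real k"] k by simp
  qed
  have sq0: "0 \<le> 1 / sqrt (norm v)" for v :: plane by simp
  have sk0: "0 \<le> 1 / sqrt k" using k by simp
  have lin: "t + 160000 \<le> 160001 * (t + 1)" "t \<le> 160001 * (t + 1)" if "0 \<le> t" for t :: real using that by auto
  have kk: "160000 / k ^ 3 \<le> 160000 / sqrt k" using s k by (intro divide_left_mono) auto
  show "sing_kernel (160001 / sqrt k) (Gk L0 (of_real k))"
    unfolding sing_kernel_def
  proof (intro conjI allI impI mG)
    fix v :: plane assume v: "v \<noteq> 0" "norm v \<le> 2 * \<rho>"
    have "norm (Gk L0 (of_real k) v) \<le> 1 / sqrt k * (1 / sqrt (norm v)) + 160000 / sqrt k"
      unfolding E(1)[OF v(2)] using Ga[OF v(1)] E(2)[OF v(2)] kk by (intro order_trans[OF norm_triangle_ineq] add_mono) auto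
    also have "... = 1 / sqrt k * (1 / sqrt (norm v) + 160000)" by (simp add: distrib_left)
    also have "... \<le> 1 / sqrt k * (160001 * (1 / sqrt (norm v) + 1))" by (intro mult_left_mono lin sq0 sk0)
    finally show "norm (Gk L0 (of_real k) v) \<le> 160001 / sqrt k * (1 / sqrt (norm v) + 1)" by simp
  qed (use k in auto)
  show "sing_kernel (160001 / sqrt k) (Gam L0 k)"
    unfolding sing_kernel_def
  proof (intro conjI allI impI mGa)
    fix v :: plane assume v: "v \<noteq> 0" "norm v \<le> 2 * \<rho>"
    have "norm (Gam L0 k v) \<le> 1 / sqrt k * (1 / sqrt (norm v))" by (rule Ga[OF v(1)])
    also have "... \<le> 1 / sqrt k * (160001 * (1 / sqrt (norm v) + 1))" by (intro mult_left_mono lin sq0 sk0)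
    finally show "norm (Gam L0 k v) \<le> 160001 / sqrt k * (1 / sqrt (norm v) + 1)" by simp
  qed (use k in auto)
  show "sing_kernel (160000 / k ^ 3) (\<lambda>v. Gk L0 (of_real k) v - Gam L0 k v)"
    unfolding sing_kernel_def
  proof (intro conjI allI impI)
    show "(\<lambda>v. Gk L0 (of_real k) v - Gam L0 k v) \<in> borel_fun" using mG mGa by measurable
    fix v :: plane assume v: "v \<noteq> 0" "norm v \<le> 2 * \<rho>"
    have "norm (Gk L0 (of_real k) v - Gam L0 k v) \<le> 160000 / k ^ 3 * 1" using E[OF v(2)] by simp
    also have "... \<le> 160000 / k ^ 3 * (1 / sqrt (norm v) + 1)" using k by (intro mult_left_mono) auto
    finally show "norm (Gk L0 (of_real k) v - Gam L0 k v) \<le> 160000 / k ^ 3 * (1 / sqrt (norm v) + 1)" .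
  qed (use k in auto)
qed

definition wv :: "plane \<Rightarrow> cfun" where "wv kv x = ep kv x"

lemma wv_measurable [measurable (raw)]:
  assumes [measurable]: "f \<in> borel_measurable M" "g \<in> borel_measurable M"
  shows "(\<lambda>x. wv (f x) (g x)) \<in> borel_measurable M"
  unfolding wv_def by measurable

lemma norm_wv [simp]: "norm (wv kv x) = 1" by (simp add: wv_def)

abbreviation Gw :: "plane \<Rightarrow> cfun" where "Gw kv \<equiv> Gk L0 (of_real (norm kv))"

text \<open>The unknown \<open>f\<close> stands for \<open>q u\<close>, where \<open>u\<close> is the scattering solution.\<close>

definition solves :: "plane \<Rightarrow> cfun \<Rightarrow> bool" where
  "solves kv f \<longleftrightarrow> sup_ball f \<and> (AE x in lborel. f x = q x * wv kv x + Tq (Gw kv) f x)"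

text \<open>The contraction constant of the integral equation in L^1.\<close>

definition \<beta> :: "plane \<Rightarrow> real" where "\<beta> kv = Cb / sqrt (norm kv)"

lemma beta_nonneg: "0 \<le> \<beta> kv" using Cq_nonneg by (simp add: \<beta>_def Cb_def)

lemma Gw_op:
  assumes k: "norm kv \<ge> 1" and f: "sup_ball f"
  shows "sup_ball (Tq (Gw kv) f)" "(LBINT x. norm (Tq (Gw kv) f x)) \<le> \<beta> kv * (LBINT y. norm (f y))"
    "(LBINT x. norm (Tq (Gam L0 (norm kv)) f x)) \<le> \<beta> kv * (LBINT y. norm (f y))" "sup_ball (Tq (Gam L0 (norm kv)) f)"
  using Tq_facts[OF Gk_sing(1)[OF k] f] Tq_facts[OF Gk_sing(2)[OF k] f] by (auto simp: \<beta>_def Cb_def)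

lemma qwv_sup: "sup_ball (\<lambda>x. q x * wv kv x)" "(LBINT x. norm (q x * wv kv x)) = N1"
proof -
  have "L1 (\<lambda>x. q x * wv kv x)"
    by (rule L1_bound[OF q_int]) (auto simp: norm_mult)
  moreover have "AE x in lborel. norm x \<le> \<rho> \<or> q x * wv kv x = 0" using q_supp by eventually_elim auto
  ultimately show "sup_ball (\<lambda>x. q x * wv kv x)" by (simp add: sup_ball_def)
  show "(LBINT x. norm (q x * wv kv x)) = N1" by (simp add: N1_def norm_mult)
qed

lemma sup_ball_measurable: "sup_ball f \<Longrightarrow> f \<in> borel_fun" by (auto simp: sup_ball_def)

lemma sup_ball_integrable: "sup_ball f \<Longrightarrow> L1 f" by (auto simp: sup_ball_def)

primrec fs :: "plane \<Rightarrow> nat \<Rightarrow> cfun" where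
  "fs kv 0 = (\<lambda>x. q x * wv kv x)"
| "fs kv (Suc j) = Tq (Gw kv) (fs kv j)"

lemma fs_facts:
  assumes k: "norm kv \<ge> 1"
  shows "sup_ball (fs kv j)" "(LBINT x. norm (fs kv j x)) \<le> \<beta> kv ^ j * N1"
proof -
  have "sup_ball (fs kv j) \<and> (LBINT x. norm (fs kv j x)) \<le> \<beta> kv ^ j * N1"
  proof (induction j)
    case 0 show ?case using qwv_sup by simp
  next
    case (Suc j)
    then have s: "sup_ball (fs kv j)" and le: "(LBINT x. norm (fs kv j x)) \<le> \<beta> kv ^ j * N1" by auto
    show ?case using Gw_op(1,2)[OF k s] mult_left_mono[OF le beta_nonneg[of kv]] by simp
  qed
  then show "sup_ball (fs kv j)" "(LBINT x. norm (fs kv j x)) \<le> \<beta> kv ^ j * N1" by auto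
qed

text \<open>Stated for an arbitrary solution rather than for the sum of the series, because the
  amplitude is built from a solution picked by \<open>SOME\<close>. Absorbing half of the norm gives
  the a priori bound \<open>2 * N1\<close>; each application of the operator then contributes a
  factor \<open>\<beta> kv\<close>.\<close>

lemma solves_remainder:
  assumes k: "norm kv \<ge> 1" "\<beta> kv \<le> 1 / 2" and f: "solves kv f"
  shows "sup_ball (\<lambda>x. f x - (\<Sum>j<n. fs kv j x))" "(LBINT x. norm (f x - (\<Sum>j<n. fs kv j x))) \<le> \<beta> kv ^ n * (2 * N1)"
proof -
  have fS: "sup_ball f" and fe: "AE x in lborel. f x = q x * wv kv x + Tq (Gw kv) f x" using f by (auto simp: solves_def)
  have f2: "(LBINT x. norm (f x)) \<le> 2 * N1"
  proof -
    note op = Gw_op[OF k(1) fS]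
    have "(LBINT x. norm (f x)) = (LBINT x. norm (q x * wv kv x + Tq (Gw kv) f x))"
      using fe sup_ball_measurable[OF fS] sup_ball_measurable[OF op(1)] by (intro integral_cong_AE) (auto elim: eventually_mono)
    also have "... \<le> (LBINT x. norm (q x * wv kv x) + norm (Tq (Gw kv) f x))"
      using sup_ball_integrable[OF op(1)] sup_ball_integrable[OF qwv_sup(1)[of kv]]
      by (intro integral_mono) (auto intro: norm_triangle_ineq)
    also have "... = N1 + (LBINT x. norm (Tq (Gw kv) f x))"
      using sup_ball_integrable[OF op(1)] sup_ball_integrable[OF qwv_sup(1)[of kv]] qwv_sup(2)[of kv] by simp
    also have "... \<le> N1 + 1 / 2 * (LBINT x. norm (f x))"
      using op(2) k mult_right_mono[OF k(2), of "LBINT x. norm (f x)"] by simp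
    finally show ?thesis by simp
  qed
  \<comment> \<open>The third conjunct, the equation linking consecutive remainders, is what the
    induction step consumes.\<close>
  have "sup_ball (\<lambda>x. f x - (\<Sum>j<n. fs kv j x)) \<and> (LBINT x. norm (f x - (\<Sum>j<n. fs kv j x))) \<le> \<beta> kv ^ n * (2 * N1)
     \<and> (AE x in lborel. Tq (Gw kv) (\<lambda>x. f x - (\<Sum>j<n. fs kv j x)) x = f x - (\<Sum>j<Suc n. fs kv j x))"
  proof (induction n)
    case 0
    have "AE x in lborel. Tq (Gw kv) f x = f x - q x * wv kv x" using fe by eventually_elim simp
    then show ?case using fS f2 by simp
  next
    case (Suc n)
    define r where "r x = f x - (\<Sum>j<n. fs kv j x)" for x
    define r' where "r' x = f x - (\<Sum>j<Suc n. fs kv j x)" for x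
    have r: "sup_ball r" "(LBINT x. norm (r x)) \<le> \<beta> kv ^ n * (2 * N1)" "AE x in lborel. Tq (Gw kv) r x = r' x"
      using Suc unfolding r_def[abs_def] r'_def by blast+
    have r'_eq: "r' = (\<lambda>x. r x - fs kv n x)" by (simp add: r'_def r_def fun_eq_iff)
    have r's: "sup_ball r'" unfolding r'_eq by (intro sup_ball_diff r fs_facts k)
    have "(LBINT x. norm (r' x)) = (LBINT x. norm (Tq (Gw kv) r x))"
      using r(3) sup_ball_measurable[OF r's] sup_ball_measurable[OF Gw_op(1)[OF k(1) r(1)]] by (intro integral_cong_AE) (auto elim: eventually_mono)
    also have "... \<le> \<beta> kv * (LBINT x. norm (r x))" by (rule Gw_op(2)[OF k(1) r(1)])
    also have "... \<le> \<beta> kv * (\<beta> kv ^ n * (2 * N1))" by (intro mult_left_mono r beta_nonneg)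
    finally have le: "(LBINT x. norm (r' x)) \<le> \<beta> kv ^ Suc n * (2 * N1)" by simp
    have "AE x in lborel. Tq (Gw kv) r' x = r' x - fs kv (Suc n) x"
      using Tq_diff[OF Gk_sing(1)[OF k(1)] r(1) fs_facts(1)[OF k(1), of n]] r(3)
      by eventually_elim (simp add: r'_eq)
    then have "AE x in lborel. Tq (Gw kv) r' x = f x - (\<Sum>j<Suc (Suc n). fs kv j x)"
      by eventually_elim (simp add: r'_def)
    then show ?case using le r's by (simp add: r'_def[abs_def])
  qed
  then show "sup_ball (\<lambda>x. f x - (\<Sum>j<n. fs kv j x))" "(LBINT x. norm (f x - (\<Sum>j<n. fs kv j x))) \<le> \<beta> kv ^ n * (2 * N1)" by auto
qed

text \<open>The Neumann series converges in L^1 and almost everywhere. The defect \<open>D\<close>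
  of its sum in the equation is bounded by distances to the partial sums, and these tend to
  0.\<close>

lemma solves_exists:
  assumes k: "norm kv \<ge> 1" "\<beta> kv \<le> 1 / 2"
  shows "\<exists>f. solves kv f"
proof -
  note [measurable] = sup_ball_measurable[OF fs_facts(1)[OF k(1)]]
  have i: "L1 (fs kv j)" for j by (rule sup_ball_integrable[OF fs_facts(1)[OF k(1)]])
  have sn: "summable (\<lambda>j. LBINT x. norm (fs kv j x))"
  proof (rule summable_comparison_test')
    show "summable (\<lambda>j. (1 / 2) ^ j * N1)" by (intro summable_mult2 summable_geometric) auto
    show "norm (LBINT x. norm (fs kv j x)) \<le> (1 / 2) ^ j * N1" for j
    proof -
      have "\<beta> kv ^ j * N1 \<le> (1 / 2) ^ j * N1" using k(2) beta_nonneg N1_nonneg by (intro mult_right_mono power_mono) auto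
      then show ?thesis using fs_facts(2)[OF k(1), of j] by simp
    qed
  qed
  have sA: "AE x in lborel. summable (\<lambda>j. norm (fs kv j x))"
  proof -
    have "(NN x. (\<Sum>j. en (norm (fs kv j x)))) = (\<Sum>j. NN x. en (norm (fs kv j x)))"
      by (rule nn_integral_suminf) measurable
    also have "... = (\<Sum>j. en (LBINT x. norm (fs kv j x)))"
      using i by (simp add: nn_integral_eq_integral)
    also have "... = en (\<Sum>j. LBINT x. norm (fs kv j x))"
      by (rule suminf_ennreal2[OF _ sn]) simp
    finally have "(NN x. (\<Sum>j. en (norm (fs kv j x)))) \<noteq> \<infinity>" by simp
    then have "AE x in lborel. (\<Sum>j. en (norm (fs kv j x))) \<noteq> \<infinity>" by (intro nn_integral_PInf_AE) measurable
    then show ?thesis by eventually_elim (intro summable_suminf_not_top, auto)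
  qed
  define f where "f x = (\<Sum>j. fs kv j x)" for x
  have fi: "L1 f" unfolding f_def by (rule integrable_suminf[OF i sA sn])
  have fS: "sup_ball f"
  proof -
    have "AE x in lborel. \<forall>j. norm x \<le> \<rho> \<or> fs kv j x = 0"
      by (rule AE_all_countable[THEN iffD2]) (use fs_facts(1)[OF k(1)] in \<open>auto simp: sup_ball_def\<close>)
    then have "AE x in lborel. norm x \<le> \<rho> \<or> f x = 0" by eventually_elim (auto simp: f_def)
    then show ?thesis using fi by (simp add: sup_ball_def)
  qed
  define S where "S n x = (\<Sum>j<n. fs kv j x)" for n x
  have Ssup: "sup_ball (S n)" for n
  proof (induction n)
    case 0 then show ?case by (simp add: S_def sup_ball_def)
  next
    case (Suc n)
    have "sup_ball (\<lambda>x. 0 - fs kv n x)" by (intro sup_ball_diff fs_facts k) (simp add: sup_ball_def)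
    from sup_ball_diff[OF Suc this] show ?case by (simp add: S_def[abs_def])
  qed
  have STq: "AE x in lborel. S (Suc n) x = q x * wv kv x + Tq (Gw kv) (S n) x" for n
  proof (induction n)
    case 0 show ?case by (simp add: S_def Tq_def conv_def)
  next
    case (Suc n)
    have e: "S (Suc n) = (\<lambda>x. S n x - (0 - fs kv n x))" by (simp add: S_def fun_eq_iff)
    have z: "sup_ball (\<lambda>x. 0 - fs kv n x)" by (intro sup_ball_diff fs_facts k) (simp add: sup_ball_def)
    have "Tq (Gw kv) (\<lambda>x. 0 - fs kv n x) x = - Tq (Gw kv) (fs kv n) x" for x by (simp add: Tq_def conv_def)
    then have m: "AE x in lborel. Tq (Gw kv) (\<lambda>x. 0 - fs kv n x) x = - Tq (Gw kv) (fs kv n) x" by simp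
    show ?case using Suc Tq_diff[OF Gk_sing(1)[OF k(1)] Ssup[of n] z] m
    proof eventually_elim
      case (elim x)
      have "S (Suc (Suc n)) x = S (Suc n) x + fs kv (Suc n) x" by (simp add: S_def)
      also have "S (Suc n) x = q x * wv kv x + Tq (Gw kv) (S n) x" by (rule elim(1))
      finally show ?case using elim(2)[folded e] unfolding elim(3) by (simp add: algebra_simps)
    qed
  qed
  have d: "(\<lambda>n. LBINT x. norm (f x - S n x)) \<longlonglongrightarrow> (LINT x|(lborel :: plane measure). 0)"
  proof (rule integral_dominated_convergence)
    show "L1 (\<lambda>x. \<Sum>j. norm (fs kv j x))"
      using sA sn i by (intro integrable_suminf) auto
    show "AE x in lborel. (\<lambda>n. norm (f x - S n x)) \<longlonglongrightarrow> 0"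
      using sA
    proof eventually_elim
      case (elim x)
      have "(\<lambda>n. S n x) \<longlonglongrightarrow> f x" unfolding S_def f_def by (intro summable_LIMSEQ summable_norm_cancel[OF elim])
      then have "(\<lambda>n. f x - S n x) \<longlonglongrightarrow> f x - f x" by (intro tendsto_intros)
      then show ?case by (intro tendsto_norm_zero) simp
    qed
    show "AE x in lborel. norm (norm (f x - S n x)) \<le> (\<Sum>j. norm (fs kv j x))" for n
      using sA
    proof eventually_elim
      case (elim x)
      have "f x - S n x = (\<Sum>j. fs kv (j + n) x)" unfolding f_def S_def
        using suminf_minus_initial_segment[OF summable_norm_cancel[OF elim], of n] by simp
      also have "norm ... \<le> (\<Sum>j. norm (fs kv (j + n) x))" by (rule summable_norm) (use elim in \<open>simp add: summable_iff_shift[of "\<lambda>j. norm (fs kv j x)"]\<close>)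
      also have "... = (\<Sum>j. norm (fs kv j x)) - (\<Sum>j<n. norm (fs kv j x))" by (rule suminf_minus_initial_segment[OF elim])
      also have "... \<le> (\<Sum>j. norm (fs kv j x))" by (simp add: sum_nonneg)
      finally show ?case by simp
    qed
  qed (use sup_ball_measurable[OF fS] sup_ball_measurable[OF Ssup] in auto)
  define D where "D = (LBINT x. norm (f x - (q x * wv kv x + Tq (Gw kv) f x)))"
  note fT = Gw_op(1)[OF k(1) fS]
  note [measurable] = sup_ball_measurable[OF fS] sup_ball_measurable[OF Ssup] sup_ball_measurable[OF fT]
  have iD: "L1 (\<lambda>x. f x - (q x * wv kv x + Tq (Gw kv) f x))"
    using fi sup_ball_integrable[OF qwv_sup(1)[of kv]] sup_ball_integrable[OF fT] by auto
  have Dle: "D \<le> (LBINT x. norm (f x - S (Suc n) x)) + 1 / 2 * (LBINT x. norm (f x - S n x))" for n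
  proof -
    have s: "sup_ball (\<lambda>x. f x - S n x)" by (rule sup_ball_diff[OF fS Ssup])
    note op = Gw_op(1,2)[OF k(1) s]
    have i1: "L1 (\<lambda>x. f x - S (Suc n) x)" by (rule sup_ball_integrable[OF sup_ball_diff[OF fS Ssup]])
    have "D \<le> (LBINT x. norm (f x - S (Suc n) x) + norm (Tq (Gw kv) (\<lambda>x. f x - S n x) x))"
      unfolding D_def
    proof (rule integral_mono_AE)
      show "AE x in lborel. norm (f x - (q x * wv kv x + Tq (Gw kv) f x)) \<le> norm (f x - S (Suc n) x) + norm (Tq (Gw kv) (\<lambda>x. f x - S n x) x)"
        using STq[of n] Tq_diff[OF Gk_sing(1)[OF k(1)] fS Ssup[of n]]
      proof eventually_elim
        case (elim x)
        have "f x - (q x * wv kv x + Tq (Gw kv) f x) = (f x - S (Suc n) x) - Tq (Gw kv) (\<lambda>x. f x - S n x) x"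
          unfolding elim(1) elim(2)[symmetric] by simp
        then show ?case by (simp only: norm_triangle_ineq4)
      qed
    qed (use iD i1 sup_ball_integrable[OF op(1)] in auto)
    also have "... = (LBINT x. norm (f x - S (Suc n) x)) + (LBINT x. norm (Tq (Gw kv) (\<lambda>x. f x - S n x) x))"
      using i1 sup_ball_integrable[OF op(1)] by simp
    also have "(LBINT x. norm (Tq (Gw kv) (\<lambda>x. f x - S n x) x)) \<le> \<beta> kv * (LBINT x. norm (f x - S n x))" by (rule op(2))
    also have "... \<le> 1 / 2 * (LBINT x. norm (f x - S n x))" using k(2) by (intro mult_right_mono) auto
    finally show ?thesis by simp
  qed
  have "(\<lambda>n. (LBINT x. norm (f x - S (Suc n) x)) + 1 / 2 * (LBINT x. norm (f x - S n x))) \<longlonglongrightarrow> 0 + 1 / 2 * 0"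
    using tendsto_add[OF LIMSEQ_Suc[OF d] tendsto_mult[OF tendsto_const[of "1 / 2"] d]] by simp
  from LIMSEQ_le_const[OF this, of D] have "D \<le> 0" using Dle by auto
  then have "D = 0" unfolding D_def by (intro antisym) simp_all
  then have "AE x in lborel. norm (f x - (q x * wv kv x + Tq (Gw kv) f x)) = 0"
    unfolding D_def using iD by (subst (asm) integral_nonneg_eq_0_iff_AE) auto
  then have "AE x in lborel. f x = q x * wv kv x + Tq (Gw kv) f x" by eventually_elim simp
  then show ?thesis using fS by (auto simp: solves_def)
qed

end

section \<open>Equivalence with the Lippmann-Schwinger equation, and the amplitude\<close>

lemma integrable_weight_mono:
  fixes h :: "cfun"
  assumes i: "L1 (\<lambda>x. h x / of_real (jb x ^ m))" and m: "m \<le> n" and h: "h \<in> borel_fun"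
  shows "L1 (\<lambda>x. h x / of_real (jb x ^ n))"
proof (rule L1_bound[OF i], use h in measurable, rule AE_I2)
  fix x :: plane
  have "jb x ^ m \<le> jb x ^ n" using m by (intro power_increasing) auto
  then have "norm (h x) / jb x ^ n \<le> norm (h x) / jb x ^ m"
    by (intro divide_left_mono mult_pos_pos zero_less_power add_pos_nonneg) auto
  then show "norm (h x / complex_of_real (jb x ^ n)) \<le> norm (h x / complex_of_real (jb x ^ m))"
    by (simp add: norm_divide norm_power abs_of_nonneg del: of_real_power of_real_add)
qed

context potential begin

lemma wv_weight: "3 \<le> n \<Longrightarrow> L1 (\<lambda>x. wv kv x / of_real (jb x ^ n))"
proof (erule integrable_weight_mono[rotated])
  show "L1 (\<lambda>x. wv kv x / complex_of_real (jb x ^ 3))"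
    by (rule L1_bound[OF integrable_inverse_cube[of 1]])
      (auto simp: norm_divide norm_power abs_of_nonneg simp del: of_real_power of_real_add)
qed measurable

lemma wv_mult_integrable: "L1 h \<Longrightarrow> L1 (\<lambda>x. wv kv x * h x)"
  by (rule L1_bound) (auto simp: norm_mult)

lemma plane_wave_sgn: "plane_wave (sgn kv) (norm kv) = wv kv"
proof
  fix x
  have "norm kv * (x \<bullet> sgn kv) = kv \<bullet> x"
    by (cases "kv = 0") (auto simp: sgn_div_norm inner_commute)
  then show "plane_wave (sgn kv) (norm kv) x = wv kv x" by (simp only: plane_wave_def wv_def)
qed

text \<open>\<open>f\<close> knows \<open>u\<close> only on the support of \<open>q\<close>; the
  right-hand side of the equation defines \<open>u\<close> everywhere.\<close>

lemma scattering_of_solves: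
  assumes k: "norm kv \<ge> 1" and f: "solves kv f"
  shows "\<exists>u. is_scattering_solution q (sgn kv) (norm kv) u"
proof -
  have fS: "sup_ball f" and fe: "AE x in lborel. f x = q x * wv kv x + Tq (Gw kv) f x" using f by (auto simp: solves_def)
  note [measurable] = sup_ball_measurable[OF fS]
  have fi: "L1 f" and fs: "AE x in lborel. norm x \<le> \<rho> \<or> f x = 0" using fS by (auto simp: sup_ball_def)
  have [measurable]: "Gw kv \<in> borel_fun" by measurable
  define u where "u x = wv kv x + conv (Gw kv) f x" for x
  have um [measurable]: "u \<in> borel_fun" unfolding u_def[abs_def] by measurable
  have qu: "AE x in lborel. q x * u x = f x" using fe by eventually_elim (simp add: u_def Tq_def distrib_left)
  have "L1 (\<lambda>x. u x / of_real (jb x ^ 7))"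
    unfolding u_def add_divide_distrib
    by (intro L1_add wv_weight tempered_function_conv[OF L0_ge fi fs k]) simp
  then have tu: "tempered_function u" unfolding tempered_function_def using um by auto
  have iqu: "L1 (\<lambda>x. q x * u x)" by (rule integrable_cong_AE_imp[OF fi]) (use qu in \<open>auto elim: eventually_mono\<close>)
  have "distribution_of u \<phi> = distribution_of (plane_wave (sgn kv) (norm kv)) \<phi> + outgoing_resolvent (norm kv) (\<lambda>x. q x * u x) \<phi>"
    if \<phi>: "\<phi> \<in> schwartz" for \<phi>
  proof -
    note s = schwartz_facts[OF \<phi>]
    have [measurable]: "\<phi> \<in> borel_fun" using s(2) by (rule borel_measurable_continuous_onI)
    obtain M where M: "\<And>x. norm (\<phi> x) \<le> M / jb x ^ 7" using s(3)[of 7] by auto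
    have z: "Im (of_real (norm kv)) \<ge> 0" "norm (of_real (norm kv) :: complex) \<ge> 1" using k by auto
    have "fourier (\<lambda>x. q x * u x) = fourier f" by (rule fourier_cong_AE[OF qu]) measurable
    then have "outgoing_resolvent (norm kv) (\<lambda>x. q x * u x) \<phi> = outgoing_resolvent (norm kv) f \<phi>" by (simp add: outgoing_resolvent_def)
    also have "... = (LBINT x. conv (Gw kv) f x * \<phi> x)" by (rule outgoing_resolvent_eq[OF L0_ge fi fs \<phi> k])
    finally have 1: "outgoing_resolvent (norm kv) (\<lambda>x. q x * u x) \<phi> = (LBINT x. conv (Gw kv) f x * \<phi> x)" .
    have "L1 (\<lambda>x. conv (Gw kv) f x * \<phi> x)"
      by (rule conv_Gk_integrable(1)[OF L0_ge fi fs _ M z]) measurable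
    then show ?thesis unfolding 1 plane_wave_sgn distribution_of_def
      unfolding u_def distrib_right using wv_mult_integrable[OF s(1)] by (intro LB_add)
  qed
  then show ?thesis using tu iqu unfolding is_scattering_solution_def by blast
qed

text \<open>The distributional equation becomes a pointwise one because the defect \<open>w\<close>
  is tempered and annihilated by all Schwartz functions.\<close>

lemma solves_of_scattering:
  assumes k: "norm kv \<ge> 1" and u: "is_scattering_solution q (sgn kv) (norm kv) u"
  shows "solves kv (\<lambda>x. q x * u x)"
proof -
  define f where "f x = q x * u x" for x
  have tu: "tempered_function u" and fi: "L1 f" using u by (auto simp: is_scattering_solution_def f_def[abs_def])
  have eq: "distribution_of u \<phi> = distribution_of (wv kv) \<phi> + outgoing_resolvent (norm kv) f \<phi>" if "\<phi> \<in> schwartz" for \<phi>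
    using u that unfolding is_scattering_solution_def plane_wave_sgn f_def by blast
  have fs: "AE x in lborel. norm x \<le> \<rho> \<or> f x = 0" using q_supp by eventually_elim (auto simp: f_def)
  have [measurable]: "f \<in> borel_fun" using fi by auto
  have [measurable]: "u \<in> borel_fun" using tu by (simp add: tempered_function_def)
  have [measurable]: "Gw kv \<in> borel_fun" by measurable
  obtain N where N: "L1 (\<lambda>x. u x / of_real (jb x ^ N))" using tu by (auto simp: tempered_function_def)
  \<comment> \<open>Large enough for the three terms of \<open>w\<close>: \<open>N\<close> for
    \<open>u\<close>, 3 for the plane wave, 7 for the convolution.\<close>
  define n where "n = max N 7"
  have nN: "N \<le> n" "7 \<le> n" "3 \<le> n" by (auto simp: n_def)
  define w where "w x = u x - wv kv x - conv (Gw kv) f x" for x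
  have "AE x in lborel. w x = 0"
  proof (rule AE_zero_of_schwartz)
    show "w \<in> borel_fun" unfolding w_def[abs_def] by measurable
    show "L1 (\<lambda>x. w x / of_real (jb x ^ n))"
      unfolding w_def diff_divide_distrib
      by (intro L1_diff wv_weight nN integrable_weight_mono[OF N nN(1)] integrable_weight_mono[OF tempered_function_conv[OF L0_ge fi fs k] nN(2)]) measurable
    fix \<phi> :: "cfun" assume \<phi>: "\<phi> \<in> schwartz"
    note s = schwartz_facts[OF \<phi>]
    have [measurable]: "\<phi> \<in> borel_fun" using s(2) by (rule borel_measurable_continuous_onI)
    obtain M where M: "\<And>x. norm (\<phi> x) \<le> M / jb x ^ 7" using s(3)[of 7] by auto
    obtain M' where M': "\<And>x. norm (\<phi> x) \<le> M' / jb x ^ N" using s(3)[of N] by auto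
    have z: "Im (of_real (norm kv)) \<ge> 0" "norm (of_real (norm kv) :: complex) \<ge> 1" using k by auto
    have i2: "L1 (\<lambda>x. conv (Gw kv) f x * \<phi> x)"
      by (rule conv_Gk_integrable(1)[OF L0_ge fi fs _ M z]) measurable
    have i3: "L1 (\<lambda>x. u x * \<phi> x)"
    proof (rule L1_bound[OF integrable_mult_right[OF N, of "of_real M'"]])
      show "AE x in lborel. norm (u x * \<phi> x) \<le> norm (complex_of_real M' * (u x / complex_of_real (jb x ^ N)))"
      proof (rule AE_I2)
        fix x :: plane
        have "0 \<le> M' / jb x ^ N" using M'[of x] norm_ge_zero[of "\<phi> x"] by linarith
        then have "norm (\<phi> x) \<le> \<bar>M'\<bar> / jb x ^ N" using M'[of x] by (smt (verit) divide_right_mono abs_ge_self zero_le_power norm_ge_zero)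
        then have "norm (u x) * norm (\<phi> x) \<le> norm (u x) * (\<bar>M'\<bar> / jb x ^ N)" by (intro mult_left_mono) auto
        then show "norm (u x * \<phi> x) \<le> norm (complex_of_real M' * (u x / complex_of_real (jb x ^ N)))"
          by (simp add: norm_mult norm_divide norm_power abs_of_nonneg mult_ac del: of_real_power of_real_add)
      qed
    qed measurable
    have "(LBINT x. w x * \<phi> x) = (LBINT x. u x * \<phi> x) - (LBINT x. wv kv x * \<phi> x) - (LBINT x. conv (Gw kv) f x * \<phi> x)"
      unfolding w_def left_diff_distrib using wv_mult_integrable[OF s(1)] i2 i3 by simp
    also have "(LBINT x. conv (Gw kv) f x * \<phi> x) = outgoing_resolvent (norm kv) f \<phi>" by (rule outgoing_resolvent_eq[OF L0_ge fi fs \<phi> k, symmetric])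
    finally show "(LBINT x. w x * \<phi> x) = 0" using eq[OF \<phi>] by (simp add: distribution_of_def)
  qed
  then have "AE x in lborel. f x = q x * wv kv x + Tq (Gw kv) f x"
  proof eventually_elim
    case (elim x)
    then have "u x = wv kv x + conv (Gw kv) f x" by (simp add: w_def algebra_simps)
    then show ?case by (simp add: f_def[of x] Tq_def distrib_left)
  qed
  then show ?thesis using fi fs unfolding solves_def sup_ball_def f_def[abs_def] by blast
qed

text \<open>The backscattering amplitude as a function of the vector \<open>kv\<close> of length k
  in the direction \<theta>. In the Born approximation it is the value of the transform at
  \<open>- 2 *\<^sub>R kv\<close>.\<close>

definition amp :: "cfun" where
  "amp kv = scattering_amplitude q (- sgn kv) (sgn kv) (norm kv)"

text \<open>Existence guarantees that \<open>SOME\<close> picks a genuine solution, and the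
  remainder estimate covers whichever one is picked.\<close>

lemma amp_remainder:
  assumes k: "norm kv \<ge> 1" "\<beta> kv \<le> 1 / 2"
  shows "norm (amp kv - (\<Sum>j<n. LBINT y. wv kv y * fs kv j y)) \<le> \<beta> kv ^ n * (2 * N1)"
proof -
  define u where "u = scattering_solution q (sgn kv) (norm kv)"
  have "is_scattering_solution q (sgn kv) (norm kv) u"
    using scattering_of_solves[OF k(1)] solves_exists[OF k] unfolding u_def scattering_solution_def by (metis someI_ex)
  then have s: "solves kv (\<lambda>x. q x * u x)" by (rule solves_of_scattering[OF k(1)])
  define f where "f x = q x * u x" for x
  have s: "solves kv f" using s by (simp add: f_def[abs_def])
  have A: "amp kv = (LBINT y. wv kv y * f y)"
    unfolding amp_def scattering_amplitude_def f_def u_def[symmetric] plane_wave_sgn[symmetric] plane_wave_def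
    by (intro LB_cong refl) (simp add: inner_commute mult.assoc)
  note ft = wv_mult_integrable[OF sup_ball_integrable]
  note r = solves_remainder[OF k s, of n]
  have fS: "sup_ball f" using s by (simp add: solves_def)
  have "amp kv - (\<Sum>j<n. LBINT y. wv kv y * fs kv j y) = (LBINT y. wv kv y * (f y - (\<Sum>j<n. fs kv j y)))"
    unfolding A right_diff_distrib sum_distrib_left using ft[OF fS] ft[OF fs_facts(1)[OF k(1)]] by simp
  also have "norm ... \<le> (LBINT y. norm (wv kv y * (f y - (\<Sum>j<n. fs kv j y))))" by (rule integral_norm_bound)
  also have "... = (LBINT y. norm (f y - (\<Sum>j<n. fs kv j y)))" by (simp add: norm_mult)
  also have "... \<le> \<beta> kv ^ n * (2 * N1)" by (rule r(2))
  finally show ?thesis .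
qed

text \<open>Joint measurability is what passes through the induction, since the kernel depends on
  \<open>kv\<close> through its frequency.\<close>

lemma fs_measurable_pair: "(\<lambda>p. fs (fst p) j (snd p)) \<in> borel_measurable (borel \<Otimes>\<^sub>M borel)"
proof (induction j)
  case 0 show ?case by simp
next
  case (Suc j)
  let ?M = "(borel \<Otimes>\<^sub>M borel) \<Otimes>\<^sub>M lborel :: ((plane \<times> plane) \<times> plane) measure"
  have a: "(\<lambda>w. (fst (fst w), snd w)) \<in> measurable ?M (borel \<Otimes>\<^sub>M borel)" by measurable
  have b: "(\<lambda>w. fs (fst (fst w)) j (snd w)) \<in> borel_measurable ?M"
    using measurable_compose[OF a Suc] by simp
  have c: "(\<lambda>w. Gk L0 (of_real (norm (fst (fst w)))) (snd (fst w) - snd w)) \<in> borel_measurable ?M"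
    by measurable
  have "(\<lambda>w. Gk L0 (of_real (norm (fst (fst w)))) (snd (fst w) - snd w) * fs (fst (fst w)) j (snd w)) \<in> borel_measurable ?M"
    using c b by (rule borel_measurable_times)
  then have "(\<lambda>p. LBINT y. Gk L0 (of_real (norm (fst p))) (snd p - y) * fs (fst p) j y) \<in> borel_measurable (borel \<Otimes>\<^sub>M borel)"
    by (intro lborel.borel_measurable_lebesgue_integral) (simp add: split_beta')
  moreover have "(\<lambda>p. q (snd p)) \<in> borel_measurable (borel \<Otimes>\<^sub>M borel)" by measurable
  ultimately show ?case unfolding fs.simps Tq_def conv_def by (intro borel_measurable_times)
qed

text \<open>The solution is chosen separately for every \<open>kv\<close>, so measurability cannot
  be read off the definition; it is inherited from the partial sums, which converge to
  \<open>amp\<close>.\<close>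

lemma amp_measurable:
  assumes K: "\<And>kv. norm kv \<ge> K \<Longrightarrow> norm kv \<ge> 1 \<and> \<beta> kv \<le> 1 / 2"
  shows "(\<lambda>kv. if norm kv \<ge> K then amp kv else 0) \<in> borel_fun"
proof (rule borel_measurable_LIMSEQ_metric)
  fix n
  have "(\<lambda>kv. LBINT y. wv kv y * fs kv j y) \<in> borel_fun" for j
  proof (rule lborel.borel_measurable_lebesgue_integral)
    have "(\<lambda>p. wv (fst p) (snd p) * fs (fst p) j (snd p)) \<in> borel_measurable (borel \<Otimes>\<^sub>M borel)"
      using fs_measurable_pair[of j] by (intro borel_measurable_times wv_measurable) auto
    then show "(\<lambda>(kv, y). wv kv y * fs kv j y) \<in> borel_measurable (borel \<Otimes>\<^sub>M lborel)" by (simp add: split_beta')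
  qed
  then show "(\<lambda>kv. if norm kv \<ge> K then (\<Sum>j<n. LBINT y. wv kv y * fs kv j y) else 0) \<in> borel_fun"
  proof (intro measurable_If borel_measurable_sum)
    show "{x \<in> space borel. K \<le> norm x} \<in> sets (borel :: plane measure)" by measurable
  qed auto
next
  fix kv :: plane
  show "(\<lambda>n. if norm kv \<ge> K then (\<Sum>j<n. LBINT y. wv kv y * fs kv j y) else 0) \<longlonglongrightarrow> (if norm kv \<ge> K then amp kv else 0)"
  proof (cases "norm kv \<ge> K")
    case True
    have k: "norm kv \<ge> 1" "\<beta> kv \<le> 1 / 2" using K[OF True] by auto
    have "norm (\<beta> kv) < 1" using k(2) beta_nonneg[of kv] by simp
    from tendsto_mult_left_zero[OF LIMSEQ_power_zero[OF this], of "2 * N1"]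
    have z: "(\<lambda>n. \<beta> kv ^ n * (2 * N1)) \<longlonglongrightarrow> 0" .
    have "(\<lambda>n. amp kv - (\<Sum>j<n. LBINT y. wv kv y * fs kv j y)) \<longlonglongrightarrow> 0"
      by (rule Lim_null_comparison[OF always_eventually z]) (intro allI amp_remainder k)
    from tendsto_diff[OF tendsto_const[of "amp kv"] this]
    have "(\<lambda>n. \<Sum>j<n. LBINT y. wv kv y * fs kv j y) \<longlonglongrightarrow> amp kv" by simp
    then show ?thesis using True by simp
  qed simp
qed

end

section \<open>Integrability of the low-order terms\<close>

text \<open>The majorant of the transform of the truncated kernel: the singular circle of radius
  \<open>k\<close> has become a ring of width 1.\<close>

definition Kb :: "real \<Rightarrow> real \<Rightarrow> plane \<Rightarrow> real" where
  "Kb C k \<eta> = C / (ja (k - norm \<eta>) * (k + norm \<eta>))"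

text \<open>The iterated integral that bounds the transform of the j-th Neumann term at
  \<open>\<zeta>\<close>. Values in \<open>ennreal\<close> postpone every question of
  convergence.\<close>

primrec chain :: "real \<Rightarrow> (plane \<Rightarrow> real) \<Rightarrow> nat \<Rightarrow> plane \<Rightarrow> plane \<Rightarrow> ennreal" where
  "chain C M 0 kv \<zeta> = en (M (\<zeta> - kv))"
| "chain C M (Suc j) kv \<zeta> = (NN \<eta>. en (M (\<zeta> - \<eta>)) * en (Kb C (norm kv) \<eta>) * chain C M j kv \<eta>)"

lemma ennreal_sum_plus:
  fixes f :: "'a \<Rightarrow> real"
  assumes "\<And>j. 0 \<le> f j" "0 \<le> c"
  shows "en (sum f A + c) = (\<Sum>j\<in>A. en (f j)) + en c"
  using assms by (simp add: sum_nonneg ennreal_plus)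

context potential begin

primrec gs :: "plane \<Rightarrow> nat \<Rightarrow> cfun" where
  "gs kv 0 = (\<lambda>x. q x * wv kv x)"
| "gs kv (Suc j) = Tq (Gam L0 (norm kv)) (gs kv j)"

lemma gs_facts:
  assumes k: "norm kv \<ge> 1"
  shows "sup_ball (gs kv j)" "(LBINT x. norm (gs kv j x)) \<le> \<beta> kv ^ j * N1"
proof -
  have "sup_ball (gs kv j) \<and> (LBINT x. norm (gs kv j x)) \<le> \<beta> kv ^ j * N1"
  proof (induction j)
    case 0 show ?case using qwv_sup by simp
  next
    case (Suc j)
    then have s: "sup_ball (gs kv j)" and le: "(LBINT x. norm (gs kv j x)) \<le> \<beta> kv ^ j * N1" by auto
    show ?case using Gw_op(3,4)[OF k s] mult_left_mono[OF le beta_nonneg[of kv]] by simp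
  qed
  then show "sup_ball (gs kv j)" "(LBINT x. norm (gs kv j x)) \<le> \<beta> kv ^ j * N1" by auto
qed

text \<open>Telescoping: exchanging one kernel costs a multiple of \<open>1 / norm kv ^ 3\<close>,
  and the remaining operators are contractions.\<close>

lemma fs_gs_diff:
  assumes k: "norm kv \<ge> 1" "\<beta> kv \<le> 1 / 2"
  shows "(LBINT x. norm (fs kv j x - gs kv j x)) \<le> real j * (160000 * Cq * N1 / norm kv ^ 3)"
proof (induction j)
  case 0 show ?case by simp
next
  case (Suc j)
  let ?G = "Gw kv" and ?H = "Gam L0 (norm kv)" and ?E = "160000 * Cq * N1 / norm kv ^ 3"
  let ?d = "\<lambda>y. fs kv j y - gs kv j y" and ?D = "\<lambda>v. ?G v - ?H v"
  note f = fs_facts(1)[OF k(1), of j] and g = gs_facts(1)[OF k(1), of j]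
  note sG = Gk_sing(1)[OF k(1)] and sH = Gk_sing(2)[OF k(1)] and sD = Gk_sing(3)[OF k(1)]
  note d = sup_ball_diff[OF f g]
  note D = Tq_facts[OF sD g]
  have ae: "AE x in lborel. fs kv (Suc j) x - gs kv (Suc j) x = Tq ?G ?d x + Tq ?D (gs kv j) x"
    using Tq_diff[OF sG f g] Tq_diff_kernel[OF sG sH g] by eventually_elim (simp add: algebra_simps)
  have i1: "L1 (Tq ?G ?d)" by (rule sup_ball_integrable[OF Gw_op(1)[OF k(1) d]])
  have i2: "L1 (Tq ?D (gs kv j))" by (rule sup_ball_integrable[OF D(2)])
  have m: "fs kv (Suc j) \<in> borel_fun" "gs kv (Suc j) \<in> borel_fun"
    using sup_ball_measurable[OF fs_facts(1)[OF k(1)]] sup_ball_measurable[OF gs_facts(1)[OF k(1)]] by blast+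
  have "(LBINT x. norm (fs kv (Suc j) x - gs kv (Suc j) x)) = (LBINT x. norm (Tq ?G ?d x + Tq ?D (gs kv j) x))"
  proof (rule integral_cong_AE)
    show "AE x in lborel. norm (fs kv (Suc j) x - gs kv (Suc j) x) = norm (Tq ?G ?d x + Tq ?D (gs kv j) x)"
      using ae by eventually_elim (simp only:)
    show "(\<lambda>x. norm (fs kv (Suc j) x - gs kv (Suc j) x)) \<in> borel_measurable lborel"
    proof -
      have "(\<lambda>x. norm (a x - b x)) \<in> borel_measurable lborel"
        if [measurable]: "a \<in> borel_fun" "b \<in> borel_fun" for a b :: "cfun" by measurable
      from this[OF m] show ?thesis .
    qed
  qed (use i1 i2 in simp)
  also have "... \<le> (LBINT x. norm (Tq ?G ?d x) + norm (Tq ?D (gs kv j) x))"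
    using i1 i2 by (intro integral_mono) (auto intro: norm_triangle_ineq)
  also have "... = (LBINT x. norm (Tq ?G ?d x)) + (LBINT x. norm (Tq ?D (gs kv j) x))"
    using i1 i2 by simp
  also have "... \<le> real j * ?E + ?E"
  proof (rule add_mono)
    have "(LBINT x. norm (Tq ?G ?d x)) \<le> \<beta> kv * (LBINT y. norm (fs kv j y - gs kv j y))" by (rule Gw_op(2)[OF k(1) d])
    also have "... \<le> 1 * (real j * ?E)" using k(2) Suc by (intro mult_mono) auto
    finally show "(LBINT x. norm (Tq ?G ?d x)) \<le> real j * ?E" by simp
    have "\<beta> kv ^ j \<le> 1" using k(2) beta_nonneg by (intro power_le_one) auto
    then have g1: "(LBINT y. norm (gs kv j y)) \<le> 1 * N1"
      using gs_facts(2)[OF k(1), of j] N1_nonneg by (meson order_trans mult_right_mono)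
    have "(LBINT x. norm (Tq ?D (gs kv j) x)) \<le> 160000 / norm kv ^ 3 * Cq * (LBINT y. norm (gs kv j y))" by (rule D(3))
    also have "... \<le> 160000 / norm kv ^ 3 * Cq * (1 * N1)" using Cq_nonneg by (intro mult_left_mono g1) auto
    finally show "(LBINT x. norm (Tq ?D (gs kv j) x)) \<le> ?E" by simp
  qed
  also have "... = real (Suc j) * ?E" by (simp only: of_nat_Suc distrib_right mult_1_left add.commute)
  finally show ?case .
qed

definition CK :: real where "CK = 3000 * L0 ^ 4"

lemma Kb_bound:
  assumes k: "k \<ge> 2" and e: "\<eta> \<noteq> 0"
  shows "norm (fourier (Gam L0 k) \<eta>) \<le> Kb CK k \<eta>"
  using kernel_hat_bound[OF L0_ge k, of "norm \<eta>"] e Gam_facts(2)[OF L0_ge e, of k] by (simp add: Kb_def CK_def)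

lemma Kb_nonneg: "0 \<le> C \<Longrightarrow> 0 \<le> k \<Longrightarrow> 0 \<le> Kb C k \<eta>" by (simp add: Kb_def)

lemma CK_nonneg: "0 \<le> CK" by (simp add: CK_def)

lemma q_hat_sq: "L1 (\<lambda>\<xi>. (norm (fourier q \<xi>))\<^sup>2)"
proof (rule integrableI_bounded)
  show "(\<lambda>\<xi>. (norm (fourier q \<xi>))\<^sup>2) \<in> borel_measurable lborel" by measurable
  have "(NN \<xi>. en ((norm (fourier q \<xi>))^2)) \<le> en ((2 * pi)^2) * (NN x. en ((norm (q x))^2))" by (rule fourier_L2_le[OF q_int])
  also have "... < \<infinity>" using nn_integral_eq_integral[OF q_sq] by (simp add: ennreal_mult_less_top)
  finally show "(NN \<xi>. en (norm ((norm (fourier q \<xi>))^2))) < \<infinity>" by simp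
qed

text \<open>A product becomes a convolution: this is Parseval for the function \<open>c\<close>, a
  convolution with the truncated kernel, and a modulated \<open>q\<close>. The transform of
  \<open>c\<close> is square integrable because \<open>Kb\<close> decays like the inverse square of
  the frequency.\<close>

lemma gs_fourier_bound:
  assumes k: "norm kv \<ge> 2"
  shows "en (norm (fourier (gs kv (Suc j)) \<zeta>)) \<le>
    (NN \<eta>. en (norm (fourier q (\<zeta> - \<eta>))) * en (Kb CK (norm kv) \<eta>) * en (norm (fourier (gs kv j) \<eta>)))"
proof -
  define k' where "k' = norm kv"
  have k2: "k' \<ge> 2" and k1: "norm kv \<ge> 1" using k by (auto simp: k'_def)
  note g = sup_ball_integrable[OF gs_facts(1)[OF k1, of j]]
  note [measurable] = sup_ball_measurable[OF gs_facts(1)[OF k1, of j]]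
  note Gi = Gam_facts(1)[OF L0_ge, of k']
  have [measurable]: "Gam L0 k' \<in> borel_fun" using Gi by auto
  define c where "c = conv (Gam L0 k') (gs kv j)"
  have ci: "L1 c" and cf: "\<And>\<xi>. fourier c \<xi> = fourier (Gam L0 k') \<xi> * fourier (gs kv j) \<xi>"
    unfolding c_def using conv_facts[OF g Gi] by auto
  define e where "e x = ep (- \<zeta>) x * q x" for x
  have ei: "L1 e" unfolding e_def
    by (rule L1_bound[OF q_int]) (auto simp: norm_mult)
  have ef: "fourier e \<xi> = fourier q (\<xi> + \<zeta>)" for \<xi>
    unfolding e_def[abs_def] by (subst fourier_modulate) simp
  have e2: "L1 (\<lambda>\<xi>. (norm (fourier e \<xi>))\<^sup>2)"
    unfolding ef using lborel_translate(1)[of "\<lambda>\<xi>. (norm (fourier q (- \<xi>)))\<^sup>2" "- \<zeta>"] lborel_translate(1)[of "\<lambda>\<xi>. (norm (fourier q \<xi>))\<^sup>2" 0] q_hat_sq by (simp add: add.commute)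
  have c2: "L1 (\<lambda>\<xi>. (norm (fourier c \<xi>))\<^sup>2)"
  proof (rule L1_bound[OF integrable_inverse_cube[of "(CK * (1 + k') * (LBINT x. norm (gs kv j x)))^2"]])
    show "(\<lambda>\<xi>. (norm (fourier c \<xi>))\<^sup>2) \<in> borel_measurable lborel" unfolding cf by measurable
    show "AE \<xi> in lborel. norm ((norm (fourier c \<xi>))^2) \<le> norm ((CK * (1 + k') * (LBINT x. norm (gs kv j x)))^2 / jb \<xi> ^ 3)"
      using AE_lborel_singleton[of 0]
    proof eventually_elim
      case (elim \<xi>)
      define s where "s = norm \<xi>"
      define J where "J = (LBINT x. norm (gs kv j x))"
      have s: "0 \<le> s" by (simp add: s_def)
      have J: "0 \<le> J" by (simp add: J_def)
      have "1 + s \<le> (1 + k') * ja (k' - s)"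
      proof -
        have "1 + s \<le> 1 + k' + \<bar>k' - s\<bar>" by simp
        also have "... \<le> (1 + k') * ja (k' - s)" using k2 by (simp add: algebra_simps)
        finally show ?thesis .
      qed
      then have "(1 + s) * (1 + s) \<le> ((1 + k') * ja (k' - s)) * (k' + s)"
        using s k2 by (intro mult_mono) auto
      then have le: "1 / (ja (k' - s) * (k' + s)) \<le> (1 + k') / (1 + s)^2"
        using s k2 by (simp add: divide_simps power2_eq_square mult_ac add_pos_nonneg)
      have "norm (fourier c \<xi>) \<le> Kb CK k' \<xi> * J"
        unfolding cf norm_mult J_def by (intro mult_mono Kb_bound k2 elim norm_fourier_le Kb_nonneg CK_nonneg) (use k2 in auto)
      also have "... = CK * J * (1 / (ja (k' - s) * (k' + s)))" by (simp add: Kb_def s_def)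
      also have "... \<le> CK * J * ((1 + k') / (1 + s)^2)" using CK_nonneg J by (intro mult_left_mono le) auto
      finally have n: "norm (fourier c \<xi>) \<le> (CK * (1 + k') * J) / (1 + s)^2" by (simp add: mult_ac)
      then have "(norm (fourier c \<xi>))^2 \<le> ((CK * (1 + k') * J) / (1 + s)^2)^2" by (intro power_mono) auto
      also have "... = (CK * (1 + k') * J)^2 / (1 + s) ^ 4" by (simp add: power_divide flip: power_mult)
      also have "... \<le> (CK * (1 + k') * J)^2 / (1 + s) ^ 3"
        using s by (intro divide_left_mono mult_pos_pos power_increasing) auto
      finally show ?case using s by (simp add: s_def J_def)
    qed
  qed
  have P: "of_real ((2 * pi)^2) * (LBINT x. c x * e x) = (LBINT \<xi>. fourier c \<xi> * fourier e (- \<xi>))"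
    by (rule Parseval_plane(2)[OF ci c2 ei e2])
  have G: "fourier (gs kv (Suc j)) \<zeta> = (LBINT x. c x * e x)"
    unfolding fourier_def by (intro LB_cong refl) (simp add: Tq_def c_def e_def k'_def)
  \<comment> \<open>The factor \<open>1 / (2 * pi)^2\<close> in front of the convolution is at most
    1 and is dropped.\<close>
  have "1 \<le> (2 * pi)^2" using pi_gt3 by (intro one_le_power) simp
  then have "norm (fourier (gs kv (Suc j)) \<zeta>) * 1 \<le> norm (fourier (gs kv (Suc j)) \<zeta>) * (2 * pi)^2" by (intro mult_left_mono) auto
  also have "... = norm (of_real ((2 * pi)^2) * (LBINT x. c x * e x))" unfolding G norm_mult norm_of_real by simp
  also have "... = norm (LBINT \<xi>. fourier c \<xi> * fourier e (- \<xi>))" unfolding P ..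
  finally have "en (norm (fourier (gs kv (Suc j)) \<zeta>)) \<le> en (norm (LBINT \<xi>. fourier c \<xi> * fourier e (- \<xi>)))" by (simp add: ennreal_leI)
  also have "... \<le> (NN \<xi>. en (norm (fourier c \<xi> * fourier e (- \<xi>))))" by (rule norm_integral_le_nn_integral)
  also have "... \<le> (NN \<eta>. en (norm (fourier q (\<zeta> - \<eta>))) * en (Kb CK (norm kv) \<eta>) * en (norm (fourier (gs kv j) \<eta>)))"
  proof (rule nn_integral_mono_AE)
    show "AE \<eta> in lborel. en (norm (fourier c \<eta> * fourier e (- \<eta>))) \<le> en (norm (fourier q (\<zeta> - \<eta>))) * en (Kb CK (norm kv) \<eta>) * en (norm (fourier (gs kv j) \<eta>))"
      using AE_lborel_singleton[of 0]
    proof eventually_elim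
      case (elim \<eta>)
      have "norm (fourier c \<eta> * fourier e (- \<eta>)) = norm (fourier q (\<zeta> - \<eta>)) * norm (fourier (Gam L0 k') \<eta>) * norm (fourier (gs kv j) \<eta>)"
        unfolding cf ef norm_mult by (simp add: mult_ac)
      also have "... \<le> norm (fourier q (\<zeta> - \<eta>)) * Kb CK k' \<eta> * norm (fourier (gs kv j) \<eta>)"
        by (intro mult_right_mono mult_left_mono Kb_bound k2 elim) auto
      finally have "en (norm (fourier c \<eta> * fourier e (- \<eta>))) \<le> en (norm (fourier q (\<zeta> - \<eta>)) * Kb CK k' \<eta> * norm (fourier (gs kv j) \<eta>))" by (rule ennreal_leI)
      also have "... = en (norm (fourier q (\<zeta> - \<eta>))) * en (Kb CK (norm kv) \<eta>) * en (norm (fourier (gs kv j) \<eta>))"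
        using Kb_nonneg[OF CK_nonneg, of k' \<eta>] k2 by (simp add: ennreal_mult k'_def)
      finally show ?case .
    qed
  qed
  finally show ?thesis .
qed

text \<open>Symmetrised, so that the operators bounding the terms of the series are self-adjoint.\<close>

definition Mq :: "plane \<Rightarrow> real" where "Mq \<tau> = norm (fourier q \<tau>) + norm (fourier q (- \<tau>))"

lemma gs_chain:
  assumes k: "norm kv \<ge> 2"
  shows "en (norm (fourier (gs kv j) \<zeta>)) \<le> chain CK Mq j kv \<zeta>"
proof (induction j arbitrary: \<zeta>)
  case 0
  have "fourier (gs kv 0) \<zeta> = fourier q (\<zeta> - kv)"
    using fourier_modulate[of kv q \<zeta>] by (simp add: wv_def mult.commute)
  then show ?case by (simp add: Mq_def ennreal_leI)
next
  case (Suc j)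
  show ?case unfolding chain.simps
    by (rule order_trans[OF gs_fourier_bound[OF k]], intro nn_integral_mono mult_mono Suc) (auto simp: Mq_def intro!: ennreal_leI)
qed

lemma amp_chain_bound:
  obtains C where "0 \<le> C" "\<And>kv. norm kv \<ge> 2 \<Longrightarrow> \<beta> kv \<le> 1 / 2 \<Longrightarrow>
    en (norm (amp kv - fourier q (- 2 *\<^sub>R kv))) \<le> (\<Sum>j=1..4. chain CK Mq j kv (- kv)) + en (C * jb kv powr (- 5 / 2))"
proof
  \<comment> \<open>The kernel exchange error of order j is proportional to j, and
    \<open>1 + 2 + 3 + 4 = 10\<close>; the factors 6 bound \<open>2 powr (5 / 2)\<close>, lost in
    passing from \<open>norm kv\<close> to \<open>jb kv\<close>.\<close>
  define C where "C = 10 * (160000 * Cq * N1) * 6 + Cb ^ 5 * (2 * N1) * 6"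
  have Cb0: "0 \<le> Cb" using Cq_nonneg by (simp add: Cb_def)
  show "0 \<le> C" using Cq_nonneg N1_nonneg Cb0 by (simp add: C_def)
  fix kv :: plane assume k: "norm kv \<ge> 2" "\<beta> kv \<le> 1 / 2"
  then have k1: "norm kv \<ge> 1" by simp
  define k' where "k' = norm kv"
  have kk: "k' \<ge> 2" using k by (simp add: k'_def)
  define F where "F j = (LBINT y. wv kv y * fs kv j y)" for j
  note ft = wv_mult_integrable[OF sup_ball_integrable]
  have FG: "norm (F j) \<le> norm (fourier (gs kv j) (- kv)) + real j * (160000 * Cq * N1 / k' ^ 3)" for j
  proof -
    note i = ft[OF fs_facts(1)[OF k1]] ft[OF gs_facts(1)[OF k1]]
    have "fourier (gs kv j) (- kv) = (LBINT y. wv kv y * gs kv j y)" by (simp add: fourier_def wv_def)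
    then have "F j - fourier (gs kv j) (- kv) = (LBINT y. wv kv y * (fs kv j y - gs kv j y))"
      using i by (simp add: F_def right_diff_distrib)
    also have "norm ... \<le> (LBINT y. norm (wv kv y * (fs kv j y - gs kv j y)))" by (rule integral_norm_bound)
    also have "... = (LBINT y. norm (fs kv j y - gs kv j y))" by (simp add: norm_mult)
    also have "... \<le> real j * (160000 * Cq * N1 / k' ^ 3)" unfolding k'_def by (rule fs_gs_diff[OF k1 k(2)])
    finally show ?thesis using norm_triangle_sub[of "F j" "fourier (gs kv j) (- kv)"] by linarith
  qed
  have F0: "F 0 = fourier q (- 2 *\<^sub>R kv)"
    unfolding F_def fourier_def
  proof (intro LB_cong refl)
    fix y
    have "wv kv y * wv kv y = em (- 2 *\<^sub>R kv) y"
      by (simp add: wv_def exp_add[symmetric] mult_ac)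
    then show "wv kv y * fs kv 0 y = em (- 2 *\<^sub>R kv) y * q y" by (simp add: mult_ac)
  qed
  have sets: "{1..4::nat} = {1, 2, 3, 4}" "{..<5::nat} = {0, 1, 2, 3, 4}" by auto
  have split: "(\<Sum>j<5. F j) = F 0 + (\<Sum>j=1..4. F j)"
    unfolding sets by simp
  have p: "1 / k' ^ 3 \<le> 6 * (1 + k') powr (- 5 / 2)" "1 / sqrt k' ^ 5 \<le> 6 * (1 + k') powr (- 5 / 2)"
  proof -
    have a: "sqrt k' ^ 5 = k' powr (5 / 2)"
      using kk by (simp add: powr_half_sqrt[symmetric] powr_power)
    have "(1 + k') powr (5 / 2) \<le> (2 * k') powr (5 / 2)" using kk by (intro powr_mono2) auto
    also have "... = 2 powr (5 / 2) * k' powr (5 / 2)" using kk by (simp add: powr_mult)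
    also have "... \<le> 6 * k' powr (5 / 2)"
    proof (rule mult_right_mono[OF _ powr_ge_zero])
      have "(2 powr (5 / 2)) ^ 2 = (2::real) ^ 5" by (simp add: powr_power)
      also have "... \<le> 6 ^ 2" by simp
      finally show "2 powr (5 / 2) \<le> (6::real)" by (rule power2_le_imp_le) simp
    qed
    finally have b: "(1 + k') powr (5 / 2) \<le> 6 * k' powr (5 / 2)" .
    have "1 / s \<le> 6 * inverse t" if "0 < s" "0 < t" "t \<le> 6 * s" for s t :: real using that by (simp add: field_simps)
    from this[OF _ _ b] have c: "1 / k' powr (5 / 2) \<le> 6 * (1 + k') powr (- 5 / 2)"
      using kk unfolding minus_divide_left[symmetric] powr_minus by simp
    then show "1 / sqrt k' ^ 5 \<le> 6 * (1 + k') powr (- 5 / 2)" unfolding a .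
    have "k' powr (5 / 2) \<le> k' powr 3" using kk by (intro powr_mono) auto
    then have "k' powr (5 / 2) \<le> k' ^ 3" using kk by (simp add: powr_numeral)
    then have "1 / k' ^ 3 \<le> 1 / k' powr (5 / 2)" using kk by (intro divide_left_mono mult_pos_pos) simp_all
    then show "1 / k' ^ 3 \<le> 6 * (1 + k') powr (- 5 / 2)" using c by linarith
  qed
  have b5: "\<beta> kv ^ 5 = Cb ^ 5 * (1 / sqrt k' ^ 5)" by (simp add: \<beta>_def k'_def power_divide)
  define X where "X = (1 + k') powr (- 5 / 2)"
  define E where "E = 160000 * Cq * N1"
  define a where "a j = norm (fourier (gs kv j) (- kv))" for j
  have X0: "0 \<le> X" unfolding X_def by (rule powr_ge_zero)
  have E0: "0 \<le> E" unfolding E_def using Cq_nonneg N1_nonneg by simp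
  have n0: "norm (amp kv - F 0) \<le> norm (amp kv - (\<Sum>j<5. F j)) + norm (\<Sum>j=1..4. F j)"
    using norm_triangle_ineq[of "amp kv - (\<Sum>j<5. F j)" "\<Sum>j=1..4. F j"] unfolding split by simp
  have n1: "norm (amp kv - (\<Sum>j<5. F j)) \<le> Cb ^ 5 * (1 / sqrt k' ^ 5) * (2 * N1)"
    using amp_remainder[OF k1 k(2), of 5] unfolding b5 F_def .
  have n2: "norm (\<Sum>j=1..4. F j) \<le> (\<Sum>j=1..4. a j + real j * (E / k' ^ 3))"
    by (rule sum_norm_le) (use FG in \<open>simp only: a_def E_def\<close>)
  have n3: "(\<Sum>j=1..4. a j + real j * (E / k' ^ 3)) = (\<Sum>j=1..4. a j) + 10 * E * (1 / k' ^ 3)"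
    unfolding sets by simp
  have n4: "10 * E * (1 / k' ^ 3) \<le> 10 * E * (6 * X)" using E0 p(1) unfolding X_def by (intro mult_left_mono) simp_all
  have n5: "Cb ^ 5 * (1 / sqrt k' ^ 5) * (2 * N1) \<le> Cb ^ 5 * (6 * X) * (2 * N1)"
    using Cb0 N1_nonneg p(2) unfolding X_def by (intro mult_right_mono mult_left_mono) simp_all
  have n6: "10 * E * (6 * X) + Cb ^ 5 * (6 * X) * (2 * N1) = C * X"
  proof -
    have "10 * e * (6 * x) + c * (6 * x) * n = (10 * e * 6 + c * n * 6) * x" for e c n x :: real by (simp add: algebra_simps)
    then show ?thesis unfolding C_def E_def .
  qed
  have "norm (amp kv - F 0) \<le> (\<Sum>j=1..4. a j) + C * X"
  proof -
    have "p \<le> s + w" if "p \<le> x + y" "x \<le> u" "y \<le> z" "z = s + v" "v \<le> v'" "u \<le> u'" "v' + u' = w" for p x y u z s v v' u' w :: real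
      using that by linarith
    from this[OF n0 n1 n2 n3 n4 n5 n6] show ?thesis .
  qed
  from ennreal_leI[OF this] have n7: "en (norm (amp kv - F 0)) \<le> (\<Sum>j=1..4. en (a j)) + en (C * X)"
    unfolding ennreal_sum_plus[of a, OF norm_ge_zero[of "fourier (gs kv _) (- kv)", folded a_def] mult_nonneg_nonneg[OF \<open>0 \<le> C\<close> X0]] .
  have n8: "(\<Sum>j=1..4. en (a j)) \<le> (\<Sum>j=1..4. chain CK Mq j kv (- kv))"
    unfolding a_def by (rule sum_mono) (rule gs_chain[OF k(1)])
  from order_trans[OF n7 add_right_mono[OF n8]] show "en (norm (amp kv - fourier q (- 2 *\<^sub>R kv))) \<le> (\<Sum>j=1..4. chain CK Mq j kv (- kv)) + en (C * jb kv powr (- 5 / 2))"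
    unfolding F0 k'_def X_def .
qed

end

section \<open>Integrals across a circle in Cartesian coordinates\<close>

lemma nn_integral_inverse_square_line: "(NN x. en (1 / ja (x - a)^2)) \<le> 2"
proof -
  have eq: "ja x powr - 2 = 1 / ja x^2" for x :: real
    by (simp add: powr_minus divide_inverse)
  have "(NN x. en (1 / ja x^2)) \<le> 2"
    using nn_integral_one_plus_powr[of 2] unfolding eq by simp
  moreover have "(NN x. en (1 / ja x^2)) = (NN x. en (1 / ja (x - a)^2))"
    using nn_integral_real_affine[of "\<lambda>x. en (1 / ja x^2)" 1 "- a"] by simp
  ultimately show ?thesis by simp
qed

text \<open>Let \<open>|g x0|\<close> be within 1 of the infimum of \<open>|g|\<close> on
  \<open>A\<close>. Expansion then gives \<open>1 + |x - x0| \<le> 4 * (1 + |g x|)\<close>, which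
  replaces a change of variables along \<open>g\<close>.\<close>

lemma nn_integral_expanding:
  fixes g :: "real \<Rightarrow> real"
  assumes ex: "\<And>x x'. x \<in> A \<Longrightarrow> x' \<in> A \<Longrightarrow> \<bar>x - x'\<bar> \<le> 2 * \<bar>g x - g x'\<bar>"
  shows "(NN x. en (indicator A x * (1 / ja (g x)^2))) \<le> 32"
proof (cases "A = {}")
  case False
  define S where "S = (\<lambda>x. \<bar>g x\<bar>) ` A"
  have S: "S \<noteq> {}" "bdd_below S" using False by (auto simp: S_def intro!: bdd_belowI[of _ 0])
  then obtain x0 where x0: "x0 \<in> A" "\<bar>g x0\<bar> < Inf S + 1"
    using cInf_lessD[of S "Inf S + 1"] by (auto simp: S_def)
  have "en (indicator A x * (1 / ja (g x)^2)) \<le> en 16 * en (1 / ja (x - x0)^2)" for x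
  proof (cases "x \<in> A")
    case True
    have "Inf S \<le> \<bar>g x\<bar>" using True S by (intro cInf_lower) (auto simp: S_def)
    moreover have "1 + d \<le> 4 * (1 + a)" if "i \<le> a" "d \<le> 2 * e" "e \<le> a + b" "b < i + 1" for a b d e i :: real using that by simp
    ultimately have "1 + \<bar>x - x0\<bar> \<le> 4 * ja (g x)" using ex[OF True x0(1)] x0(2) abs_triangle_ineq4[of "g x" "g x0"] by blast
    then have "ja (x - x0)^2 \<le> (4 * ja (g x))^2" by (intro power_mono) auto
    moreover have "(4 * t)^2 = 16 * t^2" for t :: real by (simp add: power_mult_distrib)
    ultimately have "ja (x - x0)^2 \<le> 16 * ja (g x)^2" by (simp only:)
    moreover have "1 / s \<le> 16 * (1 / t)" if "0 < s" "0 < t" "t \<le> 16 * s" for s t :: real using that by (simp add: field_simps)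
    ultimately have "1 / ja (g x)^2 \<le> 16 * (1 / ja (x - x0)^2)" by (simp add: add_pos_nonneg)
    then have "en (1 / ja (g x)^2) \<le> en (16 * (1 / ja (x - x0)^2))" by (rule ennreal_leI)
    moreover have "en (16 * (1 / ja (x - x0)^2)) = en 16 * en (1 / ja (x - x0)^2)" by (rule ennreal_mult) simp_all
    ultimately show ?thesis using True by (simp only: indicator_simps mult_1_left)
  qed simp
  then have "(NN x. en (indicator A x * (1 / ja (g x)^2))) \<le> (NN x. en 16 * en (1 / ja (x - x0)^2))"
    by (intro nn_integral_mono)
  also have "... = en 16 * (NN x. en (1 / ja (x - x0)^2))" by (rule nn_integral_cmult) measurable
  also have "... \<le> en 16 * 2" by (intro mult_left_mono nn_integral_inverse_square_line) auto
  also have "... = 32" using ennreal_mult[of 16 2] by simp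
  finally show ?thesis .
qed simp

text \<open>For positive \<open>x \<ge> |y|\<close> the derivative
  \<open>x / sqrt (x^2 + y^2)\<close> is at least \<open>1 / sqrt 2\<close>, which exceeds
  1/2.\<close>

lemma sqrt_sum_squares_expanding:
  fixes x x' y :: real
  assumes "\<bar>y\<bar> \<le> x" "\<bar>y\<bar> \<le> x'"
  shows "\<bar>x - x'\<bar> \<le> 2 * \<bar>sqrt (x^2 + y^2) - sqrt (x'^2 + y^2)\<bar>"
proof (cases "x + x' = 0")
  case False
  then have p: "x + x' > 0" using assms by linarith
  define u v where "u = sqrt (x^2 + y^2)" and "v = sqrt (x'^2 + y^2)"
  have b': "sqrt (t^2 + y^2) \<le> 2 * t" if "\<bar>y\<bar> \<le> t" for t
  proof (rule real_le_lsqrt)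
    have "y^2 \<le> t^2" using power_mono[OF that, of 2] by simp
    moreover have "(2 * t)^2 = 4 * t^2" by (simp add: power_mult_distrib)
    ultimately show "t^2 + y^2 \<le> (2 * t)^2" using zero_le_power2[of t] by linarith
  qed (use that in linarith)
  have b: "u \<le> 2 * x" "v \<le> 2 * x'" unfolding u_def v_def using assms by (auto intro!: b')
  have n: "0 \<le> u" "0 \<le> v" by (simp_all add: u_def v_def)
  have "(x - x') * (x + x') = u^2 - v^2" by (simp add: u_def v_def power2_eq_square algebra_simps)
  also have "... = (u - v) * (u + v)" by (simp add: power2_eq_square algebra_simps)
  finally have "\<bar>x - x'\<bar> * (x + x') = \<bar>u - v\<bar> * (u + v)" using p n by (metis abs_mult abs_of_nonneg add_nonneg_nonneg less_imp_le)
  also have "... \<le> \<bar>u - v\<bar> * (2 * (x + x'))" using b by (intro mult_left_mono) auto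
  finally have "\<bar>x - x'\<bar> * (x + x') \<le> (2 * \<bar>u - v\<bar>) * (x + x')" by (simp only: mult.assoc mult.left_commute)
  then show ?thesis using p unfolding u_def v_def by (simp only: mult_le_cancel_right_pos)
next
  case True
  then have "x = x'" using assms by linarith
  then show ?thesis by simp
qed

lemma nn_integral_strip:
  "(NN x. en (indicator {x. \<bar>y\<bar> \<le> \<bar>x\<bar>} x * (1 / ja (k - sqrt (x^2 + y^2))^2))) \<le> 64"
proof -
  let ?e = "\<lambda>x. 1 / ja (sqrt (x^2 + y^2) - k)^2"
  have em: "(\<lambda>x. en (indicator A x * ?e x)) \<in> borel_measurable lborel" if "A \<in> sets borel" for A
  proof -
    have "?e \<in> borel_fun" by measurable
    then have "(\<lambda>x. indicator A x * ?e x) \<in> borel_fun"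
      using that by (intro borel_measurable_times borel_measurable_indicator)
    then show ?thesis by simp
  qed
  have "(NN x. en (indicator {x. \<bar>y\<bar> \<le> \<bar>x\<bar>} x * (1 / ja (k - sqrt (x^2 + y^2))^2))) \<le>
      (NN x. en (indicator {\<bar>y\<bar>..} x * ?e x) + en (indicator {..- \<bar>y\<bar>} x * ?e x))"
  proof (intro nn_integral_mono)
    fix x
    have c: "\<bar>k - sqrt (x^2 + y^2)\<bar> = \<bar>sqrt (x^2 + y^2) - k\<bar>" by (rule abs_minus_commute)
    consider "\<bar>y\<bar> \<le> x" | "x \<le> - \<bar>y\<bar>" | "\<not> \<bar>y\<bar> \<le> \<bar>x\<bar>" by linarith
    then show "en (indicator {x. \<bar>y\<bar> \<le> \<bar>x\<bar>} x * (1 / ja (k - sqrt (x^2 + y^2))^2)) \<le>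
        en (indicator {\<bar>y\<bar>..} x * ?e x) + en (indicator {..- \<bar>y\<bar>} x * ?e x)"
    proof cases
      case 1
      then have i: "indicator {x. \<bar>y\<bar> \<le> \<bar>x\<bar>} x = (1::real)" "indicator {\<bar>y\<bar>..} x = (1::real)" by simp_all
      show ?thesis unfolding c i by (rule add_increasing2) (rule zero_le, rule order_refl)
    next
      case 2
      then have i: "indicator {x. \<bar>y\<bar> \<le> \<bar>x\<bar>} x = (1::real)" "indicator {..- \<bar>y\<bar>} x = (1::real)" by simp_all
      show ?thesis unfolding c i by (rule add_increasing) (rule zero_le, rule order_refl)
    next
      case 3
      then have i: "indicator {x. \<bar>y\<bar> \<le> \<bar>x\<bar>} x = (0::real)" by simp
      show ?thesis unfolding i by simp
    qed
  qed
  also have "... = (NN x. en (indicator {\<bar>y\<bar>..} x * ?e x)) + (NN x. en (indicator {..- \<bar>y\<bar>} x * ?e x))"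
    by (rule nn_integral_add; rule em) simp_all
  also have "... \<le> 32 + 32"
  proof (intro add_mono nn_integral_expanding)
    fix x x' :: real
    assume "x \<in> {\<bar>y\<bar>..}" "x' \<in> {\<bar>y\<bar>..}"
    then show "\<bar>x - x'\<bar> \<le> 2 * \<bar>sqrt (x^2 + y^2) - k - (sqrt (x'^2 + y^2) - k)\<bar>"
      using sqrt_sum_squares_expanding[of y x x'] by simp
  next
    fix x x' :: real
    assume "x \<in> {..- \<bar>y\<bar>}" "x' \<in> {..- \<bar>y\<bar>}"
    then have "\<bar>(- x) - (- x')\<bar> \<le> 2 * \<bar>sqrt ((- x)^2 + y^2) - sqrt ((- x')^2 + y^2)\<bar>"
      by (intro sqrt_sum_squares_expanding) auto
    then show "\<bar>x - x'\<bar> \<le> 2 * \<bar>sqrt (x^2 + y^2) - k - (sqrt (x'^2 + y^2) - k)\<bar>" by simp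
  qed
  also have "... = 64" by simp
  finally show ?thesis .
qed

text \<open>Where one coordinate dominates, lines parallel to its axis cross the circles
  transversally, so \<open>nn_integral_strip\<close> integrates that coordinate out and the weight
  in the other one is left. The two sectors cover the plane.\<close>

lemma nn_integral_circle:
  fixes \<omega>1 \<omega>2 :: "real \<Rightarrow> ennreal" and \<Omega> :: "plane \<Rightarrow> ennreal"
  assumes [measurable]: "\<omega>1 \<in> borel_fun" "\<omega>2 \<in> borel_fun" "\<Omega> \<in> borel_fun"
    and le: "\<And>\<eta>. \<Omega> \<eta> \<le> \<omega>1 (\<eta> $ 1)" "\<And>\<eta>. \<Omega> \<eta> \<le> \<omega>2 (\<eta> $ 2)"
  shows "(NN \<eta>. en (1 / ja (k - norm \<eta>)^2) * \<Omega> \<eta>) \<le> 64 * ((NN x. \<omega>1 x) + (NN x. \<omega>2 x))"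
proof -
  define s where "s x y = en (indicator {x. \<bar>y\<bar> \<le> \<bar>x\<bar>} x * (1 / ja (k - sqrt (x^2 + y^2))^2))" for x y :: real
  have sm [measurable]: "(\<lambda>w. s (f w) (g w)) \<in> borel_measurable N" if [measurable]: "f \<in> borel_measurable N" "g \<in> borel_measurable N" for f g and N :: "'z measure"
    unfolding s_def indicator_def mem_Collect_eq by measurable
  have smp: "(\<lambda>\<eta>::plane. s (\<eta> $ 1) (\<eta> $ 2)) \<in> borel_fun" "(\<lambda>\<eta>::plane. s (\<eta> $ 2) (\<eta> $ 1)) \<in> borel_fun"
    by (rule sm; measurable)+
  have m2: "(\<lambda>\<eta>::plane. \<omega>2 (\<eta> $ 2) * s (\<eta> $ 1) (\<eta> $ 2)) \<in> borel_fun"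
    by (rule borel_measurable_times_ennreal[OF _ smp(1)]) measurable
  have m1: "(\<lambda>\<eta>::plane. \<omega>1 (\<eta> $ 1) * s (\<eta> $ 2) (\<eta> $ 1)) \<in> borel_fun"
    by (rule borel_measurable_times_ennreal[OF _ smp(2)]) measurable
  have sx: "(\<lambda>x. s x y) \<in> borel_measurable lborel" for y by (rule sm) measurable
  have s64: "(NN x. s x y) \<le> 64" for y unfolding s_def by (rule nn_integral_strip)
  have "en (1 / ja (k - norm \<eta>)^2) * \<Omega> \<eta> \<le> \<omega>2 (\<eta> $ 2) * s (\<eta> $ 1) (\<eta> $ 2) + \<omega>1 (\<eta> $ 1) * s (\<eta> $ 2) (\<eta> $ 1)" for \<eta>
  proof (cases "\<bar>\<eta> $ 2\<bar> \<le> \<bar>\<eta> $ 1\<bar>")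
    case True
    have "en (1 / ja (k - norm \<eta>)^2) * \<Omega> \<eta> \<le> en (1 / ja (k - norm \<eta>)^2) * \<omega>2 (\<eta> $ 2)" by (intro mult_left_mono le) auto
    also have "... = \<omega>2 (\<eta> $ 2) * s (\<eta> $ 1) (\<eta> $ 2)" using True by (simp add: s_def norm_plane mult.commute)
    finally show ?thesis by (meson add_increasing2 order_trans zero_le)
  next
    case False
    have "en (1 / ja (k - norm \<eta>)^2) * \<Omega> \<eta> \<le> en (1 / ja (k - norm \<eta>)^2) * \<omega>1 (\<eta> $ 1)" by (intro mult_left_mono le) auto
    also have "... = \<omega>1 (\<eta> $ 1) * s (\<eta> $ 2) (\<eta> $ 1)" using False by (simp add: s_def norm_plane mult.commute add.commute)
    finally show ?thesis by (meson add_increasing order_trans zero_le)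
  qed
  then have e1: "(NN \<eta>. en (1 / ja (k - norm \<eta>)^2) * \<Omega> \<eta>) \<le>
      (\<integral>\<^sup>+\<eta>. \<omega>2 (\<eta> $ 2) * s (\<eta> $ 1) (\<eta> $ 2) + \<omega>1 (\<eta> $ 1) * s (\<eta> $ 2) (\<eta> $ 1) \<partial>(lborel :: plane measure))" by (intro nn_integral_mono)
  have e2: "(\<integral>\<^sup>+\<eta>. \<omega>2 (\<eta> $ 2) * s (\<eta> $ 1) (\<eta> $ 2) + \<omega>1 (\<eta> $ 1) * s (\<eta> $ 2) (\<eta> $ 1) \<partial>(lborel :: plane measure)) = (\<integral>\<^sup>+\<eta>. \<omega>2 (\<eta> $ 2) * s (\<eta> $ 1) (\<eta> $ 2) \<partial>(lborel :: plane measure)) + (\<integral>\<^sup>+\<eta>. \<omega>1 (\<eta> $ 1) * s (\<eta> $ 2) (\<eta> $ 1) \<partial>(lborel :: plane measure))"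
    using m1 m2 by (intro nn_integral_add) simp_all
  have e3: "(\<integral>\<^sup>+\<eta>. \<omega>2 (\<eta> $ 2) * s (\<eta> $ 1) (\<eta> $ 2) \<partial>(lborel :: plane measure)) = (NN y. NN x. \<omega>2 y * s x y)"
    by (subst nn_integral_plane(2)[OF m2]) simp
  have e4: "(\<integral>\<^sup>+\<eta>. \<omega>1 (\<eta> $ 1) * s (\<eta> $ 2) (\<eta> $ 1) \<partial>(lborel :: plane measure)) = (NN x. NN y. \<omega>1 x * s y x)"
    by (subst nn_integral_plane(1)[OF m1]) simp
  have e5: "(NN y. NN x. \<omega>2 y * s x y) + (NN x. NN y. \<omega>1 x * s y x) \<le> 64 * (NN y. \<omega>2 y) + 64 * (NN y. \<omega>1 y)"
  proof (rule add_mono)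
    have le: "(NN y. NN x. \<omega> y * s x y) \<le> 64 * (NN y. \<omega> y)" if [measurable]: "\<omega> \<in> borel_fun" for \<omega>
    proof -
      have "(NN x. \<omega> y * s x y) \<le> 64 * \<omega> y" for y
      proof -
        have "(NN x. \<omega> y * s x y) = \<omega> y * (NN x. s x y)" by (rule nn_integral_cmult[OF sx])
        also have "... \<le> \<omega> y * 64" by (rule mult_left_mono[OF s64]) simp
        also have "... = 64 * \<omega> y" by (rule mult.commute)
        finally show ?thesis .
      qed
      then have "(NN y. NN x. \<omega> y * s x y) \<le> (NN y. 64 * \<omega> y)" by (intro nn_integral_mono)
      also have "... = 64 * (NN y. \<omega> y)" by (rule nn_integral_cmult) measurable
      finally show ?thesis .
    qed
    show "(NN y. NN x. \<omega>2 y * s x y) \<le> 64 * (NN y. \<omega>2 y)" by (rule le) measurable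
    show "(NN y. NN x. \<omega>1 y * s x y) \<le> 64 * (NN y. \<omega>1 y)" by (rule le) measurable
  qed
  show ?thesis
    using e1[unfolded e2 e3 e4] e5 unfolding distrib_left by (subst add.commute) (rule order_trans)
qed

lemma Kb_measurable [measurable (raw)]:
  assumes [measurable]: "f \<in> borel_measurable N" "g \<in> borel_measurable N"
  shows "(\<lambda>w. Kb C (f w) (g w)) \<in> borel_measurable N"
  unfolding Kb_def by measurable

lemma Kb_sq: "(Kb C k \<eta>)^2 = C^2 * (1 / ja (k - norm \<eta>)^2 * (1 / (k + norm \<eta>)^2))"
  by (simp add: Kb_def power_divide power_mult_distrib)

lemma ennreal_mult3: "0 \<le> c \<Longrightarrow> 0 \<le> e \<Longrightarrow> 0 \<le> w \<Longrightarrow> en (c * (e * w)) = en c * (en e * en w)"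
  by (simp only: ennreal_mult mult_nonneg_nonneg)

lemma abs_component_le: "\<bar>(\<eta>::plane) $ i\<bar> \<le> norm \<eta>" by (metis component_le_norm_cart)

text \<open>Replacing \<open>1 / (k + norm u)^2\<close> by \<open>1 / k^2\<close> leaves the ring
  and a weight whose integral over any coordinate line is at most 2; hence
  \<open>64 * (2 + 2) = 256\<close>.\<close>

lemma nn_integral_Kb_sq_weight:
  assumes k: "k > 0"
  shows "(NN u. en ((Kb C k u)^2 * (1 / jb (u - v)^2))) \<le> en (256 * C^2 / k^2)"
proof -
  let ?o = "\<lambda>u. 1 / jb (u - v)^2" and ?e = "\<lambda>u::plane. 1 / ja (k - norm u)^2"
  have le: "?o u \<le> 1 / ja (u $ i - v $ i)^2" for u :: plane and i
    by (rule divide_left_mono[OF power_mono]) (use abs_component_le[of "u - v" i] in \<open>simp_all add: add_pos_nonneg\<close>)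
  have "(NN u. en ((Kb C k u)^2 * (?o u))) \<le>
      (NN u. en (C^2 / k^2) * (en (?e u) * en (?o u)))"
  proof (intro nn_integral_mono)
    fix u :: plane
    have kn: "k \<le> k + norm u" "0 < k + norm u" using k by (simp_all add: add_pos_nonneg)
    have "1 / (k + norm u)^2 \<le> 1 / k^2"
      by (rule divide_left_mono[OF power_mono[OF kn(1)]]) (use k kn in simp_all)
    then have h: "?e u * (1 / (k + norm u)^2) \<le> ?e u * (1 / k^2)" by (rule mult_left_mono) simp
    have "(Kb C k u)^2 * (?o u) \<le> C^2 * (?e u * (1 / k^2)) * (?o u)"
      unfolding Kb_sq by (rule mult_right_mono[OF mult_left_mono[OF h]]) simp_all
    also have "... = C^2 / k^2 * (?e u * (?o u))"
    proof -
      have "c * (e * (1 / m)) * w = c / m * (e * w)" for c e m w :: real by simp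
      then show ?thesis .
    qed
    finally have "(Kb C k u)^2 * (?o u) \<le> C^2 / k^2 * (?e u * (?o u))" .
    from ennreal_leI[OF this] show "en ((Kb C k u)^2 * (?o u)) \<le> en (C^2 / k^2) * (en (?e u) * en (?o u))"
      by (rule order_trans[OF _ eq_refl[OF ennreal_mult3]]) (rule divide_nonneg_nonneg zero_le_power2 zero_le_one)+
  qed
  also have "... = en (C^2 / k^2) * (NN u. en (?e u) * en (?o u))"
    by (rule nn_integral_cmult) measurable
  also have "... \<le> en (C^2 / k^2) * (64 * ((NN x. en (1 / ja (x - v $ 1)^2)) + (NN x. en (1 / ja (x - v $ 2)^2))))"
    by (intro mult_left_mono nn_integral_circle ennreal_leI le) auto
  also have "... \<le> en (C^2 / k^2) * (64 * (2 + 2))" by (intro mult_left_mono add_mono nn_integral_inverse_square_line) auto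
  also have "64 * (2 + 2) = en 256" by simp
  also have "en (C^2 / k^2) * en 256 = en (C^2 / k^2 * 256)" by (rule ennreal_mult[symmetric]) simp_all
  also have "C^2 / k^2 * 256 = 256 * C^2 / k^2" by simp
  finally show ?thesis .
qed

text \<open>Here \<open>1 / (k + norm u)^2\<close> itself serves as the weight; by scaling, its
  integral along a line is of order \<open>1 / k\<close>.\<close>

lemma nn_integral_Kb_sq:
  assumes k: "k > 0"
  shows "(NN u. en ((Kb C k u)^2)) \<le> en (256 * C^2 / k)"
proof -
  have line: "(NN x. en (1 / (k + \<bar>x\<bar>)^2)) \<le> en (2 / k)"
  proof -
    have eq: "en k * en (1 / (k + \<bar>0 + k * x\<bar>)^2) = en (1 / k) * en (1 / ja (x - 0)^2)" for x
    proof -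
      have a: "k + \<bar>0 + k * x\<bar> = k * ja x" using k by (simp add: abs_mult distrib_left)
      have g: "k * (1 / (k * t)^2) = 1 / k * (1 / t^2)" for t :: real
        using k by (cases "t = 0") (simp_all add: power_mult_distrib power2_eq_square[of k])
      have e: "k * (1 / (k + \<bar>0 + k * x\<bar>)^2) = 1 / k * (1 / ja (x - 0)^2)" unfolding a diff_zero by (rule g)
      have "en k * en (1 / (k + \<bar>0 + k * x\<bar>)^2) = en (k * (1 / (k + \<bar>0 + k * x\<bar>)^2))"
        by (rule ennreal_mult[symmetric]) (use k in simp_all)
      also have "... = en (1 / k) * en (1 / ja (x - 0)^2)"
        unfolding e by (rule ennreal_mult) (use k in simp_all)
      finally show ?thesis .
    qed
    have "(NN x. en (1 / (k + \<bar>x\<bar>)^2)) = en k * (NN x. en (1 / (k + \<bar>0 + k * x\<bar>)^2))"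
      using nn_integral_real_affine[of "\<lambda>x. en (1 / (k + \<bar>x\<bar>)^2)" k 0] k by simp
    also have "... = (NN x. en k * en (1 / (k + \<bar>0 + k * x\<bar>)^2))" by (rule nn_integral_cmult[symmetric]) measurable
    also have "... = en (1 / k) * (NN x. en (1 / ja (x - 0)^2))" unfolding eq by (rule nn_integral_cmult) measurable
    also have "... \<le> en (1 / k) * 2" by (intro mult_left_mono nn_integral_inverse_square_line) auto
    also have "... = en (2 / k)" using k ennreal_mult[of "1 / k" 2] by simp
    finally show ?thesis .
  qed
  have le: "1 / (k + norm u)^2 \<le> 1 / (k + \<bar>u $ i\<bar>)^2" for u :: plane and i
    by (rule divide_left_mono[OF power_mono]) (use abs_component_le[of u i] k in \<open>simp_all add: add_pos_nonneg\<close>)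
  have "(NN u. en ((Kb C k u)^2)) = (\<integral>\<^sup>+u. en (C^2) * (en (1 / ja (k - norm u)^2) * en (1 / (k + norm u)^2)) \<partial>(lborel :: plane measure))"
    unfolding Kb_sq by (intro nn_integral_cong ennreal_mult3) (rule divide_nonneg_nonneg zero_le_power2 zero_le_one)+
  also have "... = en (C^2) * (\<integral>\<^sup>+u. en (1 / ja (k - norm u)^2) * en (1 / (k + norm u)^2) \<partial>(lborel :: plane measure))"
    by (rule nn_integral_cmult) measurable
  also have "... \<le> en (C^2) * (64 * ((NN x. en (1 / (k + \<bar>x\<bar>)^2)) + (NN x. en (1 / (k + \<bar>x\<bar>)^2))))"
    by (intro mult_left_mono nn_integral_circle ennreal_leI le) auto
  also have "... \<le> en (C^2) * (64 * (en (2 / k) + en (2 / k)))" by (intro mult_left_mono add_mono line) auto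
  also have "64 * (en (2 / k) + en (2 / k)) = en (256 / k)"
    using k ennreal_mult[of 64 "4 / k"] by (simp add: ennreal_plus[symmetric] del: ennreal_plus)
  also have "en (C^2) * en (256 / k) = en (C^2 * (256 / k))" by (rule ennreal_mult[symmetric]) (use k in simp_all)
  also have "C^2 * (256 / k) = 256 * C^2 / k" by simp
  finally show ?thesis .
qed

section \<open>Integrals across a line\<close>

lemma powr_mult_le_sum:
  fixes x y :: real
  assumes "1 \<le> x" "1 \<le> y" "0 \<le> a" "0 \<le> b"
  shows "x powr - a * y powr - b \<le> x powr - (a + b) + y powr - (a + b)"
proof (cases "x \<le> y")
  case True
  then have "y powr - b \<le> x powr - b" using assms by (intro powr_mono2') auto
  then have "x powr - a * y powr - b \<le> x powr - a * x powr - b" by (rule mult_left_mono) simp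
  also have "... = x powr - (a + b)" using assms by (simp add: powr_add[symmetric])
  also have "... \<le> x powr - (a + b) + y powr - (a + b)" by simp
  finally show ?thesis .
next
  case False
  then have "x powr - a \<le> y powr - a" using assms by (intro powr_mono2') auto
  then have "x powr - a * y powr - b \<le> y powr - a * y powr - b" by (rule mult_right_mono) simp
  also have "... = y powr - (a + b)" using assms by (simp add: powr_add[symmetric])
  also have "... \<le> x powr - (a + b) + y powr - (a + b)" by simp
  finally show ?thesis .
qed

text \<open>\<open>powr_mult_le_sum\<close> separates the two factors, and an affine substitution,
  costing \<open>1 / |e| \<le> 2\<close>, reduces the second to the first:
  \<open>2 + 2 * 2 = 6\<close>.\<close>

lemma nn_integral_line_kernel:
  fixes e c \<delta> :: real
  assumes e: "\<bar>e\<bar> \<ge> 1 / 2" and d: "\<delta> > 0"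
  shows "(NN x. en (ja x powr - \<delta> * (1 / ja (c + e * x)))) \<le> en (6 / \<delta>)"
proof -
  define f where "f t = en (ja t powr - (\<delta> + 1))" for t :: real
  have [measurable]: "f \<in> borel_fun" unfolding f_def[abs_def] by measurable
  have If: "(NN t. f t) \<le> en (2 / \<delta>)"
    using nn_integral_one_plus_powr[of "\<delta> + 1"] d unfolding f_def by simp
  have "(NN x. en (ja x powr - \<delta> * (1 / ja (c + e * x)))) \<le> (NN x. f x + 2 * (en \<bar>e\<bar> * f (c + e * x)))"
  proof (rule nn_integral_mono)
    fix x
    have i: "1 / ja (c + e * x) = ja (c + e * x) powr - 1" by (simp add: powr_minus_divide)
    have "ja x powr - \<delta> * (1 / ja (c + e * x)) \<le> ja x powr - (\<delta> + 1) + ja (c + e * x) powr - (\<delta> + 1)"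
      unfolding i using d by (intro powr_mult_le_sum) simp_all
    then have "en (ja x powr - \<delta> * (1 / ja (c + e * x))) \<le> f x + f (c + e * x)"
      unfolding f_def by (intro ennreal_le_plus) simp_all
    also have "... \<le> f x + 2 * (en \<bar>e\<bar> * f (c + e * x))"
    proof (rule add_left_mono)
      have "1 \<le> en (2 * \<bar>e\<bar>)" using e ennreal_leI[of 1 "2 * \<bar>e\<bar>"] by simp
      also have "... = 2 * en \<bar>e\<bar>" using ennreal_mult[of 2 "\<bar>e\<bar>"] by simp
      finally have "1 * f (c + e * x) \<le> 2 * en \<bar>e\<bar> * f (c + e * x)" by (rule mult_right_mono) simp
      then show "f (c + e * x) \<le> 2 * (en \<bar>e\<bar> * f (c + e * x))" by (simp add: mult.assoc)
    qed
    finally show "en (ja x powr - \<delta> * (1 / ja (c + e * x))) \<le> f x + 2 * (en \<bar>e\<bar> * f (c + e * x))" .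
  qed
  also have "... = (NN x. f x) + 2 * (en \<bar>e\<bar> * (NN x. f (c + e * x)))"
    by (simp add: nn_integral_add nn_integral_cmult)
  also have "... = (NN x. f x) + 2 * (NN x. f x)"
    using nn_integral_real_affine[of f e c] e by auto
  also have "... \<le> en (2 / \<delta>) + 2 * en (2 / \<delta>)"
    by (rule add_mono[OF If mult_left_mono[OF If]]) simp
  also have "... = en (6 / \<delta>)"
  proof -
    have "2 * en (2 / \<delta>) = en (2 * (2 / \<delta>))" using d ennreal_mult[of 2 "2 / \<delta>"] by simp
    then have "en (2 / \<delta>) + 2 * en (2 / \<delta>) = en (2 / \<delta> + 2 * (2 / \<delta>))" using d ennreal_plus[of "2 / \<delta>" "2 * (2 / \<delta>)"] by simp
    also have "2 / \<delta> + 2 * (2 / \<delta>) = 6 / \<delta>" by simp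
    finally show ?thesis .
  qed
  finally show ?thesis .
qed

text \<open>The coordinate transversal to the line is integrated first, at the price of the small
  power \<open>\<delta> / 2\<close>; the remaining power \<open>1 + \<delta> / 2\<close> is
  integrable in the other coordinate.\<close>

lemma nn_integral_direction_kernel:
  fixes e1 e2 c \<delta> :: real
  assumes e: "\<bar>e1\<bar> \<ge> 1 / 2 \<or> \<bar>e2\<bar> \<ge> 1 / 2" and d: "\<delta> > 0"
  shows "(NN v. en (jb (v::plane) powr - (1 + \<delta>) * (1 / ja (e1 * v $ 1 + e2 * v $ 2 + c)))) \<le> en (48 / \<delta>^2)"
proof -
  define F where "F v = en (jb v powr - (1 + \<delta>) * (1 / ja (e1 * v $ 1 + e2 * v $ 2 + c)))" for v :: plane
  have Fm: "F \<in> borel_fun" unfolding F_def[abs_def] by measurable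
  have split: "(1 + r) powr - (1 + \<delta>) \<le> ja y powr - (1 + \<delta> / 2) * ja x powr - (\<delta> / 2)" if "\<bar>x\<bar> \<le> r" "\<bar>y\<bar> \<le> r" for r x y :: real
  proof -
    have "(1 + r) powr - (1 + \<delta>) = (1 + r) powr - (1 + \<delta> / 2) * (1 + r) powr - (\<delta> / 2)"
      by (subst powr_add[symmetric]) (rule arg_cong2[where f = "(powr)"], simp_all)
    also have "... \<le> ja y powr - (1 + \<delta> / 2) * ja x powr - (\<delta> / 2)"
      using that d by (intro mult_mono powr_mono2') auto
    finally show ?thesis .
  qed
  have two: "(NN y. NN x. G x y) \<le> en (48 / \<delta>^2)"
    if e: "\<bar>e\<bar> \<ge> 1 / 2" and G: "\<And>x y. G x y \<le> en (ja y powr - (1 + \<delta> / 2)) * en (ja x powr - (\<delta> / 2) * (1 / ja (b y + e * x)))" for G e and b :: "real \<Rightarrow> real"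
  proof -
    have "(NN x. G x y) \<le> en (ja y powr - (1 + \<delta> / 2)) * en (6 / (\<delta> / 2))" for y
    proof -
      have "(NN x. G x y) \<le> (NN x. en (ja y powr - (1 + \<delta> / 2)) * en (ja x powr - (\<delta> / 2) * (1 / ja (b y + e * x))))"
        by (intro nn_integral_mono G)
      also have "... = en (ja y powr - (1 + \<delta> / 2)) * (NN x. en (ja x powr - (\<delta> / 2) * (1 / ja (b y + e * x))))"
        by (rule nn_integral_cmult) measurable
      also have "... \<le> en (ja y powr - (1 + \<delta> / 2)) * en (6 / (\<delta> / 2))"
        by (rule mult_left_mono[OF nn_integral_line_kernel[OF e]]) (use d in simp_all)
      finally show ?thesis .
    qed
    then have "(NN y. NN x. G x y) \<le> (NN y. en (ja y powr - (1 + \<delta> / 2)) * en (6 / (\<delta> / 2)))"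
      by (intro nn_integral_mono)
    also have "... = (NN y. en (ja y powr - (1 + \<delta> / 2))) * en (6 / (\<delta> / 2))"
      by (rule nn_integral_multc) measurable
    also have "... \<le> en (2 / ((1 + \<delta> / 2) - 1)) * en (6 / (\<delta> / 2))"
      by (rule mult_right_mono[OF nn_integral_one_plus_powr]) (use d in simp_all)
    also have "... = en (2 / ((1 + \<delta> / 2) - 1) * (6 / (\<delta> / 2)))"
      by (rule ennreal_mult[symmetric]) (use d in simp_all)
    also have "2 / ((1 + \<delta> / 2) - 1) * (6 / (\<delta> / 2)) = 48 / \<delta>^2" using d by (simp add: power2_eq_square)
    finally show ?thesis .
  qed
  have nle: "\<bar>x\<bar> \<le> norm (pl x y)" "\<bar>y\<bar> \<le> norm (pl x y)" for x y
    using abs_component_le[of "pl x y" 1] abs_component_le[of "pl x y" 2] by simp_all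
  have Fle: "F (pl x y) \<le> en (ja s powr - (1 + \<delta> / 2)) * en (ja t powr - (\<delta> / 2) * (1 / ja (e1 * x + e2 * y + c)))"
    if "\<bar>t\<bar> \<le> norm (pl x y)" "\<bar>s\<bar> \<le> norm (pl x y)" for x y s t
  proof -
    have "jb (pl x y) powr - (1 + \<delta>) * (1 / ja (e1 * x + e2 * y + c)) \<le>
        ja s powr - (1 + \<delta> / 2) * ja t powr - (\<delta> / 2) * (1 / ja (e1 * x + e2 * y + c))"
      by (rule mult_right_mono[OF split[OF that]]) simp
    then have "en (jb (pl x y) powr - (1 + \<delta>) * (1 / ja (e1 * x + e2 * y + c))) \<le>
        en (ja s powr - (1 + \<delta> / 2) * (ja t powr - (\<delta> / 2) * (1 / ja (e1 * x + e2 * y + c))))"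
      unfolding mult.assoc by (rule ennreal_leI)
    also have "... = en (ja s powr - (1 + \<delta> / 2)) * en (ja t powr - (\<delta> / 2) * (1 / ja (e1 * x + e2 * y + c)))"
      by (rule ennreal_mult) simp_all
    finally show ?thesis by (simp add: F_def)
  qed
  show ?thesis
  proof (cases "\<bar>e1\<bar> \<ge> 1 / 2")
    case True
    show ?thesis unfolding F_def[symmetric] nn_integral_plane(2)[OF Fm]
    proof (rule two[OF True, where b = "\<lambda>y. e2 * y + c"])
      fix x y :: real
      have "e1 * x + e2 * y + c = e2 * y + c + e1 * x" by simp
      from Fle[OF nle(1)[where x = x and y = y] nle(2)[where x = x and y = y], unfolded this]
      show "F (pl x y) \<le> en (ja y powr - (1 + \<delta> / 2)) * en (ja x powr - (\<delta> / 2) * (1 / ja (e2 * y + c + e1 * x)))" .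
    qed
  next
    case False
    with e have e2: "\<bar>e2\<bar> \<ge> 1 / 2" by simp
    show ?thesis unfolding F_def[symmetric] nn_integral_plane(1)[OF Fm]
    proof (rule two[OF e2, where b = "\<lambda>x. e1 * x + c"])
      fix y x :: real
      have "e1 * x + e2 * y + c = e1 * x + c + e2 * y" by simp
      from Fle[OF nle(2)[where x = x and y = y] nle(1)[where x = x and y = y], unfolded this]
      show "F (pl x y) \<le> en (ja x powr - (1 + \<delta> / 2)) * en (ja y powr - (\<delta> / 2) * (1 / ja (e1 * x + c + e2 * y)))" .
    qed
  qed
qed

text \<open>In the lemma below the first summand serves \<open>norm \<tau> \<le> 1\<close>, the
  second \<open>norm \<tau> > 1\<close>.\<close>

definition CL :: "real \<Rightarrow> real" where
  "CL \<delta> = 2 * enn2real (NN v. en (jb (v::plane) powr - (2 + \<delta>))) + 96 / \<delta>^2"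

lemma CL_nonneg: "0 \<le> CL \<delta>" by (simp add: CL_def)

text \<open>The point is the gain of one power of \<open>jb \<tau>\<close>: it pays for the weight
  that the Schur test puts on the square of \<open>M\<close>. For large \<open>\<tau>\<close> it
  comes from dividing the linear form by \<open>norm \<tau>\<close>; for small \<open>\<tau>\<close>
  there is nothing to gain, and \<open>norm v\<close> in the denominator gives convergence.\<close>

lemma nn_integral_shear_kernel:
  fixes \<tau> :: plane
  assumes d: "\<delta> > 0"
  shows "(NN v. en (jb (v::plane) powr - (1 + \<delta>) * (1 / (1 + norm \<tau> + norm v + \<bar>\<tau> \<bullet> v - c\<bar>)))) \<le> en (CL \<delta> / jb \<tau>)"
proof (cases "norm \<tau> \<le> 1")
  case True
  define I where "I = enn2real (NN v. en (jb (v::plane) powr - (2 + \<delta>)))"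
  have I: "(NN v. en (jb (v::plane) powr - (2 + \<delta>))) = en I"
    unfolding I_def using nn_integral_plane_powr[of "2 + \<delta>"] d by (simp add: less_top)
  have "(NN v. en (jb (v::plane) powr - (1 + \<delta>) * (1 / (1 + norm \<tau> + norm v + \<bar>\<tau> \<bullet> v - c\<bar>)))) \<le> (NN v. en (jb (v::plane) powr - (2 + \<delta>)))"
  proof (intro nn_integral_mono ennreal_leI)
    fix v :: plane
    have "1 / (1 + norm \<tau> + norm v + \<bar>\<tau> \<bullet> v - c\<bar>) \<le> 1 / jb v"
      by (rule divide_left_mono) (simp_all add: add_pos_nonneg)
    also have "... = jb v powr - 1" by (simp add: powr_minus_divide)
    finally have "jb v powr - (1 + \<delta>) * (1 / (1 + norm \<tau> + norm v + \<bar>\<tau> \<bullet> v - c\<bar>)) \<le> jb v powr - (1 + \<delta>) * jb v powr - 1"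
      by (rule mult_left_mono) simp
    also have "... = jb v powr - (2 + \<delta>)"
      by (subst powr_add[symmetric]) (rule arg_cong2[where f = "(powr)"], simp_all)
    finally show "jb v powr - (1 + \<delta>) * (1 / (1 + norm \<tau> + norm v + \<bar>\<tau> \<bullet> v - c\<bar>)) \<le> jb v powr - (2 + \<delta>)" .
  qed
  also have "... = en I" by (rule I)
  also have "... \<le> en (CL \<delta> / jb \<tau>)"
  proof (rule ennreal_leI)
    have I0: "0 \<le> I" by (simp add: I_def)
    have "I * jb \<tau> \<le> I * 2" using True I0 by (intro mult_left_mono) simp_all
    also have "... \<le> CL \<delta>" by (simp add: CL_def I_def)
    finally show "I \<le> CL \<delta> / jb \<tau>" by (subst pos_le_divide_eq) (simp_all add: add_pos_nonneg)
  qed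
  finally show ?thesis .
next
  case False
  let ?D = "\<lambda>v. 1 + norm \<tau> + norm v + \<bar>\<tau> \<bullet> v - c\<bar>"
  define t where "t = norm \<tau>"
  have t: "t > 1" using False by (simp add: t_def)
  define e1 e2 where "e1 = \<tau> $ 1 / t" and "e2 = \<tau> $ 2 / t"
  let ?J = "\<lambda>v::plane. ja (e1 * v $ 1 + e2 * v $ 2 + - c / t)"
  have "e1^2 + e2^2 = ((\<tau> $ 1)^2 + (\<tau> $ 2)^2) / t^2" by (simp add: e1_def e2_def power_divide add_divide_distrib)
  also have "(\<tau> $ 1)^2 + (\<tau> $ 2)^2 = t^2" by (simp add: t_def norm_plane)
  finally have e12: "e1^2 + e2^2 = 1" using t by simp
  have e: "\<bar>e1\<bar> \<ge> 1 / 2 \<or> \<bar>e2\<bar> \<ge> 1 / 2"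
  proof (rule ccontr)
    assume "\<not> ?thesis"
    then have a: "\<bar>e1\<bar> \<le> 1 / 2" "\<bar>e2\<bar> \<le> 1 / 2" by simp_all
    have "e1^2 \<le> (1 / 2)^2" "e2^2 \<le> (1 / 2)^2" using power_mono[OF a(1), of 2] power_mono[OF a(2), of 2] by simp_all
    then have "e1^2 \<le> 1 / 4" "e2^2 \<le> 1 / 4" by (simp_all add: power2_eq_square)
    then show False using e12 by linarith
  qed
  have "(NN v. en (jb (v::plane) powr - (1 + \<delta>) * (1 / ?D v))) \<le>
    (NN v. en (1 / t) * en (jb (v::plane) powr - (1 + \<delta>) * (1 / ?J v)))"
  proof (rule nn_integral_mono)
    fix v :: plane
    have "t * (e1 * v $ 1 + e2 * v $ 2 + - c / t) = \<tau> \<bullet> v - c" using t by (simp add: inner_plane e1_def e2_def field_simps)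
    then have eq: "\<bar>\<tau> \<bullet> v - c\<bar> = t * \<bar>e1 * v $ 1 + e2 * v $ 2 + - c / t\<bar>" using t by (metis abs_mult abs_of_pos less_trans zero_less_one)
    have "1 / ?D v \<le> 1 / (t * ?J v)"
    proof (rule divide_left_mono)
      show "t * ?J v \<le> 1 + norm \<tau> + norm v + \<bar>\<tau> \<bullet> v - c\<bar>"
        unfolding eq distrib_left t_def[symmetric] by simp
      show "0 < ?D v * (t * ?J v)"
        using t by (intro mult_pos_pos add_pos_nonneg) simp_all
    qed simp
    also have "... = 1 / t * (1 / ?J v)" by simp
    finally have "jb v powr - (1 + \<delta>) * (1 / ?D v) \<le> jb v powr - (1 + \<delta>) * (1 / t * (1 / ?J v))"
      by (rule mult_left_mono) simp
    then have "en (jb v powr - (1 + \<delta>) * (1 / ?D v)) \<le> en (1 / t * (jb v powr - (1 + \<delta>) * (1 / ?J v)))"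
      unfolding mult.left_commute[of "jb v powr - (1 + \<delta>)" "1 / t"] by (rule ennreal_leI)
    also have "... = en (1 / t) * en (jb v powr - (1 + \<delta>) * (1 / ?J v))"
      by (rule ennreal_mult) (use t in simp_all)
    finally show "en (jb v powr - (1 + \<delta>) * (1 / ?D v)) \<le> en (1 / t) * en (jb v powr - (1 + \<delta>) * (1 / ?J v))" .
  qed
  also have "... = en (1 / t) * (NN v. en (jb (v::plane) powr - (1 + \<delta>) * (1 / ?J v)))"
    by (rule nn_integral_cmult) measurable
  also have "... \<le> en (1 / t) * en (48 / \<delta>^2)"
    by (rule mult_left_mono[OF nn_integral_direction_kernel[OF e d]]) simp
  also have "... = en (1 / t * (48 / \<delta>^2))" by (rule ennreal_mult[symmetric]) (use t in simp_all)
  also have "... \<le> en (CL \<delta> / jb \<tau>)"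
  proof (rule ennreal_leI)
    have "1 / t \<le> 2 / (1 + t)" using t by (simp add: field_simps)
    then have "1 / t * (48 / \<delta>^2) \<le> 2 / (1 + t) * (48 / \<delta>^2)" by (rule mult_right_mono) simp
    also have "... = (96 / \<delta>^2) / (1 + t)" by simp
    also have "... \<le> CL \<delta> / (1 + t)" using t by (intro divide_right_mono) (simp_all add: CL_def)
    finally show "1 / t * (48 / \<delta>^2) \<le> CL \<delta> / jb \<tau>" by (simp only: t_def)
  qed
  finally show ?thesis .
qed

text \<open>Arranged so that in \<open>chain_Schur\<close> every product pairs a function of one
  variable with a function of the other.\<close>

lemma amgm_weighted:
  fixes a b p q :: real
  assumes "p > 0" "q > 0"
  shows "a * b \<le> (a^2 * p) * (1 / q) + (1 / p) * (b^2 * q)"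
proof -
  have "0 \<le> (a * p - b * q)^2 + (a * p)^2 + (b * q)^2" by simp
  then have "(a * b) * (p * q) \<le> a^2 * p^2 + b^2 * q^2" by (simp add: power2_eq_square algebra_simps)
  also have "... = ((a^2 * p) * (1 / q) + (1 / p) * (b^2 * q)) * (p * q)" using assms by (simp add: field_simps power2_eq_square)
  finally show ?thesis using assms by (simp only: mult_le_cancel_right_pos mult_pos_pos)
qed

lemma nn_integral_scale_translate:
  fixes h :: "plane \<Rightarrow> ennreal"
  assumes [measurable]: "h \<in> borel_fun"
  shows "(NN x. h (2 *\<^sub>R x - t)) \<le> (NN x. h x)"
proof -
  have "(NN x. h x) = (NN x. en (\<bar>2\<bar> ^ DIM(plane)) * h (- t + 2 *\<^sub>R x))"
    by (subst lborel_affine[of 2 "- t"]) (simp_all add: nn_integral_density nn_integral_distr)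
  also have "... = 4 * (NN x. h (2 *\<^sub>R x - t))"
    by (simp add: nn_integral_cmult)
  finally have e: "(NN x. h x) = 4 * (NN x. h (2 *\<^sub>R x - t))" .
  have "1 * (NN x. h (2 *\<^sub>R x - t)) \<le> 4 * (NN x. h (2 *\<^sub>R x - t))" by (rule mult_right_mono) simp_all
  then show ?thesis unfolding e by simp
qed

text \<open>The identity \<open>k\<^sup>2 - \<bar>\<tau> - \<kappa>\<bar>\<^sup>2 = \<tau> \<bullet> (2 \<kappa> - \<tau>)\<close> turns the singular circle of the kernel, for
  fixed \<open>\<tau>\<close>, into a line in the variable \<open>\<kappa>\<close>.\<close>

lemma Kb_shear:
  assumes C: "0 \<le> C" and k: "norm kv \<ge> 2"
  shows "Kb C (norm kv) (\<tau> - kv) \<le> 3 * C * (1 / (1 + norm \<tau> + norm kv + \<bar>\<tau> \<bullet> kv - (norm \<tau>)\<^sup>2 / 2\<bar>))"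
    and "Kb C (norm kv) (\<tau> - kv) \<le> 3 * C * (1 / (1 + norm \<tau> + norm (2 *\<^sub>R kv - \<tau>) + \<bar>\<tau> \<bullet> (2 *\<^sub>R kv - \<tau>) - 0\<bar>))"
proof -
  define k' s where "k' = norm kv" and "s = norm (\<tau> - kv)"
  define d where "d = \<bar>k'^2 - s^2\<bar>"
  have s: "0 \<le> s" "2 \<le> k'" "0 \<le> d" using k by (simp_all add: s_def k'_def d_def)
  have t: "norm \<tau> \<le> k' + s" unfolding k'_def s_def using norm_triangle_ineq[of kv "\<tau> - kv"] by simp
  have t2: "norm (2 *\<^sub>R kv - \<tau>) \<le> k' + s"
    unfolding k'_def s_def using norm_triangle_ineq4[of kv "\<tau> - kv"] by (simp add: scaleR_2 algebra_simps)
  have e1: "k'^2 - s^2 = 2 * (\<tau> \<bullet> kv) - (norm \<tau>)^2"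
    by (simp add: k'_def s_def power2_norm_eq_inner inner_diff_left inner_diff_right inner_commute)
  have e2: "k'^2 - s^2 = \<tau> \<bullet> (2 *\<^sub>R kv - \<tau>)" unfolding e1 by (simp add: power2_norm_eq_inner inner_diff_right)
  have "k'^2 - s^2 = (k' - s) * (k' + s)" by (simp add: power2_eq_square algebra_simps)
  \<comment> \<open>The product in \<open>Kb\<close> becomes a sum, and its last term
    \<open>d\<close> is the modulus of an affine function of \<open>kv\<close> once
    \<open>\<tau>\<close> is fixed.\<close>
  then have den: "ja (k' - s) * (k' + s) = k' + s + d" unfolding d_def using s by (simp add: abs_mult distrib_right)
  have Kb: "Kb C (norm kv) (\<tau> - kv) = C / (k' + s + d)" unfolding Kb_def k'_def[symmetric] s_def[symmetric] den ..
  have gen: "Kb C (norm kv) (\<tau> - kv) \<le> 3 * C * (1 / X)" if X: "0 < X" "X \<le> 3 * k' + 3 * s + 3 * d" for X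
  proof -
    have X: "0 < X" "X \<le> 3 * (k' + s + d)" using X by simp_all
    have "1 / (3 * (k' + s + d)) \<le> 1 / X" using X by (intro divide_left_mono mult_pos_pos) simp_all
    then have "3 * C * (1 / (3 * (k' + s + d))) \<le> 3 * C * (1 / X)" using C by (intro mult_left_mono) simp_all
    moreover have "3 * C * (1 / (3 * D)) = C / D" for D by simp
    ultimately show ?thesis unfolding Kb by (simp only:)
  qed
  have h: "\<bar>\<tau> \<bullet> kv - (norm \<tau>)\<^sup>2 / 2\<bar> = d / 2" unfolding d_def e1 by (simp add: abs_if)
  show "Kb C (norm kv) (\<tau> - kv) \<le> 3 * C * (1 / (1 + norm \<tau> + norm kv + \<bar>\<tau> \<bullet> kv - (norm \<tau>)\<^sup>2 / 2\<bar>))"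
    unfolding h k'_def[symmetric] by (rule gen[folded k'_def]; use t s norm_ge_zero[of \<tau>] in linarith)
  have h2: "\<bar>\<tau> \<bullet> (2 *\<^sub>R kv - \<tau>) - 0\<bar> = d" unfolding d_def e2 by simp
  show "Kb C (norm kv) (\<tau> - kv) \<le> 3 * C * (1 / (1 + norm \<tau> + norm (2 *\<^sub>R kv - \<tau>) + \<bar>\<tau> \<bullet> (2 *\<^sub>R kv - \<tau>) - 0\<bar>))"
    unfolding h2 by (rule gen; use t t2 s norm_ge_zero[of \<tau>] norm_ge_zero[of "2 *\<^sub>R kv - \<tau>"] in linarith)
qed

section \<open>Chains as powers of a symmetric operator, and the Schur test\<close>

locale kernel_chain =
  fixes C :: real and M :: "plane \<Rightarrow> real"
  assumes C_nonneg: "0 \<le> C" and M_measurable [measurable]: "M \<in> borel_fun"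
    and M_nonneg: "\<And>\<tau>. 0 \<le> M \<tau>" and M_even: "\<And>\<tau>. M (- \<tau>) = M \<tau>"
begin

definition T :: "real \<Rightarrow> (plane \<Rightarrow> ennreal) \<Rightarrow> plane \<Rightarrow> ennreal" where
  "T k g \<zeta> = (NN u. en (M (\<zeta> - u)) * en (Kb C k u) * g u)"

lemma chain_eq_T: "chain C M j kv = (T (norm kv) ^^ j) (\<lambda>\<zeta>. en (M (\<zeta> - kv)))"
proof (induction j)
  case (Suc j) show ?case by (rule ext) (simp add: Suc T_def)
qed (simp add: fun_eq_iff)

lemma T_measurable:
  assumes [measurable]: "g \<in> borel_fun"
  shows "T k g \<in> borel_fun"
  unfolding T_def[abs_def] by measurable

lemma Tn_measurable: "g \<in> borel_fun \<Longrightarrow> (T k ^^ n) g \<in> borel_fun"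
  by (induction n) (simp_all add: T_measurable)

text \<open>The kernel of \<open>T\<close> is positive, so a linear inequality between functions
  survives \<open>n\<close> applications.\<close>

lemma Tn_linear:
  assumes [measurable]: "b \<in> borel_fun" "f \<in> borel_fun" "h \<in> borel_fun"
    and le: "\<And>u. c * b u \<le> d * f u + e * h u"
  shows "c * (T k ^^ n) b \<zeta> \<le> d * (T k ^^ n) f \<zeta> + e * (T k ^^ n) h \<zeta>"
proof (induction n arbitrary: \<zeta>)
  case 0 show ?case using le by simp
next
  case (Suc n)
  note [measurable] = Tn_measurable[OF assms(1), of n k] Tn_measurable[OF assms(2), of n k] Tn_measurable[OF assms(3), of n k]
  let ?w = "\<lambda>u. en (M (\<zeta> - u)) * en (Kb C k u)"
  have sw: "x * (y * z) = y * (x * z)" for x y z :: ennreal by (rule mult.left_commute)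
  have "c * (T k ^^ Suc n) b \<zeta> = (NN u. c * (?w u * (T k ^^ n) b u))" by (simp add: T_def nn_integral_cmult)
  also have "... \<le> (NN u. d * (?w u * (T k ^^ n) f u) + e * (?w u * (T k ^^ n) h u))"
  proof (rule nn_integral_mono)
    fix u
    have "?w u * (c * (T k ^^ n) b u) \<le> ?w u * (d * (T k ^^ n) f u + e * (T k ^^ n) h u)" by (rule mult_left_mono[OF Suc]) simp
    then show "c * (?w u * (T k ^^ n) b u) \<le> d * (?w u * (T k ^^ n) f u) + e * (?w u * (T k ^^ n) h u)"
      unfolding distrib_left sw[of c] sw[of d] sw[of e] .
  qed
  also have "... = d * (T k ^^ Suc n) f \<zeta> + e * (T k ^^ Suc n) h \<zeta>" by (simp add: T_def nn_integral_cmult nn_integral_add)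
  finally show ?case .
qed

text \<open>\<open>T\<close> is symmetric with respect to the density \<open>Kb\<close>, because
  \<open>M\<close> is even.\<close>

lemma T_adjoint:
  assumes [measurable]: "f \<in> borel_fun" "g \<in> borel_fun"
  shows "(NN u. en (Kb C k u) * (f u * T k g u)) = (NN u. en (Kb C k u) * (g u * T k f u))"
proof -
  have e: "(NN u. en (Kb C k u) * (f u * T k g u)) =
    (NN u. NN u'. en (Kb C k u) * f u * (en (M (u - u')) * en (Kb C k u') * g u'))"
    if [measurable]: "f \<in> borel_fun" "g \<in> borel_fun" for f g
    unfolding T_def mult.assoc[symmetric, of "en (Kb C k _)" "f _"] by (intro nn_integral_cong nn_integral_cmult[symmetric]) measurable
  have "(NN u. NN u'. en (Kb C k u) * f u * (en (M (u - u')) * en (Kb C k u') * g u')) =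
      (NN u'. NN u. en (Kb C k u) * f u * (en (M (u - u')) * en (Kb C k u') * g u'))"
    by (rule lborel_pair.Fubini') measurable
  also have "... = (NN u'. NN u. en (Kb C k u') * g u' * (en (M (u' - u)) * en (Kb C k u) * f u))"
  proof (intro nn_integral_cong)
    fix x y
    have "M (x - y) = M (y - x)" using M_even[of "x - y"] by simp
    then show "en (Kb C k x) * f x * (en (M (x - y)) * en (Kb C k y) * g y) = en (Kb C k y) * g y * (en (M (y - x)) * en (Kb C k x) * f x)"
      by (simp only: mult_ac)
  qed
  finally show ?thesis unfolding e[OF assms] e[OF assms(2,1)] .
qed

lemma Tn_adjoint:
  assumes f: "f \<in> borel_fun" and g: "g \<in> borel_fun"
  shows "(NN u. en (Kb C k u) * (f u * (T k ^^ n) g u)) = (NN u. en (Kb C k u) * (g u * (T k ^^ n) f u))"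
  using f
proof (induction n arbitrary: f)
  case 0 show ?case by (simp add: mult_ac)
next
  case (Suc n)
  have "(NN u. en (Kb C k u) * (f u * (T k ^^ Suc n) g u)) = (NN u. en (Kb C k u) * ((T k ^^ n) g u * T k f u))"
    using T_adjoint[OF Suc.prems Tn_measurable[OF g]] by simp
  also have "... = (NN u. en (Kb C k u) * (T k f u * (T k ^^ n) g u))" by (simp only: mult.commute[of "(T k ^^ n) g _"])
  also have "... = (NN u. en (Kb C k u) * (g u * (T k ^^ n) (T k f) u))" by (rule Suc.IH[OF T_measurable[OF Suc.prems]])
  finally show ?case by (simp only: funpow_Suc_right comp_def)
qed

lemma Kb_even: "Kb C k (- u) = Kb C k u" by (simp add: Kb_def)

text \<open>The outermost and the innermost factor \<open>M\<close> are separated by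
  \<open>amgm_weighted\<close>, at the cost of a quotient of values of \<open>P\<close>. In the term
  with the square of the innermost factor, \<open>T ^^ n\<close> is moved onto \<open>1 / P\<close>
  by symmetry, and the reflection of \<open>u\<close> identifies the result with the other term.
  There remain one square of \<open>M\<close> and the bound \<open>B\<close> on
  \<open>T ^^ n\<close> applied to \<open>1 / P\<close>.\<close>

lemma chain_Schur:
  assumes [measurable]: "P \<in> borel_fun" and P: "\<And>\<tau>. P \<tau> > 0" "\<And>\<tau>. P (- \<tau>) = P \<tau>"
    and B [measurable]: "B \<in> borel_fun"
    and TB: "\<And>u. (T (norm kv) ^^ n) (\<lambda>u. en (1 / P (u - kv))) u \<le> en (B (u - kv))"
    and TB': "\<And>u. (T (norm kv) ^^ n) (\<lambda>u. en (1 / P (kv + u))) u \<le> en (B (kv + u))"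
    and Be: "\<And>\<tau>. B (- \<tau>) = B \<tau>"
  shows "chain C M (Suc n) kv (- kv) \<le> 2 * (NN u. en ((M (kv + u))^2 * P (kv + u)) * (en (Kb C (norm kv) u) * en (B (u - kv))))"
proof -
  let ?K = "\<lambda>u. en (Kb C (norm kv) u)" and ?T = "T (norm kv) ^^ n"
  define a b where "a u = en ((M (kv + u))^2 * P (kv + u))" and "b u = en ((M (u - kv))^2 * P (u - kv))" for u
  define p r where "p u = en (1 / P (kv + u))" and "r u = en (1 / P (u - kv))" for u
  have m [measurable]: "a \<in> borel_fun" "b \<in> borel_fun" "p \<in> borel_fun" "r \<in> borel_fun"
    unfolding a_def[abs_def] b_def[abs_def] p_def[abs_def] r_def[abs_def] by measurable
  have mM: "(\<lambda>\<zeta>. en (M (\<zeta> - kv))) \<in> borel_fun" by measurable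
  note [measurable] = Tn_measurable[OF m(2), of n "norm kv"] Tn_measurable[OF m(3), of n "norm kv"] Tn_measurable[OF m(4), of n "norm kv"]
  have lin: "en (M (kv + u)) * ?T (\<lambda>\<zeta>. en (M (\<zeta> - kv))) u \<le> a u * ?T r u + p u * ?T b u" for u
  proof (rule Tn_linear[OF mM m(4) m(2)])
    fix u'
    have "M (kv + u) * M (u' - kv) \<le> ((M (kv + u))^2 * P (kv + u)) * (1 / P (u' - kv)) + (1 / P (kv + u)) * ((M (u' - kv))^2 * P (u' - kv))"
      by (rule amgm_weighted[OF P(1) P(1)])
    from ennreal_le_plus[OF this] show "en (M (kv + u)) * en (M (u' - kv)) \<le> a u * r u' + p u * b u'"
      using P(1) M_nonneg less_imp_le[OF P(1)] unfolding a_def b_def p_def r_def by (simp add: ennreal_mult[symmetric])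
  qed
  have "chain C M (Suc n) kv (- kv) = (NN u. ?K u * (en (M (kv + u)) * ?T (\<lambda>\<zeta>. en (M (\<zeta> - kv))) u))"
  proof -
    have "M (- kv - u) = M (kv + u)" for u using M_even[of "kv + u"] by simp
    then show ?thesis by (simp add: chain_eq_T T_def mult_ac)
  qed
  also have "... \<le> (NN u. ?K u * (a u * ?T r u) + ?K u * (p u * ?T b u))"
    unfolding distrib_left[symmetric] by (intro nn_integral_mono mult_left_mono lin) simp
  also have "... = (NN u. ?K u * (a u * ?T r u)) + (NN u. ?K u * (p u * ?T b u))"
    by (rule nn_integral_add) measurable
  finally have c1: "chain C M (Suc n) kv (- kv) \<le> (NN u. ?K u * (a u * ?T r u)) + (NN u. ?K u * (p u * ?T b u))" .
  have c2: "(NN u. ?K u * (p u * ?T b u)) = (NN u. ?K u * (b u * ?T p u))"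
    by (rule Tn_adjoint[OF m(3,2)])
  define D where "D = (NN u. a u * (?K u * en (B (u - kv))))"
  have c3: "(NN u. ?K u * (a u * ?T r u)) \<le> D"
    unfolding D_def mult.left_commute[of "a _"] r_def[abs_def] by (intro nn_integral_mono mult_left_mono TB) simp_all
  have "(NN u. ?K u * (b u * ?T p u)) \<le> (NN u. b u * (?K u * en (B (kv + u))))"
    unfolding mult.left_commute[of "b _"] p_def[abs_def] by (intro nn_integral_mono mult_left_mono TB') simp_all
  also have "... = (NN u. b (0 - u) * (?K (0 - u) * en (B (kv + (0 - u)))))"
    by (rule nn_integral_translate(1)[symmetric]) measurable
  also have "... = D"
  proof -
    have "b (0 - u) = a u" for u
    proof -
      have "0 - u - kv = - (kv + u)" by simp
      then show ?thesis unfolding a_def b_def by (simp only: M_even P(2))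
    qed
    moreover have "B (kv + (0 - u)) = B (u - kv)" for u using Be[of "u - kv"] by simp
    moreover have "Kb C (norm kv) (0 - u) = Kb C (norm kv) u" for u using Kb_even[of _ u] by simp
    ultimately show ?thesis unfolding D_def by (simp only:)
  qed
  finally have c4: "(NN u. ?K u * (b u * ?T p u)) \<le> D" .
  have "chain C M (Suc n) kv (- kv) \<le> D + D" using c1 add_mono[OF c3 c4] unfolding c2 by (rule order_trans)
  then show ?thesis unfolding mult_2 D_def a_def .
qed

text \<open>Substitution of \<open>\<tau> = kv + u\<close> and exchange of the integrals:
  \<open>F\<close> depends on \<open>\<tau>\<close> alone, so \<open>kv\<close> is integrated first
  with \<open>\<tau>\<close> fixed.\<close>

lemma swap_shear:
  assumes [measurable]: "F \<in> borel_fun" "(\<lambda>p. G (fst p) (snd p)) \<in> borel_measurable (borel \<Otimes>\<^sub>M borel)"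
    and le: "\<And>\<tau>. (NN kv. G kv (\<tau> - kv)) \<le> H \<tau>"
  shows "(NN kv. NN u. F (kv + u) * G kv u) \<le> (\<integral>\<^sup>+\<tau>. F \<tau> * H \<tau> \<partial>(lborel :: plane measure))"
proof -
  have G1: "(\<lambda>u. G kv u) \<in> borel_fun" for kv
  proof -
    have a: "(\<lambda>u. (kv, u)) \<in> measurable borel (borel \<Otimes>\<^sub>M borel)" by measurable
    show ?thesis using measurable_compose[OF a assms(2)] by simp
  qed
  have G2: "(\<lambda>kv. G kv (\<tau> - kv)) \<in> borel_fun" for \<tau>
  proof -
    have a: "(\<lambda>kv. (kv, \<tau> - kv)) \<in> measurable borel (borel \<Otimes>\<^sub>M borel)" by measurable
    show ?thesis using measurable_compose[OF a assms(2)] by simp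
  qed
  have G3: "(\<lambda>p. G (snd p) (fst p - snd p)) \<in> borel_measurable (borel \<Otimes>\<^sub>M borel)"
  proof -
    have a: "(\<lambda>p. (snd p, fst p - snd p)) \<in> measurable (borel \<Otimes>\<^sub>M borel) (borel \<Otimes>\<^sub>M (borel :: plane measure))" by measurable
    show ?thesis using measurable_compose[OF a assms(2)] by simp
  qed
  have "(NN u. F (kv + u) * G kv u) = (NN \<tau>. F \<tau> * G kv (\<tau> - kv))" for kv
  proof -
    have "(\<lambda>u. F (kv + u) * G kv u) \<in> borel_fun" using G1[of kv] by measurable
    from nn_integral_translate(2)[OF this, of kv] show ?thesis by simp
  qed
  then have "(NN kv. NN u. F (kv + u) * G kv u) = (NN kv. NN \<tau>. F \<tau> * G kv (\<tau> - kv))" by simp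
  also have "... = (NN \<tau>. NN kv. F \<tau> * G kv (\<tau> - kv))"
  proof (rule lborel_pair.Fubini')
    have "(\<lambda>p. F (fst p)) \<in> borel_measurable (borel \<Otimes>\<^sub>M borel)" by measurable
    from borel_measurable_times_ennreal[OF this G3]
    show "(\<lambda>(\<tau>, kv). F \<tau> * G kv (\<tau> - kv)) \<in> borel_measurable lborel2" by (simp add: split_beta')
  qed
  also have "... = (NN \<tau>. F \<tau> * (NN kv. G kv (\<tau> - kv)))"
    using G2 by (intro nn_integral_cong nn_integral_cmult) simp
  also have "... \<le> (NN \<tau>. F \<tau> * H \<tau>)" by (intro nn_integral_mono mult_left_mono le) simp
  finally show ?thesis .
qed

end

text \<open>Integrability in \<open>kv\<close>, expressed through a measurable majorant so that
  measurability of the chains themselves is bypassed. The range of \<open>kv\<close> is that of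
  \<open>Kb_shear\<close>.\<close>

definition dominated :: "(plane \<Rightarrow> ennreal) \<Rightarrow> bool" where
  "dominated X \<longleftrightarrow> (\<exists>H. H \<in> borel_fun \<and> (\<forall>kv. 2 \<le> norm kv \<longrightarrow> X kv \<le> H kv) \<and> (NN kv. H kv) < \<infinity>)"

lemma powr_le_one_plus_powr:
  fixes k p :: real
  assumes k: "1 \<le> k" and p: "0 \<le> p" "p \<le> 2"
  shows "k powr - p \<le> 4 * (1 + k) powr - p"
proof -
  have "(1 + k) powr p \<le> (2 * k) powr p" using k p by (intro powr_mono2) simp_all
  also have "... = 2 powr p * k powr p" using k by (simp add: powr_mult)
  also have "... \<le> 4 * k powr p"
  proof (rule mult_right_mono)
    have "2 powr p \<le> (2::real) powr 2" using p by (intro powr_mono) simp_all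
    then show "2 powr p \<le> (4::real)" by simp
  qed simp
  finally have b: "(1 + k) powr p \<le> 4 * k powr p" .
  have "inverse s \<le> 4 * inverse t" if "0 < s" "0 < t" "t \<le> 4 * s" for s t :: real using that by (simp add: field_simps)
  from this[OF _ _ b] show ?thesis using k unfolding powr_minus by simp
qed

section \<open>Integrable majorants for the orders 1 to 4\<close>

context kernel_chain begin

lemma Kb_nonneg': "0 < k \<Longrightarrow> 0 \<le> Kb C k u"
  using C_nonneg by (simp add: Kb_def)

text \<open>Cauchy-Schwarz in additive form, with a free parameter \<open>s\<close> to be balanced
  against \<open>B\<close>.\<close>

lemma T_bound:
  assumes k: "k > 0" and s: "s > 0" and A: "(NN \<tau>. en ((M \<tau>)^2)) \<le> en A" "0 \<le> A" "0 \<le> B"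
    and w [measurable]: "w \<in> borel_fun" and w0: "\<And>u. 0 \<le> w u"
    and Kw: "(NN u. en ((Kb C k u)^2 * (w u)^2)) \<le> en B"
  shows "T k (\<lambda>u. en (w u)) \<zeta> \<le> en (1 / s * A + s * B)"
proof -
  let ?q = "\<lambda>u. (Kb C k u)^2 * (w u)^2"
  have "T k (\<lambda>u. en (w u)) \<zeta> \<le> (NN u. en (1 / s) * en ((M (\<zeta> - u))^2) + en s * en (?q u))"
    unfolding T_def
  proof (rule nn_integral_mono)
    fix u
    have "M (\<zeta> - u) * (Kb C k u * w u) \<le> ((M (\<zeta> - u))^2 * 1) * (1 / s) + (1 / 1) * ((Kb C k u * w u)^2 * s)"
      by (rule amgm_weighted) (use s in simp_all)
    also have "... = 1 / s * (M (\<zeta> - u))^2 + s * (?q u)" by (simp add: power_mult_distrib)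
    finally have "en (M (\<zeta> - u) * (Kb C k u * w u)) \<le> en (1 / s * (M (\<zeta> - u))^2) + en (s * (?q u))"
      by (rule ennreal_le_plus) (use s in simp_all)
    also have "en (1 / s * (M (\<zeta> - u))^2) = en (1 / s) * en ((M (\<zeta> - u))^2)" by (rule ennreal_mult) (use s in simp_all)
    also have "en (s * (?q u)) = en s * en (?q u)" by (rule ennreal_mult) (use s in simp_all)
    also have "en (M (\<zeta> - u) * (Kb C k u * w u)) = en (M (\<zeta> - u)) * en (Kb C k u) * en (w u)"
      unfolding mult.assoc by (rule ennreal_mult3[OF M_nonneg Kb_nonneg'[OF k] w0])
    finally show "en (M (\<zeta> - u)) * en (Kb C k u) * en (w u) \<le> en (1 / s) * en ((M (\<zeta> - u))^2) + en s * en (?q u)" .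
  qed
  also have "... = en (1 / s) * (NN u. en ((M (\<zeta> - u))^2)) + en s * (NN u. en (?q u))"
    by (simp add: nn_integral_add nn_integral_cmult)
  also have "(NN u. en ((M (\<zeta> - u))^2)) = (NN \<tau>. en ((M \<tau>)^2))"
    by (rule nn_integral_translate(1)[of "\<lambda>\<tau>. en ((M \<tau>)^2)"]) measurable
  also have "en (1 / s) * (NN \<tau>. en ((M \<tau>)^2)) + en s * (NN u. en (?q u)) \<le>
      en (1 / s) * en A + en s * en B"
    by (intro add_mono mult_left_mono A Kw) simp_all
  also have "... = en (1 / s * A + s * B)" using s A by (intro ennreal_lin) simp_all
  finally show ?thesis .
qed

text \<open>With \<open>s = k\<close> the two terms balance: against a decaying weight, whatever its
  centre \<open>v\<close>, a full power of \<open>k\<close> is gained.\<close>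

lemma T_weight:
  assumes k: "k > 0" and A: "(NN \<tau>. en ((M \<tau>)^2)) \<le> en A" "0 \<le> A"
  shows "T k (\<lambda>u. en (1 / jb (u - v))) \<zeta> \<le> en ((A + 256 * C^2) * (1 / k))"
proof -
  have "T k (\<lambda>u. en (1 / jb (u - v))) \<zeta> \<le> en (1 / k * A + k * (256 * C^2 / k^2))"
    using nn_integral_Kb_sq_weight[OF k, of C v] by (intro T_bound k A) (simp_all add: power_divide)
  also have "1 / k * A + k * (256 * C^2 / k^2) = (A + 256 * C^2) * (1 / k)" using k by (simp add: field_simps power2_eq_square)
  finally show ?thesis .
qed

text \<open>Without a decaying weight the balance is at \<open>s = sqrt k\<close>, and only the root
  of \<open>k\<close> is gained.\<close>

lemma T_const:
  assumes k: "k > 0" and A: "(NN \<tau>. en ((M \<tau>)^2)) \<le> en A" "0 \<le> A" and c: "0 \<le> c"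
    and g: "\<And>u. g u \<le> en c"
  shows "T k g \<zeta> \<le> en (c * ((A + 256 * C^2) * (1 / sqrt k)))"
proof -
  have "T k g \<zeta> \<le> (NN u. en c * (en (M (\<zeta> - u)) * en (Kb C k u) * en 1))"
    unfolding T_def
  proof (rule nn_integral_mono)
    fix u
    have "en (M (\<zeta> - u)) * en (Kb C k u) * g u \<le> en (M (\<zeta> - u)) * en (Kb C k u) * en c" by (rule mult_left_mono[OF g]) simp
    then show "en (M (\<zeta> - u)) * en (Kb C k u) * g u \<le> en c * (en (M (\<zeta> - u)) * en (Kb C k u) * en 1)"
      by (simp add: mult.commute)
  qed
  also have "... = en c * T k (\<lambda>u. en 1) \<zeta>" unfolding T_def by (rule nn_integral_cmult) measurable
  also have "... \<le> en c * en (1 / sqrt k * A + sqrt k * (256 * C^2 / k))"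
    using nn_integral_Kb_sq[OF k, of C] k by (intro mult_left_mono T_bound k A) simp_all
  also have "... = en (c * (1 / sqrt k * A + sqrt k * (256 * C^2 / k)))" by (rule ennreal_mult[symmetric]) (use c A k in simp_all)
  also have "1 / sqrt k * A + sqrt k * (256 * C^2 / k) = (A + 256 * C^2) * (1 / sqrt k)"
  proof -
    have "sqrt k / k = 1 / sqrt k" using k by (simp add: real_div_sqrt field_simps)
    then have "sqrt k * (256 * C^2 / k) = 256 * C^2 * (1 / sqrt k)" by (metis mult.commute times_divide_eq_right)
    then show ?thesis by (simp only: distrib_right mult.commute[of "1 / sqrt k" A])
  qed
  finally show ?thesis .
qed

lemma Tn_weight:
  assumes k: "k > 0" and A: "(NN \<tau>. en ((M \<tau>)^2)) \<le> en A" "0 \<le> A"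
  shows "(T k ^^ Suc n) (\<lambda>u. en (1 / jb (u - v))) \<zeta> \<le> en ((A + 256 * C^2) * (1 / k) * ((A + 256 * C^2) * (1 / sqrt k)) ^ n)"
proof (induction n arbitrary: \<zeta>)
  case 0 show ?case using T_weight[OF assms, of v \<zeta>] by simp
next
  case (Suc n)
  have "0 \<le> (A + 256 * C^2) * (1 / k) * ((A + 256 * C^2) * (1 / sqrt k)) ^ n" using A k by simp
  from T_const[OF k A this Suc] show ?case by (simp add: mult_ac)
qed

text \<open>The first application of \<open>T\<close> meets the weight \<open>1 / P\<close> and
  gains \<open>1 / k\<close>; each further one meets a constant and gains
  \<open>1 / sqrt k\<close>.\<close>

lemma chain_bound:
  assumes k: "norm kv \<ge> 2" and A: "(NN \<tau>. en ((M \<tau>)^2)) \<le> en A" "0 \<le> A"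
  shows "chain C M (Suc (Suc n)) kv (- kv) \<le> 2 * (NN u. en ((M (kv + u))^2 * jb (kv + u)) * (en (Kb C (norm kv) u) *
    en ((A + 256 * C^2) * (1 / norm kv) * ((A + 256 * C^2) * (1 / sqrt (norm kv))) ^ n)))"
proof -
  let ?P = "\<lambda>\<tau>::plane. 1 + norm \<tau>"
  let ?B = "(A + 256 * C^2) * (1 / norm kv) * ((A + 256 * C^2) * (1 / sqrt (norm kv))) ^ n"
  have k0: "norm kv > 0" using k by linarith
  have e: "kv + u = u - (- kv)" for u by simp
  show ?thesis
  proof (rule chain_Schur[where P = ?P and B = "\<lambda>_. ?B"])
    show "(T (norm kv) ^^ Suc n) (\<lambda>u. en (1 / jb (u - kv))) u \<le> ennreal ?B" for u by (rule Tn_weight[OF k0 A])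
    show "(T (norm kv) ^^ Suc n) (\<lambda>u. en (1 / jb (kv + u))) u \<le> ennreal ?B" for u unfolding e by (rule Tn_weight[OF k0 A])
  qed (simp_all add: add_pos_nonneg)
qed

text \<open>The factor \<open>jb\<close> in the bound for \<open>X\<close> cancels against
  \<open>D / jb \<tau>\<close>, the outcome of integrating in \<open>kv\<close>. What is left is the
  integral of the square of \<open>M\<close> times \<open>P\<close>.\<close>

lemma dominatedI:
  fixes w :: "plane \<Rightarrow> plane \<Rightarrow> real"
  assumes P [measurable]: "P \<in> borel_fun" and P0: "\<And>\<tau>. 0 \<le> P \<tau>"
    and wm [measurable]: "(\<lambda>p. w (fst p) (snd p)) \<in> borel_measurable (borel \<Otimes>\<^sub>M borel)" and w0: "\<And>kv u. 0 \<le> w kv u"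
    and R: "\<And>\<tau>. R \<tau> \<in> borel_fun" "\<And>\<tau> kv. 0 \<le> R \<tau> kv" "\<And>\<tau>. (NN kv. en (R \<tau> kv)) \<le> en (D / jb \<tau>)"
    and KR: "\<And>\<tau> kv. 2 \<le> norm kv \<Longrightarrow> Kb C (norm kv) (\<tau> - kv) * w kv (\<tau> - kv) \<le> c * R \<tau> kv" and c: "0 \<le> c" and D: "0 \<le> D"
    and fin: "(NN \<tau>. en ((M \<tau>)^2 * P \<tau>)) < \<infinity>"
    and X: "\<And>kv. 2 \<le> norm kv \<Longrightarrow> X kv \<le> 2 * (NN u. en ((M (kv + u))^2 * (jb (kv + u) * P (kv + u))) * (en (Kb C (norm kv) u) * en (w kv u)))"
  shows "dominated X"
proof -
  define F where "F \<tau> = en ((M \<tau>)^2 * (jb \<tau> * P \<tau>))" for \<tau>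
  define G where "G kv u = (if 2 \<le> norm kv then en (Kb C (norm kv) u) * en (w kv u) else 0)" for kv u
  have Fm [measurable]: "F \<in> borel_fun" unfolding F_def[abs_def] by measurable
  have Gm: "(\<lambda>p. G (fst p) (snd p)) \<in> borel_measurable (borel \<Otimes>\<^sub>M borel)" unfolding G_def by measurable
  have le: "(NN kv. G kv (\<tau> - kv)) \<le> en c * en (D / jb \<tau>)" for \<tau>
  proof -
    have "(NN kv. G kv (\<tau> - kv)) \<le> (NN kv. en c * en (R \<tau> kv))"
    proof (rule nn_integral_mono)
      fix kv
      show "G kv (\<tau> - kv) \<le> en c * en (R \<tau> kv)"
      proof (cases "2 \<le> norm kv")
        case True
        have "en (Kb C (norm kv) (\<tau> - kv)) * en (w kv (\<tau> - kv)) = en (Kb C (norm kv) (\<tau> - kv) * w kv (\<tau> - kv))"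
          by (rule ennreal_mult[symmetric, OF Kb_nonneg' w0]) (use True in linarith)
        also have "... \<le> en (c * R \<tau> kv)" by (rule ennreal_leI[OF KR[OF True]])
        also have "... = en c * en (R \<tau> kv)" by (rule ennreal_mult[OF c R(2)])
        finally show ?thesis using True by (simp only: G_def if_True)
      qed (simp add: G_def)
    qed
    also have "... = en c * (NN kv. en (R \<tau> kv))" using R(1)[of \<tau>] by (intro nn_integral_cmult) measurable
    also have "... \<le> en c * en (D / jb \<tau>)" by (rule mult_left_mono[OF R(3)]) simp
    finally show ?thesis .
  qed
  define H where "H kv = 2 * (NN u. F (kv + u) * G kv u)" for kv
  have "(\<lambda>p. F (fst p + snd p)) \<in> borel_measurable (borel \<Otimes>\<^sub>M borel)" by measurable
  from borel_measurable_times_ennreal[OF this Gm]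
  have "(\<lambda>(kv, u). F (kv + u) * G kv u) \<in> borel_measurable lborel2" by (simp add: split_beta')
  then have FGm: "(\<lambda>kv. NN u. F (kv + u) * G kv u) \<in> borel_measurable lborel" by (rule lborel.borel_measurable_nn_integral)
  have Hm: "H \<in> borel_fun" using FGm unfolding H_def[abs_def] by simp
  have XH: "X kv \<le> H kv" if "2 \<le> norm kv" for kv
    using X[OF that] that unfolding H_def F_def G_def by simp
  have FI: "F \<tau> * (en c * en (D / jb \<tau>)) = en (c * D) * en ((M \<tau>)^2 * P \<tau>)" for \<tau>
  proof -
    have "m * (n * p) * (c * (D / n)) = c * D * (m * p)" if "n \<noteq> 0" for m n p :: real using that by simp
    then have "(M \<tau>)^2 * (jb \<tau> * P \<tau>) * (c * (D / jb \<tau>)) = c * D * ((M \<tau>)^2 * P \<tau>)" by (simp add: add_nonneg_eq_0_iff)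
    moreover have "F \<tau> * (en c * en (D / jb \<tau>)) = en ((M \<tau>)^2 * (jb \<tau> * P \<tau>) * (c * (D / jb \<tau>)))"
      unfolding F_def using c D P0 by (intro ennreal_mult3[symmetric]) simp_all
    ultimately show ?thesis using c D P0 by (simp add: ennreal_mult)
  qed
  have "(NN kv. H kv) = 2 * (NN kv. NN u. F (kv + u) * G kv u)"
    unfolding H_def using FGm by (rule nn_integral_cmult)
  also have "... \<le> 2 * (NN \<tau>. F \<tau> * (en c * en (D / jb \<tau>)))"
    by (rule mult_left_mono[OF swap_shear[OF Fm Gm le]]) simp
  also have "... = 2 * (en (c * D) * (NN \<tau>. en ((M \<tau>)^2 * P \<tau>)))"
    unfolding FI by (subst nn_integral_cmult) simp_all
  also have "... < \<infinity>" using fin by (simp add: ennreal_mult_less_top)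
  finally show ?thesis using Hm XH unfolding dominated_def by blast
qed

text \<open>Any decay in \<open>k\<close> strictly better than \<open>1 / k\<close> is enough, since
  it supplies the exponent \<open>1 + \<delta>\<close> of \<open>nn_integral_shear_kernel\<close>;
  of \<open>M\<close> only the square integral then remains.\<close>

lemma dominated_of_Schur:
  assumes A: "(NN \<tau>. en ((M \<tau>)^2)) < \<infinity>" and d: "\<delta> > 0" and c: "0 \<le> c"
    and b: "\<And>kv. norm kv \<ge> 2 \<Longrightarrow> b kv = c * norm kv powr - (1 + \<delta>)" and d1: "\<delta> \<le> 1"
    and X: "\<And>kv. norm kv \<ge> 2 \<Longrightarrow> X kv \<le> 2 * (NN u. en ((M (kv + u))^2 * jb (kv + u)) * (en (Kb C (norm kv) u) * en (b kv)))"
  shows "dominated X"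
proof (rule dominatedI[where P = "\<lambda>_. 1" and w = "\<lambda>kv _. c * norm kv powr - (1 + \<delta>)" and c = "3 * C * (4 * c)" and D = "CL \<delta>" and
    R = "\<lambda>\<tau> kv. (jb kv) powr - (1 + \<delta>) * (1 / (1 + norm \<tau> + norm kv + \<bar>\<tau> \<bullet> kv - (norm \<tau>)\<^sup>2 / 2\<bar>))"])
  fix \<tau> kv :: plane assume k: "2 \<le> norm kv"
  define r W where "r = 1 / (1 + norm \<tau> + norm kv + \<bar>\<tau> \<bullet> kv - (norm \<tau>)\<^sup>2 / 2\<bar>)" and "W = jb kv powr - (1 + \<delta>)"
  have "norm kv powr - (1 + \<delta>) \<le> 4 * W" unfolding W_def using k d d1 by (intro powr_le_one_plus_powr) linarith+
  then have le: "c * norm kv powr - (1 + \<delta>) \<le> c * (4 * W)" using c by (rule mult_left_mono)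
  have "Kb C (norm kv) (\<tau> - kv) * (c * norm kv powr - (1 + \<delta>)) \<le> 3 * C * r * (c * (4 * W))"
    unfolding r_def by (rule mult_mono[OF Kb_shear(1)[OF C_nonneg k] le]) (use C_nonneg c in simp_all)
  also have "... = 3 * C * (4 * c) * (W * r)" by simp
  finally show "Kb C (norm kv) (\<tau> - kv) * (c * norm kv powr - (1 + \<delta>)) \<le>
      3 * C * (4 * c) * (jb kv powr - (1 + \<delta>) * (1 / (1 + norm \<tau> + norm kv + \<bar>\<tau> \<bullet> kv - (norm \<tau>)\<^sup>2 / 2\<bar>)))" unfolding r_def W_def .
next
  fix kv :: plane assume "2 \<le> norm kv"
  from X[OF this, unfolded b[OF this]]
  show "X kv \<le> 2 * (NN u. en ((M (kv + u))^2 * (jb (kv + u) * 1)) * (en (Kb C (norm kv) u) * en (c * norm kv powr - (1 + \<delta>))))" by simp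
qed (use A c C_nonneg CL_nonneg nn_integral_shear_kernel[OF d] in simp_all)

text \<open>In order 1 there is no operator to gain a power of \<open>k\<close>, so the decay is
  taken from the weight: \<open>Q\<close> has exponent \<open>1 + 2 * \<alpha>\<close>, and the
  excess over 1 is paid by Sobolev regularity. The factor \<open>1 / Q\<close> lives in the variable
  \<open>2 *\<^sub>R kv - \<tau>\<close>, hence the second form of \<open>Kb_shear\<close>.\<close>

lemma dominated_chain_1:
  assumes A: "(NN \<tau>. en ((M \<tau>)^2 * jb \<tau> powr (2 * \<alpha>))) < \<infinity>" and a: "\<alpha> > 0"
  shows "dominated (\<lambda>kv. chain C M 1 kv (- kv))"
proof -
  define Q where "Q \<tau> = jb \<tau> powr (1 + 2 * \<alpha>)" for \<tau> :: plane
  have Q0: "0 < Q \<tau>" for \<tau> by (simp add: Q_def add_pos_nonneg add_nonneg_eq_0_iff)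
  have [measurable]: "Q \<in> borel_fun" unfolding Q_def[abs_def] by measurable
  have Qp: "Q \<tau> = jb \<tau> * jb \<tau> powr (2 * \<alpha>)" for \<tau> unfolding Q_def powr_add by (simp add: add_nonneg_nonneg)
  define r where "r \<tau> v = jb v powr - (1 + 2 * \<alpha>) * (1 / (1 + norm \<tau> + norm v + \<bar>\<tau> \<bullet> v - 0\<bar>))" for \<tau> v :: plane
  have rm: "r \<tau> \<in> borel_fun" for \<tau> unfolding r_def[abs_def] by measurable
  show ?thesis
  proof (rule dominatedI[where P = "\<lambda>\<tau>. (jb \<tau>) powr (2 * \<alpha>)" and w = "\<lambda>kv u. 1 / Q (u - kv)" and c = "3 * C" and D = "CL (2 * \<alpha>)" and R = "\<lambda>\<tau> kv. r \<tau> (2 *\<^sub>R kv - \<tau>)"])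
    fix \<tau> kv :: plane
    show "(\<lambda>kv. r \<tau> (2 *\<^sub>R kv - \<tau>)) \<in> borel_fun" using rm by measurable
    have "(NN kv. en (r \<tau> (2 *\<^sub>R kv - \<tau>))) \<le> (NN v. en (r \<tau> v))"
      by (rule nn_integral_scale_translate[OF measurable_compose[OF rm measurable_ennreal]])
    also have "... \<le> en (CL (2 * \<alpha>) / jb \<tau>)" unfolding r_def by (rule nn_integral_shear_kernel) (use a in simp)
    finally show "(NN kv. en (r \<tau> (2 *\<^sub>R kv - \<tau>))) \<le> en (CL (2 * \<alpha>) / jb \<tau>)" .
    assume k: "2 \<le> norm kv"
    define v where "v = 2 *\<^sub>R kv - \<tau>"
    have nv: "\<tau> - kv - kv = - v" by (simp add: v_def scaleR_2)
    have Qv: "1 / Q (\<tau> - kv - kv) = jb v powr - (1 + 2 * \<alpha>)" unfolding nv Q_def by (simp only: norm_minus_cancel powr_minus_divide)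
    have "Kb C (norm kv) (\<tau> - kv) * (1 / Q (\<tau> - kv - kv)) \<le> 3 * C * (1 / (1 + norm \<tau> + norm v + \<bar>\<tau> \<bullet> v - 0\<bar>)) * (1 / Q (\<tau> - kv - kv))"
      unfolding v_def by (rule mult_right_mono[OF Kb_shear(2)[OF C_nonneg k]]) (simp add: less_imp_le[OF Q0])
    also have "... = 3 * C * r \<tau> v" unfolding r_def Qv by (simp only: mult_ac)
    finally show "Kb C (norm kv) (\<tau> - kv) * (1 / Q (\<tau> - kv - kv)) \<le> 3 * C * r \<tau> (2 *\<^sub>R kv - \<tau>)" unfolding v_def .
  next
    fix kv :: plane
    show "chain C M 1 kv (- kv) \<le> 2 * (NN u. en ((M (kv + u))^2 * (jb (kv + u) * jb (kv + u) powr (2 * \<alpha>))) * (en (Kb C (norm kv) u) * en (1 / Q (u - kv))))"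
      unfolding Qp[symmetric] One_nat_def
    proof (rule chain_Schur[where P = Q and B = "\<lambda>\<tau>. 1 / Q \<tau>"])
      show "Q (- \<tau>) = Q \<tau>" "1 / Q (- \<tau>) = 1 / Q \<tau>" for \<tau> by (simp_all add: Q_def)
    qed (use Q0 in simp_all)
  qed (use A a C_nonneg CL_nonneg less_imp_le[OF Q0] in \<open>simp_all add: r_def\<close>)
qed

end

text \<open>The three frequencies of the chain add up to \<open>- 2 \<kappa>\<close>, so the product of their weights is at
  least \<open>k powr \<alpha>\<close>.\<close>

lemma chain_mono_gain:
  assumes N: "kernel_chain C N" and M: "kernel_chain C M" and a: "0 \<le> \<alpha>"
    and NM: "\<And>\<tau>. N \<tau> = M \<tau> * jb \<tau> powr \<alpha>" and k: "norm kv \<ge> 2"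
  shows "chain C M 2 kv (- kv) \<le> en (norm kv powr - \<alpha>) * chain C N 2 kv (- kv)"
proof -
  interpret M: kernel_chain C M by (rule M)
  interpret N: kernel_chain C N by (rule N)
  let ?K = "Kb C (norm kv)"
  have K0: "0 \<le> ?K u" for u using k by (intro M.Kb_nonneg') linarith
  define m where "m M u u' = M (- kv - u) * ?K u * (M (u - u') * ?K u' * M (u' - kv))" for M :: "plane \<Rightarrow> real" and u u'
  have expand: "chain C M 2 kv (- kv) = (NN u. NN u'. en (m M u u'))"
    if "kernel_chain C M" for M
  proof -
    interpret kernel_chain C M by (rule that)
    have "en (M (- kv - u)) * en (?K u) * (NN u'. en (M (u - u')) * en (?K u') * en (M (u' - kv))) =
        (NN u'. en (m M u u'))" for u
    proof -
      have "en (M (- kv - u)) * en (?K u) * (NN u'. en (M (u - u')) * en (?K u') * en (M (u' - kv))) =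
        (NN u'. en (M (- kv - u)) * en (?K u) * (en (M (u - u')) * en (?K u') * en (M (u' - kv))))"
        by (rule nn_integral_cmult[symmetric]) measurable
      also have "... = (NN u'. en (m M u u'))"
        unfolding m_def using K0 M_nonneg by (intro nn_integral_cong) (simp only: ennreal_mult mult_nonneg_nonneg)
      finally show ?thesis .
    qed
    then show ?thesis by (simp add: numeral_2_eq_2)
  qed
  have "m M u u' \<le> norm kv powr - \<alpha> * m N u u'" for u u'
  proof -
    define a b c where "a = norm (- kv - u)" and "b = norm (u - u')" and "c = norm (u' - kv)"
    have abc: "0 \<le> a" "0 \<le> b" "0 \<le> c" by (simp_all add: a_def b_def c_def)
    have "2 * norm kv = norm ((- kv - u) + (u - u') + (u' - kv))"
    proof -
      have "(- kv - u) + (u - u') + (u' - kv) = - (2 *\<^sub>R kv)" by (simp add: scaleR_2)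
      then show ?thesis by (simp only: norm_minus_cancel norm_scaleR abs_numeral)
    qed
    also have "... \<le> a + b + c" unfolding a_def b_def c_def by (intro order_trans[OF norm_triangle_ineq] add_right_mono norm_triangle_ineq)
    finally have s: "norm kv \<le> a + b + c" using norm_ge_zero[of kv] by linarith
    also have "... \<le> (1 + a) * (1 + b) * (1 + c)" using abc by (simp add: algebra_simps)
    finally have "norm kv powr \<alpha> \<le> ((1 + a) * (1 + b) * (1 + c)) powr \<alpha>" using a by (intro powr_mono2) simp_all
    also have "... = (1 + a) powr \<alpha> * (1 + b) powr \<alpha> * (1 + c) powr \<alpha>" using abc by (simp add: powr_mult)
    finally have p: "norm kv powr \<alpha> \<le> (1 + a) powr \<alpha> * (1 + b) powr \<alpha> * (1 + c) powr \<alpha>" .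
    have m0: "0 \<le> m M u u'" unfolding m_def using K0 M.M_nonneg by (intro mult_nonneg_nonneg)
    have "norm kv powr - \<alpha> * norm kv powr \<alpha> = 1"
    proof -
      have "kv \<noteq> 0" using k by auto
      then show ?thesis by (simp add: powr_add[symmetric])
    qed
    then have "m M u u' = norm kv powr - \<alpha> * (m M u u' * norm kv powr \<alpha>)" by (metis mult.left_commute mult.right_neutral)
    also have "... \<le> norm kv powr - \<alpha> * (m M u u' * ((1 + a) powr \<alpha> * (1 + b) powr \<alpha> * (1 + c) powr \<alpha>))"
      by (intro mult_left_mono p m0) simp
    also have "m M u u' * ((1 + a) powr \<alpha> * (1 + b) powr \<alpha> * (1 + c) powr \<alpha>) = m N u u'"
      unfolding m_def NM a_def b_def c_def by (simp only: mult_ac)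
    finally show ?thesis .
  qed
  then have le: "en (m M u u') \<le> en (norm kv powr - \<alpha>) * en (m N u u')" for u u'
    using ennreal_leI[of "m M u u'" "norm kv powr - \<alpha> * m N u u'"] ennreal_mult'[of "norm kv powr - \<alpha>" "m N u u'"] by simp
  have mm: "(\<lambda>u'. en (m N u u')) \<in> borel_measurable lborel" for u unfolding m_def by measurable
  have mm2: "(\<lambda>u. NN u'. en (m N u u')) \<in> borel_measurable lborel"
    unfolding m_def by measurable
  have "chain C M 2 kv (- kv) \<le> (NN u. NN u'. en (norm kv powr - \<alpha>) * en (m N u u'))"
    unfolding expand[OF M] by (intro nn_integral_mono le)
  also have "... = (NN u. en (norm kv powr - \<alpha>) * (NN u'. en (m N u u')))"
    by (intro nn_integral_cong nn_integral_cmult mm)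
  also have "... = en (norm kv powr - \<alpha>) * chain C N 2 kv (- kv)" unfolding expand[OF N] by (rule nn_integral_cmult[OF mm2])
  finally show ?thesis .
qed

text \<open>In order 2 the Schur test gains exactly \<open>1 / k\<close> and just misses; the factor
  \<open>k powr - \<alpha>\<close> still wanting is bought with Sobolev regularity by passing from
  \<open>M\<close> to \<open>N\<close>. Orders 3 and 4 gain the powers 3/2 and 2 from square
  integrability of \<open>M\<close> alone.\<close>

theorem dominated_chains:
  assumes M: "kernel_chain C M" and a: "0 < \<alpha>" "\<alpha> \<le> 1"
    and fin: "(NN \<tau>. en ((M \<tau>)^2 * jb \<tau> powr (2 * \<alpha>))) < \<infinity>"
    and j: "j \<in> {1..4}"
  shows "dominated (\<lambda>kv. chain C M j kv (- kv))"
proof -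
  interpret M: kernel_chain C M by (rule M)
  define N where "N \<tau> = M \<tau> * jb \<tau> powr \<alpha>" for \<tau>
  have N: "kernel_chain C N"
  proof
    show "N \<in> borel_fun" unfolding N_def[abs_def] by measurable
  qed (use M.C_nonneg M.M_nonneg M.M_even in \<open>simp_all add: N_def\<close>)
  interpret N: kernel_chain C N by (rule N)
  have N2: "(N \<tau>)^2 = (M \<tau>)^2 * jb \<tau> powr (2 * \<alpha>)" for \<tau>
    unfolding N_def power_mult_distrib by (simp add: power2_eq_square powr_add[symmetric])
  have NA: "(NN \<tau>. en ((N \<tau>)^2)) < \<infinity>" using fin unfolding N2 .
  have MA: "(NN \<tau>. en ((M \<tau>)^2)) < \<infinity>"
  proof (rule le_less_trans[OF _ NA], intro nn_integral_mono ennreal_leI)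
    fix \<tau> :: plane
    have "1 \<le> jb \<tau> powr (2 * \<alpha>)" using a by (intro ge_one_powr_ge_zero) simp_all
    then have "(M \<tau>)^2 * 1 \<le> (N \<tau>)^2" unfolding N2 by (rule mult_left_mono) simp
    then show "(M \<tau>)^2 \<le> (N \<tau>)^2" by simp
  qed
  obtain A where A: "0 \<le> A" "(NN \<tau>. en ((M \<tau>)^2)) = en A"
    using MA by (cases "NN \<tau>. en ((M \<tau>)^2)") auto
  obtain B where B: "0 \<le> B" "(NN \<tau>. en ((N \<tau>)^2)) = en B"
    using NA by (cases "NN \<tau>. en ((N \<tau>)^2)") auto
  define E E' where "E = A + 256 * C^2" and "E' = B + 256 * C^2"
  have E0: "0 \<le> E" "0 \<le> E'" using A B by (simp_all add: E_def E'_def)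
  have Mb: "(NN \<tau>. en ((M \<tau>)^2)) \<le> en A" using A by simp
  have p: "k powr - (1 + x) = k powr - x * (1 / k)" if "k > 0" for k x :: real
  proof -
    have "k powr - (1 + x) = k powr (- x + - 1)" by (rule arg_cong2[where f = "(powr)"]) simp_all
    then show ?thesis using that unfolding powr_add by (simp add: powr_minus_divide)
  qed
  consider "j = 1" | "j = 2" | "j = 3" | "j = 4" using j by fastforce
  then show ?thesis
  proof cases
    case 1
    show ?thesis unfolding 1 by (rule M.dominated_chain_1[OF fin a(1)])
  next
    case 2
    show ?thesis unfolding 2
    proof (rule N.dominated_of_Schur[OF NA a(1) E0(2) refl a(2)])
      fix kv :: plane assume k: "norm kv \<ge> 2"
      then have k0: "norm kv > 0" by linarith
      let ?n = "\<lambda>u. en ((N (kv + u))^2 * jb (kv + u))" and ?K = "\<lambda>u. en (Kb C (norm kv) u)"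
      have c: "chain C N 2 kv (- kv) \<le> 2 * (NN u. ?n u * (?K u * en (E' * (1 / norm kv))))"
        using N.chain_bound[OF k, of B 0] B unfolding E'_def numeral_2_eq_2 by simp
      have e: "en (E' * norm kv powr - (1 + \<alpha>)) = en (norm kv powr - \<alpha>) * en (E' * (1 / norm kv))"
        unfolding p[OF k0] mult.left_commute[of E'] by (rule ennreal_mult) (use E0 in simp_all)
      have "chain C M 2 kv (- kv) \<le> en (norm kv powr - \<alpha>) * chain C N 2 kv (- kv)"
        by (rule chain_mono_gain[OF N M less_imp_le[OF a(1)] N_def k])
      also have "... \<le> en (norm kv powr - \<alpha>) * (2 * (NN u. ?n u * (?K u * en (E' * (1 / norm kv)))))"
        by (rule mult_left_mono[OF c]) simp
      also have "... = 2 * (NN u. en (norm kv powr - \<alpha>) * (?n u * (?K u * en (E' * (1 / norm kv)))))"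
        by (subst nn_integral_cmult) (measurable, rule mult.left_commute)
      also have "... = 2 * (NN u. ?n u * (?K u * en (E' * norm kv powr - (1 + \<alpha>))))"
        unfolding e by (rule arg_cong2[where f = "(*)"], rule refl, rule nn_integral_cong, simp only: mult_ac)
      finally show "chain C M 2 kv (- kv) \<le> 2 * (NN u. ?n u * (?K u * en (E' * norm kv powr - (1 + \<alpha>))))" .
    qed
  next
    case 3
    show ?thesis unfolding 3
    proof (rule M.dominated_of_Schur[OF MA, where \<delta> = "1 / 2" and c = "E^2"])
      fix kv :: plane assume k: "norm kv \<ge> 2"
      then show "E * (1 / norm kv) * (E * (1 / sqrt (norm kv))) ^ 1 = E^2 * norm kv powr - (1 + 1 / 2)"
        by (subst p) (linarith, simp add: power2_eq_square powr_minus_divide powr_half_sqrt)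
      show "chain C M 3 kv (- kv) \<le> 2 * (NN u. en ((M (kv + u))^2 * jb (kv + u)) * (en (Kb C (norm kv) u) * en (E * (1 / norm kv) * (E * (1 / sqrt (norm kv))) ^ 1)))"
        using M.chain_bound[OF k Mb A(1), of 1] unfolding E_def numeral_3_eq_3 One_nat_def .
    qed simp_all
  next
    case 4
    have n4: "4 = Suc (Suc 2)" by simp
    show ?thesis unfolding 4
    proof (rule M.dominated_of_Schur[OF MA, where \<delta> = 1 and c = "E ^ 3"])
      fix kv :: plane assume k: "norm kv \<ge> 2"
      then show "E * (1 / norm kv) * (E * (1 / sqrt (norm kv))) ^ 2 = E ^ 3 * norm kv powr - (1 + 1)"
        by (subst p) (linarith, simp add: powr_minus_divide power_mult_distrib power_divide power3_eq_cube power2_eq_square)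
      show "chain C M 4 kv (- kv) \<le> 2 * (NN u. en ((M (kv + u))^2 * jb (kv + u)) * (en (Kb C (norm kv) u) * en (E * (1 / norm kv) * (E * (1 / sqrt (norm kv))) ^ 2)))"
        unfolding n4 using M.chain_bound[OF k Mb A(1), of 2] unfolding E_def .
    qed (use E0 in simp_all)
  qed
qed

section \<open>Continuity of the difference\<close>

lemma continuous_on_fourier:
  fixes f :: "'a::euclidean_space \<Rightarrow> complex"
  assumes f: "L1 f"
  shows "continuous_on UNIV (fourier f)"
proof (rule continuous_at_imp_continuous_on, rule ballI)
  fix \<xi> :: 'a
  have [measurable]: "f \<in> borel_fun" using f by auto
  show "isCont (fourier f) \<xi>"
    unfolding continuous_at_sequentially
  proof (intro allI impI)
    fix X :: "nat \<Rightarrow> 'a" assume X: "X \<longlonglongrightarrow> \<xi>"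
    have "(\<lambda>n. LBINT x. exp (- \<i> * of_real (X n \<bullet> x)) * f x) \<longlonglongrightarrow> (LBINT x. em \<xi> x * f x)"
    proof (rule integral_dominated_convergence[where w = "\<lambda>x. norm (f x)"])
      show "AE x in lborel. (\<lambda>n. exp (- \<i> * of_real (X n \<bullet> x)) * f x) \<longlonglongrightarrow> em \<xi> x * f x"
        using X by (intro AE_I2 tendsto_intros)
    qed (use f in \<open>auto simp: norm_mult\<close>)
    then show "((fourier f) \<circ> X) \<longlonglongrightarrow> fourier f \<xi>" by (simp add: fourier_def comp_def)
  qed
qed

lemma nn_integral_scale_minus_two:
  fixes h :: "plane \<Rightarrow> ennreal"
  assumes [measurable]: "h \<in> borel_fun"
  shows "(NN x. h x) = 4 * (NN x. h (- 2 *\<^sub>R x))"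
proof -
  have "(NN x. h x) = (NN x. en (\<bar>- 2\<bar> ^ DIM(plane)) * h (0 + (- 2) *\<^sub>R x))"
    by (subst lborel_affine[of "- 2" 0]) (simp_all add: nn_integral_density nn_integral_distr)
  also have "... = 4 * (NN x. h (- 2 *\<^sub>R x))"
    by (simp add: nn_integral_cmult)
  finally show ?thesis .
qed

lemma integrable_of_inverse_cube:
  fixes f :: "plane \<Rightarrow> 'b::{banach, second_countable_topology}"
  assumes "f \<in> borel_fun" "\<And>x. norm (f x) \<le> B / jb x ^ 3"
  shows "L1 f"
proof (rule L1_bound[OF integrable_inverse_cube[of B]])
  show "AE x in lborel. norm (f x) \<le> norm (B / jb x ^ 3)"
    unfolding real_norm_def by (intro AE_I2 order_trans[OF assms(2)] abs_ge_self)
qed (use assms(1) in simp)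

text \<open>By \<open>fourier_swap\<close> the defining identity says that \<open>g\<close> and
  \<open>m\<close> times the transform of \<open>q\<close> have the same integrals against Schwartz
  functions, so they agree almost everywhere.\<close>

lemma sobolev_fourier_weight:
  fixes q :: "cfun"
  assumes a: "\<alpha> > 0" and q: "L1 q" and s: "distribution_of q \<in> sobolev \<alpha>"
  shows "(NN \<xi>. en ((norm (fourier q \<xi>))^2 * (1 + (norm \<xi>)^2) powr \<alpha>)) < \<infinity>"
proof -
  define m where "m \<xi> = (1 + (norm \<xi>)^2) powr (\<alpha> / 2)" for \<xi> :: plane
  \<comment> \<open>An integer degree dominating the growth of \<open>m\<close>, so that polynomial
    weights can absorb it.\<close>
  define n where "n = nat \<lceil>\<alpha>\<rceil>"
  have [measurable]: "q \<in> borel_fun" using q by auto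
  have [measurable]: "m \<in> borel_fun" unfolding m_def[abs_def] by measurable
  have m0: "0 \<le> m \<xi>" for \<xi> by (simp add: m_def)
  have mle: "m \<xi> \<le> jb \<xi> ^ n" for \<xi>
  proof -
    have "m \<xi> \<le> (jb \<xi> powr 2) powr (\<alpha> / 2)"
      unfolding m_def using a by (intro powr_mono2) (simp_all add: add_nonneg_nonneg power2_eq_square algebra_simps)
    also have "... = jb \<xi> powr \<alpha>" unfolding powr_powr by simp
    also have "... \<le> jb \<xi> powr real n" unfolding n_def by (intro powr_mono) (simp_all add: real_nat_ceiling_ge)
    also have "... = jb \<xi> ^ n" by (rule powr_realpow) (simp add: add_pos_nonneg)
    finally show ?thesis .
  qed
  obtain g where g: "square_integrable g"
    and eq: "\<And>\<phi>. \<phi> \<in> schwartz \<Longrightarrow> fourier_distr (distribution_of q) (\<lambda>\<xi>. of_real (m \<xi>) * \<phi> \<xi>) = distribution_of g \<phi>"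
    using s unfolding sobolev_def m_def by blast
  have gm [measurable]: "g \<in> borel_fun" and g2: "L1 (\<lambda>x. (norm (g x))\<^sup>2)" using g by (auto simp: square_integrable_def)
  define w where "w \<xi> = of_real (m \<xi>) * fourier q \<xi> - g \<xi>" for \<xi>
  define N0 where "N0 = (LBINT x. norm (q x))"
  have N0: "norm (fourier q \<xi>) \<le> N0" for \<xi> unfolding N0_def by (rule norm_fourier_le)
  have i1: "L1 (\<lambda>\<xi>. of_real (m \<xi>) * fourier q \<xi> * \<psi> \<xi>)"
    if [measurable]: "\<psi> \<in> borel_fun" and \<psi>: "\<And>x. norm (\<psi> x) \<le> M / jb x ^ (n + 3)" for \<psi> :: "cfun" and M
  proof (rule integrable_of_inverse_cube[where B = "N0 * M"])
    fix x :: plane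
    define c where "c = 1 + norm x"
    have c: "c > 0" by (simp add: c_def add_pos_nonneg)
    have "norm (of_real (m x) * fourier q x * \<psi> x) \<le> c ^ n * N0 * (M / c ^ (n + 3))"
      unfolding norm_mult norm_of_real abs_of_nonneg[OF m0] c_def
      by (intro mult_mono mle N0 \<psi> mult_nonneg_nonneg norm_ge_zero m0 order_trans[OF norm_ge_zero N0] order_trans[OF m0 mle])
    also have "... = N0 * M / c ^ 3" using c by (simp add: power_add)
    finally show "norm (of_real (m x) * fourier q x * \<psi> x) \<le> N0 * M / jb x ^ 3" unfolding c_def .
  qed measurable
  have i2: "L1 (\<lambda>\<xi>. g \<xi> * \<psi> \<xi>)"
    if [measurable]: "\<psi> \<in> borel_fun" and \<psi>: "\<And>x. norm (\<psi> x) \<le> M / jb x ^ (n + 3)" for \<psi> :: "cfun" and M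
  proof (rule L1_bound[OF L1_add[OF g2 integrable_inverse_cube[of "M^2"]]])
    show "AE x in lborel. norm (g x * \<psi> x) \<le> norm ((norm (g x))^2 + M^2 / jb x ^ 3)"
    proof (rule AE_I2)
      fix x :: plane
      define c where "c = 1 + norm x"
      have c: "c \<ge> 1" by (simp add: c_def)
      have "(norm (\<psi> x))^2 \<le> (M / c ^ (n + 3))^2" unfolding c_def by (intro power_mono \<psi>) simp
      also have "... = M^2 / (c ^ (n + 3))^2" by (simp add: power_divide)
      also have "... \<le> M^2 / c ^ 3"
      proof (rule divide_left_mono)
        have "c ^ 3 \<le> c ^ ((n + 3) * 2)" using c by (intro power_increasing) simp_all
        then show "c ^ 3 \<le> (c ^ (n + 3))^2" by (simp only: power_mult)
      qed (use c in simp_all)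
      finally have p: "(norm (\<psi> x))^2 \<le> M^2 / c ^ 3" .
      have "0 \<le> norm (g x) * norm (\<psi> x)" by simp
      then have "norm (g x * \<psi> x) \<le> (norm (g x))^2 + (norm (\<psi> x))^2"
        using sum_squares_bound[of "norm (g x)" "norm (\<psi> x)"] unfolding norm_mult by linarith
      also have "... \<le> (norm (g x))^2 + M^2 / c ^ 3" using p by simp
      also have "... \<le> norm ((norm (g x))^2 + M^2 / c ^ 3)" unfolding real_norm_def by (rule abs_ge_self)
      finally show "norm (g x * \<psi> x) \<le> norm ((norm (g x))^2 + M^2 / jb x ^ 3)" unfolding c_def .
    qed
  qed measurable
  have "AE \<xi> in lborel. w \<xi> = 0"
  proof (rule AE_zero_of_schwartz)
    show "w \<in> borel_fun" unfolding w_def[abs_def] by measurable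
    have inv: "norm (1 / complex_of_real (jb x ^ (n + 3))) \<le> 1 / jb x ^ (n + 3)" for x :: plane
      by (simp add: norm_divide norm_power abs_of_nonneg del: of_real_power of_real_add power_add)
    have "L1 (\<lambda>\<xi>. of_real (m \<xi>) * fourier q \<xi> * (1 / complex_of_real (jb \<xi> ^ (n + 3))))" by (rule i1[OF _ inv]) measurable
    moreover have "L1 (\<lambda>\<xi>. g \<xi> * (1 / complex_of_real (jb \<xi> ^ (n + 3))))" by (rule i2[OF _ inv]) measurable
    ultimately have "L1 (\<lambda>\<xi>. of_real (m \<xi>) * fourier q \<xi> * (1 / complex_of_real (jb \<xi> ^ (n + 3))) - g \<xi> * (1 / complex_of_real (jb \<xi> ^ (n + 3))))"
      by (rule L1_diff)
    then show "L1 (\<lambda>\<xi>. w \<xi> / of_real (jb \<xi> ^ (n + 3)))"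
      unfolding w_def left_diff_distrib[symmetric] times_divide_eq_right mult_1_right diff_divide_distrib[symmetric] .
    fix \<phi> :: "cfun" assume \<phi>: "\<phi> \<in> schwartz"
    note sf = schwartz_facts[OF \<phi>]
    have [measurable]: "\<phi> \<in> borel_fun" using sf(2) by (rule borel_measurable_continuous_onI)
    obtain M where M: "\<And>x. norm (\<phi> x) \<le> M / jb x ^ (n + 3)" using sf(3)[of "n + 3"] by auto
    have mi: "L1 (\<lambda>\<xi>. of_real (m \<xi>) * \<phi> \<xi>)"
    proof (rule integrable_of_inverse_cube[where B = M])
      fix x :: plane
      define c where "c = 1 + norm x"
      have c: "c > 0" by (simp add: c_def add_pos_nonneg)
      have "norm (of_real (m x) * \<phi> x) \<le> c ^ n * (M / c ^ (n + 3))"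
        unfolding norm_mult norm_of_real abs_of_nonneg[OF m0] c_def
        by (intro mult_mono mle M norm_ge_zero order_trans[OF m0 mle])
      also have "... = M / c ^ 3" using c by (simp add: power_add)
      finally show "norm (of_real (m x) * \<phi> x) \<le> M / jb x ^ 3" unfolding c_def .
    qed measurable
    have "(LBINT x. g x * \<phi> x) = (LBINT x. q x * fourier (\<lambda>\<xi>. of_real (m \<xi>) * \<phi> \<xi>) x)"
      using eq[OF \<phi>] by (simp add: fourier_distr_def distribution_of_def)
    also have "... = (LBINT \<xi>. fourier q \<xi> * (of_real (m \<xi>) * \<phi> \<xi>))" by (rule fourier_swap[OF q mi, symmetric])
    also have "... = (LBINT \<xi>. of_real (m \<xi>) * fourier q \<xi> * \<phi> \<xi>)" by (simp add: mult_ac)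
    finally show "(LBINT x. w x * \<phi> x) = 0"
      unfolding w_def left_diff_distrib using i1[OF _ M] i2[OF _ M] by simp
  qed
  then have "AE \<xi> in lborel. en ((norm (fourier q \<xi>))^2 * (1 + (norm \<xi>)^2) powr \<alpha>) = en ((norm (g \<xi>))^2)"
  proof eventually_elim
    case (elim \<xi>)
    then have "g \<xi> = of_real (m \<xi>) * fourier q \<xi>" by (simp add: w_def)
    then have "(norm (g \<xi>))^2 = (m \<xi>)^2 * (norm (fourier q \<xi>))^2" by (simp add: norm_mult power_mult_distrib)
    also have "(m \<xi>)^2 = (1 + (norm \<xi>)^2) powr \<alpha>" by (simp add: m_def power2_eq_square powr_add[symmetric])
    finally show ?case by (simp add: mult.commute)
  qed
  then have "(NN \<xi>. en ((norm (fourier q \<xi>))^2 * (1 + (norm \<xi>)^2) powr \<alpha>)) = (NN \<xi>. en ((norm (g \<xi>))^2))"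
    by (rule nn_integral_cong_AE)
  also have "... < \<infinity>" using nn_integral_eq_integral[OF g2] by simp
  finally show ?thesis .
qed

lemma integrable_of_compact_support:
  fixes q :: "cfun"
  assumes "tempered_function q" "compactly_supported q"
  obtains \<rho> where "\<rho> > 0" "L1 q" "AE x in lborel. norm x \<le> \<rho> \<or> q x = 0"
proof -
  obtain N where [measurable]: "q \<in> borel_fun" and N: "L1 (\<lambda>x. q x / of_real (jb x ^ N))"
    using assms(1) by (auto simp: tempered_function_def)
  obtain K where K: "compact K" "AE x in lborel. x \<notin> K \<longrightarrow> q x = 0" using assms(2) by (auto simp: compactly_supported_def)
  obtain \<rho> where \<rho>: "\<rho> > 0" "\<And>x. x \<in> K \<Longrightarrow> norm x \<le> \<rho>" using compact_imp_bounded[OF K(1)] by (auto simp: bounded_pos)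
  have s: "AE x in lborel. norm x \<le> \<rho> \<or> q x = 0" using K(2) by eventually_elim (use \<rho>(2) in blast)
  have "L1 q"
  proof (rule L1_bound[OF integrable_mult_right[OF N, of "of_real ((1 + \<rho>) ^ N)"]])
    show "AE x in lborel. norm (q x) \<le> norm (of_real ((1 + \<rho>) ^ N) * (q x / complex_of_real (jb x ^ N)))"
      using s
    proof eventually_elim
      case (elim x)
      show ?case
      proof (cases "q x = 0")
        case False
        with elim have "jb x ^ N \<le> (1 + \<rho>) ^ N" by (intro power_mono) auto
        moreover have p: "0 < jb x ^ N" by (intro zero_less_power add_pos_nonneg) simp_all
        ultimately have "1 \<le> (1 + \<rho>) ^ N / jb x ^ N" by simp
        then have "norm (q x) * 1 \<le> norm (q x) * ((1 + \<rho>) ^ N / jb x ^ N)" by (rule mult_left_mono) simp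
        also have "... = norm (of_real ((1 + \<rho>) ^ N) * (q x / complex_of_real (jb x ^ N)))"
          unfolding norm_mult norm_divide norm_of_real using p \<rho>(1) by (simp add: mult.commute)
        finally show ?thesis by simp
      qed simp
    qed
  qed measurable
  then show ?thesis using that \<rho>(1) s by blast
qed

section \<open>Integrability of the transform of the difference\<close>

context potential begin

lemma kernel_chain_q: "kernel_chain CK Mq"
proof
  show "Mq \<in> borel_fun" unfolding Mq_def[abs_def] by measurable
qed (simp_all add: CK_nonneg Mq_def add.commute)

lemma Mq_weight:
  assumes fin: "(NN \<tau>. en ((norm (fourier q \<tau>))^2 * jb \<tau> powr p)) < \<infinity>"
  shows "(NN \<tau>. en ((Mq \<tau>)^2 * jb \<tau> powr p)) < \<infinity>"
proof -
  define f where "f \<tau> = en ((norm (fourier q \<tau>))^2 * jb \<tau> powr p)" for \<tau>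
  have [measurable]: "f \<in> borel_fun" unfolding f_def[abs_def] by measurable
  have "(NN \<tau>. en ((Mq \<tau>)^2 * jb \<tau> powr p)) \<le> (NN \<tau>. 2 * f \<tau> + 2 * f (0 - \<tau>))"
  proof (rule nn_integral_mono)
    fix \<tau> :: plane
    define a b w where "a = norm (fourier q \<tau>)" and "b = norm (fourier q (- \<tau>))" and "w = jb \<tau> powr p"
    have w: "0 \<le> w" by (simp add: w_def)
    have "(Mq \<tau>)^2 \<le> 2 * a^2 + 2 * b^2"
      using sum_squares_bound[of a b] unfolding Mq_def a_def[symmetric] b_def[symmetric] by (simp add: power2_sum)
    then have "(Mq \<tau>)^2 * w \<le> (2 * a^2 + 2 * b^2) * w" using w by (rule mult_right_mono)
    also have "... = 2 * (a^2 * w) + 2 * (b^2 * w)" by (simp add: distrib_right)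
    finally have "en ((Mq \<tau>)^2 * w) \<le> en (2 * (a^2 * w)) + en (2 * (b^2 * w))" by (rule ennreal_le_plus) (use w in simp_all)
    also have "... = 2 * en (a^2 * w) + 2 * en (b^2 * w)" using w ennreal_mult[of 2] by simp
    finally show "en ((Mq \<tau>)^2 * jb \<tau> powr p) \<le> 2 * f \<tau> + 2 * f (0 - \<tau>)" by (simp add: f_def a_def b_def w_def)
  qed
  also have "... = 2 * (NN \<tau>. f \<tau>) + 2 * (NN \<tau>. f (0 - \<tau>))" by (simp add: nn_integral_add nn_integral_cmult)
  also have "(NN \<tau>. f (0 - \<tau>)) = (NN \<tau>. f \<tau>)" by (rule nn_integral_translate(1)) measurable
  also have "2 * (NN \<tau>. f \<tau>) + 2 * (NN \<tau>. f \<tau>) < \<infinity>" using fin unfolding f_def by (simp add: ennreal_mult_less_top)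
  finally show ?thesis .
qed

lemma amp_minus_fourier_bound:
  assumes a: "0 < \<alpha>" "\<alpha> \<le> 1"
    and fin: "(NN \<tau>. en ((norm (fourier q \<tau>))^2 * jb \<tau> powr (2 * \<alpha>))) < \<infinity>"
  obtains H where "H \<in> borel_fun" "(NN kv. H kv) < \<infinity>"
    "\<And>kv. norm kv \<ge> 2 \<Longrightarrow> \<beta> kv \<le> 1 / 2 \<Longrightarrow> en (norm (amp kv - fourier q (- 2 *\<^sub>R kv))) \<le> H kv"
proof -
  obtain C where C: "0 \<le> C" "\<And>kv. norm kv \<ge> 2 \<Longrightarrow> \<beta> kv \<le> 1 / 2 \<Longrightarrow>
    en (norm (amp kv - fourier q (- 2 *\<^sub>R kv))) \<le> (\<Sum>j=1..4. chain CK Mq j kv (- kv)) + en (C * jb kv powr (- 5 / 2))"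
    using amp_chain_bound by blast
  have "\<forall>j\<in>{1..4}. \<exists>H. H \<in> borel_fun \<and> (\<forall>kv. 2 \<le> norm kv \<longrightarrow> chain CK Mq j kv (- kv) \<le> H kv) \<and> (NN kv. H kv) < \<infinity>"
    using dominated_chains[OF kernel_chain_q a Mq_weight[OF fin]] unfolding dominated_def by blast
  from bchoice[OF this] obtain h where h: "\<And>j. j \<in> {1..4} \<Longrightarrow> h j \<in> borel_fun"
    "\<And>j kv. j \<in> {1..4} \<Longrightarrow> 2 \<le> norm kv \<Longrightarrow> chain CK Mq j kv (- kv) \<le> h j kv" "\<And>j. j \<in> {1..4} \<Longrightarrow> (NN kv. h j kv) < \<infinity>"
    by blast
  define e where "e kv = en (C * jb kv powr (- 5 / 2))" for kv :: plane
  define H where "H kv = (\<Sum>j=1..4. h j kv) + e kv" for kv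
  have em [measurable]: "e \<in> borel_fun" unfolding e_def[abs_def] by measurable
  have hm: "(\<lambda>kv. \<Sum>j=1..4. h j kv) \<in> borel_fun" by (rule borel_measurable_sum) (rule h(1))
  have ei: "(NN kv. e kv) < \<infinity>"
  proof -
    have "(NN kv. e kv) = (NN kv. en C * en (jb (kv::plane) powr - (5 / 2)))"
      unfolding e_def using C(1) by (intro nn_integral_cong) (simp add: ennreal_mult)
    also have "... = en C * (NN kv. en (jb (kv::plane) powr - (5 / 2)))" by (rule nn_integral_cmult) measurable
    also have "... < \<infinity>" using nn_integral_plane_powr[of "5 / 2"] by (simp add: ennreal_mult_less_top)
    finally show ?thesis .
  qed
  have Hi: "(NN kv. H kv) < \<infinity>"
  proof -
    have "(NN kv. H kv) = (NN kv. (\<Sum>j=1..4. h j kv)) + (NN kv. e kv)"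
      unfolding H_def using hm em by (intro nn_integral_add) simp_all
    also have "(NN kv. (\<Sum>j=1..4. h j kv)) = (\<Sum>j=1..4. NN kv. h j kv)"
      by (rule nn_integral_sum) (use h(1) in simp)
    also have "... < \<infinity>"
    proof -
      have "{1..4::nat} = {1, 2, 3, 4}" by auto
      then show ?thesis using h(3) by simp
    qed
    finally show ?thesis using ei by simp
  qed
  show ?thesis
  proof (rule that[OF _ Hi])
    show "H \<in> borel_fun" unfolding H_def[abs_def] using hm by measurable
    fix kv assume k: "norm kv \<ge> 2" "\<beta> kv \<le> 1 / 2"
    show "en (norm (amp kv - fourier q (- 2 *\<^sub>R kv))) \<le> H kv"
      unfolding H_def e_def by (rule order_trans[OF C(2)[OF k]]) (intro add_right_mono sum_mono h(2) k)
  qed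
qed

text \<open>Forces \<open>sqrt (norm kv) \<ge> 2 * Cb\<close>, hence
  \<open>\<beta> kv \<le> 1 / 2\<close>; the 2 is the lower limit in \<open>Kb_bound\<close> and
  \<open>Kb_shear\<close>.\<close>

definition k_min :: real where "k_min = 2 + 4 * Cb^2"

lemma k_min: "0 < k_min" "norm kv \<ge> k_min \<Longrightarrow> norm kv \<ge> 2" "norm kv \<ge> k_min \<Longrightarrow> \<beta> kv \<le> 1 / 2"
proof -
  show "0 < k_min" using zero_le_power2[of Cb] unfolding k_min_def by linarith
  assume k: "norm kv \<ge> k_min"
  then show k2: "norm kv \<ge> 2" using zero_le_power2[of Cb] unfolding k_min_def by linarith
  have "(2 * Cb)^2 = 4 * Cb^2" by (simp add: power_mult_distrib)
  then have "2 * Cb \<le> sqrt (norm kv)" using k unfolding k_min_def by (intro real_le_rsqrt) linarith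
  moreover have "0 < sqrt (norm kv)" using k2 by (intro real_sqrt_gt_zero) linarith
  ultimately show "\<beta> kv \<le> 1 / 2" unfolding \<beta>_def by (simp add: pos_divide_le_eq)
qed

text \<open>Below \<open>k_min\<close> the cutoff vanishes and masks the uncontrolled values that
  \<open>SOME\<close> may give there, as well as the meaningless direction at the origin.\<close>

lemma born_eq_amp:
  assumes C0: "k_min \<le> C0" and eta: "high_frequency_cutoff C0 \<eta>"
  shows "born_backscattering_fourier q \<eta> (- 2 *\<^sub>R kv) = (if k_min \<le> norm kv then amp kv else 0) * of_real (\<eta> (norm kv))"
proof (cases "k_min \<le> norm kv")
  case True
  then have "kv \<noteq> 0" using k_min(1) by auto
  then have s: "- ((- 2 *\<^sub>R kv) /\<^sub>R norm (- 2 *\<^sub>R kv)) = sgn kv" by (simp add: sgn_div_norm)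
  have n: "norm (- 2 *\<^sub>R kv) / 2 = norm kv" by simp
  show ?thesis unfolding born_backscattering_fourier_def Let_def s n amp_def using True by simp
next
  case False
  then have "\<eta> (norm kv) = 0" using C0 eta by (simp add: high_frequency_cutoff_def)
  then show ?thesis using False by (simp add: born_backscattering_fourier_def Let_def)
qed

lemma cutoff_continuous: "high_frequency_cutoff C0 \<eta> \<Longrightarrow> continuous_on UNIV \<eta>"
proof -
  assume "high_frequency_cutoff C0 \<eta>"
  then have "smooth \<eta>" by (simp add: high_frequency_cutoff_def)
  then have "iterated_partial [] \<eta> differentiable (at x)" for x unfolding smooth_def by (metis empty_subsetI list.set(1))
  then show ?thesis by (auto intro!: continuous_at_imp_continuous_on differentiable_imp_continuous_within)
qed

text \<open>Below \<open>C0\<close> the difference is the transform of \<open>q\<close>, bounded on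
  a ball; between \<open>C0\<close> and \<open>2 * C0\<close> the cutoff is merely bounded by some
  \<open>E\<close>; beyond, the difference is up to sign the one majorised by
  \<open>H\<close>.\<close>

lemma born_difference_integrable:
  assumes a: "0 < \<alpha>" "\<alpha> \<le> 1"
    and fin: "(NN \<tau>. en ((norm (fourier q \<tau>))^2 * jb \<tau> powr (2 * \<alpha>))) < \<infinity>"
    and C0: "k_min \<le> C0" and eta: "high_frequency_cutoff C0 \<eta>"
  shows "L1 (\<lambda>\<xi>. fourier q \<xi> - born_backscattering_fourier q \<eta> \<xi>)"
proof -
  define B where "B \<xi> = fourier q \<xi> - born_backscattering_fourier q \<eta> \<xi>" for \<xi>
  obtain H where H: "H \<in> borel_fun" "(NN kv. H kv) < \<infinity>"
    "\<And>kv. norm kv \<ge> 2 \<Longrightarrow> \<beta> kv \<le> 1 / 2 \<Longrightarrow> en (norm (amp kv - fourier q (- 2 *\<^sub>R kv))) \<le> H kv"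
    using amp_minus_fourier_bound[OF a fin] by blast
  note [measurable] = H(1)
  have cont: "continuous_on UNIV \<eta>" by (rule cutoff_continuous[OF eta])
  then have [measurable]: "\<eta> \<in> borel_fun" by (rule borel_measurable_continuous_onI)
  have am: "(\<lambda>kv. if k_min \<le> norm kv then amp kv else 0) \<in> borel_fun"
  proof (rule amp_measurable)
    fix kv :: plane assume k: "k_min \<le> norm kv"
    show "1 \<le> norm kv \<and> \<beta> kv \<le> 1 / 2" using k_min(2,3)[OF k] by simp
  qed
  have B2: "B (- 2 *\<^sub>R kv) = fourier q (- 2 *\<^sub>R kv) - (if k_min \<le> norm kv then amp kv else 0) * of_real (\<eta> (norm kv))" for kv
    unfolding B_def born_eq_amp[OF C0 eta] ..
  have Bm [measurable]: "B \<in> borel_fun"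
  proof -
    have m: "(\<lambda>kv. fourier q (- 2 *\<^sub>R kv) - (if k_min \<le> norm kv then amp kv else 0) * of_real (\<eta> (norm kv))) \<in> borel_fun"
    proof (rule borel_measurable_diff[OF _ borel_measurable_times[OF am]])
      show "(\<lambda>kv. fourier q (- 2 *\<^sub>R kv)) \<in> borel_fun" by measurable
      show "(\<lambda>kv::plane. complex_of_real (\<eta> (norm kv))) \<in> borel_fun" by measurable
    qed
    \<comment> \<open>The values of \<open>B\<close> are described along
      \<open>- 2 *\<^sub>R kv\<close>; halving with a change of sign returns to \<open>B\<close>
      itself.\<close>
    have s: "(\<lambda>\<xi>::plane. (- (1 / 2)) *\<^sub>R \<xi>) \<in> borel_fun" by measurable
    have "(\<lambda>\<xi>. B (- 2 *\<^sub>R ((- (1 / 2)) *\<^sub>R \<xi>))) \<in> borel_fun"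
      unfolding B2 by (rule measurable_compose[OF s m])
    then show ?thesis by simp
  qed
  have "bounded (\<eta> ` {0..2 * C0})"
    by (rule compact_imp_bounded[OF compact_continuous_image[OF continuous_on_subset[OF cont]]]) simp_all
  then obtain E where E: "E > 0" "\<And>t. t \<in> {0..2 * C0} \<Longrightarrow> \<bar>\<eta> t\<bar> \<le> E" by (auto simp: bounded_pos)
  have C0p: "0 < C0" using C0 k_min(1) by linarith
  define I where "I kv = N1 * indicator (cball 0 (2 * C0)) kv" for kv :: plane
  have I0: "0 \<le> I kv" for kv by (simp add: I_def N1_nonneg)
  have [measurable]: "cball (0::plane) (2 * C0) \<in> sets borel" by simp
  have Im [measurable]: "I \<in> borel_fun" unfolding I_def[abs_def] by measurable
  have qN: "norm (fourier q \<xi>) \<le> N1" for \<xi> unfolding N1_def by (rule norm_fourier_le)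
  have le: "en (norm (B (- 2 *\<^sub>R kv))) \<le> en (1 + E) * (en (I kv) + H kv)" for kv
  proof -
    have one: "1 * x \<le> en (1 + E) * x" for x
      by (rule mult_right_mono) (use E(1) ennreal_leI[of 1 "1 + E"] in simp_all)
    let ?d = "amp kv - fourier q (- 2 *\<^sub>R kv)"
    consider "norm kv < C0" | "C0 \<le> norm kv" "norm kv < 2 * C0" | "2 * C0 \<le> norm kv" by linarith
    then show ?thesis
    proof cases
      case 1
      then have "\<eta> (norm kv) = 0" using eta by (simp add: high_frequency_cutoff_def)
      then have "norm (B (- 2 *\<^sub>R kv)) \<le> I kv" unfolding B2 using qN 1 C0p by (simp add: I_def)
      then have "en (norm (B (- 2 *\<^sub>R kv))) \<le> en (I kv) + H kv" by (intro add_increasing2) (simp_all add: ennreal_leI)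
      then show ?thesis using one[of "en (I kv) + H kv"] by simp
    next
      case 2
      then have k: "k_min \<le> norm kv" using C0 by linarith
      have e: "\<bar>\<eta> (norm kv)\<bar> \<le> E" using 2 by (intro E(2)) simp
      have "B (- 2 *\<^sub>R kv) = fourier q (- 2 *\<^sub>R kv) * (1 - of_real (\<eta> (norm kv))) - ?d * of_real (\<eta> (norm kv))"
        unfolding B2 using k by (simp add: algebra_simps)
      also have "norm ... \<le> norm (fourier q (- 2 *\<^sub>R kv) * (1 - of_real (\<eta> (norm kv)))) + norm (?d * of_real (\<eta> (norm kv)))" by (rule norm_triangle_ineq4)
      also have "... \<le> N1 * (1 + E) + norm ?d * (1 + E)"
      proof (rule add_mono)
        have "norm (1 - complex_of_real (\<eta> (norm kv))) \<le> 1 + E"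
          using norm_triangle_ineq4[of 1 "complex_of_real (\<eta> (norm kv))"] e by simp
        then show "norm (fourier q (- 2 *\<^sub>R kv) * (1 - of_real (\<eta> (norm kv)))) \<le> N1 * (1 + E)"
          unfolding norm_mult by (intro mult_mono qN N1_nonneg) simp_all
        show "norm (?d * of_real (\<eta> (norm kv))) \<le> norm ?d * (1 + E)"
          unfolding norm_mult norm_of_real using e by (intro mult_left_mono) simp_all
      qed
      also have "... = (1 + E) * (I kv + norm ?d)" using 2 by (simp add: I_def algebra_simps)
      finally have "en (norm (B (- 2 *\<^sub>R kv))) \<le> en ((1 + E) * (I kv + norm ?d))" by (rule ennreal_leI)
      also have "... = en (1 + E) * (en (I kv) + en (norm ?d))"
        using E(1) I0[of kv] by (simp add: ennreal_mult ennreal_plus[symmetric] del: ennreal_plus)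
      also have "... \<le> en (1 + E) * (en (I kv) + H kv)"
        by (intro mult_left_mono add_left_mono H(3) k_min(2,3)[OF k]) simp
      finally show ?thesis .
    next
      case 3
      then have k: "k_min \<le> norm kv" using C0 C0p by linarith
      have "\<eta> (norm kv) = 1" using 3 eta by (simp add: high_frequency_cutoff_def)
      then have "norm (B (- 2 *\<^sub>R kv)) = norm ?d" unfolding B2 using k by (simp add: norm_minus_commute)
      then have "en (norm (B (- 2 *\<^sub>R kv))) \<le> H kv" using H(3)[OF k_min(2,3)[OF k]] by simp
      then have "en (norm (B (- 2 *\<^sub>R kv))) \<le> en (I kv) + H kv" by (intro add_increasing) simp_all
      then show ?thesis using one[of "en (I kv) + H kv"] by simp
    qed
  qed
  have Ii: "(NN kv. en (I kv)) < \<infinity>"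
  proof -
    have "(NN kv. en (I kv)) = (NN kv. en N1 * indicator (cball (0::plane) (2 * C0)) kv)"
      unfolding I_def using N1_nonneg by (intro nn_integral_cong) (simp add: indicator_def)
    also have "... = en N1 * emeasure lborel (cball (0::plane) (2 * C0))" by (rule nn_integral_cmult_indicator) simp
    also have "... < \<infinity>" using emeasure_bounded_finite[OF bounded_cball, of "0::plane" "2 * C0"] by (simp add: ennreal_mult_less_top)
    finally show ?thesis .
  qed
  have "(NN \<xi>. en (norm (B \<xi>))) = 4 * (NN kv. en (norm (B (- 2 *\<^sub>R kv))))"
    by (rule nn_integral_scale_minus_two[of "\<lambda>\<xi>. en (norm (B \<xi>))"]) measurable
  also have "... \<le> 4 * (NN kv. en (1 + E) * (en (I kv) + H kv))"
    by (intro mult_left_mono nn_integral_mono le) simp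
  also have "(NN kv. en (1 + E) * (en (I kv) + H kv)) = en (1 + E) * ((NN kv. en (I kv)) + (NN kv. H kv))"
    by (simp add: nn_integral_cmult nn_integral_add)
  also have "4 * (en (1 + E) * ((NN kv. en (I kv)) + (NN kv. H kv))) < \<infinity>"
    using Ii H(2) by (simp add: ennreal_mult_less_top)
  finally have "L1 B" by (intro integrableI_bounded) simp_all
  then show ?thesis by (simp add: B_def[abs_def])
qed

text \<open>The continuous representative is the inverse transform of the integrable function
  \<open>B\<close>. Its agreement with the distribution is \<open>fourier_swap\<close> used twice,
  once for \<open>q\<close> and once for the reflected \<open>B\<close>.\<close>

lemma born_difference_continuous:
  assumes B: "L1 (\<lambda>\<xi>. fourier q \<xi> - born_backscattering_fourier q \<eta> \<xi>)"
  shows "is_continuous_function (\<lambda>\<phi>. distribution_of q \<phi> - born_backscattering q \<eta> \<phi>)"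
proof -
  define b where "b = born_backscattering_fourier q \<eta>"
  define B where "B \<xi> = fourier q \<xi> - b \<xi>" for \<xi>
  have Bi: "L1 B" using B by (simp add: B_def[abs_def] b_def)
  have [measurable]: "B \<in> borel_fun" using Bi by auto
  have bB: "b \<xi> = fourier q \<xi> - B \<xi>" for \<xi> by (simp add: B_def)
  have Bi': "L1 (\<lambda>\<xi>. B (- \<xi>))" using lborel_translate(1)[of B 0] Bi by simp
  define g where "g x = fourier (\<lambda>\<xi>. B (- \<xi>)) x / of_real ((2 * pi)^2)" for x
  have gc: "continuous_on UNIV g"
    unfolding g_def[abs_def] by (intro continuous_intros continuous_on_fourier[OF Bi']) simp
  have "distribution_of q \<phi> - born_backscattering q \<eta> \<phi> = distribution_of g \<phi>" if t: "\<phi> \<in> test_functions" for \<phi>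
  proof -
    have \<phi>: "\<phi> \<in> schwartz" using t test_functions_subset_schwartz by blast
    note sf = schwartz_facts[OF \<phi>]
    have [measurable]: "\<phi> \<in> borel_fun" using sf(2) by (rule borel_measurable_continuous_onI)
    define \<psi> where "\<psi> = inverse_fourier \<phi>"
    have \<psi>i: "L1 \<psi>" and \<psi>f: "fourier \<psi> = \<phi>" using sf(4,5) by (auto simp: \<psi>_def)
    have [measurable]: "\<psi> \<in> borel_fun" using \<psi>i by auto
    have \<psi>e: "\<psi> \<xi> = fourier \<phi> (- \<xi>) / of_real ((2 * pi)^2)" for \<xi> unfolding \<psi>_def inverse_fourier_eq by simp
    have qN: "norm (fourier q \<xi>) \<le> N1" for \<xi> unfolding N1_def by (rule norm_fourier_le)
    have iq: "L1 (\<lambda>\<xi>. fourier q \<xi> * \<psi> \<xi>)"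
      by (rule L1_bound[OF integrable_mult_right[OF integrable_norm[OF \<psi>i], of N1]])
        (auto simp: norm_mult abs_mult intro!: mult_right_mono order_trans[OF qN])
    define c where "c = (LBINT x. norm (\<phi> x)) / (2 * pi)^2"
    have \<psi>b: "norm (\<psi> \<xi>) \<le> c" for \<xi>
      unfolding \<psi>e c_def norm_divide norm_of_real abs_power2 by (intro divide_right_mono norm_fourier_le) simp
    have iB: "L1 (\<lambda>\<xi>. B \<xi> * \<psi> \<xi>)"
    proof (rule L1_bound[OF integrable_mult_right[OF integrable_norm[OF Bi], of c]])
      have "norm (B \<xi>) * norm (\<psi> \<xi>) \<le> norm (B \<xi>) * c" for \<xi> by (rule mult_left_mono[OF \<psi>b]) simp
      moreover have "0 \<le> c" by (simp add: c_def)
      ultimately show "AE x in lborel. norm (B x * \<psi> x) \<le> norm (c * norm (B x))" by (simp add: norm_mult abs_mult mult.commute)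
    qed measurable
    have "distribution_of q \<phi> = (LBINT x. q x * fourier \<psi> x)" unfolding distribution_of_def \<psi>f ..
    also have "... = (LBINT \<xi>. fourier q \<xi> * \<psi> \<xi>)" by (rule fourier_swap[OF q_int \<psi>i, symmetric])
    finally have 1: "distribution_of q \<phi> = (LBINT \<xi>. fourier q \<xi> * \<psi> \<xi>)" .
    have "born_backscattering q \<eta> \<phi> = (LBINT \<xi>. b \<xi> * \<psi> \<xi>)"
      by (simp add: born_backscattering_def inverse_fourier_distr_def distribution_of_def b_def \<psi>_def)
    also have "... = (LBINT \<xi>. fourier q \<xi> * \<psi> \<xi>) - (LBINT \<xi>. B \<xi> * \<psi> \<xi>)"
      unfolding bB left_diff_distrib using iq iB by (rule LB_diff)
    finally have 2: "distribution_of q \<phi> - born_backscattering q \<eta> \<phi> = (LBINT \<xi>. B \<xi> * \<psi> \<xi>)" unfolding 1 by simp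
    also have "... = (LBINT \<xi>. B (- \<xi>) * \<psi> (- \<xi>))" using lborel_translate(2)[of "\<lambda>\<xi>. B \<xi> * \<psi> \<xi>" 0] by simp
    also have "... = (LBINT \<xi>. fourier \<phi> \<xi> * B (- \<xi>)) / of_real ((2 * pi)^2)"
      unfolding \<psi>e by (simp add: mult.commute)
    also have "(LBINT \<xi>. fourier \<phi> \<xi> * B (- \<xi>)) = (LBINT x. \<phi> x * fourier (\<lambda>\<xi>. B (- \<xi>)) x)"
      by (rule fourier_swap[OF sf(1) Bi'])
    also have "... / of_real ((2 * pi)^2) = distribution_of g \<phi>"
      unfolding distribution_of_def g_def by (simp add: mult.commute)
    finally show ?thesis .
  qed
  then show ?thesis using gc unfolding is_continuous_function_def by blast
qed

end

theorem theorem2: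
  fixes \<alpha> :: real and q :: "real ^ 2 \<Rightarrow> complex"
  assumes "\<alpha> > 0"
    and "tempered_function q"
    and "distribution_of q \<in> sobolev \<alpha>"
    and "compactly_supported q"
  shows "\<exists>K>0. \<forall>C\<^sub>0\<ge>K. \<forall>\<eta>. high_frequency_cutoff C\<^sub>0 \<eta> \<longrightarrow>
    is_continuous_function (\<lambda>\<phi>. distribution_of q \<phi> - born_backscattering q \<eta> \<phi>)"
proof -
  obtain \<rho> where \<rho>: "\<rho> > 0" "L1 q" "AE x in lborel. norm x \<le> \<rho> \<or> q x = 0"
    using integrable_of_compact_support[OF assms(2,4)] by blast
  have [measurable]: "q \<in> borel_fun" using \<rho>(2) by auto
  note fin = sobolev_fourier_weight[OF assms(1) \<rho>(2) assms(3)]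
  \<comment> \<open>\<open>dominated_chains\<close> takes exponents up to 1; lowering the exponent
    only weakens the weight.\<close>
  define a where "a = min \<alpha> 1"
  have a: "0 < a" "a \<le> 1" "a \<le> \<alpha>" using assms(1) by (auto simp: a_def)
  have "(NN \<xi>. en ((norm (fourier q \<xi>))^2)) \<le> (NN \<xi>. en ((norm (fourier q \<xi>))^2 * (1 + (norm \<xi>)^2) powr \<alpha>))"
  proof (intro nn_integral_mono ennreal_leI)
    fix \<xi> :: "real ^ 2"
    have "1 \<le> (1 + (norm \<xi>)^2) powr \<alpha>" using assms(1) by (intro ge_one_powr_ge_zero) simp_all
    then have "(norm (fourier q \<xi>))^2 * 1 \<le> (norm (fourier q \<xi>))^2 * (1 + (norm \<xi>)^2) powr \<alpha>" by (rule mult_left_mono) simp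
    then show "(norm (fourier q \<xi>))^2 \<le> (norm (fourier q \<xi>))^2 * (1 + (norm \<xi>)^2) powr \<alpha>" by simp
  qed
  from le_less_trans[OF this fin] have "L1 (\<lambda>\<xi>. (norm (fourier q \<xi>))\<^sup>2)" by (intro integrableI_bounded) simp_all
  \<comment> \<open>\<open>q\<close> enters as a tempered function of compact support, thus
    integrable; its square integrability is recovered from the frequency side.\<close>
  then have q2: "L1 (\<lambda>x. (norm (q x))\<^sup>2)" by (rule square_integrable_of_fourier'[OF \<rho>(2)])
  interpret potential q \<rho> using \<rho> q2 by unfold_locales
  have "(NN \<tau>. en ((norm (fourier q \<tau>))^2 * jb \<tau> powr (2 * a))) \<le>
    (NN \<tau>. en 2 * en ((norm (fourier q \<tau>))^2 * (1 + (norm \<tau>)^2) powr \<alpha>))"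
  proof (rule nn_integral_mono)
    fix \<tau> :: "real ^ 2"
    define s where "s = (norm \<tau>)^2"
    have s: "0 \<le> s" by (simp add: s_def)
    have "jb \<tau> powr (2 * a) = (jb \<tau>^2) powr a" using powr_powr[of "1 + norm \<tau>" 2 a] by (simp add: add_nonneg_nonneg)
    also have "... \<le> (2 * (1 + s)) powr a"
    proof (rule powr_mono2)
      show "jb \<tau>^2 \<le> 2 * (1 + s)" using sum_squares_bound[of 1 "norm \<tau>"] by (simp add: power2_sum s_def)
    qed (use a in simp_all)
    also have "... = 2 powr a * (1 + s) powr a" by (rule powr_mult)
    also have "... \<le> 2 * (1 + s) powr \<alpha>"
    proof (rule mult_mono)
      show "2 powr a \<le> (2::real)" using powr_mono[of a 1 "2::real"] a by simp
      show "(1 + s) powr a \<le> (1 + s) powr \<alpha>" using s a by (intro powr_mono) simp_all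
    qed simp_all
    finally have "(norm (fourier q \<tau>))^2 * jb \<tau> powr (2 * a) \<le> (norm (fourier q \<tau>))^2 * (2 * (1 + s) powr \<alpha>)"
      by (rule mult_left_mono) simp
    then have "(norm (fourier q \<tau>))^2 * jb \<tau> powr (2 * a) \<le> 2 * ((norm (fourier q \<tau>))^2 * (1 + s) powr \<alpha>)" by (simp only: mult.left_commute)
    from ennreal_leI[OF this] show "en ((norm (fourier q \<tau>))^2 * jb \<tau> powr (2 * a)) \<le> en 2 * en ((norm (fourier q \<tau>))^2 * (1 + (norm \<tau>)^2) powr \<alpha>)"
      by (simp only: s_def ennreal_mult'[symmetric] zero_le_numeral)
  qed
  also have "... = en 2 * (NN \<tau>. en ((norm (fourier q \<tau>))^2 * (1 + (norm \<tau>)^2) powr \<alpha>))"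
    by (rule nn_integral_cmult) measurable
  also have "... < \<infinity>" using fin by (simp add: ennreal_mult_less_top)
  finally have fin': "(NN \<tau>. en ((norm (fourier q \<tau>))^2 * jb \<tau> powr (2 * a))) < \<infinity>" .
  show ?thesis
    using k_min(1) born_difference_continuous[OF born_difference_integrable[OF a(1,2) fin']] by blast
qed

end
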